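(* Let $\mathcal{P}$ be either $\mathcal{G}$ or $\mathcal{M}$ and let $X_\lambda$ be a cellular $\mathcal{P}$-multipointed $d$-space, with set of states $X^0$. Assume $X_\lambda$ locally finite. Let $(\alpha,\beta)\in X^0\times X^0$. Then the topological space $(\mathbb{P}^{top}_{\alpha,\beta}X_\lambda)_{co}$, i.e. the set $\mathbb{P}^{top}_{\alpha,\beta}X_\lambda$ equipped with the compact-open topology, is $\Delta$-generated. The topological space \[\mathbb{P}^{top}X_\lambda=\coprod_{(\alpha,\beta)\in X^0\times X^0}\mathbb{P}^{top}_{\alpha,\beta}X_\lambda\] is metrizable with the distance of the uniform convergence. The underlying topology is the compact-open topology.
   Context: $\mathbf{Top}$ denotes either the category of $\Delta$-generated spaces (spaces whose topology is final with respect to all continuous maps from $[0,1]$) or its full subcategory of $\Delta$-Hausdorff ones (the image of every continuous map from $[0,1]$ is closed). The $\Delta$-kelleyfication of a space is the same set with the final topology with respect to all continuous maps from $[0,1]$; $\mathbf{TOP}(U,V)$ is the set of continuous maps with the $\Delta$-kelleyfication of the compact-open topology. $\mathcal{G}(1,1)$ (resp. $\mathcal{M}(1,1)$) is the set of nondecreasing homeomorphisms (resp. nondecreasing surjective maps) from $[0,1]$ to itself. Let $\mathcal{P}$ be $\mathcal{G}$ or $\mathcal{M}$. A $\mathcal{P}$-multipointed $d$-space is a triple $X=(|X|,X^0,\mathbb{P}^{top}X)$ with $|X|\in\mathbf{Top}$, $X^0\subset |X|$ a set (of states), and $\mathbb{P}^{top}X$ a set of continuous maps $[0,1]\to|X|$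 (execution paths) such that: $\gamma(0),\gamma(1)\in X^0$ for each execution path; $\gamma\phi$ is an execution path for each execution path $\gamma$ and each $\phi\in\mathcal{P}(1,1)$; and if $\gamma_1(1)=\gamma_2(0)$ the normalized composition ($t\mapsto\gamma_1(2t)$ for $t\le 1/2$, $t\mapsto\gamma_2(2t-1)$ for $t\geq 1/2$) is an execution path. Maps are continuous maps $|X|\to|Y|$ sending states to states and execution paths to execution paths. $\mathbb{P}^{top}_{\alpha,\beta}X$ is the set of execution paths from $\alpha$ to $\beta$ with the $\Delta$-kelleyfication of the relative topology from $\mathbf{TOP}([0,1],|X|)$. The notation $(-)_{co}$ means that the set is instead equipped with the (relative) compact-open topology. For $Z\in\mathbf{Top}$, $\mathrm{Glob}^{\mathcal{P}}(Z)$ is the $\mathcal{P}$-multipointed $d$-space with underlying space the quotient of $\{0,1\}\sqcup(Z\times[0,1])$ by $(z,0)=(z',0)=0$ and $(z,1)=(z',1)=1$, states $\{0,1\}$, and execution paths the maps $\delta_z\phi$ with $z\in Z$, $\phi\in\mathcal{P}(1,1)$, $\delta_z(t)=(z,t)$. Cellular objects: let $\lambda$ be an ordinal and $(X_\nu)_{\nu\le\lambda}$ a colimit-preserving transfinite sequence of $\mathcal{P}$-multipointed $d$-spaces such that $X_0=(X^0,X^0,\varnothing)$ for a set $X^0$ (discrete) and, for each $\nu<\lambda$, $X_{\nu+1}$ is the pushout of $\mathrm{Glob}^{\mathcal{P}}(\mathbf{D}^{n_\nu})\leftarrow\mathrm{Glob}^{\mathcal{P}}(\mathbf{S}^{n_\nu-1})\xrightarrow{g_\nu}X_\nu$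 with $n_\nu\ge 0$ ($\mathbf{D}^n$ the unit disk, $\mathbf{S}^{n-1}$ its boundary sphere, $\mathbf{D}^0=\{0\}$, $\mathbf{S}^{-1}=\varnothing$); write $\widehat{g_\nu}:\mathrm{Glob}^{\mathcal{P}}(\mathbf{D}^{n_\nu})\to X_{\nu+1}\to X_\lambda$. Then $X_\lambda$ is called a cellular $\mathcal{P}$-multipointed $d$-space. Its globular cells are $c_\nu=|\mathrm{Glob}^{\mathcal{P}}(\mathbf{D}^{n_\nu})|\setminus|\mathrm{Glob}^{\mathcal{P}}(\mathbf{S}^{n_\nu-1})|$, identified with their (homeomorphic) images in $|X_\lambda|$, and $\widehat{c_\nu}=\widehat{g_\nu}(|\mathrm{Glob}^{\mathcal{P}}(\mathbf{D}^{n_\nu})|)$ is the closure of $c_\nu$. $X_\lambda$ is locally finite if for all $\nu<\lambda$ the set $\{\nu'<\lambda\mid\widehat{c_{\nu'}}\cap c_\nu\neq\varnothing\}$ is finite and each state belongs to finitely many $\widehat{c_\nu}$. In this case $|X_\lambda|$ is metrizable; the distance of the uniform convergence is $\sup_{t\in[0,1]}d(\gamma(t),\gamma'(t))$ where $d$ is a distance inducing the topology of $|X_\lambda|$. *)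

theory Defs
  imports "HOL-Analysis.Analysis"
begin

section \<open>Delta-generated spaces\<close>

abbreviation unit_interval :: "real topology" where
  "unit_interval \<equiv> top_of_set {0..1}"

definition final_topology :: "'b set \<Rightarrow> 'a topology \<Rightarrow> ('a \<Rightarrow> 'b) set \<Rightarrow> 'b topology" where
  "final_topology S T F =
     topology (\<lambda>U. U \<subseteq> S \<and> (\<forall>f\<in>F. openin T {x \<in> topspace T. f x \<in> U}))"

lemma openin_final_topology:
  fixes T :: "'a topology" and S :: "'b set"
  shows "openin (final_topology S T F) U \<longleftrightarrow>
     U \<subseteq> S \<and> (\<forall>f\<in>F. openin T {x \<in> topspace T. f x \<in> U})"
proof -
  have "{x \<in> topspace T. f x \<in> U \<inter> V} =
      {x \<in> topspace T. f x \<in> U} \<inter> {x \<in> topspace T. f x \<in> V}" for f :: "'a \<Rightarrow> 'b" and U V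
    by auto
  moreover have "{x \<in> topspace T. f x \<in> \<Union>K} = (\<Union>U\<in>K. {x \<in> topspace T. f x \<in> U})"
    for f :: "'a \<Rightarrow> 'b" and K
    by auto
  ultimately have "istopology (\<lambda>U. U \<subseteq> S \<and> (\<forall>f\<in>F. openin T {x \<in> topspace T. f x \<in> U}))"
    unfolding istopology_def by (auto intro!: openin_Int openin_Union)
  then show ?thesis
    by (simp add: final_topology_def)
qed

lemma topspace_final_topology:
  assumes "\<And>f. f \<in> F \<Longrightarrow> f ` topspace T \<subseteq> S"
  shows "topspace (final_topology S T F) = S"
proof -
  have "{x \<in> topspace T. f x \<in> S} = topspace T" if "f \<in> F" for f
    using assms[OF that] by auto
  then have "openin (final_topology S T F) S"
    by (simp add: openin_final_topology)
  moreover have "topspace (final_topology S T F) \<subseteq> S"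
    by (metis openin_final_topology openin_topspace)
  ultimately show ?thesis
    using openin_subset by blast
qed

definition delta_kelleyfication :: "'a topology \<Rightarrow> 'a topology" where
  "delta_kelleyfication T = final_topology (topspace T) unit_interval {p. pathin T p}"

lemma topspace_delta_kelleyfication [simp]:
  "topspace (delta_kelleyfication T) = topspace T"
  unfolding delta_kelleyfication_def
  by (rule topspace_final_topology)
     (auto simp: pathin_def dest!: continuous_map_image_subset_topspace)

definition delta_generated :: "'a topology \<Rightarrow> bool" where
  "delta_generated T \<longleftrightarrow> delta_kelleyfication T = T"

definition delta_hausdorff :: "'a topology \<Rightarrow> bool" where
  "delta_hausdorff T \<longleftrightarrow> (\<forall>p. pathin T p \<longrightarrow> closedin T (p ` {0..1}))"

text \<open>The two possible meanings of the category Top.\<close>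

datatype top_category = All_Delta_Generated | Delta_Hausdorff_Only

fun in_Top :: "top_category \<Rightarrow> 'a topology \<Rightarrow> bool" where
  "in_Top All_Delta_Generated T \<longleftrightarrow> delta_generated T"
| "in_Top Delta_Hausdorff_Only T \<longleftrightarrow> delta_generated T \<and> delta_hausdorff T"


section \<open>Mapping spaces\<close>

text \<open>A map with source \<^term>\<open>S\<close> is represented by the function that is undefined
  off \<^term>\<open>topspace S\<close>, so that equality of maps is equality of functions.\<close>

definition continuous_maps :: "'a topology \<Rightarrow> 'b topology \<Rightarrow> ('a \<Rightarrow> 'b) set" where
  "continuous_maps S T = {f \<in> extensional (topspace S). continuous_map S T f}"

definition compact_open_topology :: "'a topology \<Rightarrow> 'b topology \<Rightarrow> ('a \<Rightarrow> 'b) topology" where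
  "compact_open_topology S T = topology_generated_by
     {{f \<in> continuous_maps S T. f ` K \<subseteq> U} |K U. compactin S K \<and> openin T U}"

lemma topspace_compact_open_topology [simp]:
  "topspace (compact_open_topology S T) = continuous_maps S T"
proof -
  have "continuous_maps S T \<in>
      {{f \<in> continuous_maps S T. f ` K \<subseteq> U} |K U. compactin S K \<and> openin T U}"
    by (rule CollectI, rule exI[of _ "{}"], rule exI[of _ "topspace T"]) auto
  then show ?thesis
    unfolding compact_open_topology_def topology_generated_by_topspace by blast
qed

definition TOP :: "'a topology \<Rightarrow> 'b topology \<Rightarrow> ('a \<Rightarrow> 'b) topology" where
  "TOP S T = delta_kelleyfication (compact_open_topology S T)"


section \<open>Multipointed d-spaces\<close>

text \<open>The two choices for \<open>\<P>\<close>: \<open>\<G>\<close> (homeomorphisms) and \<open>\<M>\<close> (surjections).\<close>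

datatype reparam_kind = Homeos | Surjections

fun reparams :: "reparam_kind \<Rightarrow> (real \<Rightarrow> real) set" where
  "reparams Homeos =
     {\<phi>. mono_on {0..1} \<phi> \<and> homeomorphic_map unit_interval unit_interval \<phi>}"
| "reparams Surjections =
     {\<phi>. mono_on {0..1} \<phi> \<and> continuous_map unit_interval unit_interval \<phi> \<and> \<phi> ` {0..1} = {0..1}}"

definition normalized_composition :: "(real \<Rightarrow> 'a) \<Rightarrow> (real \<Rightarrow> 'a) \<Rightarrow> real \<Rightarrow> 'a" where
  "normalized_composition \<gamma>1 \<gamma>2 =
     restrict (\<lambda>t. if t \<le> 1/2 then \<gamma>1 (2 * t) else \<gamma>2 (2 * t - 1)) {0..1}"

record 'a mdspace =
  underlying :: "'a topology"
  states :: "'a set"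
  execution_paths :: "(real \<Rightarrow> 'a) set"

definition multipointed_d_space :: "top_category \<Rightarrow> reparam_kind \<Rightarrow> 'a mdspace \<Rightarrow> bool" where
  "multipointed_d_space C P X \<longleftrightarrow>
     in_Top C (underlying X) \<and>
     states X \<subseteq> topspace (underlying X) \<and>
     execution_paths X \<subseteq> continuous_maps unit_interval (underlying X) \<and>
     (\<forall>\<gamma>\<in>execution_paths X. \<gamma> 0 \<in> states X \<and> \<gamma> 1 \<in> states X) \<and>
     (\<forall>\<gamma>\<in>execution_paths X. \<forall>\<phi>\<in>reparams P. restrict (\<gamma> \<circ> \<phi>) {0..1} \<in> execution_paths X) \<and>
     (\<forall>\<gamma>1\<in>execution_paths X. \<forall>\<gamma>2\<in>execution_paths X.
        \<gamma>1 1 = \<gamma>2 0 \<longrightarrow> normalized_composition \<gamma>1 \<gamma>2 \<in> execution_paths X)"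

definition md_map :: "'a mdspace \<Rightarrow> 'b mdspace \<Rightarrow> ('a \<Rightarrow> 'b) \<Rightarrow> bool" where
  "md_map X Y f \<longleftrightarrow>
     continuous_map (underlying X) (underlying Y) f \<and>
     f ` states X \<subseteq> states Y \<and>
     (\<forall>\<gamma>\<in>execution_paths X. restrict (f \<circ> \<gamma>) {0..1} \<in> execution_paths Y)"

text \<open>Equality of maps with source \<^term>\<open>X\<close>.\<close>

definition eq_on :: "'a mdspace \<Rightarrow> ('a \<Rightarrow> 'b) \<Rightarrow> ('a \<Rightarrow> 'b) \<Rightarrow> bool" where
  "eq_on X f g \<longleftrightarrow> (\<forall>x\<in>topspace (underlying X). f x = g x)"

definition execution_paths_between :: "'a mdspace \<Rightarrow> 'a \<Rightarrow> 'a \<Rightarrow> (real \<Rightarrow> 'a) set" where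
  "execution_paths_between X \<alpha> \<beta> = {\<gamma> \<in> execution_paths X. \<gamma> 0 = \<alpha> \<and> \<gamma> 1 = \<beta>}"

definition path_space_between :: "'a mdspace \<Rightarrow> 'a \<Rightarrow> 'a \<Rightarrow> (real \<Rightarrow> 'a) topology" where
  "path_space_between X \<alpha> \<beta> = delta_kelleyfication
     (subtopology (TOP unit_interval (underlying X)) (execution_paths_between X \<alpha> \<beta>))"

definition path_space_between_co :: "'a mdspace \<Rightarrow> 'a \<Rightarrow> 'a \<Rightarrow> (real \<Rightarrow> 'a) topology" where
  "path_space_between_co X \<alpha> \<beta> =
     subtopology (compact_open_topology unit_interval (underlying X)) (execution_paths_between X \<alpha> \<beta>)"

text \<open>The points of this coproduct are pairs \<open>((\<alpha>, \<beta>), \<gamma>)\<close>; since \<open>\<gamma>\<close> determines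
  \<open>\<alpha>\<close> and \<open>\<beta>\<close>, \<^const>\<open>snd\<close> identifies it with the set of execution paths.\<close>

definition path_space :: "'a mdspace \<Rightarrow> (('a \<times> 'a) \<times> (real \<Rightarrow> 'a)) topology" where
  "path_space X =
     sum_topology (\<lambda>(\<alpha>, \<beta>). path_space_between X \<alpha> \<beta>) (states X \<times> states X)"

definition path_space_co :: "'a mdspace \<Rightarrow> (real \<Rightarrow> 'a) topology" where
  "path_space_co X =
     subtopology (compact_open_topology unit_interval (underlying X)) (execution_paths X)"

text \<open>The value off the set of execution paths is irrelevant, but \<^const>\<open>Metric_space\<close>
  demands nonnegativity everywhere, and a supremum of an unbounded set is unspecified.\<close>

definition uniform_dist ::
  "'a mdspace \<Rightarrow> ('a \<Rightarrow> 'a \<Rightarrow> real) \<Rightarrow> (real \<Rightarrow> 'a) \<Rightarrow> (real \<Rightarrow> 'a) \<Rightarrow> real" where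
  "uniform_dist X d \<gamma> \<gamma>' =
     (if \<gamma> \<in> execution_paths X \<and> \<gamma>' \<in> execution_paths X
      then SUP t\<in>{0..1}. d (\<gamma> t) (\<gamma>' t) else 0)"


section \<open>Globes\<close>

text \<open>\<open>Src\<close> and \<open>Tgt\<close> are the classes of \<open>0\<close> and \<open>1\<close>, and \<open>Mid z t\<close> is the class
  of \<open>(z, t)\<close> for \<open>0 < t < 1\<close>.\<close>

datatype 'z globe = Src | Tgt | Mid 'z real

definition globe_proj :: "'z \<times> real \<Rightarrow> 'z globe" where
  "globe_proj = (\<lambda>(z, t). if t = 0 then Src else if t = 1 then Tgt else Mid z t)"

text \<open>The product is that of \<open>Top\<close>. The discrete summand \<open>{0, 1}\<close> imposes no condition
  on the open sets of the quotient, so only the summand \<open>Z \<times> [0,1]\<close> occurs.\<close>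

definition globe_topology :: "'z topology \<Rightarrow> 'z globe topology" where
  "globe_topology Z = final_topology
     ({Src, Tgt} \<union> globe_proj ` (topspace Z \<times> {0..1}))
     (delta_kelleyfication (prod_topology Z unit_interval)) {globe_proj}"

lemma topspace_globe_topology [simp]:
  "topspace (globe_topology Z) = {Src, Tgt} \<union> globe_proj ` (topspace Z \<times> {0..1})"
  unfolding globe_topology_def by (rule topspace_final_topology) auto

definition Glob :: "reparam_kind \<Rightarrow> 'z topology \<Rightarrow> 'z globe mdspace" where
  "Glob P Z =
     \<lparr>underlying = globe_topology Z,
      states = {Src, Tgt},
      execution_paths = {restrict (\<lambda>t. globe_proj (z, \<phi> t)) {0..1} |z \<phi>.
        z \<in> topspace Z \<and> \<phi> \<in> reparams P}\<rparr>"

definition disk :: "nat \<Rightarrow> (nat \<Rightarrow> real) topology" where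
  "disk n = subtopology (Euclidean_space n) {x. (\<Sum>i<n. x i ^ 2) \<le> 1}"

text \<open>This is the sphere of dimension \<open>n - 1\<close>; it is empty for \<open>n = 0\<close>.\<close>

definition boundary_sphere :: "nat \<Rightarrow> (nat \<Rightarrow> real) topology" where
  "boundary_sphere n = subtopology (Euclidean_space n) {x. (\<Sum>i<n. x i ^ 2) = 1}"

type_synonym cell_point = "(nat \<Rightarrow> real) globe"


section \<open>Pushouts and transfinite colimits\<close>

text \<open>Colimits in the category of multipointed d-spaces, by their universal properties. A
  formula cannot quantify over all types, so the test objects range over the spaces with
  carrier in a given type \<open>'u\<close>. The universal property determines the actual
  colimit as soon as \<open>'u\<close> is large enough to contain copies of the actual
  colimit and of the candidate.\<close>

definition is_pushout ::
  "'u itself \<Rightarrow> top_category \<Rightarrow> reparam_kind \<Rightarrow>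
   'a mdspace \<Rightarrow> 'b mdspace \<Rightarrow> 'c mdspace \<Rightarrow> 'd mdspace \<Rightarrow>
   ('a \<Rightarrow> 'b) \<Rightarrow> ('a \<Rightarrow> 'c) \<Rightarrow> ('b \<Rightarrow> 'd) \<Rightarrow> ('c \<Rightarrow> 'd) \<Rightarrow> bool" where
  "is_pushout _ C P A B B' D f f' h h' \<longleftrightarrow>
     multipointed_d_space C P D \<and>
     md_map A B f \<and> md_map A B' f' \<and> md_map B D h \<and> md_map B' D h' \<and>
     eq_on A (h \<circ> f) (h' \<circ> f') \<and>
     (\<forall>(Y :: 'u mdspace) u u'.
        multipointed_d_space C P Y \<and> md_map B Y u \<and> md_map B' Y u' \<and> eq_on A (u \<circ> f) (u' \<circ> f')
        \<longrightarrow> (\<exists>w. md_map D Y w \<and> eq_on B (w \<circ> h) u \<and> eq_on B' (w \<circ> h') u' \<and>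
              (\<forall>w'. md_map D Y w' \<and> eq_on B (w' \<circ> h) u \<and> eq_on B' (w' \<circ> h') u'
                    \<longrightarrow> eq_on D w' w)))"

definition is_colimit_at ::
  "'u itself \<Rightarrow> top_category \<Rightarrow> reparam_kind \<Rightarrow>
   ('i::linorder \<Rightarrow> 'a mdspace) \<Rightarrow> ('i \<Rightarrow> 'i \<Rightarrow> 'a \<Rightarrow> 'a) \<Rightarrow> 'i \<Rightarrow> bool" where
  "is_colimit_at _ C P X tr \<nu> \<longleftrightarrow>
     (\<forall>(Y :: 'u mdspace) u.
        multipointed_d_space C P Y \<and> (\<forall>\<mu><\<nu>. md_map (X \<mu>) Y (u \<mu>)) \<and>
        (\<forall>\<mu><\<nu>. \<forall>\<kappa>\<le>\<mu>. eq_on (X \<kappa>) (u \<mu> \<circ> tr \<kappa> \<mu>) (u \<kappa>))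
        \<longrightarrow> (\<exists>w. md_map (X \<nu>) Y w \<and> (\<forall>\<mu><\<nu>. eq_on (X \<mu>) (w \<circ> tr \<mu> \<nu>) (u \<mu>)) \<and>
              (\<forall>w'. md_map (X \<nu>) Y w' \<and> (\<forall>\<mu><\<nu>. eq_on (X \<mu>) (w' \<circ> tr \<mu> \<nu>) (u \<mu>))
                    \<longrightarrow> eq_on (X \<nu>) w' w)))"


section \<open>Cellular multipointed d-spaces\<close>

text \<open>An ordinal is an element \<open>l\<close> of a well-ordered type, and stands for the order
  type of its set of predecessors; the elements \<open>\<nu> \<le> l\<close> are the ordinals up to it.\<close>

definition next_ordinal :: "'i::wellorder \<Rightarrow> 'i" where
  "next_ordinal \<nu> = (LEAST \<mu>. \<nu> < \<mu>)"

definition zero_ordinal :: "'i::wellorder" where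
  "zero_ordinal = (LEAST \<mu>. True)"

definition limit_ordinal :: "'i::wellorder \<Rightarrow> bool" where
  "limit_ordinal \<nu> \<longleftrightarrow> \<nu> \<noteq> zero_ordinal \<and> (\<forall>\<mu><\<nu>. next_ordinal \<mu> < \<nu>)"

text \<open>\<open>tr \<mu> \<nu>\<close> is the transition map from \<open>X \<mu>\<close> to \<open>X \<nu>\<close>, \<open>g \<nu>\<close> the attaching map of
  the cell \<open>\<nu>\<close> and \<open>h \<nu>\<close> the induced map from its globe to the successor stage. The
  test objects of \<^const>\<open>is_pushout\<close> and \<^const>\<open>is_colimit_at\<close> have carriers in sets of
  subsets of a type containing all the globes and the disjoint union of all the stages, hence
  comprise all quotients of these and a copy of each stage (by singletons).\<close>

definition cellular_sequence ::
  "top_category \<Rightarrow> reparam_kind \<Rightarrow> 'i::wellorder \<Rightarrow> ('i \<Rightarrow> 'a mdspace) \<Rightarrow>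
   ('i \<Rightarrow> 'i \<Rightarrow> 'a \<Rightarrow> 'a) \<Rightarrow> ('i \<Rightarrow> nat) \<Rightarrow>
   ('i \<Rightarrow> cell_point \<Rightarrow> 'a) \<Rightarrow> ('i \<Rightarrow> cell_point \<Rightarrow> 'a) \<Rightarrow> bool" where
  "cellular_sequence C P l X tr n g h \<longleftrightarrow>
     (\<forall>\<nu>\<le>l. multipointed_d_space C P (X \<nu>)) \<and>
     (\<forall>\<nu>\<le>l. \<forall>\<mu>\<le>\<nu>. md_map (X \<mu>) (X \<nu>) (tr \<mu> \<nu>)) \<and>
     (\<forall>\<nu>\<le>l. eq_on (X \<nu>) (tr \<nu> \<nu>) (\<lambda>x. x)) \<and>
     (\<forall>\<nu>\<le>l. \<forall>\<mu>\<le>\<nu>. \<forall>\<kappa>\<le>\<mu>. eq_on (X \<kappa>) (tr \<mu> \<nu> \<circ> tr \<kappa> \<mu>) (tr \<kappa> \<nu>)) \<and>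
     (\<forall>\<nu>\<le>l. limit_ordinal \<nu> \<longrightarrow>
        is_colimit_at TYPE(('i \<times> 'a + cell_point) set) C P X tr \<nu>) \<and>
     (\<exists>S. X zero_ordinal =
        \<lparr>underlying = discrete_topology S, states = S, execution_paths = {}\<rparr>) \<and>
     (\<forall>\<nu><l. is_pushout TYPE(('i \<times> 'a + cell_point) set) C P
        (Glob P (boundary_sphere (n \<nu>))) (Glob P (disk (n \<nu>))) (X \<nu>) (X (next_ordinal \<nu>))
        (\<lambda>x. x) (g \<nu>) (h \<nu>) (tr \<nu> (next_ordinal \<nu>)))"

definition characteristic_map ::
  "'i::wellorder \<Rightarrow> ('i \<Rightarrow> 'i \<Rightarrow> 'a \<Rightarrow> 'a) \<Rightarrow> ('i \<Rightarrow> cell_point \<Rightarrow> 'a) \<Rightarrow> 'i \<Rightarrow> cell_point \<Rightarrow> 'a" where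
  "characteristic_map l tr h \<nu> = tr (next_ordinal \<nu>) l \<circ> h \<nu>"

definition globular_cell ::
  "'i::wellorder \<Rightarrow> ('i \<Rightarrow> 'i \<Rightarrow> 'a \<Rightarrow> 'a) \<Rightarrow> ('i \<Rightarrow> nat) \<Rightarrow> ('i \<Rightarrow> cell_point \<Rightarrow> 'a) \<Rightarrow> 'i \<Rightarrow> 'a set" where
  "globular_cell l tr n h \<nu> = characteristic_map l tr h \<nu> `
     (topspace (globe_topology (disk (n \<nu>))) - topspace (globe_topology (boundary_sphere (n \<nu>))))"

definition closed_globular_cell ::
  "'i::wellorder \<Rightarrow> ('i \<Rightarrow> 'i \<Rightarrow> 'a \<Rightarrow> 'a) \<Rightarrow> ('i \<Rightarrow> nat) \<Rightarrow> ('i \<Rightarrow> cell_point \<Rightarrow> 'a) \<Rightarrow> 'i \<Rightarrow> 'a set" where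
  "closed_globular_cell l tr n h \<nu> =
     characteristic_map l tr h \<nu> ` topspace (globe_topology (disk (n \<nu>)))"

definition locally_finite_cells ::
  "'i::wellorder \<Rightarrow> ('i \<Rightarrow> 'a mdspace) \<Rightarrow> ('i \<Rightarrow> 'i \<Rightarrow> 'a \<Rightarrow> 'a) \<Rightarrow> ('i \<Rightarrow> nat) \<Rightarrow>
   ('i \<Rightarrow> cell_point \<Rightarrow> 'a) \<Rightarrow> bool" where
  "locally_finite_cells l X tr n h \<longleftrightarrow>
     (\<forall>\<nu><l. finite {\<nu>'. \<nu>' < l \<and>
        closed_globular_cell l tr n h \<nu>' \<inter> globular_cell l tr n h \<nu> \<noteq> {}}) \<and>
     (\<forall>\<alpha>\<in>states (X l). finite {\<nu>. \<nu> < l \<and> \<alpha> \<in> closed_globular_cell l tr n h \<nu>})"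

end

theory Submission
  imports Defs "HOL-Complex_Analysis.Great_Picard"
begin

text \<open>The argument determines what a cellular space looks like, why local finiteness makes it
  metrizable, and why its spaces of execution paths are first countable and locally path-connected.
  The last property gives \<open>\<Delta>\<close>-generation: a set which is not a neighbourhood of one of its points,
  in a first countable and locally path-connected space, is detected by one path that makes ever
  smaller excursions from this point to points off the set
  (\<open>first_countable_locally_path_connected_imp_delta_generated\<close>).

  Structure. The pushouts and colimits are given by universal properties only, so a candidate for
  the result is written down (\<open>cell_model\<close>): the union of the states and of the images of the
  cylinders over the disks, with the final topology, and as execution paths the reparametrized
  chains of segments of open cells. It includes into the space, and the universal properties,
  applied stage by stage, give a map in the other direction. Hence the candidate is the space
  itself (\<open>topspace_eq_cells\<close>, \<open>openin_iff_cells\<close>, \<open>execution_paths_eq_chains\<close>). A second use of the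
  universal properties produces real functions: into the unit interval with all points as states
  and all paths as execution paths, the maps are the continuous functions, and by Tietze's theorem
  these extend from every stage to all later ones (\<open>extend_function\<close>). There are enough of them to
  separate points (\<open>separation\<close>), so the space is Hausdorff and its open cells are disjoint.

  Metrizability. As for CW complexes, a closed cell meets only finitely many open cells
  (\<open>closure_finite\<close>). With local finiteness, the closed cells and the single states form a family of
  compact sets, each of which meets only finitely many others, and all unions of members are
  closed. Multiplying the separating functions by Urysohn functions concentrated near the members
  yields a locally finite separating family of functions, and the supremum of their differences is
  a distance for the topology (\<open>metrizable_by_patches\<close>).

  Path spaces. As \<open>[0,1]\<close> is compact, the compact-open topology on execution paths is that of the
  uniform distance of any compatible distance (\<open>path_mtopology_eq_compact_open\<close>); in particular it
  is first countable. Local path-connectedness (\<open>nearby_paths_joined\<close>) is a compactness argument for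
  a sequence of execution paths that converges to \<open>\<gamma>\<close>, each written as a reparametrized chain.
  Finitely many cells come near \<open>\<gamma>\<close>, and every segment of one of these oscillates by at least a
  fixed amount, so the chains have bounded length (\<open>bounded_pattern\<close>), and on a subsequence their
  sequence of cells is constant and the points of the disks converge. Moving these points straight
  to their limits is a homotopy through execution paths with the same end points, after which all
  paths traverse one and the same chain. No part of positive length of this chain is constant once
  it is rewritten with open cells, so its reparametrizations are equicontinuous along the sequence;
  by the Arzela-Ascoli theorem \<open>\<gamma>\<close> itself is a limit reparametrization of it (\<open>chain_limit\<close>), which
  is joined to the others by convex combinations. Far out in the sequence both homotopies stay close
  to \<open>\<gamma>\<close>.

  Finally, the states are isolated from each other, so that the paths with given end points form an
  open set and the coproduct over all pairs of states is the set of all execution paths with the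
  uniform distance (\<open>path_space_homeomorphic\<close>).\<close>

section \<open>Delta-generated spaces\<close>

lemma openin_delta_kelleyfication:
  "openin (delta_kelleyfication T) U \<longleftrightarrow>
     U \<subseteq> topspace T \<and> (\<forall>p. pathin T p \<longrightarrow> openin unit_interval {t \<in> {0..1}. p t \<in> U})"
  by (auto simp: delta_kelleyfication_def openin_final_topology)

lemma openin_imp_openin_delta_kelleyfication:
  "openin T U \<Longrightarrow> openin (delta_kelleyfication T) U"
  unfolding openin_delta_kelleyfication pathin_def
  using openin_continuous_map_preimage[of unit_interval T] openin_subset by fastforce

lemma pathin_delta_kelleyfication [simp]: "pathin (delta_kelleyfication T) p \<longleftrightarrow> pathin T p"
proof
  assume "pathin (delta_kelleyfication T) p"
  then show "pathin T p"
    unfolding pathin_def continuous_map_def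
    by (auto intro: openin_imp_openin_delta_kelleyfication)
next
  assume "pathin T p"
  then show "pathin (delta_kelleyfication T) p"
    unfolding pathin_def continuous_map_def
    using openin_delta_kelleyfication[of T] \<open>pathin T p\<close> by auto
qed

lemma delta_generated_iff:
  "delta_generated T \<longleftrightarrow>
     (\<forall>U. U \<subseteq> topspace T \<longrightarrow> (\<forall>p. pathin T p \<longrightarrow> openin unit_interval {t \<in> {0..1}. p t \<in> U})
        \<longrightarrow> openin T U)"
proof -
  have "delta_generated T \<longleftrightarrow> (\<forall>U. openin (delta_kelleyfication T) U \<longrightarrow> openin T U)"
    unfolding delta_generated_def topology_eq
    using openin_imp_openin_delta_kelleyfication[of T] by auto
  then show ?thesis unfolding openin_delta_kelleyfication by blast
qed

lemma delta_generatedD: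
  assumes "delta_generated T" "U \<subseteq> topspace T"
    "\<And>p. pathin T p \<Longrightarrow> openin unit_interval {t \<in> {0..1}. p t \<in> U}"
  shows "openin T U"
  using assms unfolding delta_generated_iff by simp

lemma delta_kelleyfication_cong_pathin:
  assumes "topspace T = topspace T'" "\<And>p. pathin T p \<longleftrightarrow> pathin T' p"
  shows "delta_kelleyfication T = delta_kelleyfication T'"
  unfolding topology_eq openin_delta_kelleyfication using assms by simp

lemma nested_pathconnected_base:
  assumes "first_countable T" "locally_path_connected_space T" "x \<in> topspace T"
  obtains C :: "nat \<Rightarrow> _ set" where "\<And>k. openin T (C k)" "\<And>k. path_connectedin T (C k)"
    "\<And>k. x \<in> C k" "\<And>V. openin T V \<Longrightarrow> x \<in> V \<Longrightarrow> \<exists>K. \<forall>k\<ge>K. C k \<subseteq> V"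
proof -
  obtain \<B> where "countable \<B>" and op: "\<And>V. V \<in> \<B> \<Longrightarrow> openin T V"
    and base: "\<And>U. openin T U \<Longrightarrow> x \<in> U \<Longrightarrow> \<exists>V\<in>\<B>. x \<in> V \<and> V \<subseteq> U"
    using assms(1,3) unfolding first_countable_def by metis
  define \<B>' where "\<B>' = {V \<in> \<B>. x \<in> V}"
  have "countable \<B>'" "\<B>' \<noteq> {}"
    using \<open>countable \<B>\<close> base[OF openin_topspace assms(3)] by (auto simp: \<B>'_def)
  define B where "B k = (\<Inter>i\<le>k. from_nat_into \<B>' i)" for k :: nat
  have in': "from_nat_into \<B>' i \<in> \<B>'" for i
    using \<open>\<B>' \<noteq> {}\<close> by (rule from_nat_into)
  have opB: "openin T (B k)" for k
    unfolding B_def using in' op by (intro openin_INT2) (auto simp: \<B>'_def)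
  have xB: "x \<in> B k" for k
    using in' by (auto simp: B_def \<B>'_def)
  have "\<exists>C. openin T C \<and> path_connectedin T C \<and> x \<in> C \<and> C \<subseteq> B k" for k
    using assms(2) opB xB unfolding locally_path_connected_space by blast
  then obtain C where C: "\<And>k. openin T (C k) \<and> path_connectedin T (C k) \<and> x \<in> C k \<and> C k \<subseteq> B k"
    by metis
  show ?thesis
  proof
    fix V assume "openin T V" "x \<in> V"
    then obtain W where W: "W \<in> \<B>'" "W \<subseteq> V"
      using base unfolding \<B>'_def by blast
    then obtain K where K: "from_nat_into \<B>' K = W"
      using \<open>countable \<B>'\<close> from_nat_into_surj by metis
    have "C k \<subseteq> V" if "k \<ge> K" for k
      using C[of k] W K that by (auto simp: B_def)
    then show "\<exists>K. \<forall>k\<ge>K. C k \<subseteq> V" by blast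
  qed (use C in auto)
qed

text \<open>On the interval \<open>[1 / (k + 2), 1 / (k + 1)]\<close> the path \<open>q\<close> runs along \<open>p k\<close> from \<open>x\<close> to the other end
  and back; it is continuous at \<open>0\<close> because the excursions shrink to \<open>x\<close>. The excursion \<open>k\<close> turns
  round at the midpoint \<open>k + 3/2\<close> of \<open>[k + 1, k + 2]\<close> in the coordinate \<open>1 / t\<close>, that is at
  \<open>t = 2 / (2 * k + 3)\<close>.\<close>

lemma pathin_of_shrinking_paths:
  assumes p: "\<And>k. pathin T (p k)" and p0: "\<And>k. p k 0 = x" and x: "x \<in> topspace T"
    and small: "\<And>V. openin T V \<Longrightarrow> x \<in> V \<Longrightarrow> \<exists>K. \<forall>k\<ge>K. p k ` {0..1} \<subseteq> V"
  shows "\<exists>q. pathin T q \<and> q 0 = x \<and> (\<forall>k::nat. q (2 / (2 * real k + 3)) = p k 1)"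
proof -
  \<comment> \<open>The argument of \<open>p k\<close> is the tent function of \<open>1 / t\<close> on \<open>[k + 1, k + 2]\<close>.
    \<open>J t\<close> is the index of an interval that contains \<open>t\<close>.\<close>
  define f where "f k t = p k (1 - \<bar>2 * (1 / t - (real k + 1)) - 1\<bar>)" for k :: nat and t :: real
  define I where "I k = {1 / (real k + 2) .. 1 / (real k + 1)}" for k :: nat
  define J where "J t = nat \<lfloor>1 / t\<rfloor> - 1" for t :: real
  define q where "q t = (if t = 0 then x else f (J t) t)" for t
  have pos: "t > 0" if "t \<in> I k" for t k
  proof -
    have "0 < 1 / (real k + 2)" by simp
    also have "\<dots> \<le> t" using that by (simp add: I_def)
    finally show ?thesis .
  qed
  have inv: "real k + 1 \<le> 1 / t" "1 / t \<le> real k + 2" if "t \<in> I k" for t k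
    using that pos[OF that] by (auto simp: I_def field_simps)
  have JI: "t \<in> I (J t)" if "0 < t" "t \<le> 1" for t
  proof -
    have "1 / t \<ge> 1" using that by simp
    then have fl: "\<lfloor>1 / t\<rfloor> \<ge> 1" by linarith
    then have "real (J t) = of_int \<lfloor>1 / t\<rfloor> - 1"
      unfolding J_def by linarith
    then have "real (J t) + 1 \<le> 1 / t" "1 / t \<le> real (J t) + 2" by linarith+
    then show ?thesis using that by (auto simp: I_def field_simps)
  qed
  have fI: "f k t = f j t" if "t \<in> I k" "t \<in> I j" for k j t
  proof (cases k j rule: linorder_cases)
    case less
    then have "real k + 1 \<le> real j" by linarith
    with inv[OF that(1)] inv[OF that(2)] have e: "1 / t = real k + 2" "real j = real k + 1" by linarith+
    then show ?thesis by (simp add: f_def p0)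
  next
    case greater
    then have "real j + 1 \<le> real k" by linarith
    with inv[OF that(1)] inv[OF that(2)] have e: "1 / t = real j + 2" "real k = real j + 1" by linarith+
    then show ?thesis by (simp add: f_def p0)
  qed simp
  have par: "1 - \<bar>2 * (1 / t - (real k + 1)) - 1\<bar> \<in> {0..1}" if "t \<in> I k" for k t
    using inv[OF that] by auto
  have cont_f: "continuous_map (subtopology (top_of_set {0<..1}) (I k)) T (f k)" for k
  proof -
    have sub: "subtopology (top_of_set {0<..1}) (I k) = top_of_set ({0<..1} \<inter> I k)"
      by (simp add: subtopology_subtopology)
    have "continuous_on ({0<..1} \<inter> I k) (\<lambda>t. 1 - \<bar>2 * (1 / t - (real k + 1)) - 1\<bar>)"
      by (intro continuous_intros) auto
    then have "continuous_map (top_of_set ({0<..1} \<inter> I k)) unit_interval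
       (\<lambda>t. 1 - \<bar>2 * (1 / t - (real k + 1)) - 1\<bar>)"
      using par by (auto simp: continuous_map_in_subtopology)
    then have "continuous_map (top_of_set ({0<..1} \<inter> I k)) T
       (p k \<circ> (\<lambda>t. 1 - \<bar>2 * (1 / t - (real k + 1)) - 1\<bar>))"
      using p[of k] unfolding pathin_def by (rule continuous_map_compose)
    then show ?thesis unfolding sub f_def o_def .
  qed
  have cont: "continuous_map (top_of_set {0<..1}) T q"
  proof (rule pasting_lemma_locally_finite[where I=UNIV and T=I and f=f])
    fix x assume "x \<in> topspace (top_of_set {0<..1::real})"
    then have x: "0 < x" "x \<le> 1" by auto
    have "k \<le> nat \<lceil>2 / x\<rceil>" if "I k \<inter> {x/2<..1} \<noteq> {}" for k
    proof -
      from that have "x / 2 < 1 / (real k + 1)" by (auto simp: I_def)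
      then have "real k + 1 < 2 / x" using x by (simp add: field_simps)
      then show ?thesis by linarith
    qed
    then have "finite {k \<in> UNIV. I k \<inter> {x/2<..1} \<noteq> {}}"
      using finite_nat_set_iff_bounded_le by auto
    moreover have "openin (top_of_set {0<..1}) {x/2<..1}"
      unfolding openin_open by (rule exI[of _ "{x/2<..}"]) (use x in auto)
    ultimately show "\<exists>V. openin (top_of_set {0<..1}) V \<and> x \<in> V \<and> finite {k \<in> UNIV. I k \<inter> V \<noteq> {}}"
      using x by (intro exI[of _ "{x/2<..1}"]) auto
  next
    fix k :: nat
    have "I k \<subseteq> {0<..1}"
    proof
      fix t assume t: "t \<in> I k"
      have "1 / (real k + 1) \<le> 1" by simp
      moreover have "t \<le> 1 / (real k + 1)" using t by (simp add: I_def)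
      ultimately have "t \<le> 1" by (rule order_trans[rotated])
      then show "t \<in> {0<..1}" using pos[OF t] by simp
    qed
    then show "closedin (top_of_set {0<..1}) (I k)"
      by (auto simp: I_def closedin_closed_eq intro!: closed_subset)
  next
    show "continuous_map (subtopology (top_of_set {0<..1}) (I i)) T (f i)" for i by (rule cont_f)
    show "\<exists>j. j \<in> UNIV \<and> t \<in> I j \<and> q t = f j t" if "t \<in> topspace (top_of_set {0<..1})" for t
      using that JI[of t] by (auto simp: q_def)
  qed (use fI in auto)
  have "pathin T q"
    unfolding pathin_def continuous_map_def
  proof (intro conjI allI impI)
    have "q t \<in> topspace T" if "t \<in> {0..1}" for t
      using that x continuous_map_image_subset_topspace[OF cont] by (cases "t = 0") (auto simp: q_def)
    then show "q \<in> topspace unit_interval \<rightarrow> topspace T" by auto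
  next
    fix V assume V: "openin T V"
    have "openin (top_of_set {0<..1}) {t \<in> topspace (top_of_set {0<..1}). q t \<in> V}"
      using cont V openin_continuous_map_preimage by blast
    then obtain W where W: "open W" "{t \<in> {0<..1}. q t \<in> V} = {0<..1} \<inter> W"
      by (auto simp: openin_open)
    have 1: "openin unit_interval {t \<in> {0<..1}. q t \<in> V}"
      unfolding openin_open W(2) by (rule exI[of _ "W \<inter> {0<..}"]) (use W(1) in auto)
    show "openin unit_interval {t \<in> topspace unit_interval. q t \<in> V}"
    proof (cases "x \<in> V")
      case False
      then have "{t \<in> topspace unit_interval. q t \<in> V} = {t \<in> {0<..1}. q t \<in> V}"
        by (auto simp: q_def order_le_less)
      with 1 show ?thesis by simp
    next
      case True
      obtain K where K: "\<And>k. k \<ge> K \<Longrightarrow> p k ` {0..1} \<subseteq> V"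
        using small[OF V True] by blast
      have "q t \<in> V" if "0 < t" "t < 1 / (real K + 1)" for t
      proof -
        have "1 / (real K + 1) \<le> 1" by simp
        then have t1: "t \<le> 1" using that by linarith
        have "real K + 1 < 1 / t" using that by (simp add: field_simps)
        then have "real K < real (J t) + 1"
          using inv[OF JI[OF that(1) t1]] by linarith
        then have "J t \<ge> K" by linarith
        then show ?thesis
          using K[of "J t"] par[OF JI[OF that(1) t1]] that by (auto simp: q_def f_def image_subset_iff)
      qed
      then have "{t \<in> topspace unit_interval. q t \<in> V} =
         {t \<in> {0<..1}. q t \<in> V} \<union> ({0..1} \<inter> {..<1 / (real K + 1)})"
        using True by (auto simp: q_def order_le_less)
      moreover have "openin unit_interval ({0..1} \<inter> {..<1 / (real K + 1)})"
        by (rule openin_open_Int) auto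
      ultimately show ?thesis using 1 by auto
    qed
  qed
  moreover have "q 0 = x" by (simp add: q_def)
  moreover have "q (2 / (2 * real k + 3)) = p k 1" for k :: nat
  proof -
    let ?t = "2 / (2 * real k + 3)"
    have t: "0 < ?t" "?t \<le> 1" by auto
    have "?t \<in> I k" by (auto simp: I_def field_simps)
    moreover have "1 - \<bar>2 * (1 / ?t - (real k + 1)) - 1\<bar> = 1" by (simp add: field_simps)
    ultimately have "f k ?t = p k 1" "f (J ?t) ?t = f k ?t"
      unfolding f_def[of k] using fI[OF JI[OF t]] by (auto simp: f_def)
    then show ?thesis using t by (simp add: q_def)
  qed
  ultimately show ?thesis by blast
qed

text \<open>If \<open>U\<close> is not a neighbourhood of its point \<open>x\<close>, there are points \<open>y k\<close> off \<open>U\<close> in a shrinking base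
  of path-connected neighbourhoods of \<open>x\<close>, and a single path visits \<open>x\<close> at time \<open>0\<close> and the \<open>y k\<close> at
  times that tend to \<open>0\<close>. The preimage of \<open>U\<close> under this path is not open.\<close>

lemma first_countable_locally_path_connected_imp_delta_generated:
  assumes "first_countable T" "locally_path_connected_space T"
  shows "delta_generated T"
  unfolding delta_generated_iff
proof (intro allI impI)
  fix U assume U: "U \<subseteq> topspace T"
    and pre: "\<forall>p. pathin T p \<longrightarrow> openin unit_interval {t \<in> {0..1}. p t \<in> U}"
  show "openin T U"
  proof (subst openin_subopen, intro ballI, rule ccontr)
    fix x assume "x \<in> U" and no: "\<not> (\<exists>V. openin T V \<and> x \<in> V \<and> V \<subseteq> U)"
    then have x: "x \<in> topspace T" using U by auto
    obtain C :: "nat \<Rightarrow> _ set" where C: "\<And>k. openin T (C k)" "\<And>k. path_connectedin T (C k)"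
      "\<And>k. x \<in> C k" "\<And>V. openin T V \<Longrightarrow> x \<in> V \<Longrightarrow> \<exists>K. \<forall>k\<ge>K. C k \<subseteq> V"
      by (rule nested_pathconnected_base[OF assms x]) (erule that, assumption+)
    have "\<exists>y. y \<in> C k \<and> y \<notin> U" for k
      using no C(1,3) by blast
    then obtain y where y: "\<And>k. y k \<in> C k \<and> y k \<notin> U" by metis
    have "\<exists>p. pathin T p \<and> p ` {0..1} \<subseteq> C k \<and> p 0 = x \<and> p 1 = y k" for k
      using C(2)[of k] C(3)[of k] y[of k] unfolding path_connectedin by (auto simp: image_subset_iff Pi_iff)
    then obtain p where p: "\<And>k. pathin T (p k) \<and> p k ` {0..1} \<subseteq> C k \<and> p k 0 = x \<and> p k 1 = y k"
      by metis
    have small: "\<exists>K. \<forall>k\<ge>K. p k ` {0..1} \<subseteq> V" if V: "openin T V" "x \<in> V" for V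
    proof -
      obtain K where K: "\<forall>k\<ge>K. C k \<subseteq> V" using C(4)[OF V] by (rule exE)
      have "p k ` {0..1} \<subseteq> V" if "k \<ge> K" for k
        using K[rule_format, OF that] p[of k] by (meson order_trans)
      then show ?thesis by blast
    qed
    have "\<exists>q. pathin T q \<and> q 0 = x \<and> (\<forall>k::nat. q (2 / (2 * real k + 3)) = p k 1)"
    proof (rule pathin_of_shrinking_paths)
      show "pathin T (p k)" "p k 0 = x" for k using p[of k] by simp_all
    qed (fact x, fact small)
    then obtain q where q0: "pathin T q \<and> q 0 = x \<and> (\<forall>k::nat. q (2 / (2 * real k + 3)) = p k 1)" ..
    then have q: "pathin T q" "q 0 = x" "\<And>k::nat. q (2 / (2 * real k + 3)) = p k 1"
      by simp_all
    have "openin unit_interval {t \<in> {0..1}. q t \<in> U}"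
      using pre q(1) by blast
    then obtain W where W: "open W" "{t \<in> {0..1}. q t \<in> U} = {0..1} \<inter> W"
      unfolding openin_open by blast
    have "0 \<in> {t \<in> {0..1}. q t \<in> U}" using q(2) \<open>x \<in> U\<close> by simp
    then have "0 \<in> W" unfolding W(2) by simp
    then obtain e where e: "e > 0" "ball 0 e \<subseteq> W"
      using W(1) open_contains_ball by blast
    obtain k :: nat where k: "real k > 1 / e" using reals_Archimedean2 by blast
    then have "2 / (2 * real k + 3) < e" using e(1) by (simp add: field_simps)
    then have "2 / (2 * real k + 3) \<in> {0..1} \<inter> W" using e by (auto simp: dist_real_def)
    then have "q (2 / (2 * real k + 3)) \<in> U" using W(2) by blast
    then show False using q(3)[of k] p y by auto
  qed
qed

section \<open>Globes as quotients of cylinders\<close>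

lemma Euclidean_space_eq: "Euclidean_space n = top_of_set {x. \<forall>i\<ge>n. x i = 0}"
  by (simp add: Euclidean_space_def euclidean_product_topology)

definition sqnorm :: "nat \<Rightarrow> (nat \<Rightarrow> real) \<Rightarrow> real" where "sqnorm n x = (\<Sum>i<n. x i ^ 2)"

text \<open>The topologies of \<open>disk\<close> and \<open>boundary_sphere\<close> are those of subsets of the metric space
  \<open>nat \<Rightarrow> real\<close>, so that uniform continuity and sequential compactness apply to them.\<close>

definition disk_set :: "nat \<Rightarrow> (nat \<Rightarrow> real) set" where
  "disk_set n = {x. (\<forall>i\<ge>n. x i = 0) \<and> sqnorm n x \<le> 1}"

definition sphere_set :: "nat \<Rightarrow> (nat \<Rightarrow> real) set" where
  "sphere_set n = {x. (\<forall>i\<ge>n. x i = 0) \<and> sqnorm n x = 1}"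

lemma disk_eq: "disk n = top_of_set (disk_set n)"
  unfolding disk_def Euclidean_space_eq subtopology_subtopology
  by (rule arg_cong[of _ _ top_of_set]) (auto simp: disk_set_def sqnorm_def)

lemma boundary_sphere_eq: "boundary_sphere n = top_of_set (sphere_set n)"
  unfolding boundary_sphere_def Euclidean_space_eq subtopology_subtopology
  by (rule arg_cong[of _ _ top_of_set]) (auto simp: sphere_set_def sqnorm_def)

lemma sphere_subset_disk: "sphere_set n \<subseteq> disk_set n"
  by (auto simp: sphere_set_def disk_set_def)

lemma continuous_on_sqnorm [continuous_intros]: "continuous_on S (sqnorm n)"
proof -
  have "continuous_on UNIV (sqnorm n)"
    unfolding sqnorm_def by (intro continuous_intros continuous_on_product_coordinates)
  then show ?thesis by (rule continuous_on_subset) simp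
qed

lemma sqnorm_nonneg: "sqnorm n x \<ge> 0"
  by (auto simp: sqnorm_def intro: sum_nonneg)

lemma sqnorm_scale: "sqnorm n (\<lambda>i. c * x i) = c^2 * sqnorm n x"
  by (simp add: sqnorm_def power_mult_distrib sum_distrib_left)

lemma coordinate_le_sqnorm: "i < n \<Longrightarrow> x i ^ 2 \<le> sqnorm n x"
  unfolding sqnorm_def by (rule member_le_sum) auto

lemma disk_set_coordinate: "x \<in> disk_set n \<Longrightarrow> \<bar>x i\<bar> \<le> 1"
proof (cases "i < n")
  case True
  assume "x \<in> disk_set n"
  then have "x i ^ 2 \<le> 1" using coordinate_le_sqnorm[OF True, of x] by (auto simp: disk_set_def)
  then show ?thesis by (simp add: abs_square_le_1)
qed (auto simp: disk_set_def)

lemma compact_disk_set: "compact (disk_set n)"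
proof -
  have "compactin (product_topology (\<lambda>i. euclideanreal) UNIV) (PiE UNIV (\<lambda>_. {-1..1}))"
    unfolding compactin_PiE by auto
  then have K: "compact (PiE UNIV (\<lambda>_::nat. {-1..1::real}))"
    by (simp add: euclidean_product_topology)
  have "closed {x::nat\<Rightarrow>real. \<forall>i\<ge>n. x i = 0}"
    using closedin_Euclidean_space[of n]
    by (simp add: topspace_Euclidean_space euclidean_product_topology)
  moreover have "closed {x. sqnorm n x \<le> 1}"
    by (intro closed_Collect_le continuous_intros)
  ultimately have "closed (disk_set n)"
    unfolding disk_set_def by (simp add: Collect_conj_eq closed_Int)
  moreover have "disk_set n \<subseteq> PiE UNIV (\<lambda>_. {-1..1})"
    using disk_set_coordinate by (fastforce simp: PiE_def Pi_def abs_le_iff)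
  ultimately show ?thesis using K compact_Int_closed[of "PiE UNIV (\<lambda>_. {-1..1})" "disk_set n"]
    by (simp add: inf_absorb2)
qed

lemma compact_sphere_set: "compact (sphere_set n)"
proof -
  have "closed {x. sqnorm n x = 1}"
    by (intro closed_Collect_eq continuous_intros)
  then have "compact (disk_set n \<inter> {x. sqnorm n x = 1})"
    using compact_disk_set compact_Int_closed by blast
  also have "disk_set n \<inter> {x. sqnorm n x = 1} = sphere_set n" by (auto simp: disk_set_def sphere_set_def)
  finally show ?thesis .
qed

lemma continuous_on_scale:
  fixes f :: "(nat \<Rightarrow> real) \<Rightarrow> real"
  assumes "continuous_on S f"
  shows "continuous_on S (\<lambda>x i. f x * x i)"
  by (intro continuous_on_coordinatewise_then_product continuous_on_mult assms
      continuous_on_subset[OF continuous_on_product_coordinates]) auto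

lemma retract_locally_path_connected:
  fixes S R :: "'b::topological_space set"
  assumes "locally_path_connected_space (top_of_set S)" "R \<subseteq> S" "continuous_on S r" "r ` S \<subseteq> R"
    "\<And>x. x \<in> R \<Longrightarrow> r x = x"
  shows "locally_path_connected_space (top_of_set R)"
proof (rule locally_path_connected_space_retraction_map_image)
  show "retraction_map (top_of_set S) (top_of_set R) r"
    unfolding retraction_map_def retraction_maps_def
    using assms(2-5) by (intro exI[of _ id])
       (auto simp: continuous_map_in_subtopology image_subset_iff continuous_on_subset)
qed (rule assms)

text \<open>Radial truncation retracts Euclidean space onto the disk, and radial projection retracts the open
  complement of the origin onto the sphere.\<close>

lemma locally_path_connected_disk_set: "locally_path_connected_space (top_of_set (disk_set n))"
proof (rule retract_locally_path_connected)
  let ?S = "{x. \<forall>i\<ge>n. x i = 0} :: (nat \<Rightarrow> real) set"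
  let ?c = "\<lambda>x. 1 / max 1 (sqrt (sqnorm n x))"
  show "locally_path_connected_space (top_of_set ?S)"
    using locally_path_connected_Euclidean_space[of n] by (simp add: Euclidean_space_eq)
  show "disk_set n \<subseteq> ?S" by (auto simp: disk_set_def)
  show "continuous_on ?S (\<lambda>x i. ?c x * x i)"
    by (intro continuous_on_scale continuous_intros) auto
  show "(\<lambda>x i. ?c x * x i) ` ?S \<subseteq> disk_set n"
  proof clarify
    fix x :: "nat \<Rightarrow> real" assume "\<forall>i\<ge>n. x i = 0"
    moreover have "sqnorm n x \<le> (max 1 (sqrt (sqnorm n x)))\<^sup>2"
      using sqnorm_nonneg[of n x] power_mono[of "sqrt (sqnorm n x)" "max 1 (sqrt (sqnorm n x))" 2] by simp
    then have "sqnorm n (\<lambda>i. ?c x * x i) \<le> 1"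
      unfolding sqnorm_scale by (simp add: power_divide divide_le_eq_1)
    ultimately show "(\<lambda>i. ?c x * x i) \<in> disk_set n" by (simp add: disk_set_def)
  qed
qed (auto simp: disk_set_def max_def)

lemma locally_path_connected_sphere_set: "locally_path_connected_space (top_of_set (sphere_set n))"
proof (rule retract_locally_path_connected)
  let ?E = "{x. \<forall>i\<ge>n. x i = 0} :: (nat \<Rightarrow> real) set"
  let ?S = "?E \<inter> {x. sqnorm n x > 0}"
  let ?c = "\<lambda>x. 1 / sqrt (sqnorm n x)"
  have "open {x. sqnorm n x > 0}"
    by (intro open_Collect_less continuous_intros)
  then have "openin (top_of_set ?E) ?S" by blast
  moreover have "locally_path_connected_space (top_of_set ?E)"
    using locally_path_connected_Euclidean_space[of n] by (simp add: Euclidean_space_eq)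
  ultimately have "locally_path_connected_space (subtopology (top_of_set ?E) ?S)"
    by (rule locally_path_connected_space_open_subset[rotated])
  then show "locally_path_connected_space (top_of_set ?S)"
    by (simp add: subtopology_subtopology)
  show "sphere_set n \<subseteq> ?S" by (auto simp: sphere_set_def)
  show "continuous_on ?S (\<lambda>x i. ?c x * x i)"
    by (intro continuous_on_scale continuous_intros) auto
  show "(\<lambda>x i. ?c x * x i) ` ?S \<subseteq> sphere_set n"
    unfolding sphere_set_def by (clarify, simp only: sqnorm_scale) (simp add: power_divide)
qed (auto simp: sphere_set_def)

lemma prod_unit_interval: "prod_topology (top_of_set S) unit_interval = top_of_set (S \<times> {0..1})"
  by (metis euclidean_product_topology prod_topology_subtopology(1) prod_topology_subtopology_eu subtopology_UNIV)

text \<open>Consequently the \<open>\<Delta>\<close>-kelleyfication of the product in the definition of the globe leaves the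
  topology unchanged for disks and spheres.\<close>

lemma delta_generated_cylinder:
  fixes S :: "(nat \<Rightarrow> real) set"
  assumes "locally_path_connected_space (top_of_set S)"
  shows "delta_generated (top_of_set (S \<times> {0..1::real}))"
proof (rule first_countable_locally_path_connected_imp_delta_generated)
  show "first_countable (top_of_set (S \<times> {0..1::real}))"
    by (intro metrizable_imp_first_countable metrizable_space_subtopology metrizable_space_euclidean)
  show "locally_path_connected_space (top_of_set (S \<times> {0..1::real}))"
    unfolding prod_unit_interval[symmetric] locally_path_connected_space_prod_topology
    using assms locally_path_connected_real_interval(1) by blast
qed

text \<open>The two end points are mentioned separately because of the boundary of the zero-dimensional disk:
  there \<open>S\<close> is empty, and the globe consists of the end points alone.\<close>

lemma continuous_map_from_globe:
  fixes S :: "(nat \<Rightarrow> real) set"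
  assumes "locally_path_connected_space (top_of_set S)"
  shows "continuous_map (globe_topology (top_of_set S)) Y u \<longleftrightarrow>
    u Src \<in> topspace Y \<and> u Tgt \<in> topspace Y \<and>
    continuous_map (top_of_set (S \<times> {0..1})) Y (u \<circ> globe_proj)" (is "?L \<longleftrightarrow> ?R")
proof -
  have dk: "delta_kelleyfication (prod_topology (top_of_set S) unit_interval) = top_of_set (S \<times> {0..1})"
    using delta_generated_cylinder[OF assms] by (simp add: prod_unit_interval delta_generated_def)
  let ?A = "{Src, Tgt} \<union> globe_proj ` (S \<times> {0..1})"
  have tp: "topspace (globe_topology (top_of_set S)) = ?A" by simp
  have op: "openin (globe_topology (top_of_set S)) U \<longleftrightarrow>
     U \<subseteq> ?A \<and> openin (top_of_set (S \<times> {0..1})) {x \<in> S \<times> {0..1}. globe_proj x \<in> U}" for U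
    unfolding globe_topology_def openin_final_topology dk by simp
  show ?thesis
  proof
    assume L: ?L
    have "continuous_map (top_of_set (S \<times> {0..1})) (globe_topology (top_of_set S)) globe_proj"
      unfolding continuous_map_def using op tp by auto
    then show ?R using L continuous_map_compose continuous_map_image_subset_topspace[OF L] by fastforce
  next
    assume R: ?R
    show ?L unfolding continuous_map_def
    proof (intro conjI allI impI)
      show "u \<in> topspace (globe_topology (top_of_set S)) \<rightarrow> topspace Y"
        using R unfolding tp continuous_map_def by auto
      fix U assume "openin Y U"
      then have "openin (top_of_set (S \<times> {0..1})) {x \<in> S \<times> {0..1}. u (globe_proj x) \<in> U}"
        using R unfolding continuous_map_def by simp
      moreover have "{x \<in> S \<times> {0..1}. globe_proj x \<in> {x \<in> ?A. u x \<in> U}} = {x \<in> S \<times> {0..1}. u (globe_proj x) \<in> U}"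
        by auto
      ultimately show "openin (globe_topology (top_of_set S)) {x \<in> topspace (globe_topology (top_of_set S)). u x \<in> U}"
        unfolding op tp by (simp only: mem_Collect_eq) blast
    qed
  qed
qed

section \<open>Maps of multipointed d-spaces and their test objects\<close>

lemma reparams_continuous:
  assumes "\<phi> \<in> reparams P"
  shows "continuous_map unit_interval unit_interval \<phi>"
proof (cases P)
  case Homeos
  then have "homeomorphic_map unit_interval unit_interval \<phi>" using assms by simp
  then show ?thesis by (rule homeomorphic_imp_continuous_map)
next
  case Surjections
  then show ?thesis using assms by simp
qed

lemma reparams_range: "\<phi> \<in> reparams P \<Longrightarrow> t \<in> {0..1} \<Longrightarrow> \<phi> t \<in> {0..1}"
  using continuous_map_image_subset_topspace[OF reparams_continuous, of \<phi> P] by fastforce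

lemma restrict_in_continuous_maps:
  "continuous_map S T f \<Longrightarrow> restrict f (topspace S) \<in> continuous_maps S T"
  unfolding continuous_maps_def by (auto intro: continuous_map_eq)

lemma restrict_path_in_continuous_maps:
  "continuous_map unit_interval T f \<Longrightarrow> restrict f {0..1} \<in> continuous_maps unit_interval T"
  using restrict_in_continuous_maps[of unit_interval T f] by simp

lemma md_mapI:
  assumes "continuous_map (underlying X) (underlying Y) f"
    "\<And>x. x \<in> states X \<Longrightarrow> f x \<in> states Y"
    "\<And>\<gamma>. \<gamma> \<in> execution_paths X \<Longrightarrow> restrict (f \<circ> \<gamma>) {0..1} \<in> execution_paths Y"
  shows "md_map X Y f"
  unfolding md_map_def using assms by auto

lemma md_mapD:
  assumes "md_map X Y f"
  shows "continuous_map (underlying X) (underlying Y) f"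
    "\<And>x. x \<in> states X \<Longrightarrow> f x \<in> states Y"
    "\<And>\<gamma>. \<gamma> \<in> execution_paths X \<Longrightarrow> restrict (f \<circ> \<gamma>) {0..1} \<in> execution_paths Y"
    "\<And>x. x \<in> topspace (underlying X) \<Longrightarrow> f x \<in> topspace (underlying Y)"
proof -
  show c: "continuous_map (underlying X) (underlying Y) f" using assms by (simp add: md_map_def)
  show "f x \<in> topspace (underlying Y)" if "x \<in> topspace (underlying X)" for x
    using continuous_map_image_subset_topspace[OF c] that by blast
qed (use assms in \<open>unfold md_map_def, blast+\<close>)

lemma multipointedD:
  assumes "multipointed_d_space C P X"
  shows "in_Top C (underlying X)" "states X \<subseteq> topspace (underlying X)"
    "execution_paths X \<subseteq> continuous_maps unit_interval (underlying X)"
    "\<And>\<gamma>. \<gamma> \<in> execution_paths X \<Longrightarrow> \<gamma> 0 \<in> states X"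
    "\<And>\<gamma>. \<gamma> \<in> execution_paths X \<Longrightarrow> \<gamma> 1 \<in> states X"
    "\<And>\<gamma> \<phi>. \<gamma> \<in> execution_paths X \<Longrightarrow> \<phi> \<in> reparams P \<Longrightarrow> restrict (\<gamma> \<circ> \<phi>) {0..1} \<in> execution_paths X"
    "\<And>\<gamma>1 \<gamma>2. \<gamma>1 \<in> execution_paths X \<Longrightarrow> \<gamma>2 \<in> execution_paths X \<Longrightarrow> \<gamma>1 1 = \<gamma>2 0 \<Longrightarrow>
       normalized_composition \<gamma>1 \<gamma>2 \<in> execution_paths X"
    "\<And>\<gamma>. \<gamma> \<in> execution_paths X \<Longrightarrow> \<gamma> \<in> extensional {0..1}"
    "\<And>\<gamma>. \<gamma> \<in> execution_paths X \<Longrightarrow> continuous_map unit_interval (underlying X) \<gamma>"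
proof -
  show "\<gamma> \<in> extensional {0..1}" "continuous_map unit_interval (underlying X) \<gamma>"
    if "\<gamma> \<in> execution_paths X" for \<gamma>
  proof -
    have "\<gamma> \<in> continuous_maps unit_interval (underlying X)"
      using assms that unfolding multipointed_d_space_def by blast
    then show "\<gamma> \<in> extensional {0..1}" "continuous_map unit_interval (underlying X) \<gamma>"
      unfolding continuous_maps_def by simp_all
  qed
qed (use assms in \<open>unfold multipointed_d_space_def, blast+\<close>)

lemma multipointed_path_range:
  assumes "multipointed_d_space C P X" "\<gamma> \<in> execution_paths X" "t \<in> {0..1}"
  shows "\<gamma> t \<in> topspace (underlying X)"
  using continuous_map_image_subset_topspace[OF multipointedD(9)[OF assms(1,2)]] assms(3) by auto

lemma md_map_compose:
  assumes f: "md_map X Y f" and g: "md_map Y Z g"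
  shows "md_map X Z (g \<circ> f)"
proof (rule md_mapI)
  show "continuous_map (underlying X) (underlying Z) (g \<circ> f)"
    using md_mapD(1)[OF f] md_mapD(1)[OF g] by (rule continuous_map_compose)
  show "(g \<circ> f) x \<in> states Z" if "x \<in> states X" for x
    using md_mapD(2)[OF g md_mapD(2)[OF f that]] by simp
  show "restrict (g \<circ> f \<circ> \<gamma>) {0..1} \<in> execution_paths Z" if "\<gamma> \<in> execution_paths X" for \<gamma>
  proof -
    have "restrict (g \<circ> f \<circ> \<gamma>) {0..1} = restrict (g \<circ> restrict (f \<circ> \<gamma>) {0..1}) {0..1}"
      by (simp add: restrict_def fun_eq_iff)
    then show ?thesis using md_mapD(3)[OF g md_mapD(3)[OF f that]] by simp
  qed
qed

lemma md_map_eq_on: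
  assumes f: "md_map X Y f" and eq: "eq_on X f g" and X: "multipointed_d_space C P X"
  shows "md_map X Y g"
proof (rule md_mapI)
  have fg: "f x = g x" if "x \<in> topspace (underlying X)" for x
    using eq that by (simp add: eq_on_def)
  show "continuous_map (underlying X) (underlying Y) g"
    using md_mapD(1)[OF f] fg by (rule continuous_map_eq)
  show "g x \<in> states Y" if "x \<in> states X" for x
    using md_mapD(2)[OF f that] fg multipointedD(2)[OF X] that by auto
  show "restrict (g \<circ> \<gamma>) {0..1} \<in> execution_paths Y" if "\<gamma> \<in> execution_paths X" for \<gamma>
  proof -
    have "restrict (g \<circ> \<gamma>) {0..1} = restrict (f \<circ> \<gamma>) {0..1}"
      using fg multipointed_path_range[OF X that] by (auto simp: restrict_def fun_eq_iff)
    then show ?thesis using md_mapD(3)[OF f that] by simp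
  qed
qed

text \<open>Transport of structure along an injection. The universal properties range over test objects with
  carrier in one type; copies in this type make test objects with other carriers available.\<close>

definition md_copy :: "('b \<Rightarrow> 'u) \<Rightarrow> 'b mdspace \<Rightarrow> 'u mdspace" where
  "md_copy e Y = \<lparr>underlying = pullback_topology (e ` topspace (underlying Y)) (inv e) (underlying Y),
     states = e ` states Y,
     execution_paths = (\<lambda>\<gamma>. restrict (e \<circ> \<gamma>) {0..1}) ` execution_paths Y\<rparr>"

lemma
  assumes "inj e"
  shows topspace_md_copy: "topspace (underlying (md_copy e Y)) = e ` topspace (underlying Y)"
    and continuous_map_to_md_copy: "continuous_map (underlying Y) (underlying (md_copy e Y)) e"
    and continuous_map_from_md_copy: "continuous_map (underlying (md_copy e Y)) (underlying Y) (inv e)"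
proof -
  show "topspace (underlying (md_copy e Y)) = e ` topspace (underlying Y)"
    using assms by (auto simp: md_copy_def topspace_pullback_topology)
  have "inv e \<circ> e = id" using assms by simp
  then show "continuous_map (underlying Y) (underlying (md_copy e Y)) e"
    unfolding md_copy_def by (auto intro!: continuous_map_pullback')
  show "continuous_map (underlying (md_copy e Y)) (underlying Y) (inv e)"
    using continuous_map_pullback[of "underlying Y" "underlying Y" id "e ` topspace (underlying Y)" "inv e"]
    by (simp add: md_copy_def)
qed

lemma openin_md_copy:
  assumes "inj e"
  shows "openin (underlying (md_copy e Y)) U \<longleftrightarrow>
    U \<subseteq> e ` topspace (underlying Y) \<and> openin (underlying Y) {x \<in> topspace (underlying Y). e x \<in> U}"
proof
  assume "openin (underlying (md_copy e Y)) U"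
  then show "U \<subseteq> e ` topspace (underlying Y) \<and> openin (underlying Y) {x \<in> topspace (underlying Y). e x \<in> U}"
    using openin_subset[of "underlying (md_copy e Y)" U] topspace_md_copy[OF assms, of Y]
      openin_continuous_map_preimage[OF continuous_map_to_md_copy[OF assms], of Y U] by simp
next
  let ?V = "{x \<in> topspace (underlying Y). e x \<in> U}"
  assume A: "U \<subseteq> e ` topspace (underlying Y) \<and> openin (underlying Y) ?V"
  have "U \<subseteq> e ` topspace (underlying Y)" using A by (rule conjunct1)
  then have "U = inv e -` ?V \<inter> e ` topspace (underlying Y)"
    using inv_f_f[OF assms] by fastforce
  then show "openin (underlying (md_copy e Y)) U"
    using conjunct2[OF A] unfolding md_copy_def openin_pullback_topology mdspace.simps by (metis (no_types, lifting))
qed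

lemma multipointed_md_copy:
  assumes inj: "inj e" and Y: "multipointed_d_space C P Y"
  shows "multipointed_d_space C P (md_copy e Y)"
proof -
  let ?T = "underlying Y" and ?T' = "underlying (md_copy e Y)"
  note cont = continuous_map_to_md_copy[OF inj] continuous_map_from_md_copy[OF inj]
  have ie: "inv e (e x) = x" for x using inj by simp
  have YE: "\<gamma> \<in> extensional {0..1} \<and> continuous_map unit_interval ?T \<gamma>" if "\<gamma> \<in> execution_paths Y" for \<gamma>
    using Y that by (auto simp: multipointed_d_space_def continuous_maps_def)
  have gen: "delta_generated ?T'" if T: "delta_generated ?T"
    unfolding delta_generated_iff
  proof (intro allI impI)
    fix U assume U: "U \<subseteq> topspace ?T'"
      and pre: "\<forall>p. pathin ?T' p \<longrightarrow> openin unit_interval {t \<in> {0..1}. p t \<in> U}"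
    have "openin unit_interval {t \<in> {0..1}. p t \<in> {x \<in> topspace ?T. e x \<in> U}}" if p: "pathin ?T p" for p
    proof -
      have "pathin ?T' (e \<circ> p)" using p cont(1) unfolding pathin_def by (rule continuous_map_compose)
      then have "openin unit_interval {t \<in> {0..1}. (e \<circ> p) t \<in> U}" using pre by blast
      moreover have "{t \<in> {0..1}. (e \<circ> p) t \<in> U} = {t \<in> {0..1}. p t \<in> {x \<in> topspace ?T. e x \<in> U}}"
        using continuous_map_image_subset_topspace[OF p[unfolded pathin_def]] by auto
      ultimately show ?thesis by simp
    qed
    then have "openin ?T {x \<in> topspace ?T. e x \<in> U}"
      by (intro delta_generatedD[OF T]) auto
    then show "openin ?T' U"
      using U by (simp add: openin_md_copy[OF inj] topspace_md_copy[OF inj])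
  qed
  have haus: "delta_hausdorff ?T'" if T: "delta_hausdorff ?T"
    unfolding delta_hausdorff_def
  proof (intro allI impI)
    fix p assume p: "pathin ?T' p"
    then have "pathin ?T (inv e \<circ> p)"
      using cont(2) unfolding pathin_def by (rule continuous_map_compose)
    then have "closedin ?T ((inv e \<circ> p) ` {0..1})"
      using T unfolding delta_hausdorff_def by blast
    then have "closedin ?T' {y \<in> topspace ?T'. inv e y \<in> (inv e \<circ> p) ` {0..1}}"
      by (rule closedin_continuous_map_preimage[OF cont(2)])
    moreover have "{y \<in> topspace ?T'. inv e y \<in> (inv e \<circ> p) ` {0..1}} = p ` {0..1}"
    proof -
      have sub: "p ` {0..1} \<subseteq> topspace ?T'"
        using continuous_map_image_subset_topspace[OF p[unfolded pathin_def]] by simp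
      have inj': "inj_on (inv e) (topspace ?T')"
        unfolding topspace_md_copy[OF inj] by (auto simp: inj_on_def ie)
      have "inv e y \<in> (inv e \<circ> p) ` {0..1} \<longleftrightarrow> y \<in> p ` {0..1}" if "y \<in> topspace ?T'" for y
        unfolding image_comp[symmetric] by (rule inj_on_image_mem_iff[OF inj' that sub])
      then show ?thesis
        using sub by blast
    qed
    ultimately show "closedin ?T' (p ` {0..1})" by simp
  qed
  have "in_Top C ?T'"
    using Y gen haus by (cases C) (auto simp: multipointed_d_space_def)
  moreover have "states (md_copy e Y) \<subseteq> topspace ?T'"
    unfolding topspace_md_copy[OF inj] using multipointedD(2)[OF Y] by (auto simp: md_copy_def)
  moreover have "execution_paths (md_copy e Y) \<subseteq> continuous_maps unit_interval ?T'"
  proof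
    fix \<gamma>' assume "\<gamma>' \<in> execution_paths (md_copy e Y)"
    then obtain \<gamma> where g: "\<gamma> \<in> execution_paths Y" "\<gamma>' = restrict (e \<circ> \<gamma>) {0..1}"
      by (auto simp: md_copy_def)
    have "continuous_map unit_interval ?T' (e \<circ> \<gamma>)"
      using YE[OF g(1)] cont(1) by (blast intro: continuous_map_compose)
    then show "\<gamma>' \<in> continuous_maps unit_interval ?T'"
      unfolding g(2) continuous_maps_def by (auto intro: continuous_map_eq)
  qed
  moreover have "\<forall>\<gamma>\<in>execution_paths (md_copy e Y). \<gamma> 0 \<in> states (md_copy e Y) \<and> \<gamma> 1 \<in> states (md_copy e Y)"
    using Y by (auto simp: md_copy_def multipointed_d_space_def)
  moreover have "\<forall>\<gamma>\<in>execution_paths (md_copy e Y). \<forall>\<phi>\<in>reparams P.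
      restrict (\<gamma> \<circ> \<phi>) {0..1} \<in> execution_paths (md_copy e Y)"
  proof (intro ballI)
    fix \<gamma>' \<phi> assume "\<gamma>' \<in> execution_paths (md_copy e Y)" and \<phi>: "\<phi> \<in> reparams P"
    then obtain \<gamma> where g: "\<gamma> \<in> execution_paths Y" "\<gamma>' = restrict (e \<circ> \<gamma>) {0..1}"
      by (auto simp: md_copy_def)
    have "restrict (\<gamma>' \<circ> \<phi>) {0..1} = restrict (e \<circ> restrict (\<gamma> \<circ> \<phi>) {0..1}) {0..1}"
      using reparams_range[OF \<phi>] by (auto simp: g(2) restrict_def)
    moreover have "restrict (\<gamma> \<circ> \<phi>) {0..1} \<in> execution_paths Y"
      using Y g(1) \<phi> by (auto simp: multipointed_d_space_def)
    ultimately show "restrict (\<gamma>' \<circ> \<phi>) {0..1} \<in> execution_paths (md_copy e Y)"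
      by (auto simp: md_copy_def)
  qed
  moreover have "\<forall>\<gamma>1\<in>execution_paths (md_copy e Y). \<forall>\<gamma>2\<in>execution_paths (md_copy e Y).
      \<gamma>1 1 = \<gamma>2 0 \<longrightarrow> normalized_composition \<gamma>1 \<gamma>2 \<in> execution_paths (md_copy e Y)"
  proof (intro ballI impI)
    fix \<gamma>1' \<gamma>2' assume "\<gamma>1' \<in> execution_paths (md_copy e Y)" "\<gamma>2' \<in> execution_paths (md_copy e Y)"
      and e: "\<gamma>1' 1 = \<gamma>2' 0"
    then obtain \<gamma>1 \<gamma>2 where g: "\<gamma>1 \<in> execution_paths Y" "\<gamma>1' = restrict (e \<circ> \<gamma>1) {0..1}"
      "\<gamma>2 \<in> execution_paths Y" "\<gamma>2' = restrict (e \<circ> \<gamma>2) {0..1}"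
      by (auto simp: md_copy_def)
    have "\<gamma>1 1 = \<gamma>2 0" using e inj by (auto simp: g inj_eq)
    then have "normalized_composition \<gamma>1 \<gamma>2 \<in> execution_paths Y"
      using Y g by (auto simp: multipointed_d_space_def)
    moreover have "normalized_composition \<gamma>1' \<gamma>2' = restrict (e \<circ> normalized_composition \<gamma>1 \<gamma>2) {0..1}"
      by (auto simp: g normalized_composition_def restrict_def fun_eq_iff)
    ultimately show "normalized_composition \<gamma>1' \<gamma>2' \<in> execution_paths (md_copy e Y)"
      by (auto simp: md_copy_def)
  qed
  ultimately show ?thesis unfolding multipointed_d_space_def by blast
qed

lemma md_map_to_copy: "inj e \<Longrightarrow> md_map Y (md_copy e Y) e"
  using continuous_map_to_md_copy[of e Y] by (auto simp: md_map_def) (auto simp: md_copy_def)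

lemma md_map_from_copy:
  assumes "inj e" "multipointed_d_space C P Y"
  shows "md_map (md_copy e Y) Y (inv e)"
proof -
  have "restrict (inv e \<circ> restrict (e \<circ> \<gamma>) {0..1}) {0..1} = \<gamma>" if "\<gamma> \<in> execution_paths Y" for \<gamma>
  proof -
    have "\<gamma> \<in> extensional {0..1}"
      using assms(2) that by (auto simp: multipointed_d_space_def continuous_maps_def)
    then show ?thesis using assms(1) by (auto simp: restrict_def extensional_def)
  qed
  then show ?thesis
    using continuous_map_from_md_copy[OF assms(1), of Y] assms(1)
    by (auto simp: md_map_def) (auto simp: md_copy_def)
qed

text \<open>Factorization and uniqueness in the universal property of a pushout, and then of a colimit, for
  test objects with carrier in any type that embeds into the type of the universal property. The
  maps are composed with the embedding \<open>e\<close>, respectively with its inverse.\<close>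

lemma pushout_factor:
  fixes e :: "'b \<Rightarrow> 'u" and Y :: "'b mdspace"
  assumes po: "is_pushout TYPE('u) C P A B B' D f f' h h'" and e: "inj e"
    and Y: "multipointed_d_space C P Y" "md_map B Y u" "md_map B' Y u'" "eq_on A (u \<circ> f) (u' \<circ> f')"
  shows "\<exists>w. md_map D Y w \<and> eq_on B (w \<circ> h) u \<and> eq_on B' (w \<circ> h') u'"
proof -
  have "\<exists>w. md_map D (md_copy e Y) w \<and> eq_on B (w \<circ> h) (e \<circ> u) \<and> eq_on B' (w \<circ> h') (e \<circ> u')"
  proof -
    have "eq_on A ((e \<circ> u) \<circ> f) ((e \<circ> u') \<circ> f')" using Y(4) by (simp add: eq_on_def)
    then show ?thesis
      using po multipointed_md_copy[OF e Y(1)] md_map_compose[OF Y(2) md_map_to_copy[OF e]]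
        md_map_compose[OF Y(3) md_map_to_copy[OF e]]
      unfolding is_pushout_def by meson
  qed
  then obtain w where w: "md_map D (md_copy e Y) w" "eq_on B (w \<circ> h) (e \<circ> u)" "eq_on B' (w \<circ> h') (e \<circ> u')"
    by blast
  show ?thesis
    using md_map_compose[OF w(1) md_map_from_copy[OF e Y(1)]] w(2,3) e
    by (intro exI[of _ "inv e \<circ> w"]) (auto simp: eq_on_def)
qed

lemma pushout_unique:
  fixes e :: "'b \<Rightarrow> 'u" and Y :: "'b mdspace"
  assumes po: "is_pushout TYPE('u) C P A B B' D f f' h h'" and e: "inj e"
    and Y: "multipointed_d_space C P Y" and w: "md_map D Y w" and w': "md_map D Y w'"
    and eq: "eq_on B (w \<circ> h) (w' \<circ> h)" "eq_on B' (w \<circ> h') (w' \<circ> h')"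
  shows "eq_on D w w'"
proof -
  let ?u = "e \<circ> (w \<circ> h)" and ?u' = "e \<circ> (w \<circ> h')"
  have h: "md_map B D h" "md_map B' D h'" "eq_on A (h \<circ> f) (h' \<circ> f')"
    using po unfolding is_pushout_def by auto
  have m: "md_map D (md_copy e Y) (e \<circ> w)" "md_map D (md_copy e Y) (e \<circ> w')"
    using w w' md_map_to_copy[OF e] by (auto intro: md_map_compose)
  have u: "md_map B (md_copy e Y) ?u" "md_map B' (md_copy e Y) ?u'"
    using h md_map_compose[OF _ m(1)] by (simp_all add: comp_assoc)
  have "eq_on A (?u \<circ> f) (?u' \<circ> f')" using h(3) by (auto simp: eq_on_def)
  then obtain W where W: "\<And>w'. md_map D (md_copy e Y) w' \<and> eq_on B (w' \<circ> h) ?u \<and> eq_on B' (w' \<circ> h') ?u'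
      \<longrightarrow> eq_on D w' W"
    using po multipointed_md_copy[OF e Y] u unfolding is_pushout_def by meson
  have "eq_on D (e \<circ> w) W" "eq_on D (e \<circ> w') W"
    using W[of "e \<circ> w"] W[of "e \<circ> w'"] m eq by (auto simp: eq_on_def)
  then show ?thesis using e by (auto simp: eq_on_def inj_eq) (metis injD)
qed

lemma colimit_factor:
  fixes e :: "'b \<Rightarrow> 'u" and Y :: "'b mdspace"
  assumes co: "is_colimit_at TYPE('u) C P X tr \<nu>" and e: "inj e"
    and Y: "multipointed_d_space C P Y" "\<And>\<mu>. \<mu> < \<nu> \<Longrightarrow> md_map (X \<mu>) Y (u \<mu>)"
    and u: "\<And>\<mu> \<kappa>. \<mu> < \<nu> \<Longrightarrow> \<kappa> \<le> \<mu> \<Longrightarrow> eq_on (X \<kappa>) (u \<mu> \<circ> tr \<kappa> \<mu>) (u \<kappa>)"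
  shows "\<exists>w. md_map (X \<nu>) Y w \<and> (\<forall>\<mu><\<nu>. eq_on (X \<mu>) (w \<circ> tr \<mu> \<nu>) (u \<mu>))"
proof -
  have "\<forall>\<mu><\<nu>. md_map (X \<mu>) (md_copy e Y) (e \<circ> u \<mu>)"
    using Y(2) md_map_to_copy[OF e] by (auto intro: md_map_compose)
  moreover have "\<forall>\<mu><\<nu>. \<forall>\<kappa>\<le>\<mu>. eq_on (X \<kappa>) (e \<circ> u \<mu> \<circ> tr \<kappa> \<mu>) (e \<circ> u \<kappa>)"
    using u by (auto simp: eq_on_def)
  ultimately obtain w where w: "md_map (X \<nu>) (md_copy e Y) w" "\<And>\<mu>. \<mu> < \<nu> \<Longrightarrow> eq_on (X \<mu>) (w \<circ> tr \<mu> \<nu>) (e \<circ> u \<mu>)"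
    using co[unfolded is_colimit_at_def, rule_format, of "md_copy e Y" "\<lambda>\<mu>. e \<circ> u \<mu>"]
      multipointed_md_copy[OF e Y(1)] by blast
  show ?thesis
    using md_map_compose[OF w(1) md_map_from_copy[OF e Y(1)]] w(2) e
    by (intro exI[of _ "inv e \<circ> w"]) (auto simp: eq_on_def)
qed

lemma colimit_unique:
  fixes e :: "'b \<Rightarrow> 'u" and Y :: "'b mdspace"
  assumes co: "is_colimit_at TYPE('u) C P X tr \<nu>" and e: "inj e"
    and Y: "multipointed_d_space C P Y" and w: "md_map (X \<nu>) Y w" and w': "md_map (X \<nu>) Y w'"
    and tr: "\<And>\<mu>. \<mu> < \<nu> \<Longrightarrow> md_map (X \<mu>) (X \<nu>) (tr \<mu> \<nu>)"
    and tr_tr: "\<And>\<mu> \<kappa>. \<mu> < \<nu> \<Longrightarrow> \<kappa> \<le> \<mu> \<Longrightarrow> eq_on (X \<kappa>) (tr \<mu> \<nu> \<circ> tr \<kappa> \<mu>) (tr \<kappa> \<nu>)"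
    and eq: "\<And>\<mu>. \<mu> < \<nu> \<Longrightarrow> eq_on (X \<mu>) (w \<circ> tr \<mu> \<nu>) (w' \<circ> tr \<mu> \<nu>)"
  shows "eq_on (X \<nu>) w w'"
proof -
  let ?u = "\<lambda>\<mu>. e \<circ> (w \<circ> tr \<mu> \<nu>)"
  have m: "md_map (X \<nu>) (md_copy e Y) (e \<circ> w)" "md_map (X \<nu>) (md_copy e Y) (e \<circ> w')"
    using w w' md_map_to_copy[OF e] by (auto intro: md_map_compose)
  have "\<forall>\<mu><\<nu>. md_map (X \<mu>) (md_copy e Y) (?u \<mu>)"
    using tr by (auto simp: comp_assoc[symmetric] intro: md_map_compose[OF _ m(1)])
  moreover have "\<forall>\<mu><\<nu>. \<forall>\<kappa>\<le>\<mu>. eq_on (X \<kappa>) (?u \<mu> \<circ> tr \<kappa> \<mu>) (?u \<kappa>)"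
    using tr_tr by (auto simp: eq_on_def)
  ultimately obtain W where W: "\<And>w'. md_map (X \<nu>) (md_copy e Y) w' \<and> (\<forall>\<mu><\<nu>. eq_on (X \<mu>) (w' \<circ> tr \<mu> \<nu>) (?u \<mu>))
      \<longrightarrow> eq_on (X \<nu>) w' W"
    using co[unfolded is_colimit_at_def, rule_format, of "md_copy e Y" ?u]
      multipointed_md_copy[OF e Y(1)] by blast
  have "eq_on (X \<nu>) (e \<circ> w) W" "eq_on (X \<nu>) (e \<circ> w') W"
    using W[of "e \<circ> w"] W[of "e \<circ> w'"] m eq by (auto simp: eq_on_def)
  then show ?thesis using e by (auto simp: eq_on_def inj_eq) (metis injD)
qed

text \<open>All points are states and all paths are execution paths, so that a map into this object is nothing
  but a continuous function. It turns the universal properties into statements on functions.\<close>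

definition cofree_unit :: "real mdspace" where
  "cofree_unit = \<lparr>underlying = unit_interval, states = {0..1},
     execution_paths = continuous_maps unit_interval unit_interval\<rparr>"

lemma continuous_normalized_composition:
  assumes "continuous_map unit_interval T \<gamma>1" "continuous_map unit_interval T \<gamma>2" "\<gamma>1 1 = \<gamma>2 0"
  shows "continuous_map unit_interval T (normalized_composition \<gamma>1 \<gamma>2)"
proof -
  let ?f = "\<lambda>t. if t \<le> 1/2 then \<gamma>1 (2 * t) else \<gamma>2 (2 * t - 1)"
  have 1: "continuous_map (subtopology unit_interval {t. t \<le> 1/2}) T (\<gamma>1 \<circ> (\<lambda>t. 2 * t))"
    by (rule continuous_map_compose[OF _ assms(1)])
       (auto simp: subtopology_subtopology continuous_map_in_subtopology intro!: continuous_intros)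
  have 2: "continuous_map (subtopology unit_interval {t. 1/2 \<le> t}) T (\<gamma>2 \<circ> (\<lambda>t. 2 * t - 1))"
    by (rule continuous_map_compose[OF _ assms(2)])
       (auto simp: subtopology_subtopology continuous_map_in_subtopology intro!: continuous_intros)
  have "continuous_map unit_interval T ?f"
  proof (rule continuous_map_cases_le)
    have "subtopology unit_interval {x \<in> topspace unit_interval. x \<le> 1/2} = subtopology unit_interval {t. t \<le> 1/2}"
      "subtopology unit_interval {x \<in> topspace unit_interval. 1/2 \<le> x} = subtopology unit_interval {t. 1/2 \<le> t}"
      unfolding subtopology_subtopology by (auto intro!: arg_cong[of _ _ top_of_set])
    then show "continuous_map (subtopology unit_interval {x \<in> topspace unit_interval. x \<le> 1/2}) T (\<lambda>t. \<gamma>1 (2 * t))"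
      "continuous_map (subtopology unit_interval {x \<in> topspace unit_interval. 1/2 \<le> x}) T (\<lambda>t. \<gamma>2 (2 * t - 1))"
      using 1 2 by (simp_all only: o_def)
    show "\<gamma>1 (2 * t) = \<gamma>2 (2 * t - 1)" if "t \<in> topspace unit_interval" "t = 1/2" for t
      using assms(3) by (simp add: that(2))
  qed auto
  then show ?thesis
    unfolding normalized_composition_def by (auto intro: continuous_map_eq)
qed

lemma multipointed_continuous_paths:
  assumes "in_Top C T"
  shows "multipointed_d_space C P
    \<lparr>underlying = T, states = topspace T, execution_paths = continuous_maps unit_interval T\<rparr>"
proof -
  have "restrict (\<gamma> \<circ> \<phi>) {0..1} \<in> continuous_maps unit_interval T"
    if "\<gamma> \<in> continuous_maps unit_interval T" "\<phi> \<in> reparams P" for \<gamma> \<phi>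
  proof -
    have "continuous_map unit_interval T (\<gamma> \<circ> \<phi>)"
      using that(1) continuous_map_compose[OF reparams_continuous[OF that(2)]]
      unfolding continuous_maps_def by blast
    then show ?thesis by (rule restrict_path_in_continuous_maps)
  qed
  moreover have "normalized_composition \<gamma>1 \<gamma>2 \<in> continuous_maps unit_interval T"
    if "\<gamma>1 \<in> continuous_maps unit_interval T" "\<gamma>2 \<in> continuous_maps unit_interval T" "\<gamma>1 1 = \<gamma>2 0" for \<gamma>1 \<gamma>2
    using that continuous_normalized_composition[of T \<gamma>1 \<gamma>2]
    by (auto simp: continuous_maps_def normalized_composition_def)
  ultimately show ?thesis
    using assms unfolding multipointed_d_space_def
    by (auto simp: continuous_maps_def dest!: continuous_map_image_subset_topspace)
qed

lemma in_Top_if_Hausdorff: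
  assumes "delta_generated T" "Hausdorff_space T"
  shows "in_Top C T"
proof -
  have "delta_hausdorff T"
    unfolding delta_hausdorff_def pathin_def
    using assms(2) by (auto intro!: compactin_imp_closedin image_compactin[of unit_interval])
  then show ?thesis using assms by (cases C) auto
qed

lemma multipointed_cofree_unit: "multipointed_d_space C P cofree_unit"
proof -
  have "in_Top C unit_interval"
    by (intro in_Top_if_Hausdorff first_countable_locally_path_connected_imp_delta_generated
         metrizable_imp_first_countable metrizable_space_subtopology metrizable_space_euclidean
         locally_path_connected_real_interval Hausdorff_space_subtopology Hausdorff_space_euclidean)
  from multipointed_continuous_paths[OF this] show ?thesis
    by (simp add: cofree_unit_def)
qed

lemma md_map_cofree_unit_iff:
  assumes "states X \<subseteq> topspace (underlying X)"
    "execution_paths X \<subseteq> continuous_maps unit_interval (underlying X)"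
  shows "md_map X cofree_unit f \<longleftrightarrow> continuous_map (underlying X) unit_interval f"
proof
  assume f: "continuous_map (underlying X) unit_interval f"
  have "f x \<in> {0..1}" if "x \<in> states X" for x
    using continuous_map_image_subset_topspace[OF f] assms(1) that by fastforce
  moreover have "restrict (f \<circ> \<gamma>) {0..1} \<in> continuous_maps unit_interval unit_interval"
    if "\<gamma> \<in> execution_paths X" for \<gamma>
  proof -
    have "continuous_map unit_interval (underlying X) \<gamma>"
      using that assms(2) by (auto simp: continuous_maps_def)
    then have "continuous_map unit_interval unit_interval (f \<circ> \<gamma>)"
      using f by (rule continuous_map_compose)
    then show ?thesis by (rule restrict_path_in_continuous_maps)
  qed
  ultimately show "md_map X cofree_unit f" using f by (auto simp: md_map_def cofree_unit_def)
qed (auto simp: md_map_def cofree_unit_def)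

lemma Glob_execution_paths_continuous:
  fixes S :: "(nat \<Rightarrow> real) set"
  shows "execution_paths (Glob P (top_of_set S)) \<subseteq> continuous_maps unit_interval (globe_topology (top_of_set S))"
proof
  fix \<gamma> assume "\<gamma> \<in> execution_paths (Glob P (top_of_set S))"
  then obtain z \<phi> where g: "\<gamma> = restrict (\<lambda>t. globe_proj (z, \<phi> t)) {0..1}" "z \<in> S" "\<phi> \<in> reparams P"
    by (auto simp: Glob_def)
  let ?X = "prod_topology (top_of_set S) unit_interval"
  have "continuous_map unit_interval ?X (\<lambda>t. (z, \<phi> t))"
    using reparams_continuous[OF g(3)] g(2) by (intro continuous_map_pairedI) auto
  then have 1: "continuous_map unit_interval (delta_kelleyfication ?X) (\<lambda>t. (z, \<phi> t))"
    using pathin_delta_kelleyfication[of ?X] unfolding pathin_def by blast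
  have "continuous_map (delta_kelleyfication ?X) (globe_topology (top_of_set S)) globe_proj"
    unfolding continuous_map_def
    by (auto simp: topspace_globe_topology simp del: prod_unit_interval)
       (simp add: globe_topology_def openin_final_topology)
  from continuous_map_compose[OF 1 this]
  show "\<gamma> \<in> continuous_maps unit_interval (globe_topology (top_of_set S))"
    unfolding g(1) o_def by (rule restrict_path_in_continuous_maps)
qed

lemma md_map_Glob_cofree_unit:
  fixes S :: "(nat \<Rightarrow> real) set"
  shows "md_map (Glob P (top_of_set S)) cofree_unit f \<longleftrightarrow>
    continuous_map (globe_topology (top_of_set S)) unit_interval f"
  using md_map_cofree_unit_iff[of "Glob P (top_of_set S)" f] Glob_execution_paths_continuous[of P S]
  by (simp add: Glob_def)

text \<open>On the cylinder over the disk, the function is prescribed on the lateral boundary and on the two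
  ends, where it is constant. Tietze's theorem extends it from this closed set, and the extension
  descends to the globe.\<close>

lemma globe_extension:
  assumes "continuous_map (globe_topology (boundary_sphere n)) unit_interval w"
  obtains u where "continuous_map (globe_topology (disk n)) unit_interval u"
    "\<And>p. p \<in> topspace (globe_topology (boundary_sphere n)) \<Longrightarrow> u p = w p"
proof -
  let ?D = "disk_set n" and ?S = "sphere_set n"
  let ?K = "?S \<times> {0..1::real} \<union> (?D \<times> {0} \<union> ?D \<times> {1})"
  have w: "w Src \<in> {0..1}" "w Tgt \<in> {0..1}" "continuous_map (top_of_set (?S \<times> {0..1})) unit_interval (w \<circ> globe_proj)"
    using assms unfolding boundary_sphere_eq continuous_map_from_globe[OF locally_path_connected_sphere_set]
    by auto
  have cl: "closed (?S \<times> {0..1::real})" "closed (?D \<times> {0::real})" "closed (?D \<times> {1::real})"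
    by (auto intro!: compact_imp_closed compact_Times compact_disk_set compact_sphere_set)
  have "continuous_on (?S \<times> {0..1}) (w \<circ> globe_proj)"
    using w(3) by (simp add: continuous_map_in_subtopology)
  moreover have "continuous_on (?D \<times> {0}) (w \<circ> globe_proj)"
    by (rule continuous_on_eq[of _ "\<lambda>_. w Src"]) (auto simp: globe_proj_def)
  moreover have "continuous_on (?D \<times> {1}) (w \<circ> globe_proj)"
    by (rule continuous_on_eq[of _ "\<lambda>_. w Tgt"]) (auto simp: globe_proj_def)
  ultimately have contK: "continuous_on ?K (w \<circ> globe_proj)"
    using cl by (intro continuous_on_closed_Un closed_Un)
  have KD: "?K \<subseteq> ?D \<times> {0..1}" using sphere_subset_disk by auto
  have wK: "(w \<circ> globe_proj) ` ?K \<subseteq> {0..1}"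
  proof -
    have "(w \<circ> globe_proj) ` (?S \<times> {0..1}) \<subseteq> {0..1}"
      using continuous_map_image_subset_topspace[OF w(3)] by simp
    moreover have "(w \<circ> globe_proj) ` (?D \<times> {0} \<union> ?D \<times> {1}) \<subseteq> {0..1}"
      using w(1,2) by (auto simp: globe_proj_def)
    ultimately show ?thesis unfolding image_Un by simp
  qed
  obtain g where g: "continuous_map (top_of_set (?D \<times> {0..1})) euclideanreal g"
    "\<And>x. x \<in> ?K \<Longrightarrow> g x = (w \<circ> globe_proj) x" "g ` topspace (top_of_set (?D \<times> {0..1::real})) \<subseteq> {0..1}"
  proof (rule Tietze_extension_closed_real_interval[of "top_of_set (?D \<times> {0..1::real})" ?K "w \<circ> globe_proj" 0 1])
    show "normal_space (top_of_set (?D \<times> {0..1::real}))"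
      by (intro metrizable_imp_normal_space metrizable_space_subtopology metrizable_space_euclidean)
    show "closedin (top_of_set (?D \<times> {0..1})) ?K"
      using cl KD by (intro closed_subset closed_Un) auto
    have "?D \<times> {0..1} \<inter> ?K = ?K" using KD by blast
    then show "continuous_map (subtopology (top_of_set (?D \<times> {0..1})) ?K) euclideanreal (w \<circ> globe_proj)"
      using contK by (simp add: subtopology_subtopology)
  qed (use wK in auto)
  define u where "u p = (case p of Src \<Rightarrow> w Src | Tgt \<Rightarrow> w Tgt | Mid z t \<Rightarrow> g (z, t))" for p
  have ug: "u (globe_proj (z, t)) = g (z, t)" if "z \<in> ?D" "t \<in> {0..1}" for z t
    using that g(2)[of "(z, t)"] by (auto simp: u_def globe_proj_def)
  have "continuous_map (top_of_set (?D \<times> {0..1})) unit_interval g"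
    using g(1,3) by (auto simp: continuous_map_in_subtopology)
  then have "continuous_map (top_of_set (?D \<times> {0..1})) unit_interval (u \<circ> globe_proj)"
    by (rule continuous_map_eq) (use ug in auto)
  then have "continuous_map (globe_topology (disk n)) unit_interval u"
    unfolding disk_eq continuous_map_from_globe[OF locally_path_connected_disk_set]
    using w by (auto simp: u_def)
  moreover have "u p = w p" if p: "p \<in> topspace (globe_topology (boundary_sphere n))" for p
  proof -
    consider "p = Src" | "p = Tgt" | z t where "p = globe_proj (z, t)" "z \<in> ?S" "t \<in> {0..1}"
      using p by (auto simp: boundary_sphere_eq)
    then show ?thesis
      using ug g(2) sphere_subset_disk[of n] by cases (auto simp: u_def)
  qed
  ultimately show thesis using that by blast
qed

section \<open>Chains of cells\<close>

text \<open>A chain of \<open>L\<close> segments is traversed by means of a reparametrization onto \<open>[0, L]\<close>. The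
  homeomorphisms are singled out by strict monotonicity; \<open>reparams P\<close> is the case \<open>L = 1\<close>.\<close>

definition reparam_to :: "reparam_kind \<Rightarrow> real \<Rightarrow> (real \<Rightarrow> real) set" where
  "reparam_to P L = {\<psi>. continuous_on {0..1} \<psi> \<and> mono_on {0..1} \<psi> \<and> \<psi> 0 = 0 \<and> \<psi> 1 = L \<and>
     (P = Homeos \<longrightarrow> strict_mono_on {0..1} \<psi>)}"

lemma reparam_toD:
  assumes "\<psi> \<in> reparam_to P L"
  shows "continuous_on {0..1} \<psi>" "\<psi> 0 = 0" "\<psi> 1 = L"
    "\<And>s t. 0 \<le> s \<Longrightarrow> s \<le> t \<Longrightarrow> t \<le> 1 \<Longrightarrow> \<psi> s \<le> \<psi> t"
    "\<And>s t. P = Homeos \<Longrightarrow> 0 \<le> s \<Longrightarrow> s < t \<Longrightarrow> t \<le> 1 \<Longrightarrow> \<psi> s < \<psi> t"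
    "\<And>t. 0 \<le> t \<Longrightarrow> t \<le> 1 \<Longrightarrow> 0 \<le> \<psi> t \<and> \<psi> t \<le> L"
proof -
  show m: "\<psi> s \<le> \<psi> t" if "0 \<le> s" "s \<le> t" "t \<le> 1" for s t
    using assms that by (auto simp: reparam_to_def mono_on_def)
  show "\<psi> s < \<psi> t" if "P = Homeos" "0 \<le> s" "s < t" "t \<le> 1" for s t
    using assms that by (auto simp: reparam_to_def strict_mono_on_def)
  show "0 \<le> \<psi> t \<and> \<psi> t \<le> L" if "0 \<le> t" "t \<le> 1" for t
    using m[of 0 t] m[of t 1] that assms by (auto simp: reparam_to_def)
qed (use assms in \<open>auto simp: reparam_to_def\<close>)

lemma reparam_toI:
  assumes "continuous_on {0..1} \<psi>" "\<psi> 0 = 0" "\<psi> 1 = L"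
    "\<And>s t. 0 \<le> s \<Longrightarrow> s < t \<Longrightarrow> t \<le> 1 \<Longrightarrow> \<psi> s \<le> \<psi> t"
    "\<And>s t. P = Homeos \<Longrightarrow> 0 \<le> s \<Longrightarrow> s < t \<Longrightarrow> t \<le> 1 \<Longrightarrow> \<psi> s < \<psi> t"
  shows "\<psi> \<in> reparam_to P L"
proof -
  have "mono_on {0..1} \<psi>"
    unfolding mono_on_def using assms(4) by (metis atLeastAtMost_iff order_le_less)
  moreover have "strict_mono_on {0..1} \<psi>" if "P = Homeos"
    unfolding strict_mono_on_def using assms(5)[OF that] by auto
  ultimately show ?thesis using assms by (simp add: reparam_to_def)
qed

lemma reparam_to_surj:
  assumes "\<psi> \<in> reparam_to P L" "0 \<le> y" "y \<le> L"
  obtains t where "0 \<le> t" "t \<le> 1" "\<psi> t = y"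
  using IVT'[of \<psi> 0 y 1] reparam_toD(1-3)[OF assms(1)] assms(2,3) by auto

lemma reparam_to_compose:
  assumes "\<psi> \<in> reparam_to P L" "\<phi> \<in> reparam_to P 1"
  shows "\<psi> \<circ> \<phi> \<in> reparam_to P L"
proof (rule reparam_toI)
  note p = reparam_toD[OF assms(1)] and f = reparam_toD[OF assms(2)]
  have "\<phi> ` {0..1} \<subseteq> {0..1}" using f(6) by auto
  then show "continuous_on {0..1} (\<psi> \<circ> \<phi>)"
    using continuous_on_compose[OF f(1) continuous_on_subset[OF p(1)]] by blast
  show "(\<psi> \<circ> \<phi>) s \<le> (\<psi> \<circ> \<phi>) t" if "0 \<le> s" "s < t" "t \<le> 1" for s t
    using p(4)[of "\<phi> s" "\<phi> t"] f(4)[of s t] f(6)[of s] f(6)[of t] that by simp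
  show "(\<psi> \<circ> \<phi>) s < (\<psi> \<circ> \<phi>) t" if "P = Homeos" "0 \<le> s" "s < t" "t \<le> 1" for s t
    using p(5)[of "\<phi> s" "\<phi> t"] f(5)[of s t] f(6)[of s] f(6)[of t] that by simp
qed (use reparam_toD[OF assms(1)] reparam_toD[OF assms(2)] in auto)

lemma reparam_to_Homeos_le: "\<psi> \<in> reparam_to Homeos L \<Longrightarrow> \<psi> \<in> reparam_to P L"
  by (auto simp: reparam_to_def)

text \<open>A monotone surjection of the unit interval fixes its end points, and an injective one is a
  homeomorphism by compactness.\<close>

lemma reparams_eq_reparam_to: "reparams P = reparam_to P 1"
proof (cases P)
  case Homeos
  have "\<phi> \<in> reparam_to Homeos 1" if "mono_on {0..1} \<phi>" "homeomorphic_map unit_interval unit_interval \<phi>" for \<phi>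
  proof -
    have inj: "inj_on \<phi> {0..1}" and surj: "\<phi> ` {0..1} = {0..1}"
      using that(2) homeomorphic_imp_injective_map homeomorphic_imp_surjective_map
      by (metis topspace_euclidean_subtopology)+
    have c: "continuous_on {0..1} \<phi>"
      using homeomorphic_imp_continuous_map[OF that(2)] by simp
    have m: "\<phi> s \<le> \<phi> t" if "0 \<le> s" "s \<le> t" "t \<le> 1" for s t
      using \<open>mono_on {0..1} \<phi>\<close> that by (auto simp: mono_on_def)
    have im: "\<phi> t \<in> {0..1}" if "t \<in> {0..1}" for t using surj that by blast
    have "0 \<in> \<phi> ` {0..1}" "1 \<in> \<phi> ` {0..1}" unfolding surj by simp_all
    then obtain a b where "a \<in> {0..1}" "\<phi> a = 0" "b \<in> {0..1}" "\<phi> b = 1"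
      by (metis imageE)
    then have "\<phi> 0 = 0" "\<phi> 1 = 1"
      using m[of 0 a] m[of b 1] im[of 0] im[of 1] by auto
    then show ?thesis
      using c m inj by (intro reparam_toI) (auto simp: order_less_le inj_on_def)
  qed
  moreover have "mono_on {0..1} \<phi> \<and> homeomorphic_map unit_interval unit_interval \<phi>"
    if "\<phi> \<in> reparam_to Homeos 1" for \<phi>
  proof -
    note f = reparam_toD[OF that]
    have s: "\<phi> ` {0..1} = {0..1}"
      using f(6) reparam_to_surj[OF that] by (auto simp: image_iff) (metis atLeastAtMost_iff)
    have "inj_on \<phi> {0..1}"
      using f(5) by (auto simp: inj_on_def) (metis linorder_neq_iff order_less_irrefl)
    then have "homeomorphic_map unit_interval unit_interval \<phi>"
      using s f(1) by (intro continuous_imp_homeomorphic_map)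
        (auto simp: compact_space_subtopology Hausdorff_space_subtopology)
    then show ?thesis using that by (auto simp: reparam_to_def)
  qed
  ultimately show ?thesis using Homeos by auto
next
  case Surjections
  have "\<phi> \<in> reparam_to Surjections 1"
    if "mono_on {0..1} \<phi>" "continuous_map unit_interval unit_interval \<phi>" "\<phi> ` {0..1} = {0..1}" for \<phi>
  proof -
    have m: "\<phi> s \<le> \<phi> t" if "0 \<le> s" "s \<le> t" "t \<le> 1" for s t
      using \<open>mono_on {0..1} \<phi>\<close> that by (auto simp: mono_on_def)
    have im: "\<phi> t \<in> {0..1}" if "t \<in> {0..1}" for t using \<open>\<phi> ` {0..1} = {0..1}\<close> that by blast
    have "0 \<in> \<phi> ` {0..1}" "1 \<in> \<phi> ` {0..1}" unfolding that(3) by simp_all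
    then obtain a b where "a \<in> {0..1}" "\<phi> a = 0" "b \<in> {0..1}" "\<phi> b = 1"
      by (metis imageE)
    then have "\<phi> 0 = 0" "\<phi> 1 = 1"
      using m[of 0 a] m[of b 1] im[of 0] im[of 1] by auto
    then show ?thesis
      using that(2) m by (intro reparam_toI) auto
  qed
  moreover have "mono_on {0..1} \<phi> \<and> continuous_map unit_interval unit_interval \<phi> \<and> \<phi> ` {0..1} = {0..1}"
    if "\<phi> \<in> reparam_to Surjections 1" for \<phi>
  proof -
    note f = reparam_toD[OF that]
    have s: "\<phi> ` {0..1} = {0..1}"
      using f(6) reparam_to_surj[OF that] by (auto simp: image_iff) (metis atLeastAtMost_iff)
    then show ?thesis using that f(1) by (auto simp: reparam_to_def)
  qed
  ultimately show ?thesis using Surjections by auto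
qed

text \<open>The \<open>j\<close>th entry \<open>(\<nu>, z)\<close> of the list stands for the segment \<open>t \<mapsto> q \<nu> (z, t)\<close>, which is
  traversed on \<open>[j, j + 1]\<close>.\<close>

fun chain :: "('i \<Rightarrow> 'z \<times> real \<Rightarrow> 'a) \<Rightarrow> ('i \<times> 'z) list \<Rightarrow> real \<Rightarrow> 'a" where
  "chain q [] s = undefined"
| "chain q (c # cs) s = (if cs = [] \<or> s \<le> 1 then q (fst c) (snd c, s) else chain q cs (s - 1))"

definition linked :: "('i \<Rightarrow> 'z \<times> real \<Rightarrow> 'a) \<Rightarrow> ('i \<times> 'z) list \<Rightarrow> bool" where
  "linked q = successively (\<lambda>c c'. q (fst c) (snd c, 1) = q (fst c') (snd c', 0))"

lemma chain_start: "cs \<noteq> [] \<Longrightarrow> chain q cs 0 = q (fst (hd cs)) (snd (hd cs), 0)"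
  by (cases cs) auto

lemma chain_end: "cs \<noteq> [] \<Longrightarrow> chain q cs (real (length cs)) = q (fst (last cs)) (snd (last cs), 1)"
proof (induction cs)
  case (Cons c cs)
  then show ?case by (cases "cs = []") (auto simp: Suc_le_eq)
qed simp

lemma chain_append:
  "cs1 \<noteq> [] \<Longrightarrow> cs2 \<noteq> [] \<Longrightarrow> chain q (cs1 @ cs2) s =
     (if s \<le> length cs1 then chain q cs1 s else chain q cs2 (s - length cs1))"
proof (induction cs1 arbitrary: s)
  case (Cons c cs1)
  show ?case
  proof (cases "cs1 = []")
    case False
    then have "length cs1 \<ge> 1" by (cases cs1) auto
    then show ?thesis using Cons.IH[OF False Cons.prems(2), of "s - 1"] False by (auto simp: algebra_simps)
  qed (use Cons.prems in auto)
qed simp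

lemma chain_nth:
  assumes "linked q cs" "j < length cs" "0 \<le> s" "s \<le> 1"
  shows "chain q cs (real j + s) = q (fst (cs ! j)) (snd (cs ! j), s)"
  using assms
proof (induction cs arbitrary: j)
  case (Cons c cs)
  show ?case
  proof (cases j)
    case 0
    then show ?thesis using Cons.prems by auto
  next
    case (Suc k)
    then have k: "k < length cs" "cs \<noteq> []" using Cons.prems by auto
    have lk: "linked q cs" "q (fst c) (snd c, 1) = q (fst (hd cs)) (snd (hd cs), 0)"
      using Cons.prems(1) k(2) by (auto simp: linked_def successively_Cons)
    show ?thesis
    proof (cases "real j + s \<le> 1")
      case True
      then have "s = 0" "k = 0" using Suc Cons.prems(3) by auto
      then show ?thesis using lk(2) Suc k(2) by (auto simp: hd_conv_nth)
    next
      case False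
      then show ?thesis using Cons.IH[OF lk(1) k(1) Cons.prems(3,4)] Suc k(2) by (simp add: algebra_simps)
    qed
  qed
qed simp

text \<open>The smallest set of paths which contains the reparametrized segments with index in \<open>A\<close> and is
  closed under reparametrization and normalized composition, as the next lemmas show. Iterated
  compositions of reparametrized segments are put into the normal form of a single chain, traversed
  by a single reparametrization.\<close>

definition chain_paths :: "('i \<Rightarrow> 'z \<times> real \<Rightarrow> 'a) \<Rightarrow> ('i \<times> 'z) set \<Rightarrow> reparam_kind \<Rightarrow> (real \<Rightarrow> 'a) set" where
  "chain_paths q A P = {restrict (chain q cs \<circ> \<psi>) {0..1} | cs \<psi>.
     cs \<noteq> [] \<and> linked q cs \<and> set cs \<subseteq> A \<and> \<psi> \<in> reparam_to P (length cs)}"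

lemma chain_pathsI:
  "cs \<noteq> [] \<Longrightarrow> linked q cs \<Longrightarrow> set cs \<subseteq> A \<Longrightarrow> \<psi> \<in> reparam_to P (length cs) \<Longrightarrow>
    restrict (chain q cs \<circ> \<psi>) {0..1} \<in> chain_paths q A P"
  unfolding chain_paths_def by blast

lemma chain_paths_reparam:
  assumes "\<gamma> \<in> chain_paths q A P" "\<phi> \<in> reparams P"
  shows "restrict (\<gamma> \<circ> \<phi>) {0..1} \<in> chain_paths q A P"
proof -
  obtain cs \<psi> where c: "\<gamma> = restrict (chain q cs \<circ> \<psi>) {0..1}" "cs \<noteq> []" "linked q cs" "set cs \<subseteq> A"
    "\<psi> \<in> reparam_to P (length cs)"
    using assms(1) unfolding chain_paths_def by blast
  have "restrict (\<gamma> \<circ> \<phi>) {0..1} = restrict (chain q cs \<circ> (\<psi> \<circ> \<phi>)) {0..1}"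
    using reparams_range[OF assms(2)] by (auto simp: c(1) restrict_def fun_eq_iff)
  then show ?thesis
    using chain_pathsI[OF c(2-4) reparam_to_compose[OF c(5)]] assms(2)
    by (simp add: reparams_eq_reparam_to)
qed

lemma chain_paths_composition:
  assumes "\<gamma>1 \<in> chain_paths q A P" "\<gamma>2 \<in> chain_paths q A P" "\<gamma>1 1 = \<gamma>2 0"
  shows "normalized_composition \<gamma>1 \<gamma>2 \<in> chain_paths q A P"
proof -
  obtain cs1 \<psi>1 where c1: "\<gamma>1 = restrict (chain q cs1 \<circ> \<psi>1) {0..1}" "cs1 \<noteq> []" "linked q cs1" "set cs1 \<subseteq> A"
    "\<psi>1 \<in> reparam_to P (length cs1)"
    using assms(1) unfolding chain_paths_def by blast
  obtain cs2 \<psi>2 where c2: "\<gamma>2 = restrict (chain q cs2 \<circ> \<psi>2) {0..1}" "cs2 \<noteq> []" "linked q cs2" "set cs2 \<subseteq> A"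
    "\<psi>2 \<in> reparam_to P (length cs2)"
    using assms(2) unfolding chain_paths_def by blast
  note p1 = reparam_toD[OF c1(5)] and p2 = reparam_toD[OF c2(5)]
  have e: "q (fst (last cs1)) (snd (last cs1), 1) = q (fst (hd cs2)) (snd (hd cs2), 0)"
    using assms(3) p1(3) p2(2) c1(2) c2(2) by (simp add: c1(1) c2(1) chain_start chain_end)
  have lk: "linked q (cs1 @ cs2)"
    using c1(3) c2(3) e c1(2) c2(2) by (auto simp: linked_def successively_append_iff)
  define \<psi> where "\<psi> t = (if t \<le> 1/2 then \<psi>1 (2 * t) else length cs1 + \<psi>2 (2 * t - 1))" for t
  have b1: "\<psi>1 (2 * t) \<le> length cs1" if "0 \<le> t" "t \<le> 1/2" for t using p1(6)[of "2*t"] that by simp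
  have b2: "0 \<le> \<psi>2 (2 * t - 1)" if "1/2 \<le> t" "t \<le> 1" for t using p2(6)[of "2*t-1"] that by simp
  have "\<psi> \<in> reparam_to P (length (cs1 @ cs2))"
  proof (rule reparam_toI)
    have "continuous_on ({0..1/2} \<union> {1/2..1}) \<psi>"
      unfolding \<psi>_def
    proof (rule continuous_on_If)
      show "continuous_on {0..1/2} (\<lambda>t. \<psi>1 (2 * t))"
        by (rule continuous_on_compose2[OF p1(1)]) (auto intro!: continuous_intros)
      show "continuous_on {1/2..1} (\<lambda>t. length cs1 + \<psi>2 (2 * t - 1))"
        by (intro continuous_intros continuous_on_compose2[OF p2(1)]) auto
    next
      fix t :: real assume "t \<in> {0..1/2}" "\<not> t \<le> 1/2"
      then show "\<psi>1 (2 * t) = length cs1 + \<psi>2 (2 * t - 1)" by simp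
    next
      fix t :: real assume "t \<in> {1/2..1}" "t \<le> 1/2"
      then have t: "t = 1/2" by simp
      show "\<psi>1 (2 * t) = length cs1 + \<psi>2 (2 * t - 1)" unfolding t using p1(3) p2(2) by simp
    qed auto
    moreover have "{0..1/2} \<union> {1/2..1} = {0..1::real}" by auto
    ultimately show "continuous_on {0..1} \<psi>" by simp
    show "\<psi> 0 = 0" "\<psi> 1 = length (cs1 @ cs2)" using p1(2) p2(3) by (auto simp: \<psi>_def)
    show "\<psi> s \<le> \<psi> t" if "0 \<le> s" "s < t" "t \<le> 1" for s t
      using that p1(4)[of "2 * s" "2 * t"] p2(4)[of "2 * s - 1" "2 * t - 1"] b1[of s] b2[of t]
      by (auto simp: \<psi>_def)
    show "\<psi> s < \<psi> t" if "P = Homeos" "0 \<le> s" "s < t" "t \<le> 1" for s t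
      using that p1(5)[of "2 * s" "2 * t"] p2(5)[of "2 * s - 1" "2 * t - 1"] b1[of s]
        p2(5)[of 0 "2 * t - 1"] p2(2)
      by (auto simp: \<psi>_def)
  qed
  moreover have "normalized_composition \<gamma>1 \<gamma>2 = restrict (chain q (cs1 @ cs2) \<circ> \<psi>) {0..1}"
  proof
    fix t
    show "normalized_composition \<gamma>1 \<gamma>2 t = restrict (chain q (cs1 @ cs2) \<circ> \<psi>) {0..1} t"
    proof (cases "t \<in> {0..1}")
      case True
      show ?thesis
      proof (cases "t \<le> 1/2")
        case le: True
        then show ?thesis using True b1[of t] c1(2) c2(2)
          by (simp add: normalized_composition_def c1(1) \<psi>_def chain_append)
      next
        case False
        have "chain q (cs1 @ cs2) (length cs1 + \<psi>2 (2 * t - 1)) = chain q cs2 (\<psi>2 (2 * t - 1))"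
          using b2[of t] False True c1(2) c2(2) e
          by (cases "\<psi>2 (2 * t - 1) = 0") (auto simp: chain_append chain_start chain_end)
        then show ?thesis using True False
          by (simp add: normalized_composition_def c2(1) \<psi>_def)
      qed
    qed (auto simp: normalized_composition_def)
  qed
  ultimately show ?thesis
    using chain_pathsI[of "cs1 @ cs2" q A \<psi> P] lk c1(2,4) c2(4) by simp
qed

text \<open>Induction on the chain. At a time \<open>a\<close> with \<open>\<psi> a = 1\<close> the path is cut into a path along the first
  segment and a path along the remaining chain. Their normalized composition is the given path up
  to the piecewise linear homeomorphism \<open>\<theta>\<close> that moves \<open>a\<close> to \<open>1/2\<close>. The intervals on which \<open>\<psi>\<close> is
  constant are inherited by the two parts, so closure under homeomorphisms is enough.\<close>

lemma chain_paths_subset: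
  assumes reparam: "\<And>\<gamma> \<theta>. \<gamma> \<in> E \<Longrightarrow> \<theta> \<in> reparams Homeos \<Longrightarrow> restrict (\<gamma> \<circ> \<theta>) {0..1} \<in> E"
    and comp: "\<And>\<gamma>1 \<gamma>2. \<gamma>1 \<in> E \<Longrightarrow> \<gamma>2 \<in> E \<Longrightarrow> \<gamma>1 1 = \<gamma>2 0 \<Longrightarrow> normalized_composition \<gamma>1 \<gamma>2 \<in> E"
    and base: "\<And>c \<phi>. c \<in> A \<Longrightarrow> \<phi> \<in> reparams P \<Longrightarrow> restrict (\<lambda>t. q (fst c) (snd c, \<phi> t)) {0..1} \<in> E"
  shows "chain_paths q A P \<subseteq> E"
proof -
  have "restrict (chain q cs \<circ> \<psi>) {0..1} \<in> E"
    if "cs \<noteq> []" "linked q cs" "set cs \<subseteq> A" "\<psi> \<in> reparam_to P (length cs)" for cs \<psi>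
    using that
  proof (induction cs arbitrary: \<psi>)
    case (Cons c cs)
    note p = reparam_toD[OF Cons.prems(4)]
    show ?case
    proof (cases "cs = []")
      case True
      then have "restrict (\<lambda>t. q (fst c) (snd c, \<psi> t)) {0..1} \<in> E"
        using Cons.prems base by (simp add: reparams_eq_reparam_to)
      moreover have "restrict (chain q (c # cs) \<circ> \<psi>) {0..1} = restrict (\<lambda>t. q (fst c) (snd c, \<psi> t)) {0..1}"
        using True by (auto simp: restrict_def)
      ultimately show ?thesis by (simp only:)
    next
      case False
      then have L: "length cs \<ge> 1" by (cases cs) auto
      have lk: "linked q cs" "q (fst c) (snd c, 1) = q (fst (hd cs)) (snd (hd cs), 0)"
        using Cons.prems(2) False by (auto simp: linked_def successively_Cons)
      obtain a where a: "0 \<le> a" "a \<le> 1" "\<psi> a = 1"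
        using reparam_to_surj[OF Cons.prems(4), of 1] L by auto
      have a01: "0 < a" "a < 1"
        using a p(2,3) L by (auto simp: order_less_le)
      have ab: "a * t \<in> {0..1}" "a + (1 - a) * t \<in> {0..1}" if "t \<in> {0..1}" for t
      proof -
        have "0 \<le> (1 - a) * (1 - t)" using that a01 by (intro mult_nonneg_nonneg) auto
        then have "a + (1 - a) * t \<le> 1" by (simp add: algebra_simps)
        moreover have "0 \<le> (1 - a) * t" using that a01 by simp
        ultimately show "a + (1 - a) * t \<in> {0..1}" using a01 by auto
        show "a * t \<in> {0..1}" using that a01 by (auto intro: mult_le_one)
      qed
      have ab01: "(\<lambda>t. a * t) ` {0..1} \<subseteq> {0..1}" "(\<lambda>t. a + (1 - a) * t) ` {0..1} \<subseteq> {0..1}"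
      proof -
        show "(\<lambda>t. a * t) ` {0..1} \<subseteq> {0..1}"
          by (rule image_subsetI) (rule ab(1))
        show "(\<lambda>t. a + (1 - a) * t) ` {0..1} \<subseteq> {0..1}"
          by (rule image_subsetI) (rule ab(2))
      qed
      define \<psi>1 where "\<psi>1 t = \<psi> (a * t)" for t
      define \<psi>2 where "\<psi>2 t = \<psi> (a + (1 - a) * t) - 1" for t
      have \<psi>1: "\<psi>1 \<in> reparam_to P 1"
        unfolding \<psi>1_def
      proof (rule reparam_toI)
        show "continuous_on {0..1} (\<lambda>t. \<psi> (a * t))"
          by (rule continuous_on_compose2[OF p(1) _ ab01(1)]) (intro continuous_intros)
        show "\<psi> (a * s) \<le> \<psi> (a * t)" if "0 \<le> s" "s < t" "t \<le> 1" for s t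
          using that ab[of s] ab[of t] a01 by (intro p(4)) (auto simp: mult_left_mono)
        show "\<psi> (a * s) < \<psi> (a * t)" if "P = Homeos" "0 \<le> s" "s < t" "t \<le> 1" for s t
          using that ab[of s] ab[of t] a01 by (intro p(5)) auto
      qed (use a p in auto)
      have \<psi>2: "\<psi>2 \<in> reparam_to P (length cs)"
        unfolding \<psi>2_def
      proof (rule reparam_toI)
        show "continuous_on {0..1} (\<lambda>t. \<psi> (a + (1 - a) * t) - 1)"
          by (intro continuous_intros continuous_on_compose2[OF p(1) _ ab01(2)])
        show "\<psi> (a + (1 - a) * s) - 1 \<le> \<psi> (a + (1 - a) * t) - 1" if "0 \<le> s" "s < t" "t \<le> 1" for s t
          using that ab[of s] ab[of t] a01 p(4)[of "a + (1 - a) * s" "a + (1 - a) * t"]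
          by (auto simp: mult_left_mono)
        show "\<psi> (a + (1 - a) * s) - 1 < \<psi> (a + (1 - a) * t) - 1" if "P = Homeos" "0 \<le> s" "s < t" "t \<le> 1" for s t
          using that ab[of s] ab[of t] a01 p(5)[of "a + (1 - a) * s" "a + (1 - a) * t"] by auto
      qed (use a p L in auto)
      define \<gamma>1 where "\<gamma>1 = restrict (\<lambda>t. q (fst c) (snd c, \<psi>1 t)) {0..1}"
      define \<gamma>2 where "\<gamma>2 = restrict (chain q cs \<circ> \<psi>2) {0..1}"
      have "\<gamma>1 \<in> E" unfolding \<gamma>1_def
        using base[of c \<psi>1] \<psi>1 Cons.prems(3) by (simp add: reparams_eq_reparam_to)
      moreover have "\<gamma>2 \<in> E" unfolding \<gamma>2_def
        by (rule Cons.IH[OF False lk(1) _ \<psi>2]) (use Cons.prems(3) in auto)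
      moreover have "\<gamma>1 1 = \<gamma>2 0"
        using reparam_toD(3)[OF \<psi>1] reparam_toD(2)[OF \<psi>2] lk(2) False
        by (simp add: \<gamma>1_def \<gamma>2_def chain_start)
      ultimately have nc: "normalized_composition \<gamma>1 \<gamma>2 \<in> E" by (rule comp)
      define \<theta> where "\<theta> t = (if t \<le> a then t / (2 * a) else 1/2 + (t - a) / (2 * (1 - a)))" for t
      have \<theta>1: "\<theta> t \<le> 1/2" "0 \<le> \<theta> t" if "0 \<le> t" "t \<le> a" for t
        using that a01 by (auto simp: \<theta>_def field_simps)
      have \<theta>2: "\<theta> t > 1/2" "\<theta> t \<le> 1" if "t > a" "t \<le> 1" for t
        using that a01 by (auto simp: \<theta>_def field_simps)
      have \<theta>: "\<theta> \<in> reparam_to Homeos 1"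
      proof (rule reparam_toI)
        have "continuous_on ({0..a} \<union> {a..1}) \<theta>"
          unfolding \<theta>_def
          by (rule continuous_on_If) (use a01 in \<open>auto intro!: continuous_intros\<close>)
        moreover have "{0..a} \<union> {a..1} = {0..1}" using a01 by auto
        ultimately show "continuous_on {0..1} \<theta>" by simp
        have mono: "\<theta> s < \<theta> t" if "0 \<le> s" "s < t" "t \<le> 1" for s t
        proof -
          consider "t \<le> a" | "s \<le> a" "a < t" | "a < s" by linarith
          then show ?thesis
          proof cases
            case 2
            then show ?thesis using \<theta>1[of s] \<theta>2[of t] that by linarith
          qed (use that a01 in \<open>auto simp: \<theta>_def divide_strict_right_mono\<close>)
        qed
        show "\<theta> s < \<theta> t" if "0 \<le> s" "s < t" "t \<le> 1" for s t using mono that .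
        show "\<theta> s \<le> \<theta> t" if "0 \<le> s" "s < t" "t \<le> 1" for s t using mono[OF that] by simp
        have half: "(1 - a) / (2 - 2 * a) = 1/2" using a01 by (subst divide_eq_eq) auto
        show "\<theta> 1 = 1" using a01 by (simp add: \<theta>_def half)
      qed (use a01 in \<open>auto simp: \<theta>_def\<close>)
      have "restrict (normalized_composition \<gamma>1 \<gamma>2 \<circ> \<theta>) {0..1} = restrict (chain q (c # cs) \<circ> \<psi>) {0..1}"
      proof (rule restrict_ext)
        fix t :: real assume t: "t \<in> {0..1}"
        show "(normalized_composition \<gamma>1 \<gamma>2 \<circ> \<theta>) t = (chain q (c # cs) \<circ> \<psi>) t"
        proof (cases "t \<le> a")
          case True
          have e: "2 * \<theta> t = t / a" using True a01 by (simp add: \<theta>_def)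
          have "\<psi> t \<le> 1" using p(4)[of t a] True t a by simp
          then show ?thesis using True t \<theta>1[of t] a01 e
            by (simp add: normalized_composition_def \<gamma>1_def \<psi>1_def)
        next
          case False
          have e: "2 * \<theta> t - 1 = (t - a) / (1 - a)"
            using False a01 by (simp add: \<theta>_def field_simps)
          have 1: "\<psi>2 ((t - a) / (1 - a)) = \<psi> t - 1" using a01 by (simp add: \<psi>2_def)
          have 2: "\<psi> t \<ge> 1" using p(4)[of a t] False t a by simp
          have 3: "chain q (c # cs) (\<psi> t) = chain q cs (\<psi> t - 1)"
            using 2 \<open>cs \<noteq> []\<close> lk(2) by (cases "\<psi> t = 1") (auto simp: chain_start)
          have "(t - a) / (1 - a) \<in> {0..1}" using False t a01 by (auto simp: field_simps)
          then show ?thesis using False t \<theta>2[of t] a01 1 3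
            by (simp add: normalized_composition_def \<gamma>2_def e del: chain.simps)
        qed
      qed
      moreover have "restrict (normalized_composition \<gamma>1 \<gamma>2 \<circ> \<theta>) {0..1} \<in> E"
        by (rule reparam[OF nc]) (simp add: reparams_eq_reparam_to \<theta>)
      ultimately show ?thesis by (simp only:)
    qed
  qed simp
  then show ?thesis unfolding chain_paths_def by blast
qed

section \<open>The structure of a cellular multipointed d-space\<close>

lemma zero_ordinal_le: "zero_ordinal \<le> \<nu>"
  unfolding zero_ordinal_def by (rule Least_le) simp

lemma next_ordinal_greater: "\<nu> < l \<Longrightarrow> \<nu> < next_ordinal \<nu>"
  unfolding next_ordinal_def by (rule LeastI)

lemma next_ordinal_le: "\<nu> < \<mu> \<Longrightarrow> next_ordinal \<nu> \<le> \<mu>"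
  unfolding next_ordinal_def by (rule Least_le)

lemma less_next_ordinal: "\<nu> < l \<Longrightarrow> \<mu> < next_ordinal \<nu> \<longleftrightarrow> \<mu> \<le> \<nu>"
  using next_ordinal_greater[of \<nu> l] next_ordinal_le[of \<nu> \<mu>] by (metis leD leI le_less_trans)

lemma ordinal_cases:
  fixes \<nu> :: "'i::wellorder"
  obtains "\<nu> = zero_ordinal" | \<mu> where "\<mu> < \<nu>" "\<nu> = next_ordinal \<mu>" | "limit_ordinal \<nu>"
  unfolding limit_ordinal_def using next_ordinal_le by (metis order_le_less)

text \<open>The characteristic map of a cell, read on the cylinder over the disk instead of the globe.\<close>

definition cell_map :: "'i::wellorder \<Rightarrow> ('i \<Rightarrow> 'i \<Rightarrow> 'a \<Rightarrow> 'a) \<Rightarrow> ('i \<Rightarrow> cell_point \<Rightarrow> 'a) \<Rightarrow>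
    'i \<Rightarrow> (nat \<Rightarrow> real) \<times> real \<Rightarrow> 'a" where
  "cell_map l tr h \<nu> = characteristic_map l tr h \<nu> \<circ> globe_proj"

abbreviation cylinder :: "nat \<Rightarrow> ((nat \<Rightarrow> real) \<times> real) set" where
  "cylinder n \<equiv> disk_set n \<times> {0..1}"

definition open_disk :: "nat \<Rightarrow> (nat \<Rightarrow> real) set" where
  "open_disk n = disk_set n - sphere_set n"

lemma zero_in_disk: "(\<lambda>_. 0) \<in> disk_set n"
  by (simp add: disk_set_def sqnorm_def)

lemma topspace_globe_disk: "topspace (globe_topology (disk n)) = globe_proj ` cylinder n"
proof -
  have "globe_proj (\<lambda>_. 0, 0) \<in> globe_proj ` cylinder n" "globe_proj (\<lambda>_. 0, 1) \<in> globe_proj ` cylinder n"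
    by (intro imageI; simp add: zero_in_disk)+
  then have "Src \<in> globe_proj ` cylinder n" "Tgt \<in> globe_proj ` cylinder n"
    by (simp_all only: globe_proj_def prod.case) simp_all
  then show ?thesis by (auto simp: disk_eq)
qed

lemma topspace_globe_sphere:
  "topspace (globe_topology (boundary_sphere n)) = {Src, Tgt} \<union> globe_proj ` (sphere_set n \<times> {0..1})"
  by (simp add: boundary_sphere_eq)

lemma pathin_in_topspace: "pathin T p \<Longrightarrow> t \<in> {0..1} \<Longrightarrow> p t \<in> topspace T"
  using continuous_map_image_subset_topspace[of unit_interval T p] unfolding pathin_def
  by (simp add: image_subset_iff)

locale cellular =
  fixes C :: top_category and P :: reparam_kind and l :: "'i::wellorder"
    and X :: "'i \<Rightarrow> 'a mdspace" and tr :: "'i \<Rightarrow> 'i \<Rightarrow> 'a \<Rightarrow> 'a" and n :: "'i \<Rightarrow> nat"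
    and g h :: "'i \<Rightarrow> cell_point \<Rightarrow> 'a"
  assumes cs: "cellular_sequence C P l X tr n g h"
begin

abbreviation T :: "'i \<Rightarrow> 'a topology" where "T \<nu> \<equiv> underlying (X \<nu>)"
abbreviation q :: "'i \<Rightarrow> (nat \<Rightarrow> real) \<times> real \<Rightarrow> 'a" where "q \<equiv> cell_map l tr h"

lemma X_multipointed: "\<nu> \<le> l \<Longrightarrow> multipointed_d_space C P (X \<nu>)"
  and tr_md_map: "\<mu> \<le> \<nu> \<Longrightarrow> \<nu> \<le> l \<Longrightarrow> md_map (X \<mu>) (X \<nu>) (tr \<mu> \<nu>)"
  and tr_id: "\<nu> \<le> l \<Longrightarrow> x \<in> topspace (T \<nu>) \<Longrightarrow> tr \<nu> \<nu> x = x"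
  and tr_tr: "\<kappa> \<le> \<mu> \<Longrightarrow> \<mu> \<le> \<nu> \<Longrightarrow> \<nu> \<le> l \<Longrightarrow> x \<in> topspace (T \<kappa>) \<Longrightarrow> tr \<mu> \<nu> (tr \<kappa> \<mu> x) = tr \<kappa> \<nu> x"
  and colimit: "limit_ordinal \<nu> \<Longrightarrow> \<nu> \<le> l \<Longrightarrow>
    is_colimit_at TYPE(('i \<times> 'a + cell_point) set) C P X tr \<nu>"
  and X_zero: "\<exists>S. X zero_ordinal = \<lparr>underlying = discrete_topology S, states = S, execution_paths = {}\<rparr>"
  and pushout: "\<nu> < l \<Longrightarrow> is_pushout TYPE(('i \<times> 'a + cell_point) set) C P
        (Glob P (boundary_sphere (n \<nu>))) (Glob P (disk (n \<nu>))) (X \<nu>) (X (next_ordinal \<nu>))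
        (\<lambda>x. x) (g \<nu>) (h \<nu>) (tr \<nu> (next_ordinal \<nu>))"
  using cs unfolding cellular_sequence_def eq_on_def o_def by simp_all

lemma stage: "\<kappa> \<le> l \<Longrightarrow> cellular C P \<kappa> X tr n g h"
  using cs unfolding cellular_def cellular_sequence_def by (meson order_trans order_less_le_trans)

lemma
  assumes "\<nu> < l"
  shows g_md_map: "md_map (Glob P (boundary_sphere (n \<nu>))) (X \<nu>) (g \<nu>)"
    and h_md_map: "md_map (Glob P (disk (n \<nu>))) (X (next_ordinal \<nu>)) (h \<nu>)"
    and h_eq_g: "\<And>p. p \<in> topspace (globe_topology (boundary_sphere (n \<nu>))) \<Longrightarrow>
      h \<nu> p = tr \<nu> (next_ordinal \<nu>) (g \<nu> p)"
proof -
  have "md_map (Glob P (boundary_sphere (n \<nu>))) (X \<nu>) (g \<nu>) \<and>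
     md_map (Glob P (disk (n \<nu>))) (X (next_ordinal \<nu>)) (h \<nu>) \<and>
     eq_on (Glob P (boundary_sphere (n \<nu>))) (h \<nu> \<circ> (\<lambda>x. x)) (tr \<nu> (next_ordinal \<nu>) \<circ> g \<nu>)"
    using pushout[OF assms] unfolding is_pushout_def by blast
  then show "md_map (Glob P (boundary_sphere (n \<nu>))) (X \<nu>) (g \<nu>)"
    "md_map (Glob P (disk (n \<nu>))) (X (next_ordinal \<nu>)) (h \<nu>)"
    "\<And>p. p \<in> topspace (globe_topology (boundary_sphere (n \<nu>))) \<Longrightarrow>
      h \<nu> p = tr \<nu> (next_ordinal \<nu>) (g \<nu> p)"
    by (simp_all add: eq_on_def Glob_def del: topspace_globe_topology)
qed

lemma tr_in: "\<mu> \<le> \<nu> \<Longrightarrow> \<nu> \<le> l \<Longrightarrow> x \<in> topspace (T \<mu>) \<Longrightarrow> tr \<mu> \<nu> x \<in> topspace (T \<nu>)"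
  using md_mapD(4)[OF tr_md_map] by blast

lemma next_le: "\<nu> < l \<Longrightarrow> next_ordinal \<nu> \<le> l" and le_next: "\<nu> < l \<Longrightarrow> \<nu> \<le> next_ordinal \<nu>"
  using next_ordinal_le[of \<nu> l] next_ordinal_greater[of \<nu> l] by auto

lemma char_md_map:
  assumes "\<nu> < l"
  shows "md_map (Glob P (disk (n \<nu>))) (X l) (characteristic_map l tr h \<nu>)"
  unfolding characteristic_map_def
  using h_md_map[OF assms] tr_md_map[OF next_le[OF assms]] by (auto intro: md_map_compose)

lemma g_in: "\<nu> < l \<Longrightarrow> p \<in> topspace (globe_topology (boundary_sphere (n \<nu>))) \<Longrightarrow> g \<nu> p \<in> topspace (T \<nu>)"
  using md_mapD(4)[OF g_md_map] by (simp add: Glob_def)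

lemma char_boundary:
  assumes "\<nu> < l" "p \<in> topspace (globe_topology (boundary_sphere (n \<nu>)))"
  shows "characteristic_map l tr h \<nu> p = tr \<nu> l (g \<nu> p)"
  using h_eq_g[OF assms] tr_tr[OF le_next next_le _ g_in] assms
  by (simp add: characteristic_map_def)

lemma continuous_cell_map:
  assumes "\<nu> < l"
  shows "continuous_map (top_of_set (cylinder (n \<nu>))) (T l) (q \<nu>)"
  using md_mapD(1)[OF char_md_map[OF assms]]
  unfolding cell_map_def disk_eq by (simp add: Glob_def continuous_map_from_globe[OF locally_path_connected_disk_set])

lemma cell_map_in: "\<nu> < l \<Longrightarrow> z \<in> disk_set (n \<nu>) \<Longrightarrow> t \<in> {0..1} \<Longrightarrow> q \<nu> (z, t) \<in> topspace (T l)"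
  using continuous_map_image_subset_topspace[OF continuous_cell_map, of \<nu>] by fastforce

lemma cell_map_ends: "q \<nu> (z, 0) = characteristic_map l tr h \<nu> Src" "q \<nu> (z, 1) = characteristic_map l tr h \<nu> Tgt"
  by (auto simp: cell_map_def globe_proj_def)

text \<open>Transfinite induction on the stage. The universal property yields a map from the stage to \<open>Y\<close>;
  followed by the inclusion of \<open>Y\<close> into \<open>X l\<close> it is the transition map, by uniqueness.\<close>

lemma factor_through:
  fixes Y :: "'a mdspace"
  assumes Y: "multipointed_d_space C P Y" and YX: "md_map Y (X l) (\<lambda>x. x)"
    and zero: "md_map (X zero_ordinal) Y (tr zero_ordinal l)"
    and step: "\<And>\<nu>. \<nu> < l \<Longrightarrow> md_map (X \<nu>) Y (tr \<nu> l) \<Longrightarrow>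
      md_map (Glob P (disk (n \<nu>))) Y (characteristic_map l tr h \<nu>)"
  shows "\<mu> \<le> l \<Longrightarrow> md_map (X \<mu>) Y (tr \<mu> l)"
proof (induction \<mu> rule: less_induct)
  case (less \<mu>)
  \<comment> \<open>The carrier type of \<open>Y\<close> embeds into that of the test objects by singletons.\<close>
  let ?e = "\<lambda>x. {Inl (l, x)} :: ('i \<times> 'a + cell_point) set"
  have e: "inj ?e" by (auto simp: inj_def)
  consider "\<mu> = zero_ordinal" | \<nu> where "\<nu> < \<mu>" "\<mu> = next_ordinal \<nu>" | "limit_ordinal \<mu>"
    by (rule ordinal_cases)
  then show ?case
  proof cases
    case 1
    then show ?thesis using zero by simp
  next
    case (2 \<nu>)
    have \<nu>: "\<nu> < l" using 2 less.prems by simp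
    have IH: "md_map (X \<nu>) Y (tr \<nu> l)" using less.IH[OF 2(1)] \<nu> by simp
    have "eq_on (Glob P (boundary_sphere (n \<nu>))) (characteristic_map l tr h \<nu> \<circ> (\<lambda>x. x)) (tr \<nu> l \<circ> g \<nu>)"
      using char_boundary[OF \<nu>] by (simp add: eq_on_def Glob_def)
    then obtain w where w: "md_map (X \<mu>) Y w" "eq_on (Glob P (disk (n \<nu>))) (w \<circ> h \<nu>) (characteristic_map l tr h \<nu>)"
      "eq_on (X \<nu>) (w \<circ> tr \<nu> \<mu>) (tr \<nu> l)"
      using pushout_factor[OF pushout[OF \<nu>] e Y step[OF \<nu> IH] IH] 2(2) by blast
    have "md_map (X \<mu>) (X l) w" using md_map_compose[OF w(1) YX] by (simp add: o_def)
    moreover have "eq_on (Glob P (disk (n \<nu>))) (w \<circ> h \<nu>) (tr \<mu> l \<circ> h \<nu>)"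
      using w(2) by (simp add: eq_on_def characteristic_map_def 2(2))
    moreover have "eq_on (X \<nu>) (w \<circ> tr \<nu> \<mu>) (tr \<mu> l \<circ> tr \<nu> \<mu>)"
      using w(3) tr_tr[of \<nu> \<mu> l] 2 less.prems by (simp add: eq_on_def)
    ultimately have "eq_on (X \<mu>) w (tr \<mu> l)"
      using pushout_unique[OF pushout[OF \<nu>] e X_multipointed[of l]] tr_md_map[OF less.prems] 2(2) by simp
    then show ?thesis using md_map_eq_on[OF w(1)] X_multipointed[OF less.prems] by blast
  next
    case 3
    have le: "\<kappa> \<le> l" if "\<kappa> < \<mu>" for \<kappa> using that less.prems by simp
    have "eq_on (X \<kappa>) (tr \<nu> l \<circ> tr \<kappa> \<nu>) (tr \<kappa> l)" if "\<nu> < \<mu>" "\<kappa> \<le> \<nu>" for \<nu> \<kappa>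
      using tr_tr[OF that(2) le[OF that(1)]] by (simp add: eq_on_def)
    then obtain w where w: "md_map (X \<mu>) Y w" "\<And>\<nu>. \<nu> < \<mu> \<Longrightarrow> eq_on (X \<nu>) (w \<circ> tr \<nu> \<mu>) (tr \<nu> l)"
      using colimit_factor[OF colimit[OF 3 less.prems] e Y, of "\<lambda>\<nu>. tr \<nu> l"] less.IH le by blast
    have "md_map (X \<mu>) (X l) w" using md_map_compose[OF w(1) YX] by (simp add: o_def)
    then have "eq_on (X \<mu>) w (tr \<mu> l)"
    proof (rule colimit_unique[OF colimit[OF 3 less.prems] e X_multipointed[OF order_refl]])
      show "md_map (X \<mu>) (X l) (tr \<mu> l)" by (rule tr_md_map) (use less.prems in auto)
      show "md_map (X \<nu>) (X \<mu>) (tr \<nu> \<mu>)" if "\<nu> < \<mu>" for \<nu>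
        by (rule tr_md_map) (use less.prems that in auto)
      show "eq_on (X \<kappa>) (tr \<nu> \<mu> \<circ> tr \<kappa> \<nu>) (tr \<kappa> \<mu>)" if "\<nu> < \<mu>" "\<kappa> \<le> \<nu>" for \<nu> \<kappa>
        using tr_tr[OF that(2), of \<mu>] that less.prems by (simp add: eq_on_def)
      show "eq_on (X \<nu>) (w \<circ> tr \<nu> \<mu>) (tr \<mu> l \<circ> tr \<nu> \<mu>)" if "\<nu> < \<mu>" for \<nu>
        using w(2)[OF that] tr_tr[of \<nu> \<mu> l] that less.prems by (simp add: eq_on_def)
    qed
    then show ?thesis using md_map_eq_on[OF w(1)] X_multipointed[OF less.prems] by blast
  qed
qed

text \<open>Hence a structure on a part of \<open>X l\<close> which is at least as fine as that of \<open>X l\<close>, and through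
  which all cells factor, is all of \<open>X l\<close>. This is how explicit candidates for states, points, open
  sets and execution paths are compared with the actual colimit.\<close>

lemma identity_factor:
  fixes Y :: "'a mdspace"
  assumes Y: "multipointed_d_space C P Y" and YX: "md_map Y (X l) (\<lambda>x. x)"
    and zero: "md_map (X zero_ordinal) Y (tr zero_ordinal l)"
    and step: "\<And>\<nu>. \<nu> < l \<Longrightarrow> md_map (X \<nu>) Y (tr \<nu> l) \<Longrightarrow>
      md_map (Glob P (disk (n \<nu>))) Y (characteristic_map l tr h \<nu>)"
  shows "md_map (X l) Y (\<lambda>x. x)"
  using md_map_eq_on[OF factor_through[OF assms, of l]] X_multipointed[of l] tr_id[of l]
  by (simp add: eq_on_def)

end

text \<open>Forgetting the states that do not come from the initial stage, and the execution paths which begin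
  or end in one of these, leaves a structure through which all cells factor: the attaching maps send
  the end points of the globe to states of earlier stages, for which the claim holds by induction.\<close>

lemma cellular_states_eq:
  assumes "cellular C P l X tr n g h"
  shows "states (X l) = tr zero_ordinal l ` topspace (underlying (X zero_ordinal))"
  using assms
proof (induction l rule: less_induct)
  case (less l)
  then interpret cellular C P l X tr n g h by simp
  obtain S where S: "X zero_ordinal = \<lparr>underlying = discrete_topology S, states = S, execution_paths = {}\<rparr>"
    using X_zero by blast
  let ?S = "tr zero_ordinal l ` S"
  let ?Y = "\<lparr>underlying = T l, states = ?S,
     execution_paths = {\<gamma> \<in> execution_paths (X l). \<gamma> 0 \<in> ?S \<and> \<gamma> 1 \<in> ?S}\<rparr>"
  have zmd: "md_map (X zero_ordinal) (X l) (tr zero_ordinal l)"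
    by (rule tr_md_map) (auto simp: zero_ordinal_le)
  note Xl = multipointedD[OF X_multipointed[OF order_refl]]
  have sub: "?S \<subseteq> states (X l)" using md_mapD(2)[OF zmd] by (auto simp: S)
  have "restrict (\<gamma> \<circ> \<phi>) {0..1} 0 \<in> ?S \<and> restrict (\<gamma> \<circ> \<phi>) {0..1} 1 \<in> ?S"
    if "\<phi> \<in> reparams P" "\<gamma> 0 \<in> ?S" "\<gamma> 1 \<in> ?S" for \<gamma> \<phi>
    using that reparam_toD(2,3)[of \<phi> P 1] by (simp add: reparams_eq_reparam_to)
  moreover have "normalized_composition \<gamma>1 \<gamma>2 0 \<in> ?S \<and> normalized_composition \<gamma>1 \<gamma>2 1 \<in> ?S"
    if "\<gamma>1 0 \<in> ?S" "\<gamma>2 1 \<in> ?S" for \<gamma>1 \<gamma>2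
    using that by (simp add: normalized_composition_def)
  ultimately have Y: "multipointed_d_space C P ?Y"
    unfolding multipointed_d_space_def using Xl(1-3,6,7) sub by auto
  have YX: "md_map ?Y (X l) (\<lambda>x. x)"
  proof (rule md_mapI)
    show "restrict ((\<lambda>x. x) \<circ> \<gamma>) {0..1} \<in> execution_paths (X l)" if "\<gamma> \<in> execution_paths ?Y" for \<gamma>
    proof -
      have "restrict \<gamma> {0..1} = \<gamma>" using Xl(8)[of \<gamma>] that by (simp add: extensional_restrict)
      then show ?thesis using that by (simp add: o_def)
    qed
  qed (use sub in auto)
  have zero: "md_map (X zero_ordinal) ?Y (tr zero_ordinal l)"
    using md_mapD(1)[OF zmd] by (intro md_mapI) (auto simp: S)
  have step: "md_map (Glob P (disk (n \<nu>))) ?Y (characteristic_map l tr h \<nu>)" if \<nu>: "\<nu> < l" for \<nu>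
  proof (rule md_mapI)
    note c = md_mapD[OF char_md_map[OF \<nu>]]
    have IH: "states (X \<nu>) = tr zero_ordinal \<nu> ` S"
      using less.IH[OF \<nu>] stage[of \<nu>] \<nu> by (simp add: S)
    have "characteristic_map l tr h \<nu> p \<in> ?S" if "p \<in> {Src, Tgt}" for p
    proof -
      have p: "p \<in> topspace (globe_topology (boundary_sphere (n \<nu>)))" using that by auto
      have "g \<nu> p \<in> states (X \<nu>)"
        using md_mapD(2)[OF g_md_map[OF \<nu>], of p] that by (simp add: Glob_def)
      then obtain s where "s \<in> S" "g \<nu> p = tr zero_ordinal \<nu> s" using IH by auto
      then have "tr \<nu> l (g \<nu> p) = tr zero_ordinal l s"
        using tr_tr[of zero_ordinal \<nu> l s] \<nu> by (simp add: S zero_ordinal_le)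
      then show ?thesis using char_boundary[OF \<nu> p] \<open>s \<in> S\<close> by simp
    qed
    then have ch: "characteristic_map l tr h \<nu> Src \<in> ?S" "characteristic_map l tr h \<nu> Tgt \<in> ?S" by auto
    show "characteristic_map l tr h \<nu> x \<in> states ?Y" if "x \<in> states (Glob P (disk (n \<nu>)))" for x
      using that ch by (auto simp: Glob_def)
    show "restrict (characteristic_map l tr h \<nu> \<circ> \<gamma>) {0..1} \<in> execution_paths ?Y"
      if \<gamma>: "\<gamma> \<in> execution_paths (Glob P (disk (n \<nu>)))" for \<gamma>
    proof -
      obtain z \<phi> where "\<gamma> = restrict (\<lambda>t. globe_proj (z, \<phi> t)) {0..1}" "\<phi> \<in> reparams P"
        using \<gamma> by (auto simp: Glob_def)
      then have "\<gamma> 0 = Src" "\<gamma> 1 = Tgt"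
        using reparam_toD(2,3)[of \<phi> P 1] by (auto simp: reparams_eq_reparam_to globe_proj_def)
      then show ?thesis using c(3)[OF \<gamma>] ch by simp
    qed
    show "continuous_map (underlying (Glob P (disk (n \<nu>)))) (underlying ?Y) (characteristic_map l tr h \<nu>)"
      using c(1) by simp
  qed
  have "md_map (X l) ?Y (\<lambda>x. x)"
    by (rule identity_factor[OF Y YX zero step])
  then have "states (X l) \<subseteq> ?S" using md_mapD(2) by fastforce
  then show ?case using sub by (auto simp: S)
qed

context cellular
begin

lemmas states_eq = cellular_states_eq[OF cellular_axioms]

text \<open>A segment is given by a cell and a point of its disk.\<close>

definition open_cells :: "('i \<times> (nat \<Rightarrow> real)) set" where
  "open_cells = {(\<nu>, z). \<nu> < l \<and> z \<in> open_disk (n \<nu>)}"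

definition closed_cells :: "('i \<times> (nat \<Rightarrow> real)) set" where
  "closed_cells = {(\<nu>, z). \<nu> < l \<and> z \<in> disk_set (n \<nu>)}"

lemma open_cells_subset: "open_cells \<subseteq> closed_cells"
  by (auto simp: open_cells_def closed_cells_def open_disk_def)

lemma cell_path_execution:
  assumes "\<nu> < l" "z \<in> disk_set (n \<nu>)" "\<phi> \<in> reparams P"
  shows "restrict (\<lambda>t. q \<nu> (z, \<phi> t)) {0..1} \<in> execution_paths (X l)"
proof -
  have "restrict (\<lambda>t. globe_proj (z, \<phi> t)) {0..1} \<in> execution_paths (Glob P (disk (n \<nu>)))"
    using assms by (auto simp: Glob_def disk_eq)
  from md_mapD(3)[OF char_md_map[OF assms(1)] this]
  have "restrict (characteristic_map l tr h \<nu> \<circ> restrict (\<lambda>t. globe_proj (z, \<phi> t)) {0..1}) {0..1}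
     \<in> execution_paths (X l)" .
  moreover have "restrict (characteristic_map l tr h \<nu> \<circ> restrict (\<lambda>t. globe_proj (z, \<phi> t)) {0..1}) {0..1}
     = restrict (\<lambda>t. q \<nu> (z, \<phi> t)) {0..1}"
    by (auto simp: cell_map_def restrict_def)
  ultimately show ?thesis by simp
qed

lemma Homeos_subset: "reparams Homeos \<subseteq> reparams P"
  by (auto simp: reparams_eq_reparam_to reparam_to_Homeos_le)

lemma chain_paths_execution: "chain_paths q closed_cells P \<subseteq> execution_paths (X l)"
proof (rule chain_paths_subset)
  note Xl = multipointedD[OF X_multipointed[OF order_refl]]
  show "restrict (\<gamma> \<circ> \<theta>) {0..1} \<in> execution_paths (X l)"
    if "\<gamma> \<in> execution_paths (X l)" "\<theta> \<in> reparams Homeos" for \<gamma> \<theta>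
    using Xl(6) that Homeos_subset by blast
qed (use multipointedD(7)[OF X_multipointed[OF order_refl]] cell_path_execution in \<open>auto simp: closed_cells_def\<close>)

definition closed_cover :: "'a set" where
  "closed_cover = states (X l) \<union> (\<Union>\<nu>\<in>{..<l}. q \<nu> ` cylinder (n \<nu>))"

text \<open>The topology of the candidate is generated by the images of the paths in the cylinders, so that it
  is \<open>\<Delta>\<close>-generated by construction. As the cylinders are \<open>\<Delta>\<close>-generated, the open sets are those of
  the final topology with respect to the cylinders (\<open>openin_cell_topology\<close>).\<close>

definition cell_paths :: "(real \<Rightarrow> 'a) set" where
  "cell_paths = {q \<nu> \<circ> p |\<nu> p. \<nu> < l \<and> pathin (top_of_set (cylinder (n \<nu>))) p}"

definition cell_topology :: "'a topology" where
  "cell_topology = final_topology closed_cover unit_interval cell_paths"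

definition cell_model :: "'a mdspace" where
  "cell_model = \<lparr>underlying = cell_topology, states = states (X l),
     execution_paths = chain_paths q open_cells P\<rparr>"

lemma cell_paths_range: "f \<in> cell_paths \<Longrightarrow> t \<in> {0..1} \<Longrightarrow> f t \<in> closed_cover"
proof -
  assume "f \<in> cell_paths" and t: "t \<in> {0..1}"
  then obtain \<nu> p where f: "f = q \<nu> \<circ> p" "\<nu> < l" "pathin (top_of_set (cylinder (n \<nu>))) p"
    by (auto simp: cell_paths_def)
  have "p t \<in> cylinder (n \<nu>)"
    using pathin_in_topspace[OF f(3) t] by simp
  then have "q \<nu> (p t) \<in> (\<Union>\<nu>\<in>{..<l}. q \<nu> ` cylinder (n \<nu>))"
    by (intro UN_I[of \<nu>] imageI) (simp add: f(2))
  then show ?thesis unfolding closed_cover_def f(1) o_def by (rule UnI2)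
qed

lemma topspace_cell_topology: "topspace cell_topology = closed_cover"
  unfolding cell_topology_def
  by (rule topspace_final_topology) (auto intro: cell_paths_range)

lemma openin_cell_topology:
  "openin cell_topology U \<longleftrightarrow> U \<subseteq> closed_cover \<and>
     (\<forall>\<nu><l. openin (top_of_set (cylinder (n \<nu>))) {x \<in> cylinder (n \<nu>). q \<nu> x \<in> U})"
proof -
  have "(\<forall>f\<in>cell_paths. openin unit_interval {t \<in> topspace unit_interval. f t \<in> U}) \<longleftrightarrow>
     (\<forall>\<nu><l. openin (top_of_set (cylinder (n \<nu>))) {x \<in> cylinder (n \<nu>). q \<nu> x \<in> U})" (is "?L \<longleftrightarrow> ?R")
  proof
    assume ?L
    show ?R
    proof (intro allI impI)
      fix \<nu> assume \<nu>: "\<nu> < l"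
      show "openin (top_of_set (cylinder (n \<nu>))) {x \<in> cylinder (n \<nu>). q \<nu> x \<in> U}"
      proof (rule delta_generatedD[OF delta_generated_cylinder[OF locally_path_connected_disk_set]])
        fix p assume p: "pathin (top_of_set (cylinder (n \<nu>))) p"
        have "p t \<in> cylinder (n \<nu>)" if "t \<in> {0..1}" for t
          using pathin_in_topspace[OF p that] by simp
        then have "{t \<in> {0..1}. p t \<in> {x \<in> cylinder (n \<nu>). q \<nu> x \<in> U}} = {t \<in> topspace unit_interval. (q \<nu> \<circ> p) t \<in> U}"
          by auto
        moreover have "q \<nu> \<circ> p \<in> cell_paths" using \<nu> p by (auto simp: cell_paths_def)
        with \<open>?L\<close> have "openin unit_interval {t \<in> topspace unit_interval. (q \<nu> \<circ> p) t \<in> U}" by (rule bspec)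
        ultimately show "openin unit_interval {t \<in> {0..1}. p t \<in> {x \<in> cylinder (n \<nu>). q \<nu> x \<in> U}}"
          by (simp only:)
      qed auto
    qed
  next
    assume R: ?R
    show ?L
    proof
      fix f assume "f \<in> cell_paths"
      then obtain \<nu> p where f: "f = q \<nu> \<circ> p" "\<nu> < l" "pathin (top_of_set (cylinder (n \<nu>))) p"
        by (auto simp: cell_paths_def)
      have "openin unit_interval {t \<in> topspace unit_interval. p t \<in> {x \<in> cylinder (n \<nu>). q \<nu> x \<in> U}}"
        using R f(2,3) unfolding pathin_def by (intro openin_continuous_map_preimage) auto
      moreover have "p t \<in> cylinder (n \<nu>)" if "t \<in> {0..1}" for t
        using pathin_in_topspace[OF f(3) that] by simp
      then have "{t \<in> topspace unit_interval. p t \<in> {x \<in> cylinder (n \<nu>). q \<nu> x \<in> U}} = {t \<in> topspace unit_interval. f t \<in> U}"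
        by (auto simp: f(1))
      ultimately show "openin unit_interval {t \<in> topspace unit_interval. f t \<in> U}" by simp
    qed
  qed
  then show ?thesis unfolding cell_topology_def openin_final_topology by simp
qed

lemma closed_cover_subset: "closed_cover \<subseteq> topspace (T l)"
  using multipointedD(2)[OF X_multipointed[of l]] cell_map_in by (auto simp: closed_cover_def)

lemma continuous_cell_topology_inclusion: "continuous_map cell_topology (T l) (\<lambda>x. x)"
  unfolding continuous_map_def topspace_cell_topology
proof (intro conjI allI impI)
  fix U assume U: "openin (T l) U"
  have "openin (top_of_set (cylinder (n \<nu>))) {x \<in> cylinder (n \<nu>). q \<nu> x \<in> {x \<in> closed_cover. x \<in> U}}"
    if "\<nu> < l" for \<nu>
  proof -
    have "{x \<in> cylinder (n \<nu>). q \<nu> x \<in> {x \<in> closed_cover. x \<in> U}} = {x \<in> topspace (top_of_set (cylinder (n \<nu>))). q \<nu> x \<in> U}"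
      using that by (auto simp: closed_cover_def)
    then show ?thesis using openin_continuous_map_preimage[OF continuous_cell_map[OF that] U] by simp
  qed
  then show "openin cell_topology {x \<in> closed_cover. x \<in> U}"
    unfolding openin_cell_topology by auto
qed (use closed_cover_subset in auto)

lemma pathin_cell_paths: "f \<in> cell_paths \<Longrightarrow> pathin cell_topology f"
  unfolding pathin_def continuous_map_def topspace_cell_topology
  by (intro conjI allI impI Pi_I)
     (use cell_paths_range in \<open>auto simp: cell_topology_def openin_final_topology\<close>)

text \<open>The \<open>\<Delta>\<close>-Hausdorff property is inherited from \<open>X l\<close>, as the topology of the candidate is finer.\<close>

lemma in_Top_cell_topology: "in_Top C cell_topology"
proof -
  have T: "in_Top C (T l)" using multipointedD(1)[OF X_multipointed[of l]] by simp
  have gen: "delta_generated cell_topology"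
    unfolding delta_generated_iff topspace_cell_topology
  proof (intro allI impI)
    fix U assume "U \<subseteq> closed_cover"
      and "\<forall>p. pathin cell_topology p \<longrightarrow> openin unit_interval {t \<in> {0..1}. p t \<in> U}"
    then show "openin cell_topology U"
      using pathin_cell_paths by (auto simp: cell_topology_def openin_final_topology)
  qed
  have "delta_hausdorff cell_topology" if dh: "delta_hausdorff (T l)"
    unfolding delta_hausdorff_def
  proof (intro allI impI)
    fix p assume p: "pathin cell_topology p"
    have "pathin (T l) ((\<lambda>x. x) \<circ> p)"
      using continuous_map_compose[OF p[unfolded pathin_def] continuous_cell_topology_inclusion]
      unfolding pathin_def .
    then have "closedin (T l) (p ` {0..1})"
      using dh by (simp add: delta_hausdorff_def o_def)
    then have "closedin cell_topology {x \<in> topspace cell_topology. x \<in> p ` {0..1}}"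
      by (rule closedin_continuous_map_preimage[OF continuous_cell_topology_inclusion])
    moreover have "p ` {0..1} \<subseteq> topspace cell_topology"
      using continuous_map_image_subset_topspace[OF p[unfolded pathin_def]] by simp
    then have "{x \<in> topspace cell_topology. x \<in> p ` {0..1}} = p ` {0..1}" by auto
    ultimately show "closedin cell_topology (p ` {0..1})" by simp
  qed
  then show ?thesis using T gen by (cases C) auto
qed

lemma multipointed_cell_model: "multipointed_d_space C P cell_model"
proof -
  have "chain_paths q open_cells P \<subseteq> continuous_maps unit_interval cell_topology"
  proof (rule chain_paths_subset)
    note M = multipointedD[OF multipointed_continuous_paths[OF in_Top_cell_topology, of P]]
    show "restrict (\<gamma> \<circ> \<theta>) {0..1} \<in> continuous_maps unit_interval cell_topology"
      if "\<gamma> \<in> continuous_maps unit_interval cell_topology" "\<theta> \<in> reparams Homeos" for \<gamma> \<theta>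
      using M(6)[of \<gamma> \<theta>] that Homeos_subset by auto
    show "normalized_composition \<gamma>1 \<gamma>2 \<in> continuous_maps unit_interval cell_topology"
      if "\<gamma>1 \<in> continuous_maps unit_interval cell_topology" "\<gamma>2 \<in> continuous_maps unit_interval cell_topology"
        "\<gamma>1 1 = \<gamma>2 0" for \<gamma>1 \<gamma>2
      using M(7)[of \<gamma>1 \<gamma>2] that by simp
    fix c \<phi> assume c: "c \<in> open_cells" "\<phi> \<in> reparams P"
    then have v: "fst c < l" "snd c \<in> disk_set (n (fst c))" by (auto simp: open_cells_def open_disk_def)
    have "pathin (top_of_set (cylinder (n (fst c)))) (\<lambda>t. (snd c, \<phi> t))"
      using reparams_continuous[OF c(2)] v(2) unfolding pathin_def
      by (auto simp: continuous_map_in_subtopology intro!: continuous_intros)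
    then have "q (fst c) \<circ> (\<lambda>t. (snd c, \<phi> t)) \<in> cell_paths" using v(1) by (auto simp: cell_paths_def)
    from pathin_cell_paths[OF this]
    show "restrict (\<lambda>t. q (fst c) (snd c, \<phi> t)) {0..1} \<in> continuous_maps unit_interval cell_topology"
      unfolding pathin_def o_def by (rule restrict_path_in_continuous_maps)
  qed
  moreover have "\<gamma> 0 \<in> states (X l) \<and> \<gamma> 1 \<in> states (X l)" if "\<gamma> \<in> chain_paths q open_cells P" for \<gamma>
  proof -
    have "\<gamma> \<in> chain_paths q closed_cells P"
      using that open_cells_subset unfolding chain_paths_def by blast
    then have "\<gamma> \<in> execution_paths (X l)" using chain_paths_execution by blast
    then show ?thesis using multipointedD(4,5)[OF X_multipointed[OF order_refl]] by blast
  qed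
  ultimately show ?thesis
    unfolding multipointed_d_space_def cell_model_def
    using in_Top_cell_topology chain_paths_reparam chain_paths_composition
    by (auto simp: topspace_cell_topology closed_cover_def)
qed

text \<open>A path of a globe over an interior point of the disk is a chain of length one. Over a boundary
  point, the attaching map carries it to an execution path of the stage \<open>X \<nu>\<close>, which is sent to a
  chain of open cells by the map \<open>X \<nu> \<rightarrow> cell_model\<close> already constructed.\<close>

lemma md_map_cell_model: "md_map (X l) cell_model (\<lambda>x. x)"
proof (rule identity_factor[OF multipointed_cell_model])
  show "md_map cell_model (X l) (\<lambda>x. x)"
  proof (rule md_mapI)
    fix \<gamma> assume "\<gamma> \<in> execution_paths cell_model"
    then have c: "\<gamma> \<in> chain_paths q open_cells P" by (simp add: cell_model_def)
    then have "\<gamma> \<in> chain_paths q closed_cells P"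
      using open_cells_subset unfolding chain_paths_def by blast
    moreover have "restrict \<gamma> {0..1} = \<gamma>" using c by (auto simp: chain_paths_def)
    ultimately show "restrict ((\<lambda>x. x) \<circ> \<gamma>) {0..1} \<in> execution_paths (X l)"
      using chain_paths_execution by (auto simp: o_def)
  qed (use continuous_cell_topology_inclusion in \<open>auto simp: cell_model_def\<close>)
next
  obtain S where S: "X zero_ordinal = \<lparr>underlying = discrete_topology S, states = S, execution_paths = {}\<rparr>"
    using X_zero by blast
  have "tr zero_ordinal l ` S \<subseteq> states (X l)" using states_eq by (simp add: S)
  then show "md_map (X zero_ordinal) cell_model (tr zero_ordinal l)"
    by (intro md_mapI) (auto simp: S cell_model_def topspace_cell_topology closed_cover_def)
next
  fix \<nu> assume \<nu>: "\<nu> < l" and IH: "md_map (X \<nu>) cell_model (tr \<nu> l)"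
  let ?c = "characteristic_map l tr h \<nu>"
  show "md_map (Glob P (disk (n \<nu>))) cell_model ?c"
  proof (rule md_mapI)
    have ch: "?c Src \<in> states (X l)" "?c Tgt \<in> states (X l)"
      using md_mapD(2)[OF char_md_map[OF \<nu>]] by (auto simp: Glob_def)
    have "continuous_map (top_of_set (cylinder (n \<nu>))) cell_topology (q \<nu>)"
      unfolding continuous_map_def topspace_cell_topology
      using \<nu> openin_cell_topology by (auto simp: closed_cover_def)
    then show "continuous_map (underlying (Glob P (disk (n \<nu>)))) (underlying cell_model) ?c"
      using ch unfolding disk_eq
      by (simp add: Glob_def cell_model_def continuous_map_from_globe[OF locally_path_connected_disk_set]
          topspace_cell_topology cell_map_def closed_cover_def)
    show "?c x \<in> states cell_model" if "x \<in> states (Glob P (disk (n \<nu>)))" for x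
      using that ch by (auto simp: Glob_def cell_model_def)
    fix \<gamma> assume "\<gamma> \<in> execution_paths (Glob P (disk (n \<nu>)))"
    then obtain z \<phi> where \<gamma>: "\<gamma> = restrict (\<lambda>t. globe_proj (z, \<phi> t)) {0..1}" "\<phi> \<in> reparams P" "z \<in> disk_set (n \<nu>)"
      by (auto simp: Glob_def disk_eq)
    have r: "restrict (?c \<circ> \<gamma>) {0..1} = restrict (\<lambda>t. q \<nu> (z, \<phi> t)) {0..1}"
      by (auto simp: cell_map_def restrict_def \<gamma>(1))
    show "restrict (?c \<circ> \<gamma>) {0..1} \<in> execution_paths cell_model"
    proof (cases "z \<in> sphere_set (n \<nu>)")
      case True
      then have "\<gamma> \<in> execution_paths (Glob P (boundary_sphere (n \<nu>)))"
        using \<gamma> by (auto simp: Glob_def boundary_sphere_eq)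
      then have "restrict (tr \<nu> l \<circ> restrict (g \<nu> \<circ> \<gamma>) {0..1}) {0..1} \<in> execution_paths cell_model"
        by (intro md_mapD(3)[OF IH] md_mapD(3)[OF g_md_map[OF \<nu>]])
      moreover have "?c (\<gamma> t) = tr \<nu> l (g \<nu> (\<gamma> t))" if "t \<in> {0..1}" for t
      proof (rule char_boundary[OF \<nu>])
        show "\<gamma> t \<in> topspace (globe_topology (boundary_sphere (n \<nu>)))"
          unfolding topspace_globe_sphere using that True reparams_range[OF \<gamma>(2) that] by (simp add: \<gamma>(1))
      qed
      then have "restrict (tr \<nu> l \<circ> restrict (g \<nu> \<circ> \<gamma>) {0..1}) {0..1} = restrict (?c \<circ> \<gamma>) {0..1}"
        by (auto simp: restrict_def)
      ultimately show ?thesis by simp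
    next
      case False
      then have "restrict (chain q [(\<nu>, z)] \<circ> \<phi>) {0..1} \<in> chain_paths q open_cells P"
        using \<nu> \<gamma> by (intro chain_pathsI) (auto simp: linked_def open_cells_def open_disk_def reparams_eq_reparam_to)
      then show ?thesis unfolding r by (simp add: cell_model_def o_def)
    qed
  qed
qed

theorem topspace_eq_cells: "topspace (T l) = states (X l) \<union> (\<Union>\<nu>\<in>{..<l}. q \<nu> ` cylinder (n \<nu>))"
proof -
  have "x \<in> closed_cover" if "x \<in> topspace (T l)" for x
    using md_mapD(4)[OF md_map_cell_model that] by (simp add: cell_model_def topspace_cell_topology)
  then have "topspace (T l) = closed_cover" using closed_cover_subset by blast
  then show ?thesis unfolding closed_cover_def .
qed

theorem openin_iff_cells:
  "openin (T l) U \<longleftrightarrow> U \<subseteq> topspace (T l) \<and>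
     (\<forall>\<nu><l. openin (top_of_set (cylinder (n \<nu>))) {x \<in> cylinder (n \<nu>). q \<nu> x \<in> U})"
proof -
  have c: "topspace (T l) = closed_cover" unfolding closed_cover_def by (rule topspace_eq_cells)
  have "openin (T l) U" if "openin cell_topology U"
  proof -
    have "openin (T l) {x \<in> topspace (T l). x \<in> U}"
      using openin_continuous_map_preimage[OF md_mapD(1)[OF md_map_cell_model]] that
      by (simp add: cell_model_def)
    moreover have "{x \<in> topspace (T l). x \<in> U} = U"
      using openin_subset[OF that] by (auto simp: c topspace_cell_topology)
    ultimately show ?thesis by simp
  qed
  moreover have "openin cell_topology U" if U: "openin (T l) U"
  proof -
    have "{x \<in> closed_cover. x \<in> U} = U" using openin_subset[OF U] c by auto
    then show ?thesis
      using openin_continuous_map_preimage[OF continuous_cell_topology_inclusion U]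
      by (simp add: topspace_cell_topology)
  qed
  ultimately have "openin (T l) U \<longleftrightarrow> openin cell_topology U" by blast
  then show ?thesis unfolding openin_cell_topology c .
qed

theorem execution_paths_eq_chains: "execution_paths (X l) = chain_paths q open_cells P"
proof -
  have "\<gamma> \<in> chain_paths q open_cells P" if "\<gamma> \<in> execution_paths (X l)" for \<gamma>
  proof -
    have "restrict \<gamma> {0..1} = \<gamma>"
      using multipointedD(8)[OF X_multipointed[OF order_refl] that] by (simp add: extensional_restrict)
    then show ?thesis
      using md_mapD(3)[OF md_map_cell_model that] by (simp add: cell_model_def o_def)
  qed
  moreover have "chain_paths q open_cells P \<subseteq> execution_paths (X l)"
    using chain_paths_execution open_cells_subset unfolding chain_paths_def by blast
  ultimately show ?thesis by blast
qed

end

section \<open>Real functions on a cellular space\<close>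

definition open_cylinder :: "nat \<Rightarrow> ((nat \<Rightarrow> real) \<times> real) set" where
  "open_cylinder n = open_disk n \<times> {0<..<1}"

lemma open_cylinder_subset: "open_cylinder n \<subseteq> cylinder n"
  by (auto simp: open_cylinder_def open_disk_def)

text \<open>These functions vanish on the boundary of the cylinder, hence extend by zero to the stage to which
  the cell is attached. The first is positive in the interior, and the quotients of the others by it
  recover the time and the coordinates of the point of the disk.\<close>

fun bump :: "nat \<Rightarrow> nat \<Rightarrow> (nat \<Rightarrow> real) \<times> real \<Rightarrow> real" where
  "bump n 0 (z, t) = (1 - sqnorm n z) * (t * (1 - t))"
| "bump n (Suc 0) (z, t) = (1 - sqnorm n z) * (t * (1 - t)) * t"
| "bump n (Suc (Suc i)) (z, t) = (1 - sqnorm n z) * (t * (1 - t)) * ((1 + z i) / 2)"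

lemma bump_0_range:
  assumes "x \<in> cylinder n"
  shows "bump n 0 x \<in> {0..1}"
proof -
  obtain z t where x: "x = (z, t)" "z \<in> disk_set n" "0 \<le> t" "t \<le> 1" using assms by (cases x) auto
  have "0 \<le> 1 - sqnorm n z" "1 - sqnorm n z \<le> 1" using x(2) sqnorm_nonneg[of n z] by (auto simp: disk_set_def)
  moreover have "0 \<le> t * (1 - t)" "t * (1 - t) \<le> 1" using x by (auto intro: mult_le_one)
  ultimately show ?thesis unfolding x(1) bump.simps by (auto intro: mult_le_one)
qed

lemma bump_range:
  assumes "x \<in> cylinder n"
  shows "bump n k x \<in> {0..1}"
proof -
  obtain z t where x: "x = (z, t)" "z \<in> disk_set n" "0 \<le> t" "t \<le> 1" using assms by (cases x) auto
  have b: "0 \<le> bump n 0 (z, t)" "bump n 0 (z, t) \<le> 1" using bump_0_range[OF assms] x(1) by auto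
  have e: "bump n (Suc 0) (z, t) = bump n 0 (z, t) * t"
    "bump n (Suc (Suc i)) (z, t) = bump n 0 (z, t) * ((1 + z i) / 2)" for i by simp_all
  have c: "0 \<le> (1 + z i) / 2" "(1 + z i) / 2 \<le> 1" for i
    using disk_set_coordinate[OF x(2), of i] by auto
  consider "k = 0" | "k = Suc 0" | i where "k = Suc (Suc i)" by (metis not0_implies_Suc)
  then show ?thesis
  proof cases
    case 1 then show ?thesis using b x(1) by simp
  next
    case 2
    then show ?thesis unfolding x(1) 2 e(1) using b x(3,4) by (auto simp del: bump.simps intro: mult_le_one)
  next
    case (3 i)
    show ?thesis unfolding x(1) 3 e(2) atLeastAtMost_iff
      using mult_nonneg_nonneg[OF b(1) c(1)[of i]] mult_le_one[OF b(2) c(1)[of i] c(2)[of i]] by (rule conjI)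
  qed
qed

lemma continuous_on_bump: "continuous_on S (bump n k)"
proof -
  have c: "continuous_on S (\<lambda>x. sqnorm n (fst x))" for S :: "((nat \<Rightarrow> real) \<times> real) set"
    by (rule continuous_on_compose2[OF continuous_on_sqnorm[of UNIV] continuous_on_fst[OF continuous_on_id]]) simp
  have z: "continuous_on S (\<lambda>x. fst x i)" for S :: "((nat \<Rightarrow> real) \<times> real) set" and i
    by (rule continuous_on_product_then_coordinatewise[OF continuous_on_fst[OF continuous_on_id]])
  have e: "bump n 0 = (\<lambda>x. (1 - sqnorm n (fst x)) * (snd x * (1 - snd x)))"
    "bump n (Suc 0) = (\<lambda>x. (1 - sqnorm n (fst x)) * (snd x * (1 - snd x)) * snd x)"
    "\<And>i. bump n (Suc (Suc i)) = (\<lambda>x. (1 - sqnorm n (fst x)) * (snd x * (1 - snd x)) * ((1 + fst x i) / 2))"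
    by auto
  consider "k = 0" | "k = Suc 0" | i where "k = Suc (Suc i)" by (metis not0_implies_Suc)
  then show ?thesis
    by cases (simp_all only: e, (intro continuous_intros c z; simp)+)
qed

lemma bump_boundary: "z \<in> sphere_set n \<Longrightarrow> bump n k (z, t) = 0" "bump n k (z, 0) = 0" "bump n k (z, 1) = 0"
  by (cases "(n, k, (z, t))" rule: bump.cases; auto simp: sphere_set_def)+

lemma bump_0_positive: "x \<in> open_cylinder n \<Longrightarrow> 0 < bump n 0 x"
  by (auto simp: open_cylinder_def open_disk_def disk_set_def sphere_set_def order_less_le
      intro!: mult_pos_pos)

lemma bump_injective:
  assumes "x \<in> open_cylinder n" "y \<in> open_cylinder n" "\<And>k. k < n + 2 \<Longrightarrow> bump n k x = bump n k y"
  shows "x = y"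
proof -
  obtain z t z' t' where e: "x = (z, t)" "y = (z', t')" by (cases x; cases y) auto
  let ?b = "bump n 0 (z, t)"
  have b: "?b = bump n 0 (z', t')" using assms(3)[of 0] e by simp
  have pos: "?b > 0" using bump_0_positive[OF assms(1)] e by simp
  have "?b * t = bump n 0 (z', t') * t'" using assms(3)[of 1] e by simp
  then have t: "t = t'" using b pos by (simp del: bump.simps)
  have "z i = z' i" for i
  proof (cases "i < n")
    case True
    then have "?b * ((1 + z i) / 2) = bump n 0 (z', t') * ((1 + z' i) / 2)"
      using assms(3)[of "Suc (Suc i)"] e by simp
    then show ?thesis using b pos by (simp del: bump.simps)
  next
    case False
    then show ?thesis using assms(1,2) e by (auto simp: open_cylinder_def open_disk_def disk_set_def)
  qed
  then show ?thesis using t e by auto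
qed

context cellular
begin

lemma pushout_function:
  assumes \<nu>: "\<nu> < l" and f: "continuous_map (T \<nu>) unit_interval f"
    and u: "continuous_map (globe_topology (disk (n \<nu>))) unit_interval u"
    and uf: "\<And>p. p \<in> topspace (globe_topology (boundary_sphere (n \<nu>))) \<Longrightarrow> u p = f (g \<nu> p)"
  shows "\<exists>F. continuous_map (T (next_ordinal \<nu>)) unit_interval F \<and>
    (\<forall>x\<in>topspace (T \<nu>). F (tr \<nu> (next_ordinal \<nu>) x) = f x) \<and>
    (\<forall>p\<in>topspace (globe_topology (disk (n \<nu>))). F (h \<nu> p) = u p)"
proof -
  \<comment> \<open>Real numbers embed into the carrier type of the test objects as the third component of \<open>Mid\<close>.\<close>
  let ?e = "\<lambda>t. {Inr (Mid (\<lambda>_. 0) t)} :: ('i \<times> 'a + cell_point) set"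
  have e: "inj ?e" by (auto simp: inj_def)
  have f': "md_map (X \<nu>) cofree_unit f"
    using md_map_cofree_unit_iff[OF multipointedD(2,3)[OF X_multipointed[OF order_less_imp_le[OF \<nu>]]]] f
    by simp
  have u': "md_map (Glob P (disk (n \<nu>))) cofree_unit u"
    using u unfolding disk_eq md_map_Glob_cofree_unit .
  have "eq_on (Glob P (boundary_sphere (n \<nu>))) (u \<circ> (\<lambda>x. x)) (f \<circ> g \<nu>)"
    using uf by (simp add: eq_on_def Glob_def del: topspace_globe_topology)
  from pushout_factor[OF pushout[OF \<nu>] e multipointed_cofree_unit u' f' this]
  obtain w where w: "md_map (X (next_ordinal \<nu>)) cofree_unit w"
    "eq_on (Glob P (disk (n \<nu>))) (w \<circ> h \<nu>) u" "eq_on (X \<nu>) (w \<circ> tr \<nu> (next_ordinal \<nu>)) f" by blast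
  then show ?thesis
    using md_mapD(1)[OF w(1)]
    by (intro exI[of _ w]) (simp add: eq_on_def Glob_def cofree_unit_def del: topspace_globe_topology)
qed

lemma colimit_function:
  assumes \<nu>: "\<nu> \<le> l" "limit_ordinal \<nu>" and f: "\<And>\<mu>. \<mu> < \<nu> \<Longrightarrow> continuous_map (T \<mu>) unit_interval (f \<mu>)"
    and ff: "\<And>\<mu> \<kappa> x. \<mu> < \<nu> \<Longrightarrow> \<kappa> \<le> \<mu> \<Longrightarrow> x \<in> topspace (T \<kappa>) \<Longrightarrow> f \<mu> (tr \<kappa> \<mu> x) = f \<kappa> x"
  shows "\<exists>F. continuous_map (T \<nu>) unit_interval F \<and>
    (\<forall>\<mu><\<nu>. \<forall>x\<in>topspace (T \<mu>). F (tr \<mu> \<nu> x) = f \<mu> x)"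
proof -
  let ?e = "\<lambda>t. {Inr (Mid (\<lambda>_. 0) t)} :: ('i \<times> 'a + cell_point) set"
  have e: "inj ?e" by (auto simp: inj_def)
  have f': "md_map (X \<mu>) cofree_unit (f \<mu>)" if "\<mu> < \<nu>" for \<mu>
  proof -
    have "\<mu> \<le> l" using \<nu> that by simp
    then show ?thesis
      using md_map_cofree_unit_iff[OF multipointedD(2,3)[OF X_multipointed]] f[OF that] by blast
  qed
  have "eq_on (X \<kappa>) (f \<mu> \<circ> tr \<kappa> \<mu>) (f \<kappa>)" if "\<mu> < \<nu>" "\<kappa> \<le> \<mu>" for \<mu> \<kappa>
    using ff that by (simp add: eq_on_def)
  then obtain w where w: "md_map (X \<nu>) cofree_unit w" "\<forall>\<mu><\<nu>. eq_on (X \<mu>) (w \<circ> tr \<mu> \<nu>) (f \<mu>)"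
    using colimit_factor[OF colimit[OF \<nu>(2,1)] e multipointed_cofree_unit, of f] f' by blast
  then show ?thesis
    using md_mapD(1)[OF w(1)] by (intro exI[of _ w]) (simp add: eq_on_def cofree_unit_def)
qed

text \<open>Transfinite recursion on the stage. At a successor stage the function is extended over the new
  globe, at a limit stage the functions chosen so far are glued. The predicate \<open>Q \<phi> \<mu> r\<close> says that
  \<open>r\<close> is admissible at stage \<open>\<mu>\<close> after the choices \<open>\<phi>\<close> at earlier stages; up to stage \<open>\<kappa>\<close> the choice
  is forced by \<open>f\<close>.\<close>

lemma extend_function:
  assumes \<kappa>: "\<kappa> \<le> l" and f: "continuous_map (T \<kappa>) unit_interval f"
  shows "\<exists>F. continuous_map (T l) unit_interval F \<and> (\<forall>x\<in>topspace (T \<kappa>). F (tr \<kappa> l x) = f x)"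
proof -
  define Q where "Q \<phi> \<mu> r \<longleftrightarrow> (\<mu> \<le> l \<longrightarrow> continuous_map (T \<mu>) unit_interval r \<and>
      (\<mu> \<le> \<kappa> \<longrightarrow> (\<forall>x\<in>topspace (T \<mu>). r x = f (tr \<mu> \<kappa> x))) \<and>
      (\<forall>\<mu>'<\<mu>. \<forall>x\<in>topspace (T \<mu>'). r (tr \<mu>' \<mu> x) = \<phi> \<mu>' x))" for \<phi> :: "'i \<Rightarrow> 'a \<Rightarrow> real" and \<mu> r
  have "\<exists>\<phi>. \<forall>\<mu>. Q \<phi> \<mu> (\<phi> \<mu>)"
  proof (rule dependent_wellorder_choice)
    show "Q \<phi> \<mu> r = Q \<phi>' \<mu> r" if "\<And>\<nu>. \<nu> < \<mu> \<Longrightarrow> \<phi> \<nu> = \<phi>' \<nu>" for r \<phi> \<phi>' \<mu>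
      using that by (simp add: Q_def)
  next
    fix \<mu> and \<phi> :: "'i \<Rightarrow> 'a \<Rightarrow> real"
    assume IH: "\<And>\<nu>. \<nu> < \<mu> \<Longrightarrow> Q \<phi> \<nu> (\<phi> \<nu>)"
    show "\<exists>r. Q \<phi> \<mu> r"
    proof (cases "\<mu> \<le> l")
      case \<mu>: True
      have IHc: "continuous_map (T \<nu>) unit_interval (\<phi> \<nu>)" if "\<nu> < \<mu>" for \<nu>
        using IH[OF that] that \<mu> by (simp add: Q_def)
      have IHt: "\<phi> \<nu> (tr \<nu>' \<nu> x) = \<phi> \<nu>' x" if "\<nu> < \<mu>" "\<nu>' \<le> \<nu>" "x \<in> topspace (T \<nu>')" for \<nu> \<nu>' x
      proof (cases "\<nu>' = \<nu>")
        case True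
        then show ?thesis using tr_id[of \<nu> x] that \<mu> by simp
      next
        case False
        then show ?thesis using IH[OF that(1)] that \<mu> by (simp add: Q_def)
      qed
      show ?thesis
      proof (cases "\<mu> \<le> \<kappa>")
        case True
        have "continuous_map (T \<mu>) unit_interval (f \<circ> tr \<mu> \<kappa>)"
          using md_mapD(1)[OF tr_md_map[OF True \<kappa>]] f by (rule continuous_map_compose)
        moreover have "(f \<circ> tr \<mu> \<kappa>) (tr \<nu> \<mu> x) = \<phi> \<nu> x" if "\<nu> < \<mu>" "x \<in> topspace (T \<nu>)" for \<nu> x
          using IH[OF that(1)] that True \<mu> \<kappa> tr_tr[of \<nu> \<mu> \<kappa> x] by (simp add: Q_def)
        ultimately show ?thesis
          by (intro exI[of _ "f \<circ> tr \<mu> \<kappa>"]) (simp add: Q_def)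
      next
        case False
        consider "\<mu> = zero_ordinal" | \<nu> where "\<nu> < \<mu>" "\<mu> = next_ordinal \<nu>" | "limit_ordinal \<mu>"
          by (rule ordinal_cases)
        then show ?thesis
        proof cases
          case 1
          then show ?thesis using False zero_ordinal_le[of \<kappa>] by simp
        next
          case (2 \<nu>)
          have \<nu>: "\<nu> < l" using 2 \<mu> by simp
          have "continuous_map (globe_topology (boundary_sphere (n \<nu>))) unit_interval (\<phi> \<nu> \<circ> g \<nu>)"
            using md_mapD(1)[OF g_md_map[OF \<nu>]] IHc[OF 2(1)]
            by (simp add: Glob_def) (rule continuous_map_compose)
          then obtain u where u: "continuous_map (globe_topology (disk (n \<nu>))) unit_interval u"
            "\<And>p. p \<in> topspace (globe_topology (boundary_sphere (n \<nu>))) \<Longrightarrow> u p = (\<phi> \<nu> \<circ> g \<nu>) p"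
            by (rule globe_extension) (erule that, assumption+)
          then obtain F where F: "continuous_map (T \<mu>) unit_interval F"
            "\<And>x. x \<in> topspace (T \<nu>) \<Longrightarrow> F (tr \<nu> \<mu> x) = \<phi> \<nu> x"
            using pushout_function[OF \<nu> IHc[OF 2(1)] u(1)] 2(2) by auto
          have "F (tr \<nu>' \<mu> x) = \<phi> \<nu>' x" if "\<nu>' < \<mu>" "x \<in> topspace (T \<nu>')" for \<nu>' x
          proof -
            have le: "\<nu>' \<le> \<nu>" using that(1) less_next_ordinal[OF \<nu>, of \<nu>'] 2(2) by simp
            have "F (tr \<nu>' \<mu> x) = F (tr \<nu> \<mu> (tr \<nu>' \<nu> x))"
              using tr_tr[OF le _ \<mu> that(2)] 2(1) by simp
            also have "\<dots> = \<phi> \<nu> (tr \<nu>' \<nu> x)"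
              using F(2) tr_in[OF le _ that(2)] \<nu> by simp
            also have "\<dots> = \<phi> \<nu>' x" by (rule IHt[OF 2(1) le that(2)])
            finally show ?thesis .
          qed
          then show ?thesis using F(1) False by (intro exI[of _ F]) (simp add: Q_def)
        next
          case 3
          obtain F where "continuous_map (T \<mu>) unit_interval F"
            "\<forall>\<nu><\<mu>. \<forall>x\<in>topspace (T \<nu>). F (tr \<nu> \<mu> x) = \<phi> \<nu> x"
            using colimit_function[OF \<mu> 3, of \<phi>] IHc IHt by blast
          then show ?thesis using False by (intro exI[of _ F]) (simp add: Q_def)
        qed
      qed
    qed (simp add: Q_def)
  qed
  then obtain \<phi> where \<phi>: "\<And>\<mu>. Q \<phi> \<mu> (\<phi> \<mu>)" by blast
  have "\<phi> l (tr \<kappa> l x) = f x" if "x \<in> topspace (T \<kappa>)" for x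
  proof (cases "\<kappa> = l")
    case True
    then show ?thesis using \<phi>[of l] that tr_id[of l x] tr_in[of l l x] by (simp add: Q_def)
  next
    case False
    then show ?thesis using \<phi>[of l] \<phi>[of \<kappa>] \<kappa> that tr_id[of \<kappa> x] by (simp add: Q_def)
  qed
  moreover have "continuous_map (T l) unit_interval (\<phi> l)" using \<phi>[of l] by (simp add: Q_def)
  ultimately show ?thesis by blast
qed

lemma cell_function:
  assumes \<nu>: "\<nu> < l"
  shows "\<exists>F. continuous_map (T l) unit_interval F \<and> (\<forall>x\<in>cylinder (n \<nu>). F (q \<nu> x) = bump (n \<nu>) k x) \<and>
    (\<forall>x\<in>topspace (T \<nu>). F (tr \<nu> l x) = 0)"
proof -
  define u where "u p = (case p of Src \<Rightarrow> 0 | Tgt \<Rightarrow> 0 | Mid z t \<Rightarrow> bump (n \<nu>) k (z, t))" for p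
  have ub: "u (globe_proj (z, t)) = bump (n \<nu>) k (z, t)" for z t
    by (simp add: u_def globe_proj_def bump_boundary)
  have ub': "u \<circ> globe_proj = bump (n \<nu>) k" using ub by auto
  have "continuous_map (top_of_set (cylinder (n \<nu>))) unit_interval (bump (n \<nu>) k)"
    unfolding continuous_map_in_subtopology using continuous_on_bump bump_range by auto
  then have u: "continuous_map (globe_topology (disk (n \<nu>))) unit_interval u"
    unfolding disk_eq continuous_map_from_globe[OF locally_path_connected_disk_set] ub'
    by (simp add: u_def)
  have "u p = 0" if "p \<in> topspace (globe_topology (boundary_sphere (n \<nu>)))" for p
    using that unfolding topspace_globe_sphere
    by (auto simp: ub bump_boundary(1)) (auto simp: u_def)
  then obtain F where F: "continuous_map (T (next_ordinal \<nu>)) unit_interval F"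
    "\<And>x. x \<in> topspace (T \<nu>) \<Longrightarrow> F (tr \<nu> (next_ordinal \<nu>) x) = 0"
    "\<And>p. p \<in> topspace (globe_topology (disk (n \<nu>))) \<Longrightarrow> F (h \<nu> p) = u p"
    using pushout_function[OF \<nu> _ u, of "\<lambda>_. 0"] by (auto simp del: topspace_globe_topology)
  obtain G where G: "continuous_map (T l) unit_interval G"
    "\<And>x. x \<in> topspace (T (next_ordinal \<nu>)) \<Longrightarrow> G (tr (next_ordinal \<nu>) l x) = F x"
    using extend_function[OF next_le[OF \<nu>] F(1)] by blast
  have "G (q \<nu> x) = bump (n \<nu>) k x" if "x \<in> cylinder (n \<nu>)" for x
  proof -
    have p: "globe_proj x \<in> topspace (globe_topology (disk (n \<nu>)))"
      unfolding topspace_globe_disk using that by (rule imageI)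
    have "h \<nu> (globe_proj x) \<in> topspace (T (next_ordinal \<nu>))"
      using md_mapD(4)[OF h_md_map[OF \<nu>], of "globe_proj x"] p by (simp add: Glob_def del: topspace_globe_topology)
    then have "G (q \<nu> x) = u (globe_proj x)"
      using F(3)[OF p] by (simp add: cell_map_def characteristic_map_def G(2))
    then show ?thesis using ub by (cases x) simp
  qed
  moreover have "G (tr \<nu> l x) = 0" if "x \<in> topspace (T \<nu>)" for x
    using G(2)[OF tr_in[OF le_next[OF \<nu>] next_le[OF \<nu>] that]] F(2)[OF that]
      tr_tr[OF le_next[OF \<nu>] next_le[OF \<nu>] order_refl that] by simp
  ultimately show ?thesis using G(1) by blast
qed

lemma state_function:
  "\<exists>F. continuous_map (T l) unit_interval F \<and> (\<forall>x\<in>states (X l). F x = (if x = s then 1 else 0))"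
proof -
  obtain S where S: "X zero_ordinal = \<lparr>underlying = discrete_topology S, states = S, execution_paths = {}\<rparr>"
    using X_zero by blast
  let ?f = "\<lambda>a. if tr zero_ordinal l a = s then 1 else 0 :: real"
  have "continuous_map (T zero_ordinal) unit_interval ?f" by (simp add: S)
  then obtain F where "continuous_map (T l) unit_interval F"
    "\<forall>x\<in>topspace (T zero_ordinal). F (tr zero_ordinal l x) = ?f x"
    using extend_function[OF zero_ordinal_le, of ?f] by blast
  then show ?thesis using states_eq by (intro exI[of _ F]) auto
qed

definition cell_fun :: "'i \<Rightarrow> nat \<Rightarrow> 'a \<Rightarrow> real" where
  "cell_fun \<nu> k = (SOME F. continuous_map (T l) unit_interval F \<and>
     (\<forall>x\<in>cylinder (n \<nu>). F (q \<nu> x) = bump (n \<nu>) k x) \<and> (\<forall>x\<in>topspace (T \<nu>). F (tr \<nu> l x) = 0))"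

definition state_fun :: "'a \<Rightarrow> 'a \<Rightarrow> real" where
  "state_fun s = (SOME F. continuous_map (T l) unit_interval F \<and> (\<forall>x\<in>states (X l). F x = (if x = s then 1 else 0)))"

lemma
  assumes "\<nu> < l"
  shows continuous_cell_fun: "continuous_map (T l) unit_interval (cell_fun \<nu> k)"
    and cell_fun_cell: "x \<in> cylinder (n \<nu>) \<Longrightarrow> cell_fun \<nu> k (q \<nu> x) = bump (n \<nu>) k x"
    and cell_fun_lower: "y \<in> topspace (T \<nu>) \<Longrightarrow> cell_fun \<nu> k (tr \<nu> l y) = 0"
  using someI_ex[OF cell_function[OF assms, of k]] unfolding cell_fun_def by blast+

lemma
  shows continuous_state_fun: "continuous_map (T l) unit_interval (state_fun s)"
    and state_fun_state: "x \<in> states (X l) \<Longrightarrow> state_fun s x = (if x = s then 1 else 0)"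
  using someI_ex[OF state_function[of s]] unfolding state_fun_def by blast+

lemma tr_cell_map:
  assumes "\<nu> < \<kappa>" "\<kappa> \<le> l" "x \<in> cylinder (n \<nu>)"
  shows "tr \<kappa> l (cell_map \<kappa> tr h \<nu> x) = q \<nu> x"
proof -
  have \<nu>: "\<nu> < l" using assms by simp
  have "globe_proj x \<in> topspace (globe_topology (disk (n \<nu>)))"
    unfolding topspace_globe_disk using assms(3) by (rule imageI)
  then have "h \<nu> (globe_proj x) \<in> topspace (T (next_ordinal \<nu>))"
    using md_mapD(4)[OF h_md_map[OF \<nu>], of "globe_proj x"] by (simp add: Glob_def del: topspace_globe_topology)
  then show ?thesis
    using tr_tr[OF next_ordinal_le[OF assms(1)] assms(2) order_refl]
    by (simp add: cell_map_def characteristic_map_def)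
qed

lemma lower_stage:
  assumes \<kappa>: "\<kappa> \<le> l"
  shows "tr \<kappa> l ` topspace (T \<kappa>) = states (X l) \<union> (\<Union>\<nu>\<in>{..<\<kappa>}. q \<nu> ` cylinder (n \<nu>))"
proof -
  interpret st: cellular C P \<kappa> X tr n g h by (rule stage[OF \<kappa>])
  have "tr \<kappa> l ` states (X \<kappa>) = states (X l)"
    unfolding states_eq st.states_eq image_image
    using tr_tr[OF zero_ordinal_le \<kappa> order_refl] by (auto simp: image_iff)
  moreover have "tr \<kappa> l ` (cell_map \<kappa> tr h \<nu> ` cylinder (n \<nu>)) = q \<nu> ` cylinder (n \<nu>)" if "\<nu> < \<kappa>" for \<nu>
    unfolding image_image by (rule image_cong) (use tr_cell_map[OF that \<kappa>] in auto)
  ultimately show ?thesis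
    unfolding st.topspace_eq_cells image_Un image_UN by simp
qed

lemma cell_map_ends_states: "\<nu> < l \<Longrightarrow> q \<nu> (z, 0) \<in> states (X l)" "\<nu> < l \<Longrightarrow> q \<nu> (z, 1) \<in> states (X l)"
  using md_mapD(2)[OF char_md_map] by (auto simp: cell_map_ends Glob_def)

lemma cell_map_boundary:
  assumes "\<nu> < l" "z \<in> sphere_set (n \<nu>)" "t \<in> {0..1}"
  shows "q \<nu> (z, t) = tr \<nu> l (g \<nu> (globe_proj (z, t)))" "g \<nu> (globe_proj (z, t)) \<in> topspace (T \<nu>)"
proof -
  have "globe_proj (z, t) \<in> topspace (globe_topology (boundary_sphere (n \<nu>)))"
    unfolding topspace_globe_sphere using assms by blast
  then show "q \<nu> (z, t) = tr \<nu> l (g \<nu> (globe_proj (z, t)))" "g \<nu> (globe_proj (z, t)) \<in> topspace (T \<nu>)"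
    using char_boundary[OF assms(1)] g_in[OF assms(1)] by (simp_all add: cell_map_def)
qed

text \<open>A point that is not a state lies in the interior of the cell whose attachment adds it.\<close>

lemma lower_stage_open_cells:
  "\<kappa> \<le> l \<Longrightarrow> x \<in> tr \<kappa> l ` topspace (T \<kappa>) \<Longrightarrow>
    x \<in> states (X l) \<or> (\<exists>\<nu><\<kappa>. x \<in> q \<nu> ` open_cylinder (n \<nu>))"
proof (induction \<kappa> rule: less_induct)
  case (less \<kappa>)
  show ?case
  proof (cases "x \<in> states (X l)")
    case False
    then obtain \<nu> z t where x: "\<nu> < \<kappa>" "x = q \<nu> (z, t)" "z \<in> disk_set (n \<nu>)" "t \<in> {0..1}"
      using less.prems(2) unfolding lower_stage[OF less.prems(1)] by auto
    have \<nu>: "\<nu> < l" using x(1) less.prems by simp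
    have t: "0 < t" "t < 1" using False x(2,4) cell_map_ends_states[OF \<nu>] by (auto simp: order_less_le)
    show ?thesis
    proof (cases "z \<in> sphere_set (n \<nu>)")
      case True
      then have "x \<in> tr \<nu> l ` topspace (T \<nu>)"
        unfolding x(2) using cell_map_boundary[OF \<nu> True x(4)] by (metis imageI)
      then have "x \<in> states (X l) \<or> (\<exists>\<nu>'<\<nu>. x \<in> q \<nu>' ` open_cylinder (n \<nu>'))"
        using less.IH[OF x(1)] \<nu> by simp
      then show ?thesis using x(1) by (meson less_trans)
    next
      case z: False
      then have "(z, t) \<in> open_cylinder (n \<nu>)" using x t by (auto simp: open_cylinder_def open_disk_def)
      then show ?thesis using x(1,2) by blast
    qed
  qed simp
qed

lemma topspace_open_cells:
  assumes "x \<in> topspace (T l)" "x \<notin> states (X l)"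
  obtains \<nu> p where "\<nu> < l" "p \<in> open_cylinder (n \<nu>)" "x = q \<nu> p"
proof -
  have "x \<in> tr l l ` topspace (T l)" using assms(1) tr_id[of l] by (simp add: image_iff)
  then show ?thesis using lower_stage_open_cells[of l x] assms(2) that by blast
qed

lemma open_cell_separation:
  assumes "\<nu> < l" "p \<in> open_cylinder (n \<nu>)"
    "y \<in> tr \<nu> l ` topspace (T \<nu>) \<or> y \<in> q \<nu> ` open_cylinder (n \<nu>)" "q \<nu> p \<noteq> y"
  shows "\<exists>k<n \<nu> + 2. cell_fun \<nu> k (q \<nu> p) \<noteq> cell_fun \<nu> k y"
  using assms(3)
proof
  assume "y \<in> tr \<nu> l ` topspace (T \<nu>)"
  then have "cell_fun \<nu> 0 y = 0" using cell_fun_lower[OF assms(1)] by auto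
  moreover have "cell_fun \<nu> 0 (q \<nu> p) > 0"
    using cell_fun_cell[OF assms(1) subsetD[OF open_cylinder_subset assms(2)]] bump_0_positive[OF assms(2)] by simp
  ultimately show ?thesis by (intro exI[of _ 0]) auto
next
  assume "y \<in> q \<nu> ` open_cylinder (n \<nu>)"
  then obtain p' where p': "p' \<in> open_cylinder (n \<nu>)" "y = q \<nu> p'" by blast
  then have "p \<noteq> p'" using assms(4) by blast
  then obtain k where k: "k < n \<nu> + 2" "bump (n \<nu>) k p \<noteq> bump (n \<nu>) k p'"
    using bump_injective[OF assms(2) p'(1)] by blast
  have "p \<in> cylinder (n \<nu>)" "p' \<in> cylinder (n \<nu>)" using assms(2) p'(1) open_cylinder_subset by blast+
  then show ?thesis using k cell_fun_cell[OF assms(1)] p'(2) by (intro exI[of _ k]) simp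
qed

lemma open_cell_disjoint_lower:
  assumes "\<nu> < l" "p \<in> open_cylinder (n \<nu>)"
  shows "q \<nu> p \<notin> tr \<nu> l ` topspace (T \<nu>)"
proof
  assume "q \<nu> p \<in> tr \<nu> l ` topspace (T \<nu>)"
  then have "cell_fun \<nu> 0 (q \<nu> p) = 0" using cell_fun_lower[OF assms(1)] by auto
  then show False
    using cell_fun_cell[OF assms(1) subsetD[OF open_cylinder_subset assms(2)]] bump_0_positive[OF assms(2)] by simp
qed

lemma open_cell_not_state: "\<nu> < l \<Longrightarrow> p \<in> open_cylinder (n \<nu>) \<Longrightarrow> q \<nu> p \<notin> states (X l)"
  using open_cell_disjoint_lower[of \<nu> p] lower_stage[of \<nu>] by auto

lemma open_cells_disjoint:
  assumes "\<nu> < l" "\<mu> < l" "p \<in> open_cylinder (n \<nu>)" "p' \<in> open_cylinder (n \<mu>)" "q \<nu> p = q \<mu> p'"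
  shows "\<nu> = \<mu>"
proof -
  have "\<not> \<mu> < \<nu>" if "\<nu> < l" "p \<in> open_cylinder (n \<nu>)" "p' \<in> open_cylinder (n \<mu>)" "q \<nu> p = q \<mu> p'" for \<mu> \<nu> p p'
  proof
    assume "\<mu> < \<nu>"
    have "q \<mu> p' \<in> q \<mu> ` cylinder (n \<mu>)" using that(3) open_cylinder_subset by (intro imageI) blast
    then have "q \<mu> p' \<in> tr \<nu> l ` topspace (T \<nu>)"
      unfolding lower_stage[OF order_less_imp_le[OF that(1)]] using \<open>\<mu> < \<nu>\<close> by blast
    then show False using open_cell_disjoint_lower[OF that(1,2)] that(4) by simp
  qed
  from this[of \<nu> p p' \<mu>] this[of \<mu> p' p \<nu>] assms show ?thesis by (metis linorder_neqE)
qed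

text \<open>Of two points that are not both states, consider one in the cell attached last. The functions of
  this cell vanish on everything attached before and separate the points of the open cell, one of
  them being positive there. The separating function belongs to a closed cell or a state containing
  one of the two points, which is the form needed in \<open>metrizable_by_patches\<close>.\<close>

lemma separation:
  assumes "x \<in> topspace (T l)" "y \<in> topspace (T l)" "x \<noteq> y"
  shows "(\<exists>s\<in>states (X l). (x = s \<or> y = s) \<and> state_fun s x \<noteq> state_fun s y) \<or>
    (\<exists>\<nu><l. \<exists>k<n \<nu> + 2. (x \<in> q \<nu> ` cylinder (n \<nu>) \<or> y \<in> q \<nu> ` cylinder (n \<nu>)) \<and> cell_fun \<nu> k x \<noteq> cell_fun \<nu> k y)"
proof -
  have half: "\<exists>\<nu><l. \<exists>k<n \<nu> + 2. x \<in> q \<nu> ` cylinder (n \<nu>) \<and> cell_fun \<nu> k x \<noteq> cell_fun \<nu> k y"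
    if A: "\<nu> < l" "p \<in> open_cylinder (n \<nu>)" "x = q \<nu> p" "x \<noteq> y"
      "y \<in> states (X l) \<or> (\<exists>\<mu>\<le>\<nu>. y \<in> q \<mu> ` open_cylinder (n \<mu>))" for x y \<nu> p
  proof -
    have sub: "q \<mu> ` open_cylinder (n \<mu>) \<subseteq> q \<mu> ` cylinder (n \<mu>)" for \<mu>
      by (intro image_mono open_cylinder_subset)
    have "y \<in> tr \<nu> l ` topspace (T \<nu>) \<or> y \<in> q \<nu> ` open_cylinder (n \<nu>)"
      using A(5)
    proof
      assume "y \<in> states (X l)"
      then show ?thesis unfolding lower_stage[OF order_less_imp_le[OF A(1)]] by simp
    next
      assume "\<exists>\<mu>\<le>\<nu>. y \<in> q \<mu> ` open_cylinder (n \<mu>)"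
      then obtain \<mu> where \<mu>: "\<mu> \<le> \<nu>" "y \<in> q \<mu> ` open_cylinder (n \<mu>)" by auto
      show ?thesis
      proof (cases "\<mu> = \<nu>")
        case False
        then have "\<mu> \<in> {..<\<nu>}" using \<mu>(1) by simp
        moreover have "y \<in> q \<mu> ` cylinder (n \<mu>)" using \<mu>(2) sub by (rule subsetD[rotated])
        ultimately have "y \<in> (\<Union>\<mu>\<in>{..<\<nu>}. q \<mu> ` cylinder (n \<mu>))" by (rule UN_I)
        then show ?thesis unfolding lower_stage[OF order_less_imp_le[OF A(1)]] by simp
      qed (use \<mu> in simp)
    qed
    then obtain k where "k < n \<nu> + 2" "cell_fun \<nu> k x \<noteq> cell_fun \<nu> k y"
      using open_cell_separation[OF A(1,2)] A(3,4) by blast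
    moreover have "x \<in> q \<nu> ` cylinder (n \<nu>)" using A(2,3) sub by blast
    ultimately show ?thesis using A(1) by blast
  qed
  consider "x \<in> states (X l)" "y \<in> states (X l)"
    | \<nu> p where "\<nu> < l" "p \<in> open_cylinder (n \<nu>)" "x = q \<nu> p" "y \<in> states (X l) \<or> (\<exists>\<mu>\<le>\<nu>. y \<in> q \<mu> ` open_cylinder (n \<mu>))"
    | \<nu> p where "\<nu> < l" "p \<in> open_cylinder (n \<nu>)" "y = q \<nu> p" "x \<in> states (X l) \<or> (\<exists>\<mu>\<le>\<nu>. x \<in> q \<mu> ` open_cylinder (n \<mu>))"
  proof (cases "x \<in> states (X l)"; cases "y \<in> states (X l)")
    assume x: "x \<notin> states (X l)" and y: "y \<notin> states (X l)"
    obtain \<nu> p where 1: "\<nu> < l" "p \<in> open_cylinder (n \<nu>)" "x = q \<nu> p"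
      by (rule topspace_open_cells[OF assms(1) x])
    obtain \<mu> p' where 2: "\<mu> < l" "p' \<in> open_cylinder (n \<mu>)" "y = q \<mu> p'"
      by (rule topspace_open_cells[OF assms(2) y])
    show thesis
    proof (cases "\<mu> \<le> \<nu>")
      case True
      then show thesis using that(2)[OF 1] 2 by blast
    next
      case False
      then have "\<nu> \<le> \<mu>" by simp
      then show thesis using that(3)[OF 2] 1 by blast
    qed
  next
    assume x: "x \<notin> states (X l)" and y: "y \<in> states (X l)"
    obtain \<nu> p where 1: "\<nu> < l" "p \<in> open_cylinder (n \<nu>)" "x = q \<nu> p"
      by (rule topspace_open_cells[OF assms(1) x])
    with y that(2)[of \<nu> p] show thesis by simp
  next
    assume x: "x \<in> states (X l)" and y: "y \<notin> states (X l)"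
    obtain \<nu> p where 1: "\<nu> < l" "p \<in> open_cylinder (n \<nu>)" "y = q \<nu> p"
      by (rule topspace_open_cells[OF assms(2) y])
    with x that(3)[of \<nu> p] show thesis by simp
  qed (rule that(1))
  then show ?thesis
  proof cases
    case 1
    then show ?thesis using state_fun_state[of x x] state_fun_state[of y x] assms(3) by auto
  next
    case (2 \<nu> p)
    then show ?thesis using half[of \<nu> p x y] assms(3) by blast
  next
    case (3 \<nu> p)
    then obtain \<nu> k where "\<nu> < l" "k < n \<nu> + 2" "y \<in> q \<nu> ` cylinder (n \<nu>)" "cell_fun \<nu> k y \<noteq> cell_fun \<nu> k x"
      using half[of \<nu> p y x] assms(3) by blast
    then show ?thesis by metis
  qed
qed

lemma Hausdorff_T: "Hausdorff_space (T l)"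
  unfolding Hausdorff_space_def
proof (intro allI impI)
  fix x y assume "x \<in> topspace (T l) \<and> y \<in> topspace (T l) \<and> x \<noteq> y"
  then have xy: "x \<in> topspace (T l)" "y \<in> topspace (T l)" "x \<noteq> y" by auto
  obtain f where f: "continuous_map (T l) unit_interval f" "f x \<noteq> f y"
    using separation[OF xy] continuous_cell_fun continuous_state_fun by blast
  then have f': "continuous_map (T l) euclideanreal f" by (simp add: continuous_map_in_subtopology)
  obtain U V where UV: "open U" "open V" "f x \<in> U" "f y \<in> V" "U \<inter> V = {}"
    using hausdorff[OF f(2)] by blast
  show "\<exists>U V. openin (T l) U \<and> openin (T l) V \<and> x \<in> U \<and> y \<in> V \<and> disjnt U V"
    using openin_continuous_map_preimage[OF f', of U] openin_continuous_map_preimage[OF f', of V] UV xy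
    by (intro exI[of _ "{a \<in> topspace (T l). f a \<in> U}"] exI[of _ "{a \<in> topspace (T l). f a \<in> V}"])
       (auto simp: disjnt_iff)
qed

end

section \<open>Metrization by locally finite families of functions\<close>

text \<open>The distance is the supremum of \<open>\<bar>f j x - f j y\<bar>\<close> over \<open>j\<close>. Near a point only finitely many of
  these functions matter, so that open sets of the distance are open in \<open>T\<close>. Conversely let \<open>x \<in> U\<close>
  with \<open>U\<close> open in \<open>T\<close>. The last hypothesis confines the ball of radius \<open>1\<close> about \<open>x\<close> to a compact
  set \<open>K\<close>, and the distance from \<open>x\<close> is bounded away from \<open>0\<close> on the compact set \<open>K - U\<close>, which is
  covered by the open complements of the balls of radius \<open>1 / (n + 1)\<close>.\<close>

lemma metrizable_by_functions:
  fixes f :: "'j \<Rightarrow> 'a \<Rightarrow> real"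
  assumes cont: "\<And>j. j \<in> J \<Longrightarrow> continuous_map T unit_interval (f j)"
    and lf: "\<And>x. x \<in> topspace T \<Longrightarrow> \<exists>U. openin T U \<and> x \<in> U \<and> finite {j \<in> J. \<exists>y\<in>U. f j y \<noteq> 0}"
    and sep: "\<And>x y. x \<in> topspace T \<Longrightarrow> y \<in> topspace T \<Longrightarrow> x \<noteq> y \<Longrightarrow> \<exists>j\<in>J. f j x \<noteq> f j y"
    and loc: "\<And>x. x \<in> topspace T \<Longrightarrow>
      \<exists>j\<in>J. \<exists>K. compactin T K \<and> f j x = 1 \<and> (\<forall>y\<in>topspace T. f j y \<noteq> 0 \<longrightarrow> y \<in> K)"
  shows "metrizable_space T"
proof -
  let ?M = "topspace T"
  \<comment> \<open>The element \<open>0\<close> keeps the set nonempty.\<close>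
  define D where "D x y = insert 0 ((\<lambda>j. \<bar>f j x - f j y\<bar>) ` J)" for x y
  define d where "d x y = (if x \<in> ?M \<and> y \<in> ?M then Sup (D x y) else 0)" for x y
  have f01: "0 \<le> f j x \<and> f j x \<le> 1" if "j \<in> J" "x \<in> ?M" for j x
    using continuous_map_image_subset_topspace[OF cont[OF that(1)]] that(2) by (auto simp: image_subset_iff)
  have D1: "c \<le> 1" if "x \<in> ?M" "y \<in> ?M" "c \<in> D x y" for x y c
    using that f01[of _ x] f01[of _ y] by (fastforce simp: D_def abs_le_iff)
  have bdd: "bdd_above (D x y)" if "x \<in> ?M" "y \<in> ?M" for x y
    using D1[OF that] by (rule bdd_aboveI)
  have d_ge: "\<bar>f j x - f j y\<bar> \<le> d x y" if "x \<in> ?M" "y \<in> ?M" "j \<in> J" for x y j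
  proof -
    have "\<bar>f j x - f j y\<bar> \<le> Sup (D x y)"
      by (rule cSup_upper[OF _ bdd[OF that(1,2)]]) (use that(3) in \<open>simp add: D_def\<close>)
    then show ?thesis using that by (simp add: d_def)
  qed
  have d_le: "d x y \<le> c" if "x \<in> ?M" "y \<in> ?M" "0 \<le> c" "\<And>j. j \<in> J \<Longrightarrow> \<bar>f j x - f j y\<bar> \<le> c" for x y c
  proof -
    have "Sup (D x y) \<le> c" by (rule cSup_least) (use that in \<open>auto simp: D_def\<close>)
    then show ?thesis using that by (simp add: d_def)
  qed
  have d_nonneg: "0 \<le> d x y" for x y
  proof (cases "x \<in> ?M \<and> y \<in> ?M")
    case True
    then have "0 \<le> Sup (D x y)"
      by (intro cSup_upper bdd) (auto simp: D_def)
    then show ?thesis by (simp add: d_def)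
  qed (auto simp: d_def)
  interpret Metric_space ?M d
  proof
    show "0 \<le> d x y" for x y by (rule d_nonneg)
    show "d x y = d y x" for x y unfolding d_def D_def by (simp add: abs_minus_commute conj_commute)
    show "d x y = 0 \<longleftrightarrow> x = y" if "x \<in> ?M" "y \<in> ?M" for x y
    proof
      assume "d x y = 0"
      then show "x = y" using sep[OF that] d_ge[OF that] by fastforce
    next
      assume "x = y"
      then show "d x y = 0" using d_le[OF that, of 0] d_nonneg[of x y] by simp
    qed
    show "d x z \<le> d x y + d y z" if "x \<in> ?M" "y \<in> ?M" "z \<in> ?M" for x y z
    proof (rule d_le[OF that(1,3)])
      show "0 \<le> d x y + d y z" using d_nonneg by simp
      show "\<bar>f j x - f j z\<bar> \<le> d x y + d y z" if "j \<in> J" for j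
        using d_ge[OF \<open>x \<in> ?M\<close> \<open>y \<in> ?M\<close> that] d_ge[OF \<open>y \<in> ?M\<close> \<open>z \<in> ?M\<close> that] by linarith
    qed
  qed
  have coarser: "openin T U" if U: "openin mtopology U" for U
  proof (subst openin_subopen, intro ballI)
    fix x assume "x \<in> U"
    then obtain r where r: "r > 0" "mball x r \<subseteq> U" and x: "x \<in> ?M"
      using U unfolding openin_mtopology by blast
    obtain W where W: "openin T W" "x \<in> W" "finite {j \<in> J. \<exists>y\<in>W. f j y \<noteq> 0}"
      using lf[OF x] by blast
    define F where "F = {j \<in> J. \<exists>y\<in>W. f j y \<noteq> 0}"
    define V where "V = W \<inter> ((\<Inter>j\<in>F. {y \<in> ?M. f j y \<in> ball (f j x) (r/2)}) \<inter> ?M)"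
    have "openin T {y \<in> ?M. f j y \<in> ball (f j x) (r/2)}" if "j \<in> F" for j
    proof (rule openin_continuous_map_preimage)
      show "continuous_map T euclideanreal (f j)"
        using cont[of j] that by (simp add: F_def continuous_map_in_subtopology)
    qed simp
    then have "openin T V"
      unfolding V_def using W(1,3) by (intro openin_Int openin_INT) (auto simp: F_def)
    moreover have "x \<in> V" using W(2) x r by (auto simp: V_def)
    moreover have "V \<subseteq> U"
    proof
      fix y assume y: "y \<in> V"
      then have yM: "y \<in> ?M" by (simp add: V_def)
      have "d x y \<le> r / 2"
      proof (rule d_le[OF x yM])
        fix j assume j: "j \<in> J"
        show "\<bar>f j x - f j y\<bar> \<le> r / 2"
        proof (cases "j \<in> F")
          case True
          then show ?thesis using y by (auto simp: V_def dist_real_def)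
        next
          case False
          then have "f j x = 0" "f j y = 0" using j W(2) y by (auto simp: F_def V_def)
          then show ?thesis using r by simp
        qed
      qed (use r in simp)
      then show "y \<in> U" using r x yM by (auto intro!: subsetD[OF r(2)])
    qed
    ultimately show "\<exists>V. openin T V \<and> x \<in> V \<and> V \<subseteq> U" by blast
  qed
  have finer: "openin mtopology U" if U: "openin T U" for U
    unfolding openin_mtopology
  proof (intro conjI allI impI)
    show "U \<subseteq> ?M" by (rule openin_subset[OF U])
    fix x assume xU: "x \<in> U"
    then have x: "x \<in> ?M" using openin_subset[OF U] by auto
    obtain j K where j: "j \<in> J" "compactin T K" "f j x = 1" "\<And>y. y \<in> ?M \<Longrightarrow> f j y \<noteq> 0 \<Longrightarrow> y \<in> K"
      using loc[OF x] by blast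
    have KM: "K \<subseteq> ?M" by (rule compactin_subset_topspace[OF j(2)])
    have "compactin T (K \<inter> (?M - U))"
      using j(2) U by (intro compact_Int_closedin) auto
    then have cK: "compactin T (K - U)" using KM by (simp add: Diff_eq Int_absorb2 inf_assoc[symmetric])
    define A where "A n = ?M - mcball x (1 / real (Suc n))" for n
    have opA: "openin T (A n)" for n
      unfolding A_def by (rule coarser) (use openin_diff[OF openin_topspace closedin_mcball] in auto)
    have "K - U \<subseteq> \<Union>(range A)"
    proof
      fix y assume y: "y \<in> K - U"
      then have yM: "y \<in> ?M" using KM by auto
      have "d x y > 0" using x yM y xU by auto
      then obtain n where "1 / real (Suc n) < d x y" using nat_approx_posE by (metis (no_types))
      then have "y \<in> A n" using yM by (simp add: A_def mcball_def)
      then show "y \<in> \<Union>(range A)" by blast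
    qed
    then have "\<exists>\<F>. finite \<F> \<and> \<F> \<subseteq> range A \<and> K - U \<subseteq> \<Union>\<F>"
      by (rule compactinD[OF cK, rotated]) (elim rangeE, simp only: opA)
    then obtain \<F> where F: "finite \<F>" "\<F> \<subseteq> range A" "K - U \<subseteq> \<Union>\<F>"
      by (elim exE conjE) (rule that)
    then obtain I where I: "finite I" "\<F> = A ` I" using finite_subset_image[OF F(1,2)] by blast
    obtain N where "\<forall>n\<in>I. n \<le> N" using I(1) unfolding finite_nat_set_iff_bounded_le by (rule exE)
    then have N: "\<And>n. n \<in> I \<Longrightarrow> n \<le> N" by simp
    define r where "r = 1 / real (Suc N)"
    have "mball x r \<subseteq> U"
    proof
      fix y assume "y \<in> mball x r"
      then have y: "y \<in> ?M" "d x y < 1 / real (Suc N)" by (auto simp: r_def)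
      moreover have "1 / real (Suc N) \<le> 1" by simp
      ultimately have y1: "d x y < 1" by linarith
      have "f j y \<noteq> 0" using d_ge[OF x y(1) j(1)] y1 j(3) by auto
      then have "y \<in> K" using j(4) y(1) by blast
      show "y \<in> U"
      proof (rule ccontr)
        assume "y \<notin> U"
        then obtain n where n: "n \<in> I" "y \<in> A n" using F(3) I(2) \<open>y \<in> K\<close> by blast
        then have "d x y > 1 / real (Suc n)" using x y(1) by (simp add: A_def mcball_def)
        moreover have "1 / real (Suc N) \<le> 1 / real (Suc n)" using N[OF n(1)] by (simp add: frac_le)
        ultimately show False using y(2) by linarith
      qed
    qed
    moreover have "r > 0" by (simp add: r_def)
    ultimately show "\<exists>r>0. mball x r \<subseteq> U" by blast
  qed
  have "T = mtopology" unfolding topology_eq using coarser finer by blast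
  then show ?thesis unfolding metrizable_space_def using Metric_space_axioms by blast
qed

text \<open>The complement \<open>V j\<close> of the union of the members that miss \<open>K j\<close> is an open neighbourhood of
  \<open>K j\<close>, contained in the union \<open>C j\<close> of the finitely many members that meet \<open>K j\<close>. So \<open>T\<close> is
  locally compact, and there are Urysohn functions \<open>G j\<close> that are \<open>1\<close> on \<open>K j\<close> and vanish off
  \<open>V j\<close>. The functions \<open>G j\<close> and their products with \<open>F j k\<close> for \<open>k < N j\<close> form a locally finite
  family. If \<open>x \<in> K j\<close> and \<open>F j k\<close> separates \<open>x\<close> from \<open>y\<close>, so does \<open>G j\<close> or its product with
  \<open>F j k\<close>.\<close>

lemma metrizable_by_patches:
  fixes K :: "'j \<Rightarrow> 'a set" and F :: "'j \<Rightarrow> nat \<Rightarrow> 'a \<Rightarrow> real"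
  assumes Haus: "Hausdorff_space T"
    and comp: "\<And>j. j \<in> J \<Longrightarrow> compactin T (K j)"
    and star: "\<And>j. j \<in> J \<Longrightarrow> finite {i \<in> J. K i \<inter> K j \<noteq> {}}"
    and clo: "\<And>I. I \<subseteq> J \<Longrightarrow> closedin T (\<Union>i\<in>I. K i)"
    and cover: "topspace T = (\<Union>j\<in>J. K j)"
    and cont: "\<And>j k. j \<in> J \<Longrightarrow> continuous_map T unit_interval (F j k)"
    and sep: "\<And>x y. x \<in> topspace T \<Longrightarrow> y \<in> topspace T \<Longrightarrow> x \<noteq> y \<Longrightarrow>
      \<exists>j\<in>J. \<exists>k<N j. (x \<in> K j \<or> y \<in> K j) \<and> F j k x \<noteq> F j k y"
  shows "metrizable_space T"
proof -
  define V where "V j = topspace T - (\<Union>i\<in>{i \<in> J. K i \<inter> K j = {}}. K i)" for j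
  have opV: "openin T (V j)" for j
    unfolding V_def by (intro openin_diff openin_topspace clo) auto
  have KM: "K j \<subseteq> topspace T" if "j \<in> J" for j using cover that by auto
  have KV: "K j \<subseteq> V j" if "j \<in> J" for j
    using KM[OF that] by (auto simp: V_def)
  have meet: "K i \<inter> K j \<noteq> {}" if "i \<in> J" "V j \<inter> K i \<noteq> {}" for i j
    using that by (auto simp: V_def)
  define C where "C j = (\<Union>i\<in>{i \<in> J. K i \<inter> K j \<noteq> {}}. K i)" for j
  have cC: "compactin T (C j)" if "j \<in> J" for j
    unfolding C_def using star[OF that] comp by (intro compactin_Union) auto
  have VC: "V j \<subseteq> C j" for j using cover by (auto simp: V_def C_def)
  have "locally_compact_space T"
    unfolding locally_compact_space_def
  proof
    fix x assume "x \<in> topspace T"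
    then obtain j where "j \<in> J" "x \<in> K j" using cover by auto
    then show "\<exists>U K. openin T U \<and> compactin T K \<and> x \<in> U \<and> U \<subseteq> K"
      using opV[of j] cC[of j] KV[of j] VC[of j] by blast
  qed
  then have cr: "completely_regular_space T"
    using locally_compact_regular_imp_completely_regular_space Haus by blast
  have "\<exists>g. continuous_map T unit_interval g \<and> (\<forall>x\<in>K j. g x = 1) \<and> (\<forall>x\<in>topspace T. g x \<noteq> 0 \<longrightarrow> x \<in> V j)"
    if j: "j \<in> J" for j
  proof -
    have "closedin T (topspace T - V j)" "disjnt (K j) (topspace T - V j)"
      using opV[of j] KV[OF j] by (auto simp: disjnt_iff)
    then obtain g where "continuous_map T unit_interval g" "g ` (topspace T - V j) \<subseteq> {0}" "g ` K j \<subseteq> {1}"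
      by (rule Urysohn_completely_regular_compact_closed[OF zero_le_one cr comp[OF j]])
    then show ?thesis by (intro exI[of _ g]) blast
  qed
  then obtain G where G: "\<And>j. j \<in> J \<Longrightarrow> continuous_map T unit_interval (G j)"
    "\<And>j x. j \<in> J \<Longrightarrow> x \<in> K j \<Longrightarrow> G j x = 1"
    "\<And>j x. j \<in> J \<Longrightarrow> x \<in> topspace T \<Longrightarrow> G j x \<noteq> 0 \<Longrightarrow> x \<in> V j" by metis
  define f where "f = (\<lambda>(j, k) x. case k of 0 \<Rightarrow> G j x | Suc k \<Rightarrow> G j x * F j k x)"
  define J' where "J' = (SIGMA j:J. {..N j})"
  have f0: "f (j, 0) x = G j x" and fS: "f (j, Suc k) x = G j x * F j k x" for j k x by (auto simp: f_def)
  have fG: "f jk x \<noteq> 0 \<Longrightarrow> G (fst jk) x \<noteq> 0" for jk x by (auto simp: f_def split: prod.splits nat.splits)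
  show ?thesis
  proof (rule metrizable_by_functions[of J' T f])
    fix jk assume "jk \<in> J'"
    then obtain j k where jk: "jk = (j, k)" "j \<in> J" by (auto simp: J'_def)
    show "continuous_map T unit_interval (f jk)"
    proof (cases k)
      case 0
      then show ?thesis using G(1)[OF jk(2)] by (simp add: jk(1) f_def)
    next
      case (Suc k')
      have 1: "continuous_map T euclideanreal (G j)" "\<And>x. x \<in> topspace T \<Longrightarrow> G j x \<in> {0..1}"
        using G(1)[OF jk(2)] by (auto simp: continuous_map_in_subtopology)
      have 2: "continuous_map T euclideanreal (F j k')" "\<And>x. x \<in> topspace T \<Longrightarrow> F j k' x \<in> {0..1}"
        using cont[OF jk(2), of k'] by (auto simp: continuous_map_in_subtopology)
      have "continuous_map T unit_interval (\<lambda>x. G j x * F j k' x)"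
        unfolding continuous_map_in_subtopology using 1 2
        by (auto intro!: continuous_map_real_mult mult_le_one)
      then show ?thesis by (simp add: jk(1) f_def Suc)
    qed
  next
    fix x assume "x \<in> topspace T"
    then obtain i where i: "i \<in> J" "x \<in> K i" using cover by auto
    let ?A = "{j \<in> J. \<exists>m\<in>{m \<in> J. K m \<inter> K i \<noteq> {}}. K j \<inter> K m \<noteq> {}}"
    have "?A = (\<Union>m\<in>{m \<in> J. K m \<inter> K i \<noteq> {}}. {j \<in> J. K j \<inter> K m \<noteq> {}})" by auto
    then have finA: "finite ?A" using star i(1) by auto
    have "{jk \<in> J'. \<exists>y\<in>V i. f jk y \<noteq> 0} \<subseteq> (SIGMA j:?A. {..N j})"
    proof
      fix jk assume "jk \<in> {jk \<in> J'. \<exists>y\<in>V i. f jk y \<noteq> 0}"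
      then obtain j k y where y: "jk = (j, k)" "j \<in> J" "k \<le> N j" "y \<in> V i" "f jk y \<noteq> 0"
        by (auto simp: J'_def)
      have yM: "y \<in> topspace T" using y(4) by (simp add: V_def)
      then obtain m where m: "m \<in> J" "y \<in> K m" using cover by auto
      have "y \<in> V j" using G(3)[OF y(2) yM] fG[OF y(5)] y(1) by simp
      then have "K m \<inter> K i \<noteq> {}" "K m \<inter> K j \<noteq> {}" using meet[OF m(1)] y(4) m(2) by blast+
      then show "jk \<in> (SIGMA j:?A. {..N j})" using y m by auto
    qed
    then have "finite {jk \<in> J'. \<exists>y\<in>V i. f jk y \<noteq> 0}"
      by (rule finite_subset) (use finA in auto)
    then show "\<exists>U. openin T U \<and> x \<in> U \<and> finite {j \<in> J'. \<exists>y\<in>U. f j y \<noteq> 0}"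
      using opV[of i] KV[OF i(1)] i(2) by blast
  next
    have half: "\<exists>j\<in>J'. f j x \<noteq> f j y" if "j \<in> J" "k < N j" "x \<in> K j" "F j k x \<noteq> F j k y" for x y j k
    proof (cases "G j y = 1")
      case True
      then have "f (j, Suc k) x \<noteq> f (j, Suc k) y" using G(2)[OF that(1,3)] that(4) by (simp add: fS)
      then show ?thesis using that(1,2) by (intro bexI[of _ "(j, Suc k)"]) (auto simp: J'_def)
    next
      case False
      then have "f (j, 0) x \<noteq> f (j, 0) y" using G(2)[OF that(1,3)] by (simp add: f0)
      then show ?thesis using that(1) by (intro bexI[of _ "(j, 0)"]) (auto simp: J'_def)
    qed
    fix x y assume "x \<in> topspace T" "y \<in> topspace T" "x \<noteq> y"
    then obtain j k where j: "j \<in> J" "k < N j" "x \<in> K j \<or> y \<in> K j" "F j k x \<noteq> F j k y"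
      using sep by blast
    then show "\<exists>j\<in>J'. f j x \<noteq> f j y"
      using half[of j k x y] half[of j k y x] by metis
  next
    fix x assume "x \<in> topspace T"
    then obtain i where i: "i \<in> J" "x \<in> K i" using cover by auto
    have "(i, 0) \<in> J'" using i(1) by (auto simp: J'_def)
    moreover have "f (i, 0) x = 1" using G(2)[OF i] by (simp add: f0)
    moreover have "\<forall>y\<in>topspace T. f (i, 0) y \<noteq> 0 \<longrightarrow> y \<in> C i" using G(3)[OF i(1)] VC by (auto simp: f0)
    ultimately show "\<exists>j\<in>J'. \<exists>K. compactin T K \<and> f j x = 1 \<and> (\<forall>y\<in>topspace T. f j y \<noteq> 0 \<longrightarrow> y \<in> K)"
      using cC[OF i(1)] by blast
  qed
qed

section \<open>Locally finite cellular spaces are metrizable\<close>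

context cellular
begin

lemma compactin_cell: "\<nu> < l \<Longrightarrow> compactin (T l) (q \<nu> ` cylinder (n \<nu>))"
  by (rule image_compactin[OF _ continuous_cell_map])
     (simp_all add: compactin_subtopology compact_Times compact_disk_set)

text \<open>As in a CW complex: \<open>W\<close> lifts to a set in the image of the attaching map, of which every subset
  meets each closed cell of the stage \<open>X \<nu>\<close> in finitely many points and is therefore closed. An
  infinite set of this kind has no accumulation point, whereas the image of the attaching map is
  compact.\<close>

lemma finite_attaching:
  assumes \<nu>: "\<nu> < l" and W: "W \<subseteq> q \<nu> ` (sphere_set (n \<nu>) \<times> {0..1})"
    and fin: "\<And>\<mu>. \<mu> < \<nu> \<Longrightarrow> finite (W \<inter> q \<mu> ` cylinder (n \<mu>))"
  shows "finite W"
proof (rule ccontr)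
  assume inf: "infinite W"
  interpret st: cellular C P \<nu> X tr n g h by (rule stage) (use \<nu> in simp)
  let ?G = "\<lambda>p. g \<nu> (globe_proj p)"
  let ?S = "sphere_set (n \<nu>) \<times> {0..1::real}"
  have b: "q \<nu> p = tr \<nu> l (?G p)" "?G p \<in> topspace (T \<nu>)" if "p \<in> ?S" for p
    using cell_map_boundary[OF \<nu>, of "fst p" "snd p"] that by auto
  have "\<forall>w\<in>W. \<exists>p\<in>?S. w = tr \<nu> l (?G p)" using W b(1) by blast
  then obtain p where p: "\<And>w. w \<in> W \<Longrightarrow> p w \<in> ?S \<and> w = tr \<nu> l (?G (p w))" by metis
  define y where "y w = ?G (p w)" for w
  have y: "tr \<nu> l (y w) = w" "y w \<in> topspace (T \<nu>)" "y w \<in> ?G ` ?S" if "w \<in> W" for w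
    using p[OF that] b(2) by (auto simp: y_def)
  have "inj_on y W" by (rule inj_on_inverseI[of _ "tr \<nu> l"]) (rule y(1))
  then have infY: "infinite (y ` W)" using inf finite_imageD by blast
  have "continuous_map (globe_topology (boundary_sphere (n \<nu>))) (T \<nu>) (g \<nu>)"
    using md_mapD(1)[OF g_md_map[OF \<nu>]] by (simp add: Glob_def)
  then have "continuous_map (top_of_set ?S) (T \<nu>) ?G"
    unfolding boundary_sphere_eq continuous_map_from_globe[OF locally_path_connected_sphere_set]
    by (simp add: o_def)
  then have comp: "compactin (T \<nu>) (?G ` ?S)"
    by (rule image_compactin[rotated]) (simp add: compactin_subtopology compact_Times compact_sphere_set)
  have closed: "closedin (T \<nu>) B" if B: "B \<subseteq> y ` W" for B
  proof -
    have BT: "B \<subseteq> topspace (T \<nu>)" using B y(2) by blast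
    have "openin (top_of_set (cylinder (n \<mu>))) {x \<in> cylinder (n \<mu>). st.q \<mu> x \<in> topspace (T \<nu>) - B}"
      if \<mu>: "\<mu> < \<nu>" for \<mu>
    proof -
      let ?B = "B \<inter> st.q \<mu> ` cylinder (n \<mu>)"
      have "tr \<nu> l ` ?B \<subseteq> W \<inter> q \<mu> ` cylinder (n \<mu>)"
        using B y(1) tr_cell_map[OF \<mu>] \<nu> by fastforce
      then have "finite (tr \<nu> l ` ?B)" using fin[OF \<mu>] finite_subset by blast
      moreover have "inj_on (tr \<nu> l) ?B"
      proof (rule inj_on_subset)
        show "inj_on (tr \<nu> l) (y ` W)" by (rule inj_onI) (use y(1) in auto)
        show "?B \<subseteq> y ` W" using B by blast
      qed
      ultimately have "finite ?B" using finite_imageD by blast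
      then have "closedin (T \<nu>) ?B"
        using st.Hausdorff_T BT by (intro closedin_Hausdorff_finite) auto
      then have "openin (T \<nu>) (topspace (T \<nu>) - ?B)" by blast
      then have "openin (top_of_set (cylinder (n \<mu>)))
          {x \<in> topspace (top_of_set (cylinder (n \<mu>))). st.q \<mu> x \<in> topspace (T \<nu>) - ?B}"
        by (rule openin_continuous_map_preimage[OF st.continuous_cell_map[OF \<mu>]])
      moreover have "{x \<in> topspace (top_of_set (cylinder (n \<mu>))). st.q \<mu> x \<in> topspace (T \<nu>) - ?B} =
          {x \<in> cylinder (n \<mu>). st.q \<mu> x \<in> topspace (T \<nu>) - B}" by auto
      ultimately show ?thesis by simp
    qed
    then have "openin (T \<nu>) (topspace (T \<nu>) - B)"
      unfolding st.openin_iff_cells by blast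
    then show ?thesis using BT by (simp add: closedin_def)
  qed
  obtain x where x: "x \<in> T \<nu> derived_set_of (y ` W)"
    using compactin_imp_Bolzano_Weierstrass[OF comp, of "y ` W"] infY y(3) by blast
  define Z where "Z = topspace (T \<nu>) - (y ` W - {x})"
  have "openin (T \<nu>) Z" unfolding Z_def using closed[of "y ` W - {x}"] by blast
  moreover have "x \<in> Z" using x by (simp add: derived_set_of_def Z_def)
  ultimately obtain y' where "y' \<noteq> x" "y' \<in> y ` W" "y' \<in> Z"
    using x unfolding derived_set_of_def mem_Collect_eq by meson
  then show False unfolding Z_def by blast
qed

lemma closed_cell_decompose:
  assumes "\<nu> < l"
  shows "q \<nu> ` cylinder (n \<nu>) \<subseteq> q \<nu> ` open_cylinder (n \<nu>) \<union> q \<nu> ` (sphere_set (n \<nu>) \<times> {0..1}) \<union>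
    {characteristic_map l tr h \<nu> Src, characteristic_map l tr h \<nu> Tgt}"
proof
  fix x assume "x \<in> q \<nu> ` cylinder (n \<nu>)"
  then obtain z t where x: "x = q \<nu> (z, t)" "z \<in> disk_set (n \<nu>)" "0 \<le> t" "t \<le> 1" by auto
  consider "t = 0" | "t = 1" | "z \<in> sphere_set (n \<nu>)" | "(z, t) \<in> open_cylinder (n \<nu>)"
    using x by (auto simp: open_cylinder_def open_disk_def order_less_le)
  then show "x \<in> q \<nu> ` open_cylinder (n \<nu>) \<union> q \<nu> ` (sphere_set (n \<nu>) \<times> {0..1}) \<union>
    {characteristic_map l tr h \<nu> Src, characteristic_map l tr h \<nu> Tgt}"
  proof cases
    case 3
    then have "x \<in> q \<nu> ` (sphere_set (n \<nu>) \<times> {0..1})" unfolding x(1) using x(3,4) by (intro imageI) auto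
    then show ?thesis by blast
  next
    case 4
    then show ?thesis unfolding x(1) by blast
  qed (simp_all add: x(1) cell_map_ends)
qed

text \<open>Induction on the cell. The lemma \<open>finite_attaching\<close> applies to the states in the boundary of the cell, and to a
  set formed by one boundary point from each of the open cells that meet the boundary.\<close>

lemma closure_finite:
  "\<nu> < l \<Longrightarrow> finite {\<mu>. \<mu> < l \<and> q \<mu> ` open_cylinder (n \<mu>) \<inter> q \<nu> ` cylinder (n \<nu>) \<noteq> {}} \<and>
     finite (states (X l) \<inter> q \<nu> ` cylinder (n \<nu>))"
proof (induction \<nu> rule: less_induct)
  case (less \<nu>)
  let ?B = "q \<nu> ` (sphere_set (n \<nu>) \<times> {0..1})"
  let ?E = "{characteristic_map l tr h \<nu> Src, characteristic_map l tr h \<nu> Tgt}"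
  note dec = closed_cell_decompose[OF less.prems]
  have IH: "finite {\<mu>. \<mu> < l \<and> q \<mu> ` open_cylinder (n \<mu>) \<inter> q \<kappa> ` cylinder (n \<kappa>) \<noteq> {}}"
    "finite (states (X l) \<inter> q \<kappa> ` cylinder (n \<kappa>))" if "\<kappa> < \<nu>" for \<kappa>
    using less.IH[OF that] that less.prems by auto
  have "finite (states (X l) \<inter> ?B)"
    by (rule finite_attaching[OF less.prems]) (use IH(2) in \<open>auto intro: finite_subset[rotated]\<close>)
  moreover have "states (X l) \<inter> q \<nu> ` open_cylinder (n \<nu>) = {}"
    using open_cell_not_state[OF less.prems] by auto
  then have "states (X l) \<inter> q \<nu> ` cylinder (n \<nu>) \<subseteq> (states (X l) \<inter> ?B) \<union> ?E"
    using dec by blast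
  ultimately have 1: "finite (states (X l) \<inter> q \<nu> ` cylinder (n \<nu>))"
    using finite_subset by (metis finite.emptyI finite.insertI finite_UnI)
  define M where "M = {\<mu>. \<mu> < l \<and> q \<mu> ` open_cylinder (n \<mu>) \<inter> ?B \<noteq> {}}"
  have "\<forall>\<mu>\<in>M. \<exists>w. w \<in> q \<mu> ` open_cylinder (n \<mu>) \<inter> ?B" by (auto simp: M_def)
  then obtain w where w: "\<And>\<mu>. \<mu> \<in> M \<Longrightarrow> w \<mu> \<in> q \<mu> ` open_cylinder (n \<mu>) \<and> w \<mu> \<in> ?B" by (metis IntE)
  have disj: "\<mu> = \<mu>'" if "\<mu> < l" "\<mu>' < l" "x \<in> q \<mu> ` open_cylinder (n \<mu>)" "x \<in> q \<mu>' ` open_cylinder (n \<mu>')" for \<mu> \<mu>' x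
    using that open_cells_disjoint[of \<mu> \<mu>'] by auto
  have Ml: "\<mu> < l" if "\<mu> \<in> M" for \<mu> using that by (simp add: M_def)
  have inj: "inj_on w M" using w disj Ml by (metis inj_onI)
  have "finite (w ` M)"
  proof (rule finite_attaching[OF less.prems])
    show "w ` M \<subseteq> ?B" using w by blast
    fix \<kappa> assume \<kappa>: "\<kappa> < \<nu>"
    have "w ` M \<inter> q \<kappa> ` cylinder (n \<kappa>) \<subseteq>
        w ` {\<mu>. \<mu> < l \<and> q \<mu> ` open_cylinder (n \<mu>) \<inter> q \<kappa> ` cylinder (n \<kappa>) \<noteq> {}}"
      using w Ml by blast
    then show "finite (w ` M \<inter> q \<kappa> ` cylinder (n \<kappa>))"
      using IH(1)[OF \<kappa>] by (rule finite_subset[OF _ finite_imageI])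
  qed
  then have finM: "finite M" using inj finite_imageD by blast
  have "{\<mu>. \<mu> < l \<and> q \<mu> ` open_cylinder (n \<mu>) \<inter> q \<nu> ` cylinder (n \<nu>) \<noteq> {}} \<subseteq> insert \<nu> M"
  proof
    fix \<mu> assume "\<mu> \<in> {\<mu>. \<mu> < l \<and> q \<mu> ` open_cylinder (n \<mu>) \<inter> q \<nu> ` cylinder (n \<nu>) \<noteq> {}}"
    then obtain x where x: "\<mu> < l" "x \<in> q \<mu> ` open_cylinder (n \<mu>)" "x \<in> q \<nu> ` cylinder (n \<nu>)" by auto
    have "?E \<subseteq> states (X l)" using md_mapD(2)[OF char_md_map[OF less.prems]] by (auto simp: Glob_def)
    moreover obtain p where "p \<in> open_cylinder (n \<mu>)" "x = q \<mu> p" using x(2) by (elim imageE) (rule that)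
    then have "x \<notin> states (X l)" using open_cell_not_state[OF x(1)] by simp
    ultimately have "x \<notin> ?E" by blast
    then have "x \<in> q \<nu> ` open_cylinder (n \<nu>) \<or> x \<in> ?B" using subsetD[OF dec x(3)] by blast
    then show "\<mu> \<in> insert \<nu> M"
    proof
      assume "x \<in> q \<nu> ` open_cylinder (n \<nu>)"
      then show ?thesis using disj[OF x(1) less.prems x(2)] by simp
    next
      assume "x \<in> ?B"
      then have "\<mu> \<in> M" unfolding M_def using x(1,2) by blast
      then show ?thesis by simp
    qed
  qed
  then have "finite {\<mu>. \<mu> < l \<and> q \<mu> ` open_cylinder (n \<mu>) \<inter> q \<nu> ` cylinder (n \<nu>) \<noteq> {}}"
    by (rule finite_subset) (simp add: finM)
  then show ?case using 1 by (rule conjI)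
qed

lemma closed_globular_cell_eq: "closed_globular_cell l tr n h \<nu> = q \<nu> ` cylinder (n \<nu>)"
  unfolding closed_globular_cell_def cell_map_def topspace_globe_disk by (simp add: image_comp)

lemma globular_cell_eq: "globular_cell l tr n h \<nu> = q \<nu> ` open_cylinder (n \<nu>)"
proof -
  have "globe_proj ` cylinder (n \<nu>) - ({Src, Tgt} \<union> globe_proj ` (sphere_set (n \<nu>) \<times> {0..1})) =
     globe_proj ` open_cylinder (n \<nu>)"
    by (auto simp: globe_proj_def open_cylinder_def open_disk_def image_iff split: if_splits)
  then show ?thesis
    unfolding globular_cell_def cell_map_def topspace_globe_disk topspace_globe_sphere
    by (simp add: image_comp)
qed

end

locale locally_finite_cellular = cellular C P l X tr n g h
  for C P and l :: "'i::wellorder" and X :: "'i \<Rightarrow> 'a mdspace" and tr n g h +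
  assumes locally_finite: "locally_finite_cells l X tr n h"
begin

text \<open>The compact pieces to which \<open>metrizable_by_patches\<close> is applied. States are pieces in their own
  right as they need not lie in any closed cell.\<close>

definition patch :: "'i + 'a \<Rightarrow> 'a set" where
  "patch j = (case j of Inl \<nu> \<Rightarrow> q \<nu> ` cylinder (n \<nu>) | Inr s \<Rightarrow> {s})"

definition patch_index :: "('i + 'a) set" where
  "patch_index = Inl ` {..<l} \<union> Inr ` states (X l)"

lemma patch_simps [simp]: "patch (Inl \<nu>) = q \<nu> ` cylinder (n \<nu>)" "patch (Inr s) = {s}"
  by (auto simp: patch_def)

lemma finite_cells_open: "\<nu> < l \<Longrightarrow> finite {\<mu>. \<mu> < l \<and> q \<mu> ` cylinder (n \<mu>) \<inter> q \<nu> ` open_cylinder (n \<nu>) \<noteq> {}}"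
  and finite_cells_state: "s \<in> states (X l) \<Longrightarrow> finite {\<mu>. \<mu> < l \<and> s \<in> q \<mu> ` cylinder (n \<mu>)}"
  using locally_finite unfolding locally_finite_cells_def closed_globular_cell_eq globular_cell_eq by auto

lemma cell_in_topspace: "\<nu> < l \<Longrightarrow> q \<nu> ` cylinder (n \<nu>) \<subseteq> topspace (T l)"
  using cell_map_in by auto

text \<open>Local finiteness is about closed cells meeting an open cell or containing a state; a closed cell is
  covered by finitely many of these.\<close>

lemma finite_cells_cell:
  assumes \<nu>: "\<nu> < l"
  shows "finite {\<mu>. \<mu> < l \<and> q \<mu> ` cylinder (n \<mu>) \<inter> q \<nu> ` cylinder (n \<nu>) \<noteq> {}}"
proof (rule finite_subset)
  let ?A = "{\<kappa>. \<kappa> < l \<and> q \<kappa> ` open_cylinder (n \<kappa>) \<inter> q \<nu> ` cylinder (n \<nu>) \<noteq> {}}"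
  let ?S = "states (X l) \<inter> q \<nu> ` cylinder (n \<nu>)"
  let ?R = "(\<Union>\<kappa>\<in>?A. {\<mu>. \<mu> < l \<and> q \<mu> ` cylinder (n \<mu>) \<inter> q \<kappa> ` open_cylinder (n \<kappa>) \<noteq> {}}) \<union>
    (\<Union>s\<in>?S. {\<mu>. \<mu> < l \<and> s \<in> q \<mu> ` cylinder (n \<mu>)})"
  show "finite ?R"
    using closure_finite[OF \<nu>] finite_cells_open finite_cells_state by auto
  show "{\<mu>. \<mu> < l \<and> q \<mu> ` cylinder (n \<mu>) \<inter> q \<nu> ` cylinder (n \<nu>) \<noteq> {}} \<subseteq> ?R"
  proof
    fix \<mu> assume "\<mu> \<in> {\<mu>. \<mu> < l \<and> q \<mu> ` cylinder (n \<mu>) \<inter> q \<nu> ` cylinder (n \<nu>) \<noteq> {}}"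
    then obtain x where x: "\<mu> < l" "x \<in> q \<mu> ` cylinder (n \<mu>)" "x \<in> q \<nu> ` cylinder (n \<nu>)" by auto
    show "\<mu> \<in> ?R"
    proof (cases "x \<in> states (X l)")
      case True
      then show ?thesis using x by blast
    next
      case False
      have "x \<in> topspace (T l)" using x(3) cell_in_topspace[OF \<nu>] by auto
      then obtain \<kappa> p where "\<kappa> < l" "p \<in> open_cylinder (n \<kappa>)" "x = q \<kappa> p"
        using topspace_open_cells False by metis
      then have "\<kappa> \<in> ?A" "q \<mu> ` cylinder (n \<mu>) \<inter> q \<kappa> ` open_cylinder (n \<kappa>) \<noteq> {}" using x by blast+
      then show ?thesis using x(1) by blast
    qed
  qed
qed

lemma finite_patch_star:
  assumes "j \<in> patch_index"
  shows "finite {i \<in> patch_index. patch i \<inter> patch j \<noteq> {}}"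
proof (cases j)
  case (Inl \<nu>)
  then have \<nu>: "\<nu> < l" using assms by (auto simp: patch_index_def)
  have "{i \<in> patch_index. patch i \<inter> patch j \<noteq> {}} \<subseteq>
      Inl ` {\<mu>. \<mu> < l \<and> q \<mu> ` cylinder (n \<mu>) \<inter> q \<nu> ` cylinder (n \<nu>) \<noteq> {}} \<union> Inr ` (states (X l) \<inter> q \<nu> ` cylinder (n \<nu>))"
  proof
    fix i assume i: "i \<in> {i \<in> patch_index. patch i \<inter> patch j \<noteq> {}}"
    then have i': "i \<in> patch_index" "patch i \<inter> q \<nu> ` cylinder (n \<nu>) \<noteq> {}" using Inl by simp_all
    show "i \<in> Inl ` {\<mu>. \<mu> < l \<and> q \<mu> ` cylinder (n \<mu>) \<inter> q \<nu> ` cylinder (n \<nu>) \<noteq> {}} \<union> Inr ` (states (X l) \<inter> q \<nu> ` cylinder (n \<nu>))"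
    proof (cases i)
      case (Inl \<mu>)
      then have "\<mu> < l" using i'(1) by (auto simp: patch_index_def)
      then show ?thesis using i'(2) unfolding Inl patch_simps by blast
    next
      case (Inr s)
      then have "s \<in> states (X l)" using i'(1) by (auto simp: patch_index_def)
      then show ?thesis using i'(2) unfolding Inr patch_simps by blast
    qed
  qed
  then show ?thesis
    by (rule finite_subset) (use finite_cells_cell[OF \<nu>] closure_finite[OF \<nu>] in auto)
next
  case (Inr s)
  then have s: "s \<in> states (X l)" using assms by (auto simp: patch_index_def)
  have "{i \<in> patch_index. patch i \<inter> patch j \<noteq> {}} \<subseteq> Inl ` {\<mu>. \<mu> < l \<and> s \<in> q \<mu> ` cylinder (n \<mu>)} \<union> {Inr s}"
    using Inr by (auto simp: patch_index_def)
  then show ?thesis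
    by (rule finite_subset) (use finite_cells_state[OF s] in auto)
qed

lemma compactin_patch: "j \<in> patch_index \<Longrightarrow> compactin (T l) (patch j)"
  using compactin_cell multipointedD(2)[OF X_multipointed[of l]] by (auto simp: patch_index_def)

lemma closedin_patch: "j \<in> patch_index \<Longrightarrow> closedin (T l) (patch j)"
  using compactin_imp_closedin[OF Hausdorff_T compactin_patch] .

text \<open>Being closed is tested on the closed cells, each of which meets only finitely many of the pieces.\<close>

lemma closedin_patches:
  assumes I: "I \<subseteq> patch_index"
  shows "closedin (T l) (\<Union>i\<in>I. patch i)"
proof -
  have sub: "(\<Union>i\<in>I. patch i) \<subseteq> topspace (T l)"
    using I compactin_patch compactin_subset_topspace by blast
  have "openin (top_of_set (cylinder (n \<nu>))) {x \<in> cylinder (n \<nu>). q \<nu> x \<in> topspace (T l) - (\<Union>i\<in>I. patch i)}"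
    if \<nu>: "\<nu> < l" for \<nu>
  proof -
    let ?I = "{i \<in> I. patch i \<inter> patch (Inl \<nu>) \<noteq> {}}"
    have "Inl \<nu> \<in> patch_index" using \<nu> by (auto simp: patch_index_def)
    then have "finite {i \<in> patch_index. patch i \<inter> patch (Inl \<nu>) \<noteq> {}}" by (rule finite_patch_star)
    moreover have "?I \<subseteq> {i \<in> patch_index. patch i \<inter> patch (Inl \<nu>) \<noteq> {}}" using I by blast
    ultimately have "finite ?I" by (rule finite_subset[rotated])
    then have "closedin (T l) (\<Union>i\<in>?I. patch i)"
      using closedin_patch I by (intro closedin_Union) auto
    then have "openin (T l) (topspace (T l) - (\<Union>i\<in>?I. patch i))" by blast
    then have "openin (top_of_set (cylinder (n \<nu>)))
       {x \<in> topspace (top_of_set (cylinder (n \<nu>))). q \<nu> x \<in> topspace (T l) - (\<Union>i\<in>?I. patch i)}"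
      by (rule openin_continuous_map_preimage[OF continuous_cell_map[OF \<nu>]])
    moreover have "{x \<in> topspace (top_of_set (cylinder (n \<nu>))). q \<nu> x \<in> topspace (T l) - (\<Union>i\<in>?I. patch i)} =
        {x \<in> cylinder (n \<nu>). q \<nu> x \<in> topspace (T l) - (\<Union>i\<in>I. patch i)}"
    proof -
      have "q \<nu> x \<in> (\<Union>i\<in>?I. patch i) \<longleftrightarrow> q \<nu> x \<in> (\<Union>i\<in>I. patch i)" if "x \<in> cylinder (n \<nu>)" for x
        using imageI[OF that, of "q \<nu>"] unfolding patch_simps by blast
      then show ?thesis unfolding topspace_euclidean_subtopology by blast
    qed
    ultimately show ?thesis by simp
  qed
  then have "openin (T l) (topspace (T l) - (\<Union>i\<in>I. patch i))"
    unfolding openin_iff_cells by blast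
  then show ?thesis using sub by (simp add: closedin_def)
qed

lemma topspace_patches: "topspace (T l) = (\<Union>j\<in>patch_index. patch j)"
  unfolding topspace_eq_cells patch_index_def by (auto simp: image_iff)

theorem metrizable_T: "metrizable_space (T l)"
proof (rule metrizable_by_patches[of "T l" patch_index patch
      "\<lambda>j k. case j of Inl \<nu> \<Rightarrow> cell_fun \<nu> k | Inr s \<Rightarrow> state_fun s" "\<lambda>j. case j of Inl \<nu> \<Rightarrow> n \<nu> + 2 | Inr s \<Rightarrow> 1"])
  show "continuous_map (T l) unit_interval (case j of Inl \<nu> \<Rightarrow> cell_fun \<nu> k | Inr s \<Rightarrow> state_fun s)"
    if "j \<in> patch_index" for j k
    using that continuous_cell_fun continuous_state_fun by (auto simp: patch_index_def)
  fix x y assume xy: "x \<in> topspace (T l)" "y \<in> topspace (T l)" "x \<noteq> y"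
  from separation[OF xy]
  show "\<exists>j\<in>patch_index. \<exists>k<(case j of Inl \<nu> \<Rightarrow> n \<nu> + 2 | Inr s \<Rightarrow> 1). (x \<in> patch j \<or> y \<in> patch j) \<and>
     (case j of Inl \<nu> \<Rightarrow> cell_fun \<nu> k | Inr s \<Rightarrow> state_fun s) x \<noteq>
     (case j of Inl \<nu> \<Rightarrow> cell_fun \<nu> k | Inr s \<Rightarrow> state_fun s) y"
  proof
    assume "\<exists>s\<in>states (X l). (x = s \<or> y = s) \<and> state_fun s x \<noteq> state_fun s y"
    then obtain s where "s \<in> states (X l)" "x = s \<or> y = s" "state_fun s x \<noteq> state_fun s y" by blast
    then show ?thesis by (intro bexI[of _ "Inr s"] exI[of _ 0]) (auto simp: patch_index_def)
  next
    assume "\<exists>\<nu><l. \<exists>k<n \<nu> + 2. (x \<in> q \<nu> ` cylinder (n \<nu>) \<or> y \<in> q \<nu> ` cylinder (n \<nu>)) \<and> cell_fun \<nu> k x \<noteq> cell_fun \<nu> k y"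
    then obtain \<nu> k where "\<nu> < l" "k < n \<nu> + 2"
      "x \<in> q \<nu> ` cylinder (n \<nu>) \<or> y \<in> q \<nu> ` cylinder (n \<nu>)" "cell_fun \<nu> k x \<noteq> cell_fun \<nu> k y" by blast
    then show ?thesis by (intro bexI[of _ "Inl \<nu>"] exI[of _ k]) (simp_all add: patch_index_def)
  qed
qed (use Hausdorff_T compactin_patch finite_patch_star closedin_patches topspace_patches in auto)

lemma compact_nbhd_finite_cells:
  assumes "compactin (T l) K"
  shows "\<exists>W. openin (T l) W \<and> K \<subseteq> W \<and> finite {\<nu>. \<nu> < l \<and> q \<nu> ` cylinder (n \<nu>) \<inter> W \<noteq> {}}"
proof -
  define V where "V j = topspace (T l) - (\<Union>i\<in>{i \<in> patch_index. patch i \<inter> patch j = {}}. patch i)" for j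
  have opV: "openin (T l) (V j)" for j
    unfolding V_def by (intro openin_diff openin_topspace closedin_patches) auto
  have finV: "finite {\<nu>. \<nu> < l \<and> q \<nu> ` cylinder (n \<nu>) \<inter> V j \<noteq> {}}" if "j \<in> patch_index" for j
  proof -
    have "Inl ` {\<nu>. \<nu> < l \<and> q \<nu> ` cylinder (n \<nu>) \<inter> V j \<noteq> {}} \<subseteq> {i \<in> patch_index. patch i \<inter> patch j \<noteq> {}}"
    proof clarify
      fix \<nu> assume \<nu>: "\<nu> < l" "q \<nu> ` cylinder (n \<nu>) \<inter> V j \<noteq> {}"
      then have "Inl \<nu> \<in> patch_index" by (simp add: patch_index_def)
      moreover have "patch (Inl \<nu>) \<inter> patch j \<noteq> {}"
      proof
        assume "patch (Inl \<nu>) \<inter> patch j = {}"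
        then have "V j \<inter> patch (Inl \<nu>) = {}" using calculation unfolding V_def by blast
        then show False using \<nu>(2) unfolding patch_simps by blast
      qed
      ultimately show "Inl \<nu> \<in> patch_index \<and> patch (Inl \<nu>) \<inter> patch j \<noteq> {}" by blast
    qed
    then have "finite (Inl ` {\<nu>. \<nu> < l \<and> q \<nu> ` cylinder (n \<nu>) \<inter> V j \<noteq> {}} :: ('i + 'a) set)"
      using finite_patch_star[OF that] by (rule finite_subset)
    then show ?thesis by (rule finite_imageD) auto
  qed
  have "K \<subseteq> \<Union>(V ` patch_index)"
  proof
    fix x assume "x \<in> K"
    then have "x \<in> topspace (T l)" using compactin_subset_topspace[OF assms] by auto
    then obtain j where "j \<in> patch_index" "x \<in> patch j" unfolding topspace_patches by blast
    then show "x \<in> \<Union>(V ` patch_index)"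
      using \<open>x \<in> topspace (T l)\<close> unfolding V_def by blast
  qed
  then obtain \<F> where F: "finite \<F>" "\<F> \<subseteq> V ` patch_index" "K \<subseteq> \<Union>\<F>"
    using compactinD[OF assms, of "V ` patch_index"] opV by blast
  then obtain I where I: "finite I" "I \<subseteq> patch_index" "\<F> = V ` I" using finite_subset_image[OF F(1,2)] by blast
  have "{\<nu>. \<nu> < l \<and> q \<nu> ` cylinder (n \<nu>) \<inter> \<Union>\<F> \<noteq> {}} \<subseteq> (\<Union>j\<in>I. {\<nu>. \<nu> < l \<and> q \<nu> ` cylinder (n \<nu>) \<inter> V j \<noteq> {}})"
    unfolding I(3) by blast
  then have "finite {\<nu>. \<nu> < l \<and> q \<nu> ` cylinder (n \<nu>) \<inter> \<Union>\<F> \<noteq> {}}"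
    by (rule finite_subset) (use I finV in blast)
  moreover have "openin (T l) (\<Union>\<F>)" unfolding I(3) using opV by blast
  ultimately show ?thesis using F(3) by blast
qed

lemma isolated_states:
  assumes "\<alpha> \<in> states (X l)"
  obtains V where "openin (T l) V" "\<alpha> \<in> V" "V \<inter> states (X l) = {\<alpha>}"
proof
  have "closedin (T l) (\<Union>i\<in>Inr ` (states (X l) - {\<alpha>}). patch i)"
    by (rule closedin_patches) (auto simp: patch_index_def)
  then have "closedin (T l) (states (X l) - {\<alpha>})" by simp
  then show "openin (T l) (topspace (T l) - (states (X l) - {\<alpha>}))" by blast
qed (use assms multipointedD(2)[OF X_multipointed[of l]] in auto)

end

section \<open>The uniform distance and the compact-open topology\<close>

lemma finite_common_radius:
  assumes "finite I" "\<And>i. i \<in> I \<Longrightarrow> \<exists>\<delta>>0::real. Q i \<delta>"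
    "\<And>i \<delta> \<delta>'. Q i \<delta> \<Longrightarrow> 0 < \<delta>' \<Longrightarrow> \<delta>' \<le> \<delta> \<Longrightarrow> Q i \<delta>'"
  shows "\<exists>\<delta>>0. \<forall>i\<in>I. Q i \<delta>"
  using assms(1,2)
proof (induction I)
  case empty
  show ?case by (auto intro: exI[of _ 1])
next
  case (insert i I)
  then obtain \<delta> \<delta>' where "\<delta> > 0" "\<forall>i\<in>I. Q i \<delta>" "\<delta>' > 0" "Q i \<delta>'" by blast
  then show ?case using assms(3)[of _ \<delta> "min \<delta> \<delta>'"] assms(3)[of i \<delta>' "min \<delta> \<delta>'"]
    by (intro exI[of _ "min \<delta> \<delta>'"]) simp
qed

context Metric_space
begin

lemma continuous_dist:
  "continuous_map X mtopology f \<Longrightarrow> continuous_map X mtopology f' \<Longrightarrow>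
    continuous_map X euclideanreal (\<lambda>x. d (f x) (f' x))"
  using continuous_map_mdist[of X Self f f'] by (simp add: mtopology_of_def)

lemma uniformly_continuous_compact:
  fixes p :: "'b::metric_space \<Rightarrow> 'a"
  assumes S: "compact S" and p: "continuous_map (top_of_set S) mtopology p" and \<epsilon>: "\<epsilon> > 0"
  shows "\<exists>\<delta>>0. \<forall>s\<in>S. \<forall>t\<in>S. dist s t < \<delta> \<longrightarrow> d (p s) (p t) < \<epsilon>"
proof -
  have pM: "p s \<in> M" if "s \<in> S" for s
    using continuous_map_image_subset_topspace[OF p] that by auto
  have "continuous_map (top_of_set (S \<times> S)) (top_of_set S) fst" "continuous_map (top_of_set (S \<times> S)) (top_of_set S) snd"
    by (auto simp: continuous_map_in_subtopology intro!: continuous_on_fst continuous_on_snd continuous_on_id)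
  then have "continuous_map (top_of_set (S \<times> S)) euclideanreal (\<lambda>x. d ((p \<circ> fst) x) ((p \<circ> snd) x))"
    using p by (intro continuous_dist continuous_map_compose) auto
  then have "uniformly_continuous_on (S \<times> S) (\<lambda>x. d (p (fst x)) (p (snd x)))"
    using S by (intro compact_uniformly_continuous compact_Times) (auto simp: o_def)
  then obtain \<delta> where \<delta>: "\<delta> > 0" "\<And>x x'. x \<in> S \<times> S \<Longrightarrow> x' \<in> S \<times> S \<Longrightarrow> dist x' x < \<delta> \<Longrightarrow>
      dist (d (p (fst x')) (p (snd x'))) (d (p (fst x)) (p (snd x))) < \<epsilon>"
    using \<epsilon> unfolding uniformly_continuous_on_def by metis
  have "d (p s) (p t) < \<epsilon>" if "s \<in> S" "t \<in> S" "dist s t < \<delta>" for s t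
  proof -
    have "dist (s, t) (s, s) < \<delta>" using that(3) by (simp add: dist_Pair_Pair dist_commute)
    from \<delta>(2)[OF _ _ this] that pM show ?thesis by (simp add: dist_real_def)
  qed
  then show ?thesis using \<delta>(1) by blast
qed

end

locale metrized_mdspace = Metric_space M d for M :: "'a set" and d +
  fixes Z :: "'a mdspace"
  assumes underlying_eq: "underlying Z = mtopology"
    and paths: "execution_paths Z \<subseteq> continuous_maps unit_interval (underlying Z)"
begin

abbreviation E :: "(real \<Rightarrow> 'a) set" where "E \<equiv> execution_paths Z"
abbreviation u :: "(real \<Rightarrow> 'a) \<Rightarrow> (real \<Rightarrow> 'a) \<Rightarrow> real" where "u \<equiv> uniform_dist Z d"

lemma path_continuous: "\<gamma> \<in> E \<Longrightarrow> continuous_map unit_interval mtopology \<gamma>"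
  and path_extensional: "\<gamma> \<in> E \<Longrightarrow> \<gamma> \<in> extensional {0..1}"
  using paths by (auto simp: continuous_maps_def underlying_eq)

lemma path_in: "\<gamma> \<in> E \<Longrightarrow> t \<in> {0..1} \<Longrightarrow> \<gamma> t \<in> M"
  using continuous_map_image_subset_topspace[OF path_continuous] by fastforce

lemma bdd_above_dist:
  assumes "\<gamma> \<in> E" "\<gamma>' \<in> E"
  shows "bdd_above ((\<lambda>t. d (\<gamma> t) (\<gamma>' t)) ` {0..1})"
proof -
  have "continuous_on {0..1} (\<lambda>t. d (\<gamma> t) (\<gamma>' t))"
    using continuous_dist[OF path_continuous[OF assms(1)] path_continuous[OF assms(2)]] by simp
  then have "compact ((\<lambda>t. d (\<gamma> t) (\<gamma>' t)) ` {0..1})"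
    by (rule compact_continuous_image) simp
  then show ?thesis by (intro bounded_imp_bdd_above compact_imp_bounded)
qed

lemma u_ge: "\<gamma> \<in> E \<Longrightarrow> \<gamma>' \<in> E \<Longrightarrow> t \<in> {0..1} \<Longrightarrow> d (\<gamma> t) (\<gamma>' t) \<le> u \<gamma> \<gamma>'"
  unfolding uniform_dist_def using cSUP_upper[OF _ bdd_above_dist] by simp

lemma u_le: "\<gamma> \<in> E \<Longrightarrow> \<gamma>' \<in> E \<Longrightarrow> (\<And>t. t \<in> {0..1} \<Longrightarrow> d (\<gamma> t) (\<gamma>' t) \<le> c) \<Longrightarrow> u \<gamma> \<gamma>' \<le> c"
  unfolding uniform_dist_def by (auto intro!: cSUP_least)

lemma u_nonneg: "0 \<le> u \<gamma> \<gamma>'"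
proof (cases "\<gamma> \<in> E \<and> \<gamma>' \<in> E")
  case True
  then have "d (\<gamma> 0) (\<gamma>' 0) \<le> u \<gamma> \<gamma>'" by (intro u_ge) auto
  then show ?thesis using nonneg[of "\<gamma> 0" "\<gamma>' 0"] by linarith
qed (auto simp: uniform_dist_def)

lemma Metric_space_u: "Metric_space E u"
proof
  show "0 \<le> u \<gamma> \<gamma>'" for \<gamma> \<gamma>' by (rule u_nonneg)
  show "u \<gamma> \<gamma>' = u \<gamma>' \<gamma>" for \<gamma> \<gamma>'
    unfolding uniform_dist_def by (simp add: commute conj_commute)
  show "u \<gamma> \<gamma>' = 0 \<longleftrightarrow> \<gamma> = \<gamma>'" if "\<gamma> \<in> E" "\<gamma>' \<in> E" for \<gamma> \<gamma>'
  proof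
    assume "u \<gamma> \<gamma>' = 0"
    have "\<gamma> t = \<gamma>' t" for t
    proof (cases "t \<in> {0..1}")
      case True
      then have "d (\<gamma> t) (\<gamma>' t) = 0" using u_ge[OF that True] \<open>u \<gamma> \<gamma>' = 0\<close> nonneg[of "\<gamma> t" "\<gamma>' t"] by linarith
      then show ?thesis using path_in[OF that(1) True] path_in[OF that(2) True] by simp
    next
      case False
      then show ?thesis using path_extensional[OF that(1)] path_extensional[OF that(2)]
        by (simp add: extensional_def)
    qed
    then show "\<gamma> = \<gamma>'" by auto
  next
    assume "\<gamma> = \<gamma>'"
    then have "u \<gamma> \<gamma>' \<le> 0" using that by (intro u_le) (auto simp: path_in)
    then show "u \<gamma> \<gamma>' = 0" using u_nonneg[of \<gamma> \<gamma>'] by linarith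
  qed
  show "u x z \<le> u x y + u y z" if "x \<in> E" "y \<in> E" "z \<in> E" for x y z
  proof (rule u_le[OF that(1,3)])
    fix t :: real assume t: "t \<in> {0..1}"
    show "d (x t) (z t) \<le> u x y + u y z"
      using triangle[OF path_in[OF that(1) t] path_in[OF that(2) t] path_in[OF that(3) t]]
        u_ge[OF that(1,2) t] u_ge[OF that(2,3) t] by linarith
  qed
qed

sublocale path: Metric_space E u by (rule Metric_space_u)

lemma path_uniformly_continuous:
  assumes "\<gamma> \<in> E" "\<epsilon> > 0"
  shows "\<exists>\<delta>>0. \<forall>s\<in>{0..1}. \<forall>t\<in>{0..1}. \<bar>s - t\<bar> < \<delta> \<longrightarrow> d (\<gamma> s) (\<gamma> t) < \<epsilon>"
  using uniformly_continuous_compact[OF _ path_continuous[OF assms(1)] assms(2)]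
  by (simp add: dist_real_def)

text \<open>The image of \<open>K\<close> under \<open>\<gamma>\<close> is compact, hence has a positive distance from the complement of \<open>U\<close>.\<close>

lemma compact_open_subbase_open:
  assumes K: "compactin unit_interval K" and U: "openin mtopology U"
  shows "openin path.mtopology {\<gamma> \<in> E. \<gamma> ` K \<subseteq> U}"
  unfolding path.openin_mtopology
proof (intro conjI allI impI)
  fix \<gamma> assume "\<gamma> \<in> {\<gamma> \<in> E. \<gamma> ` K \<subseteq> U}"
  then have \<gamma>: "\<gamma> \<in> E" "\<gamma> ` K \<subseteq> U" by auto
  have K': "K \<subseteq> {0..1}" using compactin_subset_topspace[OF K] by simp
  have "\<exists>\<epsilon>>0. \<forall>t\<in>K. mball (\<gamma> t) \<epsilon> \<subseteq> U"
  proof (rule ccontr)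
    assume no: "\<not> ?thesis"
    have "\<exists>t\<in>K. \<not> mball (\<gamma> t) (1 / real (Suc k)) \<subseteq> U" for k
    proof (rule ccontr)
      assume "\<not> (\<exists>t\<in>K. \<not> mball (\<gamma> t) (1 / real (Suc k)) \<subseteq> U)"
      then have "\<exists>\<epsilon>>0. \<forall>t\<in>K. mball (\<gamma> t) \<epsilon> \<subseteq> U" by (intro exI[of _ "1 / real (Suc k)"]) auto
      with no show False by contradiction
    qed
    then obtain t where t: "\<And>k. t k \<in> K" "\<And>k. \<not> mball (\<gamma> (t k)) (1 / real (Suc k)) \<subseteq> U" by metis
    have "compact K" using K by (simp add: compactin_subtopology)
    then obtain s r where s: "s \<in> K" "strict_mono (r :: nat \<Rightarrow> nat)" "(t \<circ> r) \<longlonglongrightarrow> s"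
      using t(1) unfolding compact_def by metis
    obtain \<epsilon> where \<epsilon>: "\<epsilon> > 0" "mball (\<gamma> s) \<epsilon> \<subseteq> U"
      using U \<gamma>(2) s(1) unfolding openin_mtopology by blast
    obtain \<delta> where \<delta>: "\<delta> > 0" "\<And>a b. a \<in> {0..1} \<Longrightarrow> b \<in> {0..1} \<Longrightarrow> \<bar>a - b\<bar> < \<delta> \<Longrightarrow> d (\<gamma> a) (\<gamma> b) < \<epsilon>/2"
      using path_uniformly_continuous[OF \<gamma>(1), of "\<epsilon>/2"] \<epsilon>(1) by auto
    obtain N where N: "\<And>k. k \<ge> N \<Longrightarrow> \<bar>t (r k) - s\<bar> < \<delta>"
      using s(3) \<delta>(1) unfolding LIMSEQ_def dist_real_def o_def by blast
    obtain N' :: nat where N': "real N' > 2 / \<epsilon>" using reals_Archimedean2 by blast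
    let ?k = "max N N'"
    have "1 / real (Suc (r ?k)) < \<epsilon>/2"
    proof -
      have "real (Suc (r ?k)) > 2 / \<epsilon>" using seq_suble[OF s(2), of ?k] N' by simp
      then show ?thesis using \<epsilon>(1) by (simp add: field_simps)
    qed
    have "mball (\<gamma> (t (r ?k))) (1 / real (Suc (r ?k))) \<subseteq> mball (\<gamma> s) \<epsilon>"
    proof
      fix y assume y: "y \<in> mball (\<gamma> (t (r ?k))) (1 / real (Suc (r ?k)))"
      have tk: "t (r ?k) \<in> {0..1}" "s \<in> {0..1}" using t(1) K' s(1) by blast+
      have "d (\<gamma> s) (\<gamma> (t (r ?k))) < \<epsilon>/2"
        using \<delta>(2)[OF tk(2,1)] N[of ?k] by (simp add: abs_minus_commute)
      moreover have "d (\<gamma> (t (r ?k))) y < \<epsilon>/2" using y \<open>1 / real (Suc (r ?k)) < \<epsilon>/2\<close> by (auto simp del: of_nat_Suc)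
      ultimately show "y \<in> mball (\<gamma> s) \<epsilon>"
        using triangle[OF path_in[OF \<gamma>(1) tk(2)] path_in[OF \<gamma>(1) tk(1)], of y] y path_in[OF \<gamma>(1) tk(2)]
        by auto
    qed
    then show False using t(2)[of "r ?k"] \<epsilon>(2) by (meson order_trans)
  qed
  then obtain \<epsilon> where \<epsilon>: "\<epsilon> > 0" "\<And>t. t \<in> K \<Longrightarrow> mball (\<gamma> t) \<epsilon> \<subseteq> U" by blast
  have "path.mball \<gamma> \<epsilon> \<subseteq> {\<gamma> \<in> E. \<gamma> ` K \<subseteq> U}"
  proof
    fix \<gamma>' assume "\<gamma>' \<in> path.mball \<gamma> \<epsilon>"
    then have g: "\<gamma>' \<in> E" "u \<gamma> \<gamma>' < \<epsilon>" by auto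
    have "\<gamma>' t \<in> U" if "t \<in> K" for t
    proof -
      have t: "t \<in> {0..1}" using that K' by auto
      have "\<gamma>' t \<in> mball (\<gamma> t) \<epsilon>"
        using u_ge[OF \<gamma>(1) g(1) t] g(2) path_in[OF \<gamma>(1) t] path_in[OF g(1) t] by simp
      then show ?thesis using \<epsilon>(2)[OF that] by blast
    qed
    then show "\<gamma>' \<in> {\<gamma> \<in> E. \<gamma> ` K \<subseteq> U}" using g(1) by auto
  qed
  then show "\<exists>r>0. path.mball \<gamma> r \<subseteq> {\<gamma> \<in> E. \<gamma> ` K \<subseteq> U}" using \<epsilon>(1) by blast
qed auto

text \<open>Cut the unit interval into \<open>N\<close> pieces on each of which \<open>\<gamma>\<close> varies by less than \<open>r / 3\<close>, and demand
  that each piece stays within \<open>r / 3\<close> of the position of \<open>\<gamma>\<close> at its left end.\<close>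

lemma compact_open_ball:
  assumes "\<gamma> \<in> E" "r > 0"
  shows "\<exists>V. openin (compact_open_topology unit_interval mtopology) V \<and> \<gamma> \<in> V \<and> V \<inter> E \<subseteq> path.mball \<gamma> r"
proof -
  obtain \<delta> where \<delta>: "\<delta> > 0" "\<And>a b. a \<in> {0..1} \<Longrightarrow> b \<in> {0..1} \<Longrightarrow> \<bar>a - b\<bar> < \<delta> \<Longrightarrow> d (\<gamma> a) (\<gamma> b) < r/3"
    using path_uniformly_continuous[OF assms(1), of "r/3"] assms(2) by auto
  obtain N :: nat where N: "real N > 1 / \<delta>" using reals_Archimedean2 by blast
  have N0: "N > 0" using N \<delta>(1) by (cases N) (auto simp: field_simps)
  have N\<delta>: "1 / real N < \<delta>" using N \<delta>(1) N0 by (simp add: field_simps)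
  define I where "I i = {real i / real N .. real (Suc i) / real N}" for i
  define ball_at where "ball_at i = mball (\<gamma> (real i / real N)) (r/3)" for i
  define B where "B i = {f \<in> continuous_maps unit_interval mtopology. f ` I i \<subseteq> ball_at i}" for i
  have I01: "I i \<subseteq> {0..1}" if "i < N" for i
  proof -
    have "real (Suc i) / real N \<le> 1" using that N0 by simp
    moreover have "0 \<le> real i / real N" by simp
    ultimately show ?thesis unfolding I_def by (meson atLeastatMost_subset_iff)
  qed
  have iI: "real i / real N \<in> I i" for i
    unfolding I_def by (simp add: divide_right_mono)
  have dI: "\<bar>real i / real N - t\<bar> < \<delta>" if "t \<in> I i" for i t
  proof -
    have "real (Suc i) / real N = real i / real N + 1 / real N" by (simp add: add_divide_distrib)
    then show ?thesis using that N\<delta> by (auto simp: I_def)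
  qed
  have opB: "openin (compact_open_topology unit_interval mtopology) (B i)" if "i < N" for i
  proof -
    have "compactin unit_interval (I i)"
      using I01[OF that] by (simp add: compactin_subtopology) (simp add: I_def)
    moreover have "openin mtopology (ball_at i)" unfolding ball_at_def by (rule openin_mball)
    ultimately show ?thesis
      unfolding compact_open_topology_def B_def by (intro topology_generated_by_Basis) blast
  qed
  define V where "V = (\<Inter>i\<in>{..<N}. B i)"
  have "openin (compact_open_topology unit_interval mtopology) V"
    unfolding V_def using N0 opB by (intro openin_INT2) auto
  moreover have "\<gamma> \<in> B i" if "i < N" for i
  proof -
    have "\<gamma> t \<in> ball_at i" if t: "t \<in> I i" for t
    proof -
      have "t \<in> {0..1}" "real i / real N \<in> {0..1}" using I01[OF \<open>i < N\<close>] t iI by blast+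
      then show ?thesis using \<delta>(2) dI[OF t] path_in[OF assms(1)] by (simp add: ball_at_def)
    qed
    moreover have "\<gamma> \<in> continuous_maps unit_interval mtopology" using assms(1) paths underlying_eq by auto
    ultimately show ?thesis by (auto simp: B_def)
  qed
  then have "\<gamma> \<in> V" by (simp add: V_def)
  moreover have "V \<inter> E \<subseteq> path.mball \<gamma> r"
  proof
    fix f assume f: "f \<in> V \<inter> E"
    have "u \<gamma> f \<le> 2 * r / 3"
    proof (rule u_le)
      fix t :: real assume t: "t \<in> {0..1}"
      obtain i where i: "i < N" "t \<in> I i"
      proof (cases "t = 1")
        case True
        then have "t \<in> I (N - 1)" using N0 by (simp add: I_def)
        then show ?thesis using that[of "N - 1"] N0 by simp
      next
        case False
        define i where "i = nat \<lfloor>t * real N\<rfloor>"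
        have "real i \<le> t * real N" "t * real N < real i + 1" using t N0 by (auto simp: i_def)
        moreover have "t * real N < real N" using False t N0 by simp
        ultimately have "real i < real N" "t \<in> I i" using N0 by (linarith, auto simp: I_def field_simps)
        then show ?thesis using that[of i] by simp
      qed
      have i01: "real i / real N \<in> {0..1}" using I01[OF i(1)] iI by blast
      have "f t \<in> ball_at i" using f i by (auto simp: V_def B_def)
      then have "d (\<gamma> (real i / real N)) (f t) < r/3" "f t \<in> M" by (auto simp: ball_at_def)
      moreover have "d (\<gamma> t) (\<gamma> (real i / real N)) < r/3"
        using \<delta>(2)[OF t i01] dI[OF i(2)] by (simp add: abs_minus_commute)
      ultimately show "d (\<gamma> t) (f t) \<le> 2 * r / 3"
        using triangle[OF path_in[OF assms(1) t] path_in[OF assms(1) i01], of "f t"] by linarith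
    qed (use f assms in auto)
    then show "f \<in> path.mball \<gamma> r" using f assms by auto
  qed
  ultimately show ?thesis by blast
qed

theorem path_mtopology_eq_compact_open: "path.mtopology = path_space_co Z"
proof -
  let ?CO = "compact_open_topology unit_interval mtopology"
  have ts: "topspace (subtopology ?CO E) = E" using paths underlying_eq by auto
  have "continuous_map path.mtopology ?CO (\<lambda>\<gamma>. \<gamma>)"
    unfolding compact_open_topology_def
  proof (rule continuous_on_generated_topo)
    fix U assume "U \<in> {{f \<in> continuous_maps unit_interval mtopology. f ` K \<subseteq> U} |K U. compactin unit_interval K \<and> openin mtopology U}"
    then obtain K V where U: "U = {f \<in> continuous_maps unit_interval mtopology. f ` K \<subseteq> V}"
      "compactin unit_interval K" "openin mtopology V" by blast
    have "(\<lambda>\<gamma>. \<gamma>) -` U \<inter> topspace path.mtopology = {\<gamma> \<in> E. \<gamma> ` K \<subseteq> V}"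
      using paths underlying_eq unfolding U(1) by auto
    then show "openin path.mtopology ((\<lambda>\<gamma>. \<gamma>) -` U \<inter> topspace path.mtopology)"
      using compact_open_subbase_open[OF U(2,3)] by simp
  next
    have "continuous_maps unit_interval mtopology \<in>
        {{f \<in> continuous_maps unit_interval mtopology. f ` K \<subseteq> U} |K U. compactin unit_interval K \<and> openin mtopology U}"
      by (rule CollectI, rule exI[of _ "{}"], rule exI[of _ M]) (auto intro: openin_topspace[of mtopology, simplified])
    then show "(\<lambda>\<gamma>. \<gamma>) ` topspace path.mtopology \<subseteq>
        \<Union> {{f \<in> continuous_maps unit_interval mtopology. f ` K \<subseteq> U} |K U. compactin unit_interval K \<and> openin mtopology U}"
      using paths underlying_eq by auto
  qed
  then have 1: "continuous_map path.mtopology (subtopology ?CO E) (\<lambda>\<gamma>. \<gamma>)"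
    by (simp add: continuous_map_in_subtopology)
  have "openin path.mtopology U" if U: "openin (subtopology ?CO E) U" for U
  proof -
    have "U \<subseteq> E" using openin_subset[OF U] ts by simp
    then have "{\<gamma> \<in> topspace path.mtopology. \<gamma> \<in> U} = U" by auto
    then show ?thesis using openin_continuous_map_preimage[OF 1 U] by simp
  qed
  moreover have "openin (subtopology ?CO E) U" if U: "openin path.mtopology U" for U
  proof (subst openin_subopen, intro ballI)
    fix \<gamma> assume "\<gamma> \<in> U"
    then obtain r where r: "r > 0" "path.mball \<gamma> r \<subseteq> U" "\<gamma> \<in> E"
      using U unfolding path.openin_mtopology by blast
    obtain V where V: "openin ?CO V" "\<gamma> \<in> V" "V \<inter> E \<subseteq> path.mball \<gamma> r"
      using compact_open_ball[OF r(3,1)] by blast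
    have "openin (subtopology ?CO E) (V \<inter> E)" using V(1) by (rule openin_subtopology_Int)
    then show "\<exists>W. openin (subtopology ?CO E) W \<and> \<gamma> \<in> W \<and> W \<subseteq> U"
      using V(2,3) r(2,3) by (intro exI[of _ "V \<inter> E"]) auto
  qed
  ultimately show ?thesis unfolding path_space_co_def underlying_eq topology_eq by blast
qed

end

section \<open>Reparametrized chains of cells\<close>

lemma reparam_to_IVT:
  assumes "\<psi> \<in> reparam_to P L" "0 \<le> a" "a \<le> b" "b \<le> 1" "\<psi> a \<le> y" "y \<le> \<psi> b"
  obtains t where "a \<le> t" "t \<le> b" "\<psi> t = y"
proof -
  have "continuous_on {a..b} \<psi>"
    by (rule continuous_on_subset[OF reparam_toD(1)[OF assms(1)]]) (use assms in auto)
  then show ?thesis using IVT'[of \<psi> a y b] assms that by auto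
qed

lemma reparam_to_linear: "L > 0 \<Longrightarrow> (\<lambda>t. L * t) \<in> reparam_to P L"
  by (rule reparam_toI) (auto intro!: continuous_intros)

lemma reparam_to_scale:
  assumes "\<psi> \<in> reparam_to P L" "L > 0"
  shows "(\<lambda>t. \<psi> t / L) \<in> reparam_to P 1"
proof (rule reparam_toI)
  note p = reparam_toD[OF assms(1)]
  show "continuous_on {0..1} (\<lambda>t. \<psi> t / L)" using p(1) assms(2) by (auto intro!: continuous_intros)
  show "\<psi> s / L \<le> \<psi> t / L" if "0 \<le> s" "s < t" "t \<le> 1" for s t
    using p(4)[of s t] that assms(2) by (simp add: divide_right_mono)
  show "\<psi> s / L < \<psi> t / L" if "P = Homeos" "0 \<le> s" "s < t" "t \<le> 1" for s t
    using p(5)[of s t] that assms(2) by (simp add: divide_strict_right_mono)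
qed (use reparam_toD(2,3)[OF assms(1)] assms(2) in auto)

lemma reparam_to_convex:
  assumes "\<psi> \<in> reparam_to P L" "\<psi>' \<in> reparam_to P L" "0 \<le> s" "s \<le> 1"
  shows "(\<lambda>t. (1 - s) * \<psi> t + s * \<psi>' t) \<in> reparam_to P L"
proof (rule reparam_toI)
  note p = reparam_toD[OF assms(1)] and p' = reparam_toD[OF assms(2)]
  show "continuous_on {0..1} (\<lambda>t. (1 - s) * \<psi> t + s * \<psi>' t)"
    using p(1) p'(1) by (intro continuous_intros)
  show "(1 - s) * \<psi> a + s * \<psi>' a \<le> (1 - s) * \<psi> b + s * \<psi>' b" if "0 \<le> a" "a < b" "b \<le> 1" for a b
    using p(4)[of a b] p'(4)[of a b] that assms(3,4) by (intro add_mono mult_left_mono) auto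
  show "(1 - s) * \<psi> a + s * \<psi>' a < (1 - s) * \<psi> b + s * \<psi>' b"
    if "P = Homeos" "0 \<le> a" "a < b" "b \<le> 1" for a b
  proof (cases "s = 0")
    case True
    then show ?thesis using p(5)[of a b] that by simp
  next
    case False
    have "s * \<psi>' a < s * \<psi>' b" using p'(5)[of a b] that False assms(3) by simp
    moreover have "(1 - s) * \<psi> a \<le> (1 - s) * \<psi> b"
      using p(5)[of a b] that assms(4) by (intro mult_left_mono) auto
    ultimately show ?thesis by linarith
  qed
qed (use reparam_toD(2,3)[OF assms(1)] reparam_toD(2,3)[OF assms(2)] in \<open>auto simp: algebra_simps\<close>)

definition interpolate :: "real \<Rightarrow> (nat \<Rightarrow> real) \<Rightarrow> (nat \<Rightarrow> real) \<Rightarrow> nat \<Rightarrow> real" where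
  "interpolate s z w = (\<lambda>i. (1 - s) * z i + s * w i)"

lemma interpolate_simps [simp]: "interpolate 0 z w = z" "interpolate 1 z w = w" "interpolate s z z = z"
  by (auto simp: interpolate_def algebra_simps)

lemma interpolate_disk:
  assumes "z \<in> disk_set n" "w \<in> disk_set n" "s \<in> {0..1}"
  shows "interpolate s z w \<in> disk_set n"
proof -
  have "((1 - s) * z i + s * w i)^2 \<le> (1 - s) * z i^2 + s * w i^2" for i
  proof -
    have "(1 - s) * z i^2 + s * w i^2 - ((1 - s) * z i + s * w i)^2 = s * (1 - s) * (z i - w i)^2"
      by (simp add: power2_eq_square algebra_simps)
    moreover have "0 \<le> s * (1 - s) * (z i - w i)^2" using assms(3) by simp
    ultimately show ?thesis by linarith
  qed
  then have "sqnorm n (interpolate s z w) \<le> (\<Sum>i<n. (1 - s) * z i^2 + s * w i^2)"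
    unfolding sqnorm_def interpolate_def by (intro sum_mono)
  also have "\<dots> = (1 - s) * sqnorm n z + s * sqnorm n w"
    by (simp add: sqnorm_def sum.distrib sum_distrib_left)
  also have "\<dots> \<le> (1 - s) * 1 + s * 1"
    using assms by (intro add_mono mult_left_mono) (auto simp: disk_set_def)
  finally show ?thesis using assms(1,2) by (auto simp: disk_set_def interpolate_def)
qed

lemma continuous_on_interpolate: "continuous_on S (\<lambda>((z, w), s). interpolate s z w)"
proof -
  have 1: "continuous_on S (\<lambda>x. fst (fst x) i)" "continuous_on S (\<lambda>x. snd (fst x) i)"
    for i and S :: "(((nat \<Rightarrow> real) \<times> (nat \<Rightarrow> real)) \<times> real) set"
    by (rule continuous_on_product_then_coordinatewise[OF continuous_on_fst[OF continuous_on_fst[OF continuous_on_id]]]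
        continuous_on_product_then_coordinatewise[OF continuous_on_snd[OF continuous_on_fst[OF continuous_on_id]]])+
  have "(\<lambda>((z, w), s). interpolate s z w) = (\<lambda>x i. (1 - snd x) * fst (fst x) i + snd x * snd (fst x) i)"
    by (auto simp: interpolate_def fun_eq_iff)
  then show ?thesis
    by (simp only:, intro continuous_on_coordinatewise_then_product continuous_intros 1)
qed

lemma interpolate_uniform:
  assumes "\<delta> > 0"
  shows "\<exists>\<delta>'>0. \<forall>z\<in>disk_set n. \<forall>w\<in>disk_set n. \<forall>z'\<in>disk_set n. \<forall>w'\<in>disk_set n. \<forall>s\<in>{0..1}. \<forall>s'\<in>{0..1}.
    dist ((z, w), s) ((z', w'), s') < \<delta>' \<longrightarrow> dist (interpolate s z w) (interpolate s' z' w') < \<delta>"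
proof -
  let ?K = "(disk_set n \<times> disk_set n) \<times> {0..1::real}"
  have "uniformly_continuous_on ?K (\<lambda>((z, w), s). interpolate s z w)"
    by (intro compact_uniformly_continuous continuous_on_interpolate compact_Times compact_disk_set) simp
  then obtain \<delta>' where \<delta>': "\<delta>' > 0" "\<And>x x'. x \<in> ?K \<Longrightarrow> x' \<in> ?K \<Longrightarrow> dist x' x < \<delta>' \<Longrightarrow>
      dist ((\<lambda>((z, w), s). interpolate s z w) x') ((\<lambda>((z, w), s). interpolate s z w) x) < \<delta>"
    using assms unfolding uniformly_continuous_on_def by metis
  have "dist (interpolate s z w) (interpolate s' z' w') < \<delta>"
    if "z \<in> disk_set n" "w \<in> disk_set n" "z' \<in> disk_set n" "w' \<in> disk_set n" "s \<in> {0..1}" "s' \<in> {0..1}"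
      "dist ((z, w), s) ((z', w'), s') < \<delta>'" for z w z' w' s s'
    using \<delta>'(2)[of "((z', w'), s')" "((z, w), s)"] that by simp
  then show ?thesis using \<delta>'(1) by blast
qed

lemma finitely_many_convergent_subsequences:
  fixes x :: "nat \<Rightarrow> nat \<Rightarrow> 'b::metric_space"
  assumes "\<And>j. j < m \<Longrightarrow> compact (K j)" "\<And>j k. j < m \<Longrightarrow> x k j \<in> K j"
  shows "\<exists>r z. strict_mono (r :: nat \<Rightarrow> nat) \<and> (\<forall>j<m. z j \<in> K j \<and> (\<lambda>k. x (r k) j) \<longlonglongrightarrow> z j)"
  using assms
proof (induction m)
  case 0
  show ?case by (rule exI[of _ id]) (simp add: strict_mono_def)
next
  case (Suc m)
  then obtain r z where r: "strict_mono (r :: nat \<Rightarrow> nat)" "\<And>j. j < m \<Longrightarrow> z j \<in> K j \<and> (\<lambda>k. x (r k) j) \<longlonglongrightarrow> z j"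
    by (metis less_SucI)
  have "compact (K m)" "\<And>k. x (r k) m \<in> K m" using Suc.prems by auto
  then obtain w r' where r': "w \<in> K m" "strict_mono (r' :: nat \<Rightarrow> nat)" "((\<lambda>k. x (r k) m) \<circ> r') \<longlonglongrightarrow> w"
    unfolding compact_def by metis
  have "strict_mono (r \<circ> r')" using r(1) r'(2) by (simp add: strict_mono_def)
  moreover have "(z(m := w)) j \<in> K j \<and> (\<lambda>k. x ((r \<circ> r') k) j) \<longlonglongrightarrow> (z(m := w)) j" if "j < Suc m" for j
  proof (cases "j = m")
    case True
    then show ?thesis using r' by (simp add: o_def)
  next
    case False
    then have j: "j < m" using that by simp
    then show ?thesis using r(2)[OF j] LIMSEQ_subseq_LIMSEQ[OF conjunct2[OF r(2)[OF j]] r'(2)] False by (simp add: o_def)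
  qed
  ultimately show ?case by blast
qed

text \<open>The segment \<open>j\<close> and the time \<open>r\<close> within it depend on \<open>s\<close> and on the length of the chain only, so
  that chains of the same length can be compared segment by segment.\<close>

lemma chain_eval:
  assumes "linked q cs" "cs \<noteq> []" "0 \<le> s" "s \<le> real (length cs)"
  obtains j r where "j < length cs" "0 \<le> r" "r \<le> 1" "s = real j + r"
    "\<And>cs'. linked q cs' \<Longrightarrow> length cs' = length cs \<Longrightarrow> chain q cs' s = q (fst (cs' ! j)) (snd (cs' ! j), r)"
proof -
  define j where "j = (if s = length cs then length cs - 1 else nat \<lfloor>s\<rfloor>)"
  have len: "length cs \<ge> 1" using assms(2) by (cases cs) auto
  have j: "j < length cs" "real j \<le> s" "s \<le> real j + 1"
  proof -
    have "j < length cs \<and> real j \<le> s \<and> s \<le> real j + 1"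
    proof (cases "s = length cs")
      case True
      then show ?thesis using len by (simp add: j_def of_nat_diff)
    next
      case False
      then have "s < length cs" using assms(4) by simp
      then show ?thesis using False assms(3) by (simp add: j_def) linarith
    qed
    then show "j < length cs" "real j \<le> s" "s \<le> real j + 1" by auto
  qed
  show ?thesis
  proof (rule that[of j "s - real j"])
    fix cs' assume "linked q cs'" "length cs' = length cs"
    then show "chain q cs' s = q (fst (cs' ! j)) (snd (cs' ! j), s - real j)"
      using chain_nth[of q cs' j "s - real j"] j by simp
  qed (use j in auto)
qed

locale metrized_cellular = locally_finite_cellular C P l X tr n g h
  for C P and l :: "'i::wellorder" and X :: "'i \<Rightarrow> 'a mdspace" and tr n g h +
  fixes d :: "'a \<Rightarrow> 'a \<Rightarrow> real"
  assumes metric: "Metric_space (topspace (underlying (X l))) d"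
    and mtopology_T: "Metric_space.mtopology (topspace (underlying (X l))) d = underlying (X l)"

sublocale metrized_cellular \<subseteq> metrized_mdspace "topspace (underlying (X l))" d "X l"
proof -
  interpret Metric_space "topspace (underlying (X l))" d by (rule metric)
  show "metrized_mdspace (topspace (underlying (X l))) d (X l)"
    by unfold_locales (use mtopology_T multipointedD(3)[OF X_multipointed[OF order_refl]] in auto)
qed

context metrized_cellular
begin

text \<open>All segments of a cell run from the image of \<open>Src\<close> to the image of \<open>Tgt\<close>. Hence the fitting of
  consecutive segments and the end points of a chain depend on its cells alone, and the points of
  the disks can be moved independently of each other.\<close>

lemma linked_fst: "linked q cs \<longleftrightarrow> successively (\<lambda>\<nu> \<nu>'. characteristic_map l tr h \<nu> Tgt = characteristic_map l tr h \<nu>' Src) (map fst cs)"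
  unfolding linked_def successively_map cell_map_ends ..

lemma chain_ends_fst:
  assumes "cs \<noteq> []"
  shows "chain q cs 0 = characteristic_map l tr h (hd (map fst cs)) Src"
    "chain q cs (length cs) = characteristic_map l tr h (last (map fst cs)) Tgt"
  using assms by (simp_all add: chain_start chain_end cell_map_ends hd_map last_map)

lemma chain_execution:
  assumes "cs \<noteq> []" "linked q cs" "set cs \<subseteq> closed_cells" "\<psi> \<in> reparam_to P (length cs)"
  shows "restrict (chain q cs \<circ> \<psi>) {0..1} \<in> E"
  using chain_pathsI[OF assms] chain_paths_execution by blast

lemma execution_chain:
  assumes "\<gamma> \<in> E"
  obtains cs \<psi> where "cs \<noteq> []" "linked q cs" "set cs \<subseteq> open_cells" "\<psi> \<in> reparam_to P (length cs)"
    "\<gamma> = restrict (chain q cs \<circ> \<psi>) {0..1}"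
  using assms unfolding execution_paths_eq_chains chain_paths_def by blast

lemma cell_map_uniform:
  assumes "\<nu> < l" "\<epsilon> > 0"
  shows "\<exists>\<delta>>0. \<forall>x\<in>cylinder (n \<nu>). \<forall>y\<in>cylinder (n \<nu>). dist x y < \<delta> \<longrightarrow> d (q \<nu> x) (q \<nu> y) < \<epsilon>"
  by (rule uniformly_continuous_compact)
     (use assms continuous_cell_map in \<open>auto simp: mtopology_T intro!: compact_Times compact_disk_set\<close>)

lemma cell_map_inj: "\<nu> < l \<Longrightarrow> inj_on (q \<nu>) (open_cylinder (n \<nu>))"
proof (rule inj_onI)
  fix p p' assume A: "\<nu> < l" "p \<in> open_cylinder (n \<nu>)" "p' \<in> open_cylinder (n \<nu>)" "q \<nu> p = q \<nu> p'"
  have "bump (n \<nu>) k p = bump (n \<nu>) k p'" for k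
    using cell_fun_cell[OF A(1) subsetD[OF open_cylinder_subset A(2)], of k]
      cell_fun_cell[OF A(1) subsetD[OF open_cylinder_subset A(3)], of k] A(4) by simp
  then show "p = p'" using bump_injective[OF A(2,3)] by blast
qed

text \<open>The characteristic map is injective on the open cell, and the interval \<open>[a, b]\<close> contains two
  distinct times inside a single segment.\<close>

lemma chain_nonconstant:
  assumes cs: "cs \<noteq> []" "linked q cs" "set cs \<subseteq> open_cells" and ab: "0 \<le> a" "a < b" "b \<le> real (length cs)"
  shows "\<exists>s s'. a \<le> s \<and> s \<le> b \<and> a \<le> s' \<and> s' \<le> b \<and> chain q cs s \<noteq> chain q cs s'"
proof -
  define j where "j = nat \<lfloor>a\<rfloor>"
  have j: "real j \<le> a" "a < real j + 1" using ab(1) by (auto simp: j_def)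
  then have "real j < length cs" using ab by linarith
  then have jl: "j < length cs" by simp
  define b' where "b' = min b (real j + 1)"
  have ab': "a < b'" "b' \<le> b" "b' \<le> real j + 1" using ab j by (auto simp: b'_def)
  define s where "s = a + (b' - a) / 3"
  define s' where "s' = a + 2 * (b' - a) / 3"
  have ss: "a < s" "s < s'" "s' < b'" using ab'(1) unfolding s_def s'_def by (simp_all add: field_simps)
  obtain \<nu> z where c: "cs ! j = (\<nu>, z)" by (cases "cs ! j") auto
  have "(\<nu>, z) \<in> open_cells" using cs(3) jl c nth_mem by force
  then have \<nu>: "\<nu> < l" "z \<in> open_disk (n \<nu>)" by (auto simp: open_cells_def)
  have e: "chain q cs x = q \<nu> (z, x - real j)" if "real j \<le> x" "x \<le> real j + 1" for x
    using chain_nth[OF cs(2) jl, of "x - real j"] that c by simp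
  have o: "(z, s - real j) \<in> open_cylinder (n \<nu>)" "(z, s' - real j) \<in> open_cylinder (n \<nu>)"
    using \<nu>(2) ss j ab' by (auto simp: open_cylinder_def)
  have "q \<nu> (z, s - real j) \<noteq> q \<nu> (z, s' - real j)"
  proof
    assume "q \<nu> (z, s - real j) = q \<nu> (z, s' - real j)"
    then have "(z, s - real j) = (z, s' - real j)" using inj_onD[OF cell_map_inj[OF \<nu>(1)]] o by blast
    then show False using ss by simp
  qed
  then have "chain q cs s \<noteq> chain q cs s'" using e[of s] e[of s'] ss j ab' by simp
  then show ?thesis using ss ab' by (intro exI[of _ s] exI[of _ s']) simp
qed

lemma path_nonconstant:
  assumes "P = Homeos" "\<gamma> \<in> E" "0 \<le> a" "a < b" "b \<le> 1"
  shows "\<exists>s s'. a \<le> s \<and> s \<le> b \<and> a \<le> s' \<and> s' \<le> b \<and> \<gamma> s \<noteq> \<gamma> s'"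
proof -
  obtain cs \<psi> where c: "cs \<noteq> []" "linked q cs" "set cs \<subseteq> open_cells" "\<psi> \<in> reparam_to P (length cs)"
    "\<gamma> = restrict (chain q cs \<circ> \<psi>) {0..1}" by (rule execution_chain[OF assms(2)])
  note p = reparam_toD[OF c(4)]
  have "\<psi> a < \<psi> b" "0 \<le> \<psi> a" "\<psi> b \<le> length cs" using p(5)[OF assms(1,3-5)] p(6)[of a] p(6)[of b] assms by auto
  then obtain y y' where y: "\<psi> a \<le> y" "y \<le> \<psi> b" "\<psi> a \<le> y'" "y' \<le> \<psi> b" "chain q cs y \<noteq> chain q cs y'"
    using chain_nonconstant[OF c(1-3), of "\<psi> a" "\<psi> b"] by blast
  obtain s where s: "a \<le> s" "s \<le> b" "\<psi> s = y"
    using reparam_to_IVT[OF c(4) assms(3) _ assms(5) y(1,2)] assms(4) by auto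
  obtain s' where s': "a \<le> s'" "s' \<le> b" "\<psi> s' = y'"
    using reparam_to_IVT[OF c(4) assms(3) _ assms(5) y(3,4)] assms(4) by auto
  show ?thesis using s s' y(5) assms(3,5) by (intro exI[of _ s] exI[of _ s']) (simp add: c(5))
qed

text \<open>A segment over a boundary point of the disk lies in lower cells. It is nevertheless an execution
  path, hence a reparametrized chain of open cells.\<close>

lemma cell_nonconstant:
  assumes "\<nu> < l" "z \<in> disk_set (n \<nu>)"
  shows "\<exists>s\<in>{0..1}. \<exists>s'\<in>{0..1}. q \<nu> (z, s) \<noteq> q \<nu> (z, s')"
proof -
  have "(\<lambda>t. t) \<in> reparams P"
    using reparam_to_linear[of 1 P] by (simp add: reparams_eq_reparam_to)
  from cell_path_execution[OF assms this]
  have "restrict (\<lambda>t. q \<nu> (z, t)) {0..1} \<in> E" .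
  then obtain cs \<psi> where c: "cs \<noteq> []" "linked q cs" "set cs \<subseteq> open_cells" "\<psi> \<in> reparam_to P (length cs)"
    "restrict (\<lambda>t. q \<nu> (z, t)) {0..1} = restrict (chain q cs \<circ> \<psi>) {0..1}" by (rule execution_chain)
  have e: "q \<nu> (z, t) = chain q cs (\<psi> t)" if "t \<in> {0..1}" for t
    using fun_cong[OF c(5), of t] that by simp
  obtain y y' where y: "0 \<le> y" "y \<le> real (length cs)" "0 \<le> y'" "y' \<le> real (length cs)" "chain q cs y \<noteq> chain q cs y'"
    using chain_nonconstant[OF c(1-3), of 0 "real (length cs)"] c(1) by auto
  obtain s where "0 \<le> s" "s \<le> 1" "\<psi> s = y" using reparam_to_surj[OF c(4) y(1,2)] .
  moreover obtain s' where "0 \<le> s'" "s' \<le> 1" "\<psi> s' = y'" using reparam_to_surj[OF c(4) y(3,4)] .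
  ultimately show ?thesis using e y(5) by (intro bexI[of _ s] bexI[of _ s']) auto
qed

text \<open>If the oscillations tended to \<open>0\<close>, compactness of the disk would provide a point
  with a constant segment.\<close>

lemma cell_oscillation:
  assumes \<nu>: "\<nu> < l"
  shows "\<exists>e>0. \<forall>z\<in>disk_set (n \<nu>). \<exists>s\<in>{0..1}. \<exists>s'\<in>{0..1}. d (q \<nu> (z, s)) (q \<nu> (z, s')) \<ge> e"
proof (rule ccontr)
  assume no: "\<not> ?thesis"
  have "\<exists>z\<in>disk_set (n \<nu>). \<forall>s\<in>{0..1}. \<forall>s'\<in>{0..1}. d (q \<nu> (z, s)) (q \<nu> (z, s')) < 1 / real (Suc k)" for k
  proof (rule ccontr)
    assume "\<not> (\<exists>z\<in>disk_set (n \<nu>). \<forall>s\<in>{0..1}. \<forall>s'\<in>{0..1}. d (q \<nu> (z, s)) (q \<nu> (z, s')) < 1 / real (Suc k))"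
    then have "\<forall>z\<in>disk_set (n \<nu>). \<exists>s\<in>{0..1}. \<exists>s'\<in>{0..1}. d (q \<nu> (z, s)) (q \<nu> (z, s')) \<ge> 1 / real (Suc k)"
      by (meson linorder_not_le)
    moreover have "1 / real (Suc k) > 0" by simp
    ultimately show False using no by blast
  qed
  then obtain z where z: "\<And>k. z k \<in> disk_set (n \<nu>)"
    "\<And>k s s'. s \<in> {0..1} \<Longrightarrow> s' \<in> {0..1} \<Longrightarrow> d (q \<nu> (z k, s)) (q \<nu> (z k, s')) < 1 / real (Suc k)" by metis
  obtain w r where w: "w \<in> disk_set (n \<nu>)" "strict_mono (r :: nat \<Rightarrow> nat)" "(z \<circ> r) \<longlonglongrightarrow> w"
    using compact_disk_set[of "n \<nu>"] z(1) unfolding compact_def by metis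
  obtain s s' where s: "s \<in> {0..1}" "s' \<in> {0..1}" "q \<nu> (w, s) \<noteq> q \<nu> (w, s')"
    using cell_nonconstant[OF \<nu> w(1)] by blast
  have M: "q \<nu> (x, t) \<in> topspace (T l)" if "x \<in> disk_set (n \<nu>)" "t \<in> {0..1}" for x t
    by (rule cell_map_in[OF \<nu> that])
  define \<epsilon> where "\<epsilon> = d (q \<nu> (w, s)) (q \<nu> (w, s')) / 3"
  have \<epsilon>: "\<epsilon> > 0" using s M[OF w(1)] by (simp add: \<epsilon>_def)
  obtain \<delta> where \<delta>: "\<delta> > 0" "\<And>x y. x \<in> cylinder (n \<nu>) \<Longrightarrow> y \<in> cylinder (n \<nu>) \<Longrightarrow> dist x y < \<delta> \<Longrightarrow> d (q \<nu> x) (q \<nu> y) < \<epsilon>"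
    using cell_map_uniform[OF \<nu> \<epsilon>] by blast
  obtain N where N: "\<And>k. k \<ge> N \<Longrightarrow> dist (z (r k)) w < \<delta>"
    using w(3) \<delta>(1) unfolding LIMSEQ_def o_def by blast
  obtain N' :: nat where N': "real N' > 1 / \<epsilon>" using reals_Archimedean2 by blast
  let ?k = "r (max N N')"
  have "real (Suc ?k) > 1 / \<epsilon>" using seq_suble[OF w(2), of "max N N'"] N' by simp
  then have k: "1 / real (Suc ?k) < \<epsilon>" using \<epsilon> by (simp add: field_simps)
  have zk: "z ?k \<in> disk_set (n \<nu>)" by (rule z(1))
  have "dist (w, t) (z ?k, t) < \<delta>" for t :: real
    using N[of "max N N'"] by (simp add: dist_Pair_Pair dist_commute)
  then have 1: "d (q \<nu> (w, t)) (q \<nu> (z ?k, t)) < \<epsilon>" if "t \<in> {0..1}" for t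
    using \<delta>(2)[of "(w, t)" "(z ?k, t)"] w(1) zk that by simp
  have 2: "d (q \<nu> (z ?k, s)) (q \<nu> (z ?k, s')) < \<epsilon>" using z(2)[OF s(1,2), of ?k] k by linarith
  have "d (q \<nu> (w, s)) (q \<nu> (w, s')) \<le> d (q \<nu> (w, s)) (q \<nu> (z ?k, s)) + d (q \<nu> (z ?k, s)) (q \<nu> (w, s'))"
    by (intro triangle M w zk s)
  also have "\<dots> \<le> d (q \<nu> (w, s)) (q \<nu> (z ?k, s)) + (d (q \<nu> (z ?k, s)) (q \<nu> (z ?k, s')) + d (q \<nu> (z ?k, s')) (q \<nu> (w, s')))"
    by (intro add_left_mono triangle M w zk s)
  also have "\<dots> < 3 * \<epsilon>" using 1[OF s(1)] 1[OF s(2)] 2 commute[of "q \<nu> (z ?k, s')"] by simp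
  finally show False by (simp add: \<epsilon>_def)
qed

lemma chain_in:
  assumes "cs \<noteq> []" "linked q cs" "set cs \<subseteq> closed_cells" "0 \<le> s" "s \<le> real (length cs)"
  shows "chain q cs s \<in> topspace (T l)"
proof -
  obtain j r where j: "j < length cs" "0 \<le> r" "r \<le> 1" "s = real j + r" by (rule chain_eval[OF assms(2,1,4,5)])
  have "cs ! j \<in> closed_cells" using assms(3) j(1) nth_mem by blast
  then show ?thesis
    using chain_nth[OF assms(2) j(1-3)] cell_map_in[of "fst (cs ! j)" "snd (cs ! j)" r] j by (auto simp: closed_cells_def)
qed

lemma chain_uniform:
  assumes cs: "cs \<noteq> []" "linked q cs" "set cs \<subseteq> closed_cells" and \<epsilon>: "\<epsilon> > 0"
  obtains \<delta> where "\<delta> > 0" "\<And>s t. s \<in> {0..real (length cs)} \<Longrightarrow> t \<in> {0..real (length cs)} \<Longrightarrow>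
    \<bar>s - t\<bar> < \<delta> \<Longrightarrow> d (chain q cs s) (chain q cs t) < \<epsilon>"
proof -
  let ?L = "real (length cs)"
  have L: "?L > 0" using cs(1) by simp
  let ?\<gamma> = "restrict (chain q cs \<circ> (\<lambda>t. ?L * t)) {0..1}"
  have "?\<gamma> \<in> E"
    by (rule chain_execution[OF cs reparam_to_linear[OF L]])
  then obtain \<delta> where \<delta>0: "\<delta> > 0" "\<forall>s\<in>{0..1}. \<forall>t\<in>{0..1}. \<bar>s - t\<bar> < \<delta> \<longrightarrow> d (?\<gamma> s) (?\<gamma> t) < \<epsilon>"
    using path_uniformly_continuous[OF _ \<epsilon>] by meson
  have \<delta>: "\<delta> > 0" "d (chain q cs (?L * s)) (chain q cs (?L * t)) < \<epsilon>"
    if "s \<in> {0..1}" "t \<in> {0..1}" "\<bar>s - t\<bar> < \<delta>" for s t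
    using \<delta>0 that by simp_all
  have *: "d (chain q cs s) (chain q cs t) < \<epsilon>"
    if "s \<in> {0..?L}" "t \<in> {0..?L}" "\<bar>s - t\<bar> < \<delta> * ?L" for s t
  proof -
    have "\<bar>s / ?L - t / ?L\<bar> = \<bar>s - t\<bar> / ?L" using L by (simp add: diff_divide_distrib[symmetric] abs_divide)
    then have "\<bar>s / ?L - t / ?L\<bar> < \<delta>" using that(3) L by (simp add: divide_less_eq)
    moreover have "s / ?L \<in> {0..1}" "t / ?L \<in> {0..1}" using that L by (simp_all add: divide_le_eq)
    ultimately have "d (chain q cs (?L * (s / ?L))) (chain q cs (?L * (t / ?L))) < \<epsilon>" by (intro \<delta>(2))
    then show ?thesis using cs(1) by simp
  qed
  have "\<delta> * ?L > 0" using \<delta>0(1) L by simp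
  then show ?thesis by (rule that) (rule *)
qed

text \<open>An interval of length \<open>\<rho>\<close> contains an interval of the grid of mesh \<open>\<rho> / 2\<close>, and there are only
  finitely many of these in \<open>[0, length cs]\<close>.\<close>

lemma chain_oscillation:
  assumes cs: "cs \<noteq> []" "linked q cs" "set cs \<subseteq> open_cells" and \<rho>: "\<rho> > 0"
  shows "\<exists>\<kappa>>0. \<forall>a b. 0 \<le> a \<longrightarrow> b \<le> real (length cs) \<longrightarrow> a + \<rho> \<le> b \<longrightarrow>
    (\<exists>s s'. a \<le> s \<and> s \<le> b \<and> a \<le> s' \<and> s' \<le> b \<and> d (chain q cs s) (chain q cs s') \<ge> \<kappa>)"
proof -
  let ?L = "real (length cs)"
  define I where "I = {i::nat. real (Suc i) * (\<rho>/2) \<le> ?L}"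
  have "I \<subseteq> {..nat \<lceil>2 * ?L / \<rho>\<rceil>}"
  proof
    fix i assume "i \<in> I"
    then have "real (Suc i) \<le> 2 * ?L / \<rho>" using \<rho> by (simp add: I_def field_simps)
    then show "i \<in> {..nat \<lceil>2 * ?L / \<rho>\<rceil>}" by simp linarith
  qed
  then have "finite I" by (rule finite_subset) simp
  then have "\<exists>\<kappa>>0. \<forall>i\<in>I. \<exists>s s'. real i * (\<rho>/2) \<le> s \<and> s \<le> real (Suc i) * (\<rho>/2) \<and>
      real i * (\<rho>/2) \<le> s' \<and> s' \<le> real (Suc i) * (\<rho>/2) \<and> d (chain q cs s) (chain q cs s') \<ge> \<kappa>"
  proof (rule finite_common_radius)
    fix i assume i: "i \<in> I"
    have "real i * (\<rho>/2) < real (Suc i) * (\<rho>/2)" using \<rho> by simp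
    then obtain s s' where s: "real i * (\<rho>/2) \<le> s" "s \<le> real (Suc i) * (\<rho>/2)"
      "real i * (\<rho>/2) \<le> s'" "s' \<le> real (Suc i) * (\<rho>/2)" "chain q cs s \<noteq> chain q cs s'"
      using chain_nonconstant[OF cs, of "real i * (\<rho>/2)" "real (Suc i) * (\<rho>/2)"] i \<rho> by (auto simp: I_def)
    have "0 \<le> real i * (\<rho>/2)" using \<rho> by simp
    then have b: "0 \<le> s" "s \<le> ?L" "0 \<le> s'" "s' \<le> ?L" using s i by (auto simp: I_def)
    have cl: "set cs \<subseteq> closed_cells" using cs(3) open_cells_subset by blast
    have "d (chain q cs s) (chain q cs s') > 0"
      using s(5) chain_in[OF cs(1,2) cl b(1,2)] chain_in[OF cs(1,2) cl b(3,4)] by simp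
    then show "\<exists>\<kappa>>0. \<exists>s s'. real i * (\<rho>/2) \<le> s \<and> s \<le> real (Suc i) * (\<rho>/2) \<and>
      real i * (\<rho>/2) \<le> s' \<and> s' \<le> real (Suc i) * (\<rho>/2) \<and> d (chain q cs s) (chain q cs s') \<ge> \<kappa>"
      using s by blast
  qed (meson order_trans)
  then obtain \<kappa> where \<kappa>: "\<kappa> > 0" "\<And>i. i \<in> I \<Longrightarrow> \<exists>s s'. real i * (\<rho>/2) \<le> s \<and> s \<le> real (Suc i) * (\<rho>/2) \<and>
      real i * (\<rho>/2) \<le> s' \<and> s' \<le> real (Suc i) * (\<rho>/2) \<and> d (chain q cs s) (chain q cs s') \<ge> \<kappa>" by blast
  have "\<exists>s s'. a \<le> s \<and> s \<le> b \<and> a \<le> s' \<and> s' \<le> b \<and> d (chain q cs s) (chain q cs s') \<ge> \<kappa>"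
    if ab: "0 \<le> a" "b \<le> ?L" "a + \<rho> \<le> b" for a b
  proof -
    define i where "i = nat \<lceil>a / (\<rho>/2)\<rceil>"
    have "0 \<le> a / (\<rho>/2)" using ab(1) \<rho> by simp
    then have "a / (\<rho>/2) \<le> real i" "real i < a / (\<rho>/2) + 1" unfolding i_def by linarith+
    then have i: "a \<le> real i * (\<rho>/2)" "real i * (\<rho>/2) < a + \<rho>/2"
      using \<rho> by (auto simp: field_simps)
    have "real (Suc i) * (\<rho>/2) = real i * (\<rho>/2) + \<rho>/2" by (simp add: algebra_simps)
    then have ib: "real (Suc i) * (\<rho>/2) \<le> b" using i ab by linarith
    then have "i \<in> I" using ab(2) by (simp add: I_def)
    from \<kappa>(2)[OF this] show ?thesis using i(1) ib by (meson order_trans)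
  qed
  then show ?thesis using \<kappa>(1) by blast
qed

end

section \<open>Local path-connectedness of spaces of execution paths\<close>

context metrized_cellular
begin

text \<open>The image of \<open>\<gamma>\<close> has a neighbourhood \<open>W\<close> that meets a finite set \<open>F\<close> of cells, and paths close to
  \<open>\<gamma>\<close> stay in \<open>W\<close>. The segments of the cells in \<open>F\<close> oscillate by at least some \<open>e > 0\<close>, whereas
  \<open>\<gamma>\<close> moves by less than \<open>e / 3\<close> during a time shorter than \<open>\<delta>\<close>. A chain close to \<open>\<gamma>\<close> therefore
  spends at least the time \<open>\<delta>\<close> on every segment.\<close>

lemma bounded_pattern:
  assumes \<gamma>: "\<gamma> \<in> E"
  shows "\<exists>\<eta>>0. \<exists>F B. finite F \<and> F \<subseteq> {..<l} \<and> (\<forall>cs \<psi>. cs \<noteq> [] \<longrightarrow> linked q cs \<longrightarrow> set cs \<subseteq> open_cells \<longrightarrow>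
    \<psi> \<in> reparam_to P (length cs) \<longrightarrow> u \<gamma> (restrict (chain q cs \<circ> \<psi>) {0..1}) < \<eta> \<longrightarrow>
    fst ` set cs \<subseteq> F \<and> length cs \<le> (B::nat))"
proof -
  have "compactin (T l) (\<gamma> ` {0..1})"
    using image_compactin[OF _ path_continuous[OF \<gamma>]] by (simp add: mtopology_T compactin_subtopology)
  then obtain W where W: "openin (T l) W" "\<gamma> ` {0..1} \<subseteq> W"
    "finite {\<nu>. \<nu> < l \<and> q \<nu> ` cylinder (n \<nu>) \<inter> W \<noteq> {}}"
    using compact_nbhd_finite_cells by blast
  define F where "F = {\<nu>. \<nu> < l \<and> q \<nu> ` cylinder (n \<nu>) \<inter> W \<noteq> {}}"
  have "openin path.mtopology {\<gamma> \<in> E. \<gamma> ` {0..1} \<subseteq> W}"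
    by (rule compact_open_subbase_open) (use W(1) in \<open>auto simp: mtopology_T compactin_subtopology\<close>)
  then obtain \<eta>1 where \<eta>1: "\<eta>1 > 0" "path.mball \<gamma> \<eta>1 \<subseteq> {\<gamma> \<in> E. \<gamma> ` {0..1} \<subseteq> W}"
    unfolding path.openin_mtopology using \<gamma> W(2) by blast
  have "\<exists>e>0. \<forall>\<nu>\<in>F. \<forall>z\<in>disk_set (n \<nu>). \<exists>s\<in>{0..1}. \<exists>s'\<in>{0..1}. d (q \<nu> (z, s)) (q \<nu> (z, s')) \<ge> e"
  proof (rule finite_common_radius)
    show "finite F" using W(3) by (simp add: F_def)
    show "\<exists>e>0. \<forall>z\<in>disk_set (n \<nu>). \<exists>s\<in>{0..1}. \<exists>s'\<in>{0..1}. d (q \<nu> (z, s)) (q \<nu> (z, s')) \<ge> e" if "\<nu> \<in> F" for \<nu>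
      using cell_oscillation[of \<nu>] that by (simp add: F_def)
  qed (meson order_trans)
  then obtain e where e: "e > 0" "\<And>\<nu> z. \<nu> \<in> F \<Longrightarrow> z \<in> disk_set (n \<nu>) \<Longrightarrow>
      \<exists>s\<in>{0..1}. \<exists>s'\<in>{0..1}. d (q \<nu> (z, s)) (q \<nu> (z, s')) \<ge> e" by blast
  obtain \<delta> where \<delta>: "\<delta> > 0" "\<And>s t. s \<in> {0..1} \<Longrightarrow> t \<in> {0..1} \<Longrightarrow> \<bar>s - t\<bar> < \<delta> \<Longrightarrow> d (\<gamma> s) (\<gamma> t) < e/3"
    using path_uniformly_continuous[OF \<gamma>, of "e/3"] e(1) by auto
  define \<eta> where "\<eta> = min \<eta>1 (e/3)"
  define B where "B = nat \<lceil>1 / \<delta>\<rceil>"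
  have main: "fst ` set cs \<subseteq> F \<and> length cs \<le> B"
    if cs: "cs \<noteq> []" "linked q cs" "set cs \<subseteq> open_cells" and \<psi>: "\<psi> \<in> reparam_to P (length cs)"
      and close: "u \<gamma> (restrict (chain q cs \<circ> \<psi>) {0..1}) < \<eta>" for cs \<psi>
  proof
    let ?\<gamma> = "restrict (chain q cs \<circ> \<psi>) {0..1}"
    let ?L = "length cs"
    have cl: "set cs \<subseteq> closed_cells" using cs(3) open_cells_subset by blast
    have \<gamma>': "?\<gamma> \<in> E" by (rule chain_execution[OF cs(1,2) cl \<psi>])
    have "?\<gamma> \<in> path.mball \<gamma> \<eta>1" using close \<gamma> \<gamma>' by (simp add: \<eta>_def)
    then have inW: "?\<gamma> ` {0..1} \<subseteq> W" using \<eta>1(2) by blast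
    have eval: "\<exists>t\<in>{a..b}. ?\<gamma> t = q (fst (cs ! j)) (snd (cs ! j), r)"
      if j: "j < ?L" "0 \<le> r" "r \<le> 1" and ab: "0 \<le> a" "a \<le> b" "b \<le> 1" "\<psi> a \<le> real j + r" "real j + r \<le> \<psi> b" for j r a b
    proof -
      obtain t where t: "a \<le> t" "t \<le> b" "\<psi> t = real j + r" by (rule reparam_to_IVT[OF \<psi> ab])
      then show ?thesis using chain_nth[OF cs(2) j] ab by (intro bexI[of _ t]) auto
    qed
    note p = reparam_toD[OF \<psi>]
    show F: "fst ` set cs \<subseteq> F"
    proof
      fix \<nu> assume "\<nu> \<in> fst ` set cs"
      then obtain j where j: "j < ?L" "\<nu> = fst (cs ! j)" by (auto simp: in_set_conv_nth)
      have "cs ! j \<in> closed_cells" using cl j(1) nth_mem by blast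
      then have c: "\<nu> < l" "snd (cs ! j) \<in> disk_set (n \<nu>)" using j(2) by (auto simp: closed_cells_def)
      obtain t where "t \<in> {0..1}" "?\<gamma> t = q \<nu> (snd (cs ! j), 0)"
        using eval[of j 0 0 1] j p(2,3) by auto
      then have "q \<nu> (snd (cs ! j), 0) \<in> W" using inW by (metis image_subset_iff)
      moreover have "q \<nu> (snd (cs ! j), 0) \<in> q \<nu> ` cylinder (n \<nu>)" using c(2) by (intro imageI) auto
      ultimately show "\<nu> \<in> F" using c(1) unfolding F_def by blast
    qed
    have "\<exists>t. 0 \<le> t \<and> t \<le> 1 \<and> \<psi> t = real j" if "j \<le> ?L" for j
      using reparam_to_surj[OF \<psi>, of "real j"] that by auto
    then obtain \<tau> where \<tau>: "\<And>j. j \<le> ?L \<Longrightarrow> 0 \<le> \<tau> j \<and> \<tau> j \<le> 1 \<and> \<psi> (\<tau> j) = real j" by metis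
    have gap: "\<tau> j + \<delta> \<le> \<tau> (Suc j)" if j: "j < ?L" for j
    proof (rule ccontr)
      assume "\<not> ?thesis"
      then have small: "\<tau> (Suc j) - \<tau> j < \<delta>" by simp
      have \<tau>j: "0 \<le> \<tau> j" "\<tau> j \<le> 1" "\<psi> (\<tau> j) = real j" "0 \<le> \<tau> (Suc j)" "\<tau> (Suc j) \<le> 1" "\<psi> (\<tau> (Suc j)) = real j + 1"
        using \<tau>[of j] \<tau>[of "Suc j"] j by auto
      have le: "\<tau> j \<le> \<tau> (Suc j)"
      proof (rule ccontr)
        assume "\<not> ?thesis"
        then have "\<psi> (\<tau> (Suc j)) \<le> \<psi> (\<tau> j)" using p(4)[of "\<tau> (Suc j)" "\<tau> j"] \<tau>j by simp
        then show False using \<tau>j by simp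
      qed
      have "cs ! j \<in> closed_cells" using cl j nth_mem by blast
      then have z: "snd (cs ! j) \<in> disk_set (n (fst (cs ! j)))" by (auto simp: closed_cells_def)
      have "fst (cs ! j) \<in> F" using F j nth_mem by blast
      then obtain s s' where s: "s \<in> {0..1}" "s' \<in> {0..1}"
        "d (q (fst (cs ! j)) (snd (cs ! j), s)) (q (fst (cs ! j)) (snd (cs ! j), s')) \<ge> e"
        using e(2) z by blast
      obtain t where t: "t \<in> {\<tau> j..\<tau> (Suc j)}" "?\<gamma> t = q (fst (cs ! j)) (snd (cs ! j), s)"
        using eval[of j s "\<tau> j" "\<tau> (Suc j)"] j s(1) \<tau>j le by auto
      obtain t' where t': "t' \<in> {\<tau> j..\<tau> (Suc j)}" "?\<gamma> t' = q (fst (cs ! j)) (snd (cs ! j), s')"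
        using eval[of j s' "\<tau> j" "\<tau> (Suc j)"] j s(2) \<tau>j le by auto
      have t01: "t \<in> {0..1}" "t' \<in> {0..1}" using t(1) t'(1) \<tau>j by auto
      have "\<bar>t - t'\<bar> < \<delta>" using t(1) t'(1) small by auto
      then have 1: "d (\<gamma> t) (\<gamma> t') < e/3" using \<delta>(2) t01 by blast
      have 2: "d (\<gamma> x) (?\<gamma> x) < e/3" if "x \<in> {0..1}" for x
        using u_ge[OF \<gamma> \<gamma>' that] close by (simp add: \<eta>_def)
      note M = path_in[OF \<gamma>] path_in[OF \<gamma>']
      have "d (?\<gamma> t) (?\<gamma> t') \<le> d (?\<gamma> t) (\<gamma> t) + d (\<gamma> t) (?\<gamma> t')"
        by (rule triangle) (use M t01 in blast)+
      also have "\<dots> \<le> d (?\<gamma> t) (\<gamma> t) + (d (\<gamma> t) (\<gamma> t') + d (\<gamma> t') (?\<gamma> t'))"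
        by (rule add_left_mono, rule triangle) (use M t01 in blast)+
      also have "\<dots> < e" using 1 2[OF t01(1)] 2[OF t01(2)] commute[of "?\<gamma> t" "\<gamma> t"] by linarith
      finally show False using s(3) unfolding t(2) t'(2) by simp
    qed
    have "j \<le> ?L \<Longrightarrow> real j * \<delta> \<le> \<tau> j" for j
    proof (induction j)
      case 0
      then show ?case using \<tau>[of 0] by simp
    next
      case (Suc j)
      then show ?case using gap[of j] by (simp add: algebra_simps)
    qed
    from this[of ?L] have "real ?L * \<delta> \<le> 1" using \<tau>[of ?L] by simp
    then have "real ?L \<le> 1 / \<delta>" using \<delta>(1) by (simp add: field_simps)
    then show "?L \<le> B" unfolding B_def by linarith
  qed
  have "\<eta> > 0" using \<eta>1(1) e(1) by (simp add: \<eta>_def)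
  moreover have "finite F" "F \<subseteq> {..<l}" using W(3) by (auto simp: F_def)
  ultimately show ?thesis using main by blast
qed

text \<open>This separates the combinatorial part of a chain, the sequence \<open>N\<close> of its cells, from the points
  of the disks.\<close>

definition pattern_chain :: "'i list \<Rightarrow> (nat \<Rightarrow> nat \<Rightarrow> real) \<Rightarrow> ('i \<times> (nat \<Rightarrow> real)) list" where
  "pattern_chain N z = map (\<lambda>j. (N ! j, z j)) [0..<length N]"

lemma length_pattern_chain [simp]: "length (pattern_chain N z) = length N"
  by (simp add: pattern_chain_def)

lemma nth_pattern_chain [simp]: "j < length N \<Longrightarrow> pattern_chain N z ! j = (N ! j, z j)"
  by (simp add: pattern_chain_def)

lemma map_fst_pattern_chain [simp]: "map fst (pattern_chain N z) = N"
  by (rule nth_equalityI) simp_all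

lemma pattern_chain_self: "pattern_chain (map fst cs) (\<lambda>j. snd (cs ! j)) = cs"
  by (rule nth_equalityI) simp_all

lemma pattern_chain_closed:
  assumes "\<And>j. j < length N \<Longrightarrow> N ! j < l \<and> z j \<in> disk_set (n (N ! j))"
  shows "set (pattern_chain N z) \<subseteq> closed_cells"
  using assms by (auto simp: pattern_chain_def closed_cells_def)

lemma pattern_chain_close:
  assumes N: "N \<noteq> []" "\<And>j. j < length N \<Longrightarrow> N ! j < l" and \<epsilon>: "\<epsilon> > 0"
  shows "\<exists>\<delta>>0. \<forall>z w s. linked q (pattern_chain N z) \<longrightarrow>
    (\<forall>j<length N. z j \<in> disk_set (n (N ! j)) \<and> w j \<in> disk_set (n (N ! j)) \<and> dist (z j) (w j) < \<delta>) \<longrightarrow>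
    0 \<le> s \<longrightarrow> s \<le> real (length N) \<longrightarrow> d (chain q (pattern_chain N z) s) (chain q (pattern_chain N w) s) < \<epsilon>"
proof -
  have "\<exists>\<delta>>0. \<forall>\<nu>\<in>set N. \<forall>x\<in>cylinder (n \<nu>). \<forall>y\<in>cylinder (n \<nu>). dist x y < \<delta> \<longrightarrow> d (q \<nu> x) (q \<nu> y) < \<epsilon>"
  proof (rule finite_common_radius)
    show "\<exists>\<delta>>0. \<forall>x\<in>cylinder (n \<nu>). \<forall>y\<in>cylinder (n \<nu>). dist x y < \<delta> \<longrightarrow> d (q \<nu> x) (q \<nu> y) < \<epsilon>" if "\<nu> \<in> set N" for \<nu>
      by (rule cell_map_uniform[OF _ \<epsilon>]) (use that N(2) in \<open>auto simp: in_set_conv_nth\<close>)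
  qed (simp, meson order_less_le_trans)
  then obtain \<delta> where \<delta>: "\<delta> > 0" "\<And>\<nu> x y. \<nu> \<in> set N \<Longrightarrow> x \<in> cylinder (n \<nu>) \<Longrightarrow> y \<in> cylinder (n \<nu>) \<Longrightarrow>
      dist x y < \<delta> \<Longrightarrow> d (q \<nu> x) (q \<nu> y) < \<epsilon>" by blast
  have "d (chain q (pattern_chain N z) s) (chain q (pattern_chain N w) s) < \<epsilon>"
    if A: "linked q (pattern_chain N z)"
      "\<forall>j<length N. z j \<in> disk_set (n (N ! j)) \<and> w j \<in> disk_set (n (N ! j)) \<and> dist (z j) (w j) < \<delta>"
      "0 \<le> s" "s \<le> real (length N)" for z w s
  proof -
    have "pattern_chain N z \<noteq> []" using N(1) by (simp add: pattern_chain_def)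
    then obtain j r where j: "j < length (pattern_chain N z)" "0 \<le> r" "r \<le> 1"
      "\<And>cs'. linked q cs' \<Longrightarrow> length cs' = length (pattern_chain N z) \<Longrightarrow> chain q cs' s = q (fst (cs' ! j)) (snd (cs' ! j), r)"
      using chain_eval[OF A(1) _ A(3)] A(4) by (metis length_pattern_chain)
    have lw: "linked q (pattern_chain N w)" using A(1) by (simp add: linked_fst)
    have jN: "j < length N" using j(1) by simp
    have "d (q (N ! j) (z j, r)) (q (N ! j) (w j, r)) < \<epsilon>"
      by (rule \<delta>(2)) (use jN A(2) j(2,3) in \<open>auto simp: dist_Pair_Pair\<close>)
    then show ?thesis using j(4)[OF A(1)] j(4)[OF lw] jN by simp
  qed
  then show ?thesis using \<delta>(1) by blast
qed

lemma path_component_of_homotopy: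
  fixes H :: "real \<Rightarrow> real \<Rightarrow> 'a"
  assumes H: "\<And>s. s \<in> {0..1} \<Longrightarrow> H s \<in> A \<and> H s \<in> E \<and> u \<gamma> (H s) < \<epsilon>" and \<gamma>: "\<gamma> \<in> E"
    and cont: "\<And>s \<eta>. s \<in> {0..1} \<Longrightarrow> \<eta> > 0 \<Longrightarrow> \<exists>\<delta>>0. \<forall>s'\<in>{0..1}. \<bar>s - s'\<bar> < \<delta> \<longrightarrow>
      (\<forall>t\<in>{0..1}. d (H s t) (H s' t) < \<eta>)"
  shows "path_component_of (subtopology path.mtopology (A \<inter> path.mball \<gamma> \<epsilon>)) (H 0) (H 1)"
proof -
  have "continuous_map unit_interval path.mtopology H"
    unfolding path.continuous_map_to_metric
  proof (intro ballI allI impI)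
    fix s and \<eta> :: real assume s: "s \<in> topspace unit_interval" and \<eta>: "\<eta> > 0"
    then have s01: "s \<in> {0..1}" by simp
    obtain \<delta> where \<delta>: "\<delta> > 0" "\<And>s' t. s' \<in> {0..1} \<Longrightarrow> \<bar>s - s'\<bar> < \<delta> \<Longrightarrow> t \<in> {0..1} \<Longrightarrow> d (H s t) (H s' t) < \<eta>/2"
      using cont[OF s01, of "\<eta>/2"] \<eta> by auto
    have "H s' \<in> path.mball (H s) \<eta>" if "s' \<in> {0..1} \<inter> ball s \<delta>" for s'
    proof -
      have s': "s' \<in> {0..1}" "\<bar>s - s'\<bar> < \<delta>" using that by (auto simp: dist_real_def)
      have "u (H s) (H s') \<le> \<eta>/2"
        by (rule u_le) (use H[OF s01] H[OF s'(1)] \<delta>(2)[OF s'] in \<open>auto intro: order_less_imp_le\<close>)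
      then show ?thesis using H[OF s01] H[OF s'(1)] \<eta> by simp
    qed
    moreover have "openin unit_interval ({0..1} \<inter> ball s \<delta>)" by (rule openin_open_Int) simp
    ultimately show "\<exists>U. openin unit_interval U \<and> s \<in> U \<and> (\<forall>y\<in>U. H y \<in> path.mball (H s) \<eta>)"
      using s01 \<delta>(1) by (intro exI[of _ "{0..1} \<inter> ball s \<delta>"]) auto
  qed
  moreover have "H ` {0..1} \<subseteq> A \<inter> path.mball \<gamma> \<epsilon>" using H \<gamma> by auto
  ultimately have "pathin (subtopology path.mtopology (A \<inter> path.mball \<gamma> \<epsilon>)) H"
    unfolding pathin_def continuous_map_in_subtopology by auto
  then show ?thesis unfolding path_component_of_def by blast
qed

text \<open>If \<open>\<theta> k\<close> grew by \<open>e\<close> during a short time, the path \<open>chain q cs \<circ> \<theta> k\<close> would oscillate by the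
  amount \<open>\<kappa>\<close> of \<open>chain_oscillation\<close> during this time, although it is close to \<open>\<gamma>\<close>. So the \<open>\<theta> k\<close> are
  equicontinuous, and the Arzela-Ascoli theorem provides \<open>\<theta>'\<close>. In the case of homeomorphisms, \<open>\<theta>'\<close>
  is strictly increasing, since \<open>\<gamma>\<close> would otherwise be constant on some interval.\<close>

lemma chain_limit:
  assumes cs: "cs \<noteq> []" "linked q cs" "set cs \<subseteq> open_cells" and \<gamma>: "\<gamma> \<in> E"
    and \<theta>: "\<And>k. \<theta> k \<in> reparam_to P (length cs)"
    and lim: "\<And>\<eta>. \<eta> > 0 \<Longrightarrow> \<exists>K. \<forall>k\<ge>K. u \<gamma> (restrict (chain q cs \<circ> \<theta> k) {0..1}) < \<eta>"
  shows "\<exists>\<theta>' r. \<theta>' \<in> reparam_to P (length cs) \<and> \<gamma> = restrict (chain q cs \<circ> \<theta>') {0..1} \<and>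
    strict_mono (r :: nat \<Rightarrow> nat) \<and> (\<forall>e>0. \<exists>K. \<forall>k\<ge>K. \<forall>t\<in>{0..1}. \<bar>\<theta> (r k) t - \<theta>' t\<bar> < e)"
proof -
  let ?L = "real (length cs)"
  have cl: "set cs \<subseteq> closed_cells" using cs(3) open_cells_subset by blast
  let ?\<gamma> = "\<lambda>k. restrict (chain q cs \<circ> \<theta> k) {0..1}"
  have \<gamma>k: "?\<gamma> k \<in> E" for k by (rule chain_execution[OF cs(1,2) cl \<theta>])
  note p = reparam_toD[OF \<theta>]
  have equi: "\<exists>\<delta>>0. \<forall>k t. t \<in> {0..1} \<and> norm (t0 - t) < \<delta> \<longrightarrow> norm (\<theta> k t0 - \<theta> k t) < e"
    if t0: "t0 \<in> {0..1}" and e: "0 < e" for t0 e :: real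
  proof -
    obtain \<kappa> where \<kappa>: "\<kappa> > 0" "\<And>a b. 0 \<le> a \<Longrightarrow> b \<le> ?L \<Longrightarrow> a + e \<le> b \<Longrightarrow>
      \<exists>s s'. a \<le> s \<and> s \<le> b \<and> a \<le> s' \<and> s' \<le> b \<and> d (chain q cs s) (chain q cs s') \<ge> \<kappa>"
      using chain_oscillation[OF cs e] by blast
    obtain \<delta>1 where \<delta>1: "\<delta>1 > 0" "\<And>s t. s \<in> {0..1} \<Longrightarrow> t \<in> {0..1} \<Longrightarrow> \<bar>s - t\<bar> < \<delta>1 \<Longrightarrow> d (\<gamma> s) (\<gamma> t) < \<kappa>/3"
      using path_uniformly_continuous[OF \<gamma>, of "\<kappa>/3"] \<kappa>(1) by auto
    obtain K where K: "\<And>k. k \<ge> K \<Longrightarrow> u \<gamma> (?\<gamma> k) < \<kappa>/3" using lim[of "\<kappa>/3"] \<kappa>(1) by auto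
    have ordered: "\<theta> k b - \<theta> k a < e" if k: "k \<ge> K" and ab: "a \<in> {0..1}" "b \<in> {0..1}" "a \<le> b" "b - a < \<delta>1" for k a b
    proof (rule ccontr)
      assume "\<not> ?thesis"
      then have "\<theta> k a + e \<le> \<theta> k b" by simp
      moreover have "0 \<le> \<theta> k a" "\<theta> k b \<le> ?L" using p(6)[of a k] p(6)[of b k] ab by auto
      ultimately obtain s s' where s: "\<theta> k a \<le> s" "s \<le> \<theta> k b" "\<theta> k a \<le> s'" "s' \<le> \<theta> k b"
        "d (chain q cs s) (chain q cs s') \<ge> \<kappa>" using \<kappa>(2) by blast
      have a0: "0 \<le> a" and b1: "b \<le> 1" using ab by auto
      obtain t where t: "a \<le> t" "t \<le> b" "\<theta> k t = s" by (rule reparam_to_IVT[OF \<theta> a0 ab(3) b1 s(1,2)])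
      obtain t' where t': "a \<le> t'" "t' \<le> b" "\<theta> k t' = s'" by (rule reparam_to_IVT[OF \<theta> a0 ab(3) b1 s(3,4)])
      have t01: "t \<in> {0..1}" "t' \<in> {0..1}" using t t' ab by auto
      have 1: "d (\<gamma> t) (\<gamma> t') < \<kappa>/3" by (rule \<delta>1(2)[OF t01]) (use t t' ab in auto)
      have 2: "d (\<gamma> x) (?\<gamma> k x) < \<kappa>/3" if "x \<in> {0..1}" for x
        using u_ge[OF \<gamma> \<gamma>k that, of k] K[OF k] by linarith
      note M = path_in[OF \<gamma>] path_in[OF \<gamma>k]
      have "d (?\<gamma> k t) (?\<gamma> k t') \<le> d (?\<gamma> k t) (\<gamma> t) + d (\<gamma> t) (?\<gamma> k t')"
        by (rule triangle) (use M t01 in blast)+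
      also have "\<dots> \<le> d (?\<gamma> k t) (\<gamma> t) + (d (\<gamma> t) (\<gamma> t') + d (\<gamma> t') (?\<gamma> k t'))"
        by (rule add_left_mono, rule triangle) (use M t01 in blast)+
      also have "\<dots> < \<kappa>" using 1 2[OF t01(1)] 2[OF t01(2)] commute[of "?\<gamma> k t" "\<gamma> t"] by linarith
      finally show False using s(5) t01 t(3) t'(3) by simp
    qed
    \<comment> \<open>The finitely many \<open>\<theta> k\<close> that are not yet close to the limit are each uniformly continuous.\<close>
    have "\<exists>\<delta>>0. \<forall>k\<in>{..<K}. \<forall>t\<in>{0..1}. \<bar>t0 - t\<bar> < \<delta> \<longrightarrow> \<bar>\<theta> k t0 - \<theta> k t\<bar> < e"
    proof (rule finite_common_radius)
      fix k
      have "uniformly_continuous_on {0..1} (\<theta> k)" by (rule compact_uniformly_continuous[OF p(1)]) simp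
      then show "\<exists>\<delta>>0. \<forall>t\<in>{0..1}. \<bar>t0 - t\<bar> < \<delta> \<longrightarrow> \<bar>\<theta> k t0 - \<theta> k t\<bar> < e"
        using t0 e unfolding uniformly_continuous_on_def dist_real_def by (metis abs_minus_commute)
    qed (simp, meson order_less_le_trans)
    then obtain \<delta>2 where \<delta>2: "\<delta>2 > 0" "\<And>k t. k < K \<Longrightarrow> t \<in> {0..1} \<Longrightarrow> \<bar>t0 - t\<bar> < \<delta>2 \<Longrightarrow> \<bar>\<theta> k t0 - \<theta> k t\<bar> < e"
      by blast
    have "\<bar>\<theta> k t0 - \<theta> k t\<bar> < e" if t: "t \<in> {0..1}" "\<bar>t0 - t\<bar> < min \<delta>1 \<delta>2" for k t
    proof (cases "k < K")
      case True
      then show ?thesis using \<delta>2(2) t by simp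
    next
      case False
      then have k: "k \<ge> K" by simp
      show ?thesis
      proof (cases "t \<le> t0")
        case True
        then have "\<theta> k t \<le> \<theta> k t0" using p(4)[of t t0 k] t t0 by simp
        moreover have "t0 - t < \<delta>1" using t(2) True by simp
        ultimately show ?thesis using ordered[OF k t(1) t0 True] by simp
      next
        case False
        then have "t0 \<le> t" by simp
        moreover have "\<theta> k t0 \<le> \<theta> k t" using p(4)[of t0 t k] t t0 False by simp
        moreover have "t - t0 < \<delta>1" using t(2) False by simp
        ultimately show ?thesis using ordered[OF k t0 t(1)] by simp
      qed
    qed
    then show ?thesis using \<delta>1(1) \<delta>2(1) by (intro exI[of _ "min \<delta>1 \<delta>2"]) simp
  qed
  have bound: "norm (\<theta> k t) \<le> ?L" if "t \<in> {0..1}" for k t using p(6)[of t k] that by simp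
  obtain \<theta>' and r :: "nat \<Rightarrow> nat" where \<theta>': "continuous_on {0..1} \<theta>'" "strict_mono r"
    "\<And>e. 0 < e \<Longrightarrow> \<exists>K. \<forall>k t. k \<ge> K \<and> t \<in> {0..1} \<longrightarrow> norm (\<theta> (r k) t - \<theta>' t) < e"
    using Arzela_Ascoli[of "{0..1::real}" \<theta> ?L, OF compact_Icc bound equi] by blast
  have ptw: "(\<lambda>k. \<theta> (r k) t) \<longlonglongrightarrow> \<theta>' t" if "t \<in> {0..1}" for t
    by (rule LIMSEQ_I) (use \<theta>'(3) that in meson)
  have e0: "\<theta>' 0 = 0" using LIMSEQ_unique[OF ptw[of 0]] p(2) by simp
  have e1: "\<theta>' 1 = ?L" using LIMSEQ_unique[OF ptw[of 1]] p(3) by simp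
  have mono: "\<theta>' s \<le> \<theta>' t" if "0 \<le> s" "s \<le> t" "t \<le> 1" for s t
    by (rule LIMSEQ_le[OF ptw ptw]) (use that p(4) in auto)
  have range: "\<theta>' t \<in> {0..?L}" if "t \<in> {0..1}" for t
    using mono[of 0 t] mono[of t 1] e0 e1 that by auto
  have eq: "\<gamma> t = chain q cs (\<theta>' t)" if t: "t \<in> {0..1}" for t
  proof (rule ccontr)
    assume ne: "\<gamma> t \<noteq> chain q cs (\<theta>' t)"
    have M: "\<gamma> t \<in> topspace (T l)" "chain q cs (\<theta>' t) \<in> topspace (T l)"
      using path_in[OF \<gamma> t] chain_in[OF cs(1,2) cl, of "\<theta>' t"] range[OF t] by auto
    define \<epsilon> where "\<epsilon> = d (\<gamma> t) (chain q cs (\<theta>' t)) / 2"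
    have \<epsilon>: "\<epsilon> > 0" using ne M by (simp add: \<epsilon>_def)
    obtain \<delta> where \<delta>: "\<delta> > 0" "\<And>a b. a \<in> {0..?L} \<Longrightarrow> b \<in> {0..?L} \<Longrightarrow> \<bar>a - b\<bar> < \<delta> \<Longrightarrow> d (chain q cs a) (chain q cs b) < \<epsilon>"
      by (rule chain_uniform[OF cs(1,2) cl \<epsilon>]) (rule that)
    obtain K where K: "\<And>k. k \<ge> K \<Longrightarrow> u \<gamma> (?\<gamma> k) < \<epsilon>" using lim[OF \<epsilon>] by auto
    obtain K' where K': "\<And>k. k \<ge> K' \<Longrightarrow> \<bar>\<theta> (r k) t - \<theta>' t\<bar> < \<delta>"
      using LIMSEQ_D[OF ptw[OF t] \<delta>(1)] by auto
    let ?k = "r (max K K')"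
    have "?k \<ge> K" using seq_suble[OF \<theta>'(2), of "max K K'"] by simp
    then have "d (\<gamma> t) (?\<gamma> ?k t) < \<epsilon>" using u_ge[OF \<gamma> \<gamma>k t, of ?k] K[of ?k] by linarith
    moreover have "\<theta> ?k t \<in> {0..?L}" using p(6)[of t ?k] t by simp
    then have "d (chain q cs (\<theta> ?k t)) (chain q cs (\<theta>' t)) < \<epsilon>"
      using \<delta>(2) range[OF t] K'[of "max K K'"] by simp
    ultimately have "d (\<gamma> t) (?\<gamma> ?k t) + d (?\<gamma> ?k t) (chain q cs (\<theta>' t)) < 2 * \<epsilon>" using t by simp
    moreover have "d (\<gamma> t) (chain q cs (\<theta>' t)) \<le> d (\<gamma> t) (?\<gamma> ?k t) + d (?\<gamma> ?k t) (chain q cs (\<theta>' t))"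
      by (rule triangle[OF M(1) path_in[OF \<gamma>k t] M(2)])
    ultimately show False by (simp add: \<epsilon>_def)
  qed
  have "\<theta>' \<in> reparam_to P ?L"
  proof (rule reparam_toI)
    show "\<theta>' s \<le> \<theta>' t" if "0 \<le> s" "s < t" "t \<le> 1" for s t using mono that by simp
    show "\<theta>' s < \<theta>' t" if hom: "P = Homeos" and st: "0 \<le> s" "s < t" "t \<le> 1" for s t
    proof (rule ccontr)
      assume "\<not> \<theta>' s < \<theta>' t"
      then have c: "\<theta>' x = \<theta>' s" if "s \<le> x" "x \<le> t" for x
        using mono[of s x] mono[of x t] st that by simp
      obtain x x' where x: "s \<le> x" "x \<le> t" "s \<le> x'" "x' \<le> t" "\<gamma> x \<noteq> \<gamma> x'"
        using path_nonconstant[OF hom \<gamma> st] by blast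
      then have "\<gamma> x = chain q cs (\<theta>' s)" "\<gamma> x' = chain q cs (\<theta>' s)"
        using eq[of x] eq[of x'] c[of x] c[of x'] st by auto
      then show False using x(5) by simp
    qed
  qed (use \<theta>'(1) e0 e1 in auto)
  moreover have "\<gamma> = restrict (chain q cs \<circ> \<theta>') {0..1}"
  proof
    show "\<gamma> t = restrict (chain q cs \<circ> \<theta>') {0..1} t" for t
      using eq[of t] path_extensional[OF \<gamma>] by (auto simp: extensional_def)
  qed
  moreover have "\<forall>e>0. \<exists>K. \<forall>k\<ge>K. \<forall>t\<in>{0..1}. \<bar>\<theta> (r k) t - \<theta>' t\<bar> < e"
  proof (intro allI impI)
    fix e :: real assume "e > 0"
    from \<theta>'(3)[OF this] obtain K where "\<forall>k t. k \<ge> K \<and> t \<in> {0..1} \<longrightarrow> norm (\<theta> (r k) t - \<theta>' t) < e"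
      by (elim exE) (rule that)
    then show "\<exists>K. \<forall>k\<ge>K. \<forall>t\<in>{0..1}. \<bar>\<theta> (r k) t - \<theta>' t\<bar> < e"
      by (intro exI[of _ K]) auto
  qed
  ultimately show ?thesis using \<theta>'(2) by (intro exI[of _ \<theta>'] exI[of _ r]) blast
qed

lemma pattern_chain_between:
  assumes cs: "cs \<noteq> []" "map fst cs' = map fst cs" "\<psi> \<in> reparam_to P (length cs)" "\<psi>' \<in> reparam_to P (length cs)"
    and "restrict (chain q cs \<circ> \<psi>) {0..1} \<in> execution_paths_between (X l) \<alpha> \<beta>"
    and "restrict (chain q cs' \<circ> \<psi>') {0..1} \<in> E"
  shows "restrict (chain q cs' \<circ> \<psi>') {0..1} \<in> execution_paths_between (X l) \<alpha> \<beta>"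
proof -
  have cs': "cs' \<noteq> []" "length cs' = length cs" using cs(1,2) by (auto dest: map_eq_imp_length_eq)
  have "chain q cs' 0 = chain q cs 0" using chain_ends_fst(1)[OF cs(1)] chain_ends_fst(1)[OF cs'(1)] cs(2) by simp
  moreover have "chain q cs' (length cs) = chain q cs (length cs)"
    using chain_ends_fst(2)[OF cs(1)] chain_ends_fst(2)[OF cs'(1)] cs(2) cs'(2) by simp
  ultimately show ?thesis
    using assms(5,6) reparam_toD(2,3)[OF cs(3)] reparam_toD(2,3)[OF cs(4)]
    by (simp add: execution_paths_between_def)
qed

lemma move_parameters:
  assumes N: "N \<noteq> []" "\<And>j. j < length N \<Longrightarrow> N ! j < l"
    and z: "\<And>j. j < length N \<Longrightarrow> z j \<in> disk_set (n (N ! j)) \<and> w j \<in> disk_set (n (N ! j))"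
    and lk: "linked q (pattern_chain N z)" and \<psi>: "\<psi> \<in> reparam_to P (length N)"
    and A: "restrict (chain q (pattern_chain N z) \<circ> \<psi>) {0..1} \<in> execution_paths_between (X l) \<alpha> \<beta>"
    and \<gamma>: "\<gamma> \<in> E"
    and near: "\<And>s. s \<in> {0..1} \<Longrightarrow> u \<gamma> (restrict (chain q (pattern_chain N (\<lambda>j. interpolate s (z j) (w j))) \<circ> \<psi>) {0..1}) < \<epsilon>"
  shows "path_component_of (subtopology path.mtopology (execution_paths_between (X l) \<alpha> \<beta> \<inter> path.mball \<gamma> \<epsilon>))
    (restrict (chain q (pattern_chain N z) \<circ> \<psi>) {0..1}) (restrict (chain q (pattern_chain N w) \<circ> \<psi>) {0..1})"
proof -
  define c where "c s = pattern_chain N (\<lambda>j. interpolate s (z j) (w j))" for s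
  define H where "H s = restrict (chain q (c s) \<circ> \<psi>) {0..1}" for s
  have c: "c s \<noteq> []" "linked q (c s)" "length (c s) = length N" "map fst (c s) = N" for s
    using N(1) lk by (auto simp: c_def linked_fst pattern_chain_def[of N] o_def map_nth)
  have disk: "interpolate s (z j) (w j) \<in> disk_set (n (N ! j))" if "s \<in> {0..1}" "j < length N" for s j
    using interpolate_disk z[OF that(2)] that(1) by blast
  have HE: "H s \<in> E" if s: "s \<in> {0..1}" for s
  proof -
    have "set (c s) \<subseteq> closed_cells" unfolding c_def
      by (rule pattern_chain_closed) (use N(2) disk[OF s] in blast)
    then show ?thesis unfolding H_def using c \<psi> by (intro chain_execution) auto
  qed
  have "path_component_of (subtopology path.mtopology (execution_paths_between (X l) \<alpha> \<beta> \<inter> path.mball \<gamma> \<epsilon>)) (H 0) (H 1)"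
  proof (rule path_component_of_homotopy[OF _ \<gamma>])
    fix s :: real assume s: "s \<in> {0..1}"
    have "H s \<in> execution_paths_between (X l) \<alpha> \<beta>"
      unfolding H_def
      by (rule pattern_chain_between[OF _ _ _ _ A]) (use N(1) c \<psi> HE[OF s] in \<open>auto simp: H_def pattern_chain_def[of N z] o_def map_nth\<close>)
    then show "H s \<in> execution_paths_between (X l) \<alpha> \<beta> \<and> H s \<in> E \<and> u \<gamma> (H s) < \<epsilon>"
      using HE[OF s] near[OF s] by (simp add: H_def c_def)
  next
    fix s \<eta> :: real assume s: "s \<in> {0..1}" and \<eta>: "\<eta> > 0"
    obtain \<delta> where \<delta>: "\<delta> > 0" "\<And>z w s. linked q (pattern_chain N z) \<Longrightarrow>
      \<forall>j<length N. z j \<in> disk_set (n (N ! j)) \<and> w j \<in> disk_set (n (N ! j)) \<and> dist (z j) (w j) < \<delta> \<Longrightarrow>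
      0 \<le> s \<Longrightarrow> s \<le> real (length N) \<Longrightarrow> d (chain q (pattern_chain N z) s) (chain q (pattern_chain N w) s) < \<eta>"
      using pattern_chain_close[OF N \<eta>] by blast
    have "\<exists>\<delta>'>0. \<forall>j\<in>{..<length N}. \<forall>s'\<in>{0..1}. \<bar>s - s'\<bar> < \<delta>' \<longrightarrow> dist (interpolate s (z j) (w j)) (interpolate s' (z j) (w j)) < \<delta>"
    proof (rule finite_common_radius)
      fix j assume "j \<in> {..<length N}"
      then have zj: "z j \<in> disk_set (n (N ! j))" "w j \<in> disk_set (n (N ! j))" using z by auto
      obtain \<delta>' where \<delta>': "\<delta>' > 0" "\<forall>a\<in>disk_set (n (N ! j)). \<forall>b\<in>disk_set (n (N ! j)). \<forall>a'\<in>disk_set (n (N ! j)).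
        \<forall>b'\<in>disk_set (n (N ! j)). \<forall>s\<in>{0..1}. \<forall>s'\<in>{0..1}.
        dist ((a, b), s) ((a', b'), s') < \<delta>' \<longrightarrow> dist (interpolate s a b) (interpolate s' a' b') < \<delta>"
        using interpolate_uniform[OF \<delta>(1)] by blast
      have "dist (interpolate s (z j) (w j)) (interpolate s' (z j) (w j)) < \<delta>" if "s' \<in> {0..1}" "\<bar>s - s'\<bar> < \<delta>'" for s'
      proof -
        have "dist ((z j, w j), s) ((z j, w j), s') < \<delta>'" using that(2) by (simp add: dist_Pair_Pair dist_real_def)
        then show ?thesis using \<delta>'(2) zj s that(1) by blast
      qed
      then show "\<exists>\<delta>'>0. \<forall>s'\<in>{0..1}. \<bar>s - s'\<bar> < \<delta>' \<longrightarrow> dist (interpolate s (z j) (w j)) (interpolate s' (z j) (w j)) < \<delta>"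
        using \<delta>'(1) by blast
    qed (simp, meson order_less_le_trans)
    then obtain \<delta>' where \<delta>': "\<delta>' > 0" "\<And>j s'. j < length N \<Longrightarrow> s' \<in> {0..1} \<Longrightarrow> \<bar>s - s'\<bar> < \<delta>' \<Longrightarrow>
      dist (interpolate s (z j) (w j)) (interpolate s' (z j) (w j)) < \<delta>" by blast
    have "d (H s t) (H s' t) < \<eta>" if s': "s' \<in> {0..1}" "\<bar>s - s'\<bar> < \<delta>'" and t: "t \<in> {0..1}" for s' t
    proof -
      have "d (chain q (c s) (\<psi> t)) (chain q (c s') (\<psi> t)) < \<eta>"
        unfolding c_def
      proof (rule \<delta>(2))
        show "linked q (pattern_chain N (\<lambda>j. interpolate s (z j) (w j)))" using c(2)[of s] by (simp add: c_def)
        show "\<forall>j<length N. interpolate s (z j) (w j) \<in> disk_set (n (N ! j)) \<and> interpolate s' (z j) (w j) \<in> disk_set (n (N ! j)) \<and>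
          dist (interpolate s (z j) (w j)) (interpolate s' (z j) (w j)) < \<delta>"
          using disk[OF s] disk[OF s'(1)] \<delta>'(2)[OF _ s'] by blast
      qed (use reparam_toD(6)[OF \<psi>, of t] t in auto)
      then show ?thesis using t by (simp add: H_def)
    qed
    then show "\<exists>\<delta>>0. \<forall>s'\<in>{0..1}. \<bar>s - s'\<bar> < \<delta> \<longrightarrow> (\<forall>t\<in>{0..1}. d (H s t) (H s' t) < \<eta>)"
      using \<delta>'(1) by blast
  qed
  then show ?thesis by (simp add: H_def c_def)
qed

lemma move_reparametrization:
  assumes cs: "cs \<noteq> []" "linked q cs" "set cs \<subseteq> closed_cells"
    and \<psi>: "\<psi> \<in> reparam_to P (length cs)" "\<psi>' \<in> reparam_to P (length cs)"
    and A: "restrict (chain q cs \<circ> \<psi>) {0..1} \<in> execution_paths_between (X l) \<alpha> \<beta>"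
    and \<gamma>: "\<gamma> \<in> E"
    and near: "\<And>s. s \<in> {0..1} \<Longrightarrow> u \<gamma> (restrict (chain q cs \<circ> (\<lambda>t. (1 - s) * \<psi> t + s * \<psi>' t)) {0..1}) < \<epsilon>"
  shows "path_component_of (subtopology path.mtopology (execution_paths_between (X l) \<alpha> \<beta> \<inter> path.mball \<gamma> \<epsilon>))
    (restrict (chain q cs \<circ> \<psi>) {0..1}) (restrict (chain q cs \<circ> \<psi>') {0..1})"
proof -
  let ?L = "real (length cs)"
  define \<phi> where "\<phi> s t = (1 - s) * \<psi> t + s * \<psi>' t" for s t
  define H where "H s = restrict (chain q cs \<circ> \<phi> s) {0..1}" for s
  have \<phi>: "\<phi> s \<in> reparam_to P ?L" if "s \<in> {0..1}" for s
    unfolding \<phi>_def[abs_def] using reparam_to_convex[OF \<psi>] that by auto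
  have HE: "H s \<in> E" if s: "s \<in> {0..1}" for s
    unfolding H_def by (rule chain_execution[OF cs \<phi>[OF s]])
  have "path_component_of (subtopology path.mtopology (execution_paths_between (X l) \<alpha> \<beta> \<inter> path.mball \<gamma> \<epsilon>)) (H 0) (H 1)"
  proof (rule path_component_of_homotopy[OF _ \<gamma>])
    fix s :: real assume s: "s \<in> {0..1}"
    have "H s \<in> execution_paths_between (X l) \<alpha> \<beta>"
      unfolding H_def
      by (rule pattern_chain_between[OF cs(1) refl \<psi>(1) \<phi>[OF s] A]) (use HE[OF s] in \<open>simp add: H_def\<close>)
    then show "H s \<in> execution_paths_between (X l) \<alpha> \<beta> \<and> H s \<in> E \<and> u \<gamma> (H s) < \<epsilon>"
      using HE[OF s] near[OF s] by (simp add: H_def \<phi>_def[abs_def])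
  next
    fix s \<eta> :: real assume s: "s \<in> {0..1}" and \<eta>: "\<eta> > 0"
    obtain \<delta> where \<delta>: "\<delta> > 0" "\<And>a b. a \<in> {0..?L} \<Longrightarrow> b \<in> {0..?L} \<Longrightarrow> \<bar>a - b\<bar> < \<delta> \<Longrightarrow> d (chain q cs a) (chain q cs b) < \<eta>"
      by (rule chain_uniform[OF cs \<eta>]) (rule that)
    have L: "?L > 0" using cs(1) by simp
    have "d (H s t) (H s' t) < \<eta>" if s': "s' \<in> {0..1}" "\<bar>s - s'\<bar> < \<delta> / ?L" and t: "t \<in> {0..1}" for s' t
    proof -
      have r: "\<phi> s t \<in> {0..?L}" "\<phi> s' t \<in> {0..?L}" "0 \<le> \<psi> t" "\<psi> t \<le> ?L" "0 \<le> \<psi>' t" "\<psi>' t \<le> ?L"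
        using reparam_toD(6)[OF \<phi>[OF s], of t] reparam_toD(6)[OF \<phi>[OF s'(1)], of t]
          reparam_toD(6)[OF \<psi>(1), of t] reparam_toD(6)[OF \<psi>(2), of t] t by auto
      have "\<phi> s t - \<phi> s' t = (s - s') * (\<psi>' t - \<psi> t)" by (simp add: \<phi>_def algebra_simps)
      then have "\<bar>\<phi> s t - \<phi> s' t\<bar> = \<bar>s - s'\<bar> * \<bar>\<psi>' t - \<psi> t\<bar>" by (simp add: abs_mult)
      also have "\<dots> \<le> \<bar>s - s'\<bar> * ?L" using r(3-6) by (intro mult_left_mono) auto
      also have "\<dots> < \<delta>" using s'(2) L by (simp add: less_divide_eq)
      finally show ?thesis using \<delta>(2)[OF r(1,2)] t by (simp add: H_def)
    qed
    then show "\<exists>\<delta>>0. \<forall>s'\<in>{0..1}. \<bar>s - s'\<bar> < \<delta> \<longrightarrow> (\<forall>t\<in>{0..1}. d (H s t) (H s' t) < \<eta>)"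
      using \<delta>(1) L by (intro exI[of _ "\<delta> / ?L"]) auto
  qed
  moreover have "H 0 = restrict (chain q cs \<circ> \<psi>) {0..1}" "H 1 = restrict (chain q cs \<circ> \<psi>') {0..1}"
    by (simp_all add: H_def \<phi>_def[abs_def])
  ultimately show ?thesis by simp
qed

text \<open>Otherwise execution paths \<open>\<sigma> k\<close> converge to \<open>\<gamma>\<close> without being joined to it near \<open>\<gamma>\<close>. A
  subsequence follows one sequence \<open>N\<close> of cells, with points of the disks that converge to \<open>w\<close>. The
  path \<open>\<sigma> (r m)\<close> is joined to \<open>\<gamma>\<close> in two steps when \<open>m\<close> is large: its points are moved to \<open>w\<close>, which
  gives a reparametrization of a fixed chain, and then its reparametrization is moved to that of
  \<open>\<gamma>\<close>.\<close>

lemma nearby_paths_joined: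
  assumes \<gamma>: "\<gamma> \<in> execution_paths_between (X l) \<alpha> \<beta>" and \<epsilon>: "\<epsilon> > 0"
  shows "\<exists>\<delta>>0. \<forall>\<gamma>'\<in>execution_paths_between (X l) \<alpha> \<beta>. u \<gamma> \<gamma>' < \<delta> \<longrightarrow>
    path_component_of (subtopology path.mtopology (execution_paths_between (X l) \<alpha> \<beta> \<inter> path.mball \<gamma> \<epsilon>)) \<gamma> \<gamma>'"
proof (rule ccontr)
  let ?A = "execution_paths_between (X l) \<alpha> \<beta>"
  let ?R = "subtopology path.mtopology (?A \<inter> path.mball \<gamma> \<epsilon>)"
  assume no: "\<not> ?thesis"
  have AE: "x \<in> E" if "x \<in> ?A" for x using that by (simp add: execution_paths_between_def)
  have \<gamma>E: "\<gamma> \<in> E" by (rule AE[OF \<gamma>])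
  have "\<exists>\<gamma>'\<in>?A. u \<gamma> \<gamma>' < 1 / real (Suc k) \<and> \<not> path_component_of ?R \<gamma> \<gamma>'" for k
  proof -
    have "1 / real (Suc k) > 0" by simp
    then show ?thesis using no by blast
  qed
  then obtain \<sigma> where \<sigma>: "\<And>k. \<sigma> k \<in> ?A" "\<And>k. u \<gamma> (\<sigma> k) < 1 / real (Suc k)"
    "\<And>k. \<not> path_component_of ?R \<gamma> (\<sigma> k)" by metis
  have "\<exists>cs \<psi>. cs \<noteq> [] \<and> linked q cs \<and> set cs \<subseteq> open_cells \<and> \<psi> \<in> reparam_to P (length cs) \<and>
      \<sigma> k = restrict (chain q cs \<circ> \<psi>) {0..1}" for k
    using execution_chain[OF AE[OF \<sigma>(1)[of k]]] by metis
  then obtain cs \<psi> where cs: "\<And>k. cs k \<noteq> []" "\<And>k. linked q (cs k)" "\<And>k. set (cs k) \<subseteq> open_cells"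
    "\<And>k. \<psi> k \<in> reparam_to P (length (cs k))" "\<And>k. \<sigma> k = restrict (chain q (cs k) \<circ> \<psi> k) {0..1}" by metis
  obtain \<eta> F B where F: "\<eta> > 0" "finite F" "F \<subseteq> {..<l}"
    "\<And>cs \<psi>. cs \<noteq> [] \<Longrightarrow> linked q cs \<Longrightarrow> set cs \<subseteq> open_cells \<Longrightarrow> \<psi> \<in> reparam_to P (length cs) \<Longrightarrow>
      u \<gamma> (restrict (chain q cs \<circ> \<psi>) {0..1}) < \<eta> \<Longrightarrow> fst ` set cs \<subseteq> F \<and> length cs \<le> (B::nat)"
    using bounded_pattern[OF \<gamma>E] by metis
  obtain k0 :: nat where k0: "real k0 > 1 / \<eta>" using reals_Archimedean2 by blast
  have small: "1 / real (Suc k) < e" if "real k > 1 / e" "e > 0" for k e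
  proof -
    have "1 / e < real (Suc k)" using that(1) by simp
    then show ?thesis using that(2) by (simp add: field_simps)
  qed
  define pat where "pat k = map fst (cs k)" for k
  have pat: "pat k \<in> {xs. set xs \<subseteq> F \<and> length xs \<le> B}" if "k \<ge> k0" for k
  proof -
    have "real k > 1 / \<eta>" using k0 that by simp
    from small[OF this F(1)] have "u \<gamma> (\<sigma> k) < \<eta>" using \<sigma>(2)[of k] by linarith
    then show ?thesis using F(4)[OF cs(1-4), of k] unfolding cs(5)[of k] by (simp add: pat_def)
  qed
  \<comment> \<open>From \<open>k0\<close> on there are only finitely many sequences of cells, so one recurs infinitely often.\<close>
  have "infinite {k0..}" by (rule infinite_Ici)
  moreover have "finite (pat ` {k0..})"
    by (rule finite_subset[OF _ finite_lists_length_le[OF F(2), of B]]) (use pat in auto)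
  ultimately obtain a where a: "a \<in> {k0..}" "infinite {k \<in> {k0..}. pat k = pat a}"
    using pigeonhole_infinite by blast
  obtain r1 :: "nat \<Rightarrow> nat" where r1: "strict_mono r1" "\<And>k. r1 k \<in> {k \<in> {k0..}. pat k = pat a}"
    using infinite_enumerate[OF a(2)] by blast
  define N where "N = pat a"
  have N: "N \<noteq> []" "\<And>j. j < length N \<Longrightarrow> N ! j < l"
  proof -
    show "N \<noteq> []" using cs(1)[of a] by (simp add: N_def pat_def)
    show "N ! j < l" if "j < length N" for j
      using pat[of a] a(1) nth_mem[OF that] F(3) by (auto simp: N_def)
  qed
  have patr: "map fst (cs (r1 k)) = N" for k using r1(2)[of k] by (simp add: N_def pat_def)
  have lenr: "length (cs (r1 k)) = length N" for k using patr[of k] by (metis length_map)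
  have zin: "snd (cs (r1 k) ! j) \<in> disk_set (n (N ! j))" if "j < length N" for j k
  proof -
    have j: "j < length (cs (r1 k))" using that lenr by simp
    then have "cs (r1 k) ! j \<in> closed_cells" using cs(3) open_cells_subset nth_mem by blast
    moreover have "fst (cs (r1 k) ! j) = N ! j" using patr[of k] j by (metis nth_map)
    ultimately show ?thesis by (auto simp: closed_cells_def)
  qed
  obtain r2 w where r2: "strict_mono (r2 :: nat \<Rightarrow> nat)"
    "\<And>j. j < length N \<Longrightarrow> w j \<in> disk_set (n (N ! j)) \<and> (\<lambda>k. snd (cs (r1 (r2 k)) ! j)) \<longlonglongrightarrow> w j"
    using finitely_many_convergent_subsequences[of "length N" "\<lambda>j. disk_set (n (N ! j))" "\<lambda>k j. snd (cs (r1 k) ! j)"]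
      zin compact_disk_set by blast
  define r where "r k = r1 (r2 k)" for k
  define z where "z k j = snd (cs (r k) ! j)" for k j
  have r: "k \<le> r k" for k
    using seq_suble[OF r1(1), of "r2 k"] seq_suble[OF r2(1), of k] by (simp add: r_def)
  have csr: "cs (r k) = pattern_chain N (z k)" for k
    using pattern_chain_self[of "cs (r k)"] patr[of "r2 k"] by (simp add: r_def z_def[abs_def])
  have zdisk: "z k j \<in> disk_set (n (N ! j))" if "j < length N" for k j
    using zin[OF that] by (simp add: z_def r_def)
  have wdisk: "w j \<in> disk_set (n (N ! j))" and zlim: "(\<lambda>k. z k j) \<longlonglongrightarrow> w j" if "j < length N" for j
    using r2(2)[OF that] by (simp_all add: z_def r_def)
  have lkz: "linked q (pattern_chain N (z k))" for k using cs(2)[of "r k"] by (simp add: csr)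
  have lk: "linked q (pattern_chain N v)" for v using lkz[of 0] by (simp add: linked_fst)
  have \<psi>r: "\<psi> (r k) \<in> reparam_to P (length N)" for k using cs(4)[of "r k"] by (simp add: csr)
  have pne: "pattern_chain N v \<noteq> []" for v using N(1) by (simp add: pattern_chain_def)
  have pcl: "set (pattern_chain N v) \<subseteq> closed_cells" if "\<And>j. j < length N \<Longrightarrow> v j \<in> disk_set (n (N ! j))" for v
    by (rule pattern_chain_closed) (use that N(2) in blast)
  have pE: "restrict (chain q (pattern_chain N v) \<circ> \<psi> (r k)) {0..1} \<in> E"
    if "\<And>j. j < length N \<Longrightarrow> v j \<in> disk_set (n (N ! j))" for v k
    by (rule chain_execution[OF pne lk pcl[OF that]]) (simp_all add: \<psi>r)
  define H where "H k s = restrict (chain q (pattern_chain N (\<lambda>j. interpolate s (z k j) (w j))) \<circ> \<psi> (r k)) {0..1}" for k s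
  have HE: "H k s \<in> E" if "s \<in> {0..1}" for k s
    unfolding H_def by (rule pE) (use interpolate_disk zdisk wdisk that in blast)
  have closeH: "\<exists>K. \<forall>k\<ge>K. \<forall>s\<in>{0..1}. u (\<sigma> (r k)) (H k s) \<le> e" if e: "e > 0" for e
  proof -
    obtain \<delta> where \<delta>: "\<delta> > 0" "\<And>z w s. linked q (pattern_chain N z) \<Longrightarrow>
      \<forall>j<length N. z j \<in> disk_set (n (N ! j)) \<and> w j \<in> disk_set (n (N ! j)) \<and> dist (z j) (w j) < \<delta> \<Longrightarrow>
      0 \<le> s \<Longrightarrow> s \<le> real (length N) \<Longrightarrow> d (chain q (pattern_chain N z) s) (chain q (pattern_chain N w) s) < e"
      using pattern_chain_close[OF N e] by blast
    have \<delta>2: "\<delta> / 2 > 0" using \<delta>(1) by simp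
    have "\<exists>\<delta>'>0. \<forall>j\<in>{..<length N}. \<forall>x\<in>disk_set (n (N ! j)). \<forall>y\<in>disk_set (n (N ! j)). \<forall>s\<in>{0..1}.
        dist x y < \<delta>' \<longrightarrow> dist (interpolate s x y) y < \<delta> / 2"
    proof (rule finite_common_radius)
      fix j
      obtain \<delta>' where \<delta>': "\<delta>' > 0" "\<forall>a\<in>disk_set (n (N ! j)). \<forall>b\<in>disk_set (n (N ! j)). \<forall>a'\<in>disk_set (n (N ! j)).
        \<forall>b'\<in>disk_set (n (N ! j)). \<forall>s\<in>{0..1}. \<forall>s'\<in>{0..1}.
        dist ((a, b), s) ((a', b'), s') < \<delta>' \<longrightarrow> dist (interpolate s a b) (interpolate s' a' b') < \<delta> / 2"
        using interpolate_uniform[OF \<delta>2] by blast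
      have "dist (interpolate s x y) y < \<delta> / 2"
        if "x \<in> disk_set (n (N ! j))" "y \<in> disk_set (n (N ! j))" "s \<in> {0..1}" "dist x y < \<delta>'" for x y s
      proof -
        have "dist ((x, y), s) ((y, y), s) < \<delta>'" using that(4) by (simp add: dist_Pair_Pair)
        then have "dist (interpolate s x y) (interpolate s y y) < \<delta> / 2" using \<delta>'(2) that(1-3) by blast
        then show ?thesis by simp
      qed
      then show "\<exists>\<delta>'>0. \<forall>x\<in>disk_set (n (N ! j)). \<forall>y\<in>disk_set (n (N ! j)). \<forall>s\<in>{0..1}.
        dist x y < \<delta>' \<longrightarrow> dist (interpolate s x y) y < \<delta> / 2" using \<delta>'(1) by blast
    qed (simp, meson order_less_le_trans)
    then obtain \<delta>' where \<delta>': "\<delta>' > 0" "\<And>j x y s. j < length N \<Longrightarrow> x \<in> disk_set (n (N ! j)) \<Longrightarrow>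
      y \<in> disk_set (n (N ! j)) \<Longrightarrow> s \<in> {0..1} \<Longrightarrow> dist x y < \<delta>' \<Longrightarrow> dist (interpolate s x y) y < \<delta> / 2" by blast
    have "min \<delta>' (\<delta> / 2) > 0" using \<delta>'(1) \<delta>2 by simp
    from tendstoD[OF zlim this]
    have "\<forall>\<^sub>F k in sequentially. \<forall>j\<in>{..<length N}. dist (z k j) (w j) < min \<delta>' (\<delta> / 2)"
      by (intro eventually_ball_finite ballI finite_lessThan) (simp only: lessThan_iff)
    then obtain K where K: "\<And>k j. k \<ge> K \<Longrightarrow> j < length N \<Longrightarrow> dist (z k j) (w j) < min \<delta>' (\<delta> / 2)"
      unfolding eventually_sequentially by blast
    have "u (\<sigma> (r k)) (H k s) \<le> e" if k: "k \<ge> K" and s: "s \<in> {0..1}" for k s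
    proof (rule u_le)
      show "\<sigma> (r k) \<in> E" by (rule AE[OF \<sigma>(1)])
      show "H k s \<in> E" by (rule HE[OF s])
      fix t :: real assume t: "t \<in> {0..1}"
      have "d (chain q (pattern_chain N (z k)) (\<psi> (r k) t)) (chain q (pattern_chain N (\<lambda>j. interpolate s (z k j) (w j))) (\<psi> (r k) t)) < e"
      proof (rule \<delta>(2)[OF lkz])
        show "\<forall>j<length N. z k j \<in> disk_set (n (N ! j)) \<and> interpolate s (z k j) (w j) \<in> disk_set (n (N ! j)) \<and>
          dist (z k j) (interpolate s (z k j) (w j)) < \<delta>"
        proof (intro allI impI conjI)
          fix j assume j: "j < length N"
          show "z k j \<in> disk_set (n (N ! j))" by (rule zdisk[OF j])
          show "interpolate s (z k j) (w j) \<in> disk_set (n (N ! j))" by (rule interpolate_disk[OF zdisk[OF j] wdisk[OF j] s])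
          have "dist (interpolate s (z k j) (w j)) (w j) < \<delta> / 2"
            by (rule \<delta>'(2)[OF j zdisk[OF j] wdisk[OF j] s]) (use K[OF k j] in simp)
          then show "dist (z k j) (interpolate s (z k j) (w j)) < \<delta>"
            using K[OF k j] dist_triangle[of "z k j" "interpolate s (z k j) (w j)" "w j"]
              dist_commute[of "interpolate s (z k j) (w j)" "w j"] by linarith
        qed
      qed (use reparam_toD(6)[OF \<psi>r, of t k] t in auto)
      then show "d (\<sigma> (r k) t) (H k s t) \<le> e" using t by (simp add: cs(5) csr H_def)
    qed
    then show ?thesis by blast
  qed
  have close: "\<exists>K. \<forall>k\<ge>K. \<forall>s\<in>{0..1}. u \<gamma> (H k s) < e" if e: "e > 0" for e
  proof -
    obtain K where K: "\<And>k s. k \<ge> K \<Longrightarrow> s \<in> {0..1} \<Longrightarrow> u (\<sigma> (r k)) (H k s) \<le> e / 2"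
      using closeH[OF half_gt_zero[OF e]] by blast
    obtain K' :: nat where K': "real K' > 1 / (e / 2)" using reals_Archimedean2 by blast
    have "u \<gamma> (H k s) < e" if k: "k \<ge> max K K'" and s: "s \<in> {0..1}" for k s
    proof -
      have "real (r k) \<ge> real K'" using r[of k] k by simp
      then have "real (r k) > 1 / (e / 2)" using K' by linarith
      from small[OF this] have "1 / real (Suc (r k)) < e / 2" using e by simp
      then have "u \<gamma> (\<sigma> (r k)) < e / 2" using \<sigma>(2)[of "r k"] by linarith
      moreover have "u (\<sigma> (r k)) (H k s) \<le> e / 2" using K k s by simp
      ultimately show ?thesis using path.triangle[OF \<gamma>E AE[OF \<sigma>(1)] HE[OF s], of k "r k"] by linarith
    qed
    then show ?thesis by blast
  qed
  have H0: "H k 0 = \<sigma> (r k)" for k by (simp add: H_def cs(5) csr)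
  have H1: "H k 1 = restrict (chain q (pattern_chain N w) \<circ> \<psi> (r k)) {0..1}" for k by (simp add: H_def)
  let ?L = "real (length N)"
  have L: "?L > 0" using N(1) by simp
  \<comment> \<open>Some points \<open>w j\<close> may lie on the boundary of the disk. The limit chain is therefore rewritten as
    a chain \<open>ds\<close> of open cells, as required by \<open>chain_limit\<close>.\<close>
  have "restrict (chain q (pattern_chain N w) \<circ> (\<lambda>t. ?L * t)) {0..1} \<in> E"
    by (rule chain_execution[OF pne lk pcl[OF wdisk]]) (simp_all add: reparam_to_linear[OF L])
  then obtain ds \<zeta> where ds: "ds \<noteq> []" "linked q ds" "set ds \<subseteq> open_cells" "\<zeta> \<in> reparam_to P (length ds)"
    "restrict (chain q (pattern_chain N w) \<circ> (\<lambda>t. ?L * t)) {0..1} = restrict (chain q ds \<circ> \<zeta>) {0..1}"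
    by (rule execution_chain)
  have ds_cl: "set ds \<subseteq> closed_cells" using ds(3) open_cells_subset by blast
  have ds_eq: "chain q (pattern_chain N w) y = chain q ds (\<zeta> (y / ?L))" if "0 \<le> y" "y \<le> ?L" for y
  proof -
    have "y / ?L \<in> {0..1}" using that L by (simp add: divide_le_eq)
    then show ?thesis using fun_cong[OF ds(5), of "y / ?L"] L N(1) by simp
  qed
  define \<theta> where "\<theta> k = \<zeta> \<circ> (\<lambda>t. \<psi> (r k) t / ?L)" for k
  have \<theta>: "\<theta> k \<in> reparam_to P (length ds)" for k
    unfolding \<theta>_def by (rule reparam_to_compose[OF ds(4) reparam_to_scale[OF \<psi>r L]])
  have H1\<theta>: "H k 1 = restrict (chain q ds \<circ> \<theta> k) {0..1}" for k
    unfolding H1 by (rule restrict_ext) (use reparam_toD(6)[OF \<psi>r] ds_eq in \<open>auto simp: \<theta>_def\<close>)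
  have "\<exists>K. \<forall>k\<ge>K. u \<gamma> (restrict (chain q ds \<circ> \<theta> k) {0..1}) < e" if e: "e > 0" for e
    using close[OF e] H1\<theta> by (metis atLeastAtMost_iff order_refl zero_le_one)
  from chain_limit[OF ds(1-3) \<gamma>E \<theta> this]
  obtain \<theta>' r3 where \<theta>': "\<theta>' \<in> reparam_to P (length ds)" "\<gamma> = restrict (chain q ds \<circ> \<theta>') {0..1}"
    "strict_mono (r3 :: nat \<Rightarrow> nat)" "\<And>e. e > 0 \<Longrightarrow> \<exists>K. \<forall>k\<ge>K. \<forall>t\<in>{0..1}. \<bar>\<theta> (r3 k) t - \<theta>' t\<bar> < e" by blast
  obtain \<delta> where \<delta>: "\<delta> > 0" "\<And>s t. s \<in> {0..real (length ds)} \<Longrightarrow> t \<in> {0..real (length ds)} \<Longrightarrow> \<bar>s - t\<bar> < \<delta> \<Longrightarrow>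
      d (chain q ds s) (chain q ds t) < \<epsilon> / 2"
    by (rule chain_uniform[OF ds(1,2) ds_cl half_gt_zero[OF \<epsilon>]]) (rule that)
  obtain K1 where K1: "\<And>k t. k \<ge> K1 \<Longrightarrow> t \<in> {0..1} \<Longrightarrow> \<bar>\<theta> (r3 k) t - \<theta>' t\<bar> < \<delta>" using \<theta>'(4)[OF \<delta>(1)] by blast
  obtain K2 where K2: "\<And>k s. k \<ge> K2 \<Longrightarrow> s \<in> {0..1} \<Longrightarrow> u \<gamma> (H k s) < \<epsilon>" using close[OF \<epsilon>] by blast
  define k where "k = max K1 K2"
  define m where "m = r3 k"
  have m: "m \<ge> K2" using seq_suble[OF \<theta>'(3), of k] by (simp add: m_def k_def)
  have \<sigma>m: "restrict (chain q (pattern_chain N (z m)) \<circ> \<psi> (r m)) {0..1} = \<sigma> (r m)" by (simp add: cs(5) csr)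
  have "path_component_of ?R (restrict (chain q (pattern_chain N (z m)) \<circ> \<psi> (r m)) {0..1})
      (restrict (chain q (pattern_chain N w) \<circ> \<psi> (r m)) {0..1})"
  proof (rule move_parameters[OF N _ lkz \<psi>r _ \<gamma>E])
    show "restrict (chain q (pattern_chain N (z m)) \<circ> \<psi> (r m)) {0..1} \<in> ?A" unfolding \<sigma>m by (rule \<sigma>(1))
    show "u \<gamma> (restrict (chain q (pattern_chain N (\<lambda>j. interpolate s (z m j) (w j))) \<circ> \<psi> (r m)) {0..1}) < \<epsilon>"
      if "s \<in> {0..1}" for s using K2[OF m that] by (simp add: H_def)
    show "z m j \<in> disk_set (n (N ! j)) \<and> w j \<in> disk_set (n (N ! j))" if "j < length N" for j
      using zdisk[OF that] wdisk[OF that] ..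
  qed
  then have 1: "path_component_of ?R (\<sigma> (r m)) (restrict (chain q ds \<circ> \<theta> m) {0..1})"
    unfolding \<sigma>m H1[symmetric] H1\<theta> .
  have "path_component_of ?R (restrict (chain q ds \<circ> \<theta>') {0..1}) (restrict (chain q ds \<circ> \<theta> m) {0..1})"
  proof (rule move_reparametrization[OF ds(1,2) ds_cl \<theta>'(1) \<theta> _ \<gamma>E])
    show "restrict (chain q ds \<circ> \<theta>') {0..1} \<in> ?A" using \<gamma> \<theta>'(2) by simp
    fix s :: real assume s: "s \<in> {0..1}"
    let ?\<phi> = "\<lambda>t. (1 - s) * \<theta>' t + s * \<theta> m t"
    have \<phi>: "?\<phi> \<in> reparam_to P (length ds)" using reparam_to_convex[OF \<theta>'(1) \<theta>] s by auto
    have "u \<gamma> (restrict (chain q ds \<circ> ?\<phi>) {0..1}) \<le> \<epsilon> / 2"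
    proof (rule u_le[OF \<gamma>E chain_execution[OF ds(1,2) ds_cl \<phi>]])
      fix t :: real assume t: "t \<in> {0..1}"
      have "\<theta>' t - ?\<phi> t = s * (\<theta>' t - \<theta> m t)" by (simp add: algebra_simps)
      then have "\<bar>\<theta>' t - ?\<phi> t\<bar> = s * \<bar>\<theta>' t - \<theta> m t\<bar>" using s by (simp add: abs_mult)
      also have "\<dots> \<le> 1 * \<bar>\<theta>' t - \<theta> m t\<bar>" using s by (intro mult_right_mono) auto
      also have "\<dots> < \<delta>" using K1[of k t] t by (simp add: m_def k_def abs_minus_commute)
      finally have "d (chain q ds (\<theta>' t)) (chain q ds (?\<phi> t)) < \<epsilon> / 2"
        using reparam_toD(6)[OF \<theta>'(1), of t] reparam_toD(6)[OF \<phi>, of t] t by (intro \<delta>(2)) auto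
      then show "d (\<gamma> t) (restrict (chain q ds \<circ> ?\<phi>) {0..1} t) \<le> \<epsilon> / 2" using t \<theta>'(2) by simp
    qed
    then show "u \<gamma> (restrict (chain q ds \<circ> ?\<phi>) {0..1}) < \<epsilon>" using \<epsilon> by simp
  qed
  then have "path_component_of ?R \<gamma> (restrict (chain q ds \<circ> \<theta> m) {0..1})" using \<theta>'(2) by simp
  then have "path_component_of ?R \<gamma> (\<sigma> (r m))"
    by (rule path_component_of_trans) (use 1 in \<open>simp only: path_component_of_sym\<close>)
  then show False using \<sigma>(3) by blast
qed

lemma path_space_between_co_eq:
  "path_space_between_co (X l) \<alpha> \<beta> = subtopology path.mtopology (execution_paths_between (X l) \<alpha> \<beta>)"
proof -
  have "E \<inter> execution_paths_between (X l) \<alpha> \<beta> = execution_paths_between (X l) \<alpha> \<beta>"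
    by (auto simp: execution_paths_between_def)
  then show ?thesis
    unfolding path_mtopology_eq_compact_open path_space_between_co_def path_space_co_def subtopology_subtopology
    by simp
qed

text \<open>The path component of \<open>\<gamma>\<close> in a small ball contains a smaller ball, which is connectedness im
  kleinen by paths; at all points this amounts to local path-connectedness.\<close>

theorem delta_generated_path_space_between_co: "delta_generated (path_space_between_co (X l) \<alpha> \<beta>)"
  unfolding path_space_between_co_eq
proof (rule first_countable_locally_path_connected_imp_delta_generated)
  let ?A = "execution_paths_between (X l) \<alpha> \<beta>"
  show "first_countable (subtopology path.mtopology ?A)"
    by (intro first_countable_subtopology path.first_countable_mtopology)
  show "locally_path_connected_space (subtopology path.mtopology ?A)"
    unfolding locally_path_connected_space_im_kleinen
  proof (intro allI impI)
    fix V \<gamma> assume V: "openin (subtopology path.mtopology ?A) V \<and> \<gamma> \<in> V"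
    then obtain W where W: "openin path.mtopology W" "V = W \<inter> ?A" by (auto simp: openin_subtopology)
    have \<gamma>: "\<gamma> \<in> ?A" "\<gamma> \<in> W" using V W(2) by auto
    then obtain \<epsilon> where \<epsilon>: "\<epsilon> > 0" "path.mball \<gamma> \<epsilon> \<subseteq> W" using W(1) unfolding path.openin_mtopology by blast
    let ?R = "subtopology path.mtopology (?A \<inter> path.mball \<gamma> \<epsilon>)"
    obtain \<delta> where \<delta>: "\<delta> > 0" "\<And>\<gamma>'. \<gamma>' \<in> ?A \<Longrightarrow> u \<gamma> \<gamma>' < \<delta> \<Longrightarrow> path_component_of ?R \<gamma> \<gamma>'"
      using nearby_paths_joined[OF \<gamma>(1) \<epsilon>(1)] by blast
    have \<gamma>E: "\<gamma> \<in> E" using \<gamma>(1) by (simp add: execution_paths_between_def)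
    define U where "U = path.mball \<gamma> (min \<delta> \<epsilon>) \<inter> ?A"
    define C where "C = Collect (path_component_of ?R \<gamma>)"
    have "path_connectedin ?R C" unfolding C_def by (rule path_connectedin_path_component_of)
    then have C: "path_connectedin (subtopology path.mtopology ?A) C" "C \<subseteq> V"
      using \<epsilon>(2) W(2) unfolding path_connectedin_subtopology by blast+
    have "openin (subtopology path.mtopology ?A) U"
      unfolding U_def by (intro openin_subtopology_Int path.openin_mball)
    moreover have "\<gamma> \<in> U" using \<gamma>(1) \<gamma>E \<delta>(1) \<epsilon>(1) by (simp add: U_def)
    moreover have "U \<subseteq> V" using \<epsilon>(2) W(2) by (auto simp: U_def)
    moreover have "y \<in> C" if "y \<in> U" for y
      using \<delta>(2)[of y] that by (simp add: C_def U_def)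
    ultimately show "\<exists>U. openin (subtopology path.mtopology ?A) U \<and> \<gamma> \<in> U \<and> U \<subseteq> V \<and>
        (\<forall>y\<in>U. \<exists>C. path_connectedin (subtopology path.mtopology ?A) C \<and> C \<subseteq> V \<and> \<gamma> \<in> C \<and> y \<in> C)"
      using C by blast
  qed
qed

text \<open>A \<open>\<Delta>\<close>-kelleyfication depends only on the paths of a space, and the inner one does not change
  these. The outer one is applied to a space that is already \<open>\<Delta>\<close>-generated.\<close>

lemma path_space_between_eq_co: "path_space_between (X l) \<alpha> \<beta> = path_space_between_co (X l) \<alpha> \<beta>"
proof -
  let ?CO = "compact_open_topology unit_interval (T l)" and ?A = "execution_paths_between (X l) \<alpha> \<beta>"
  have "path_space_between (X l) \<alpha> \<beta> = delta_kelleyfication (subtopology ?CO ?A)"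
    unfolding path_space_between_def TOP_def
    by (rule delta_kelleyfication_cong_pathin) (simp_all add: pathin_subtopology)
  also have "\<dots> = subtopology ?CO ?A"
    using delta_generated_path_space_between_co[of \<alpha> \<beta>] by (simp add: delta_generated_def path_space_between_co_def)
  finally show ?thesis by (simp add: path_space_between_co_def)
qed

text \<open>As the states are isolated from each other, starting at \<open>\<alpha>\<close> and ending at \<open>\<beta>\<close> are open conditions.\<close>

lemma open_execution_paths_between:
  assumes "\<alpha> \<in> states (X l)" "\<beta> \<in> states (X l)"
  shows "openin path.mtopology (execution_paths_between (X l) \<alpha> \<beta>)"
proof -
  obtain V where V: "openin (T l) V" "V \<inter> states (X l) = {\<alpha>}" using isolated_states[OF assms(1)] by metis
  obtain W where W: "openin (T l) W" "W \<inter> states (X l) = {\<beta>}" using isolated_states[OF assms(2)] by metis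
  have st: "\<gamma> 0 \<in> states (X l)" "\<gamma> 1 \<in> states (X l)" if "\<gamma> \<in> E" for \<gamma>
    using multipointedD(4,5)[OF X_multipointed[OF order_refl] that] .
  have "execution_paths_between (X l) \<alpha> \<beta> = {\<gamma> \<in> E. \<gamma> ` {0} \<subseteq> V} \<inter> {\<gamma> \<in> E. \<gamma> ` {1} \<subseteq> W}"
  proof -
    have "\<gamma> 0 = \<alpha> \<longleftrightarrow> \<gamma> 0 \<in> V" "\<gamma> 1 = \<beta> \<longleftrightarrow> \<gamma> 1 \<in> W" if "\<gamma> \<in> E" for \<gamma>
      using st[OF that] V(2) W(2) by blast+
    then show ?thesis by (auto simp: execution_paths_between_def)
  qed
  then show ?thesis
    using compact_open_subbase_open[of "{0}" V] compact_open_subbase_open[of "{1}" W] V(1) W(1)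
    by (simp add: mtopology_T compactin_subtopology openin_Int)
qed

theorem path_space_homeomorphic: "homeomorphic_map (path_space (X l)) path.mtopology snd"
proof (rule bijective_open_imp_homeomorphic_map)
  let ?S = "states (X l)"
  define A where "A ab = execution_paths_between (X l) (fst ab) (snd ab)" for ab
  have ps: "path_space (X l) = sum_topology (\<lambda>ab. subtopology path.mtopology (A ab)) (?S \<times> ?S)"
    unfolding path_space_def path_space_between_eq_co path_space_between_co_eq A_def by (simp add: case_prod_unfold)
  have AE: "A ab \<subseteq> E" for ab by (auto simp: A_def execution_paths_between_def)
  have tA: "topspace (subtopology path.mtopology (A ab)) = A ab" for ab
    using AE[of ab] by (simp add: Int_absorb1)
  have ts: "topspace (path_space (X l)) = Sigma (?S \<times> ?S) A"
    unfolding ps topspace_sum_topology o_def tA ..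
  have Aopen: "openin path.mtopology (A ab)" if "ab \<in> ?S \<times> ?S" for ab
    using open_execution_paths_between that by (auto simp: A_def)
  show "continuous_map (path_space (X l)) path.mtopology snd"
    unfolding continuous_map_def
  proof (intro conjI allI impI)
    show "snd \<in> topspace (path_space (X l)) \<rightarrow> topspace path.mtopology" unfolding ts by (auto dest: subsetD[OF AE])
    fix U assume U: "openin path.mtopology U"
    have "openin (subtopology path.mtopology (A ab)) {x. (ab, x) \<in> {x \<in> Sigma (?S \<times> ?S) A. snd x \<in> U}}"
      if "ab \<in> ?S \<times> ?S" for ab
    proof -
      have "{x. (ab, x) \<in> {x \<in> Sigma (?S \<times> ?S) A. snd x \<in> U}} = U \<inter> A ab" using that by auto
      then show ?thesis using openin_subtopology_Int[OF U] by simp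
    qed
    then show "openin (path_space (X l)) {x \<in> topspace (path_space (X l)). snd x \<in> U}"
      unfolding ts unfolding ps openin_sum_topology by (auto simp: tA dest: subsetD[OF AE])
  qed
  show "open_map (path_space (X l)) path.mtopology snd"
    unfolding open_map_def
  proof (intro allI impI)
    fix V assume V: "openin (path_space (X l)) V"
    have "openin path.mtopology {x. (ab, x) \<in> V}" if "ab \<in> ?S \<times> ?S" for ab
    proof -
      have "openin (subtopology path.mtopology (A ab)) {x. (ab, x) \<in> V}"
        using V that unfolding ps openin_sum_topology by blast
      then show ?thesis using Aopen[OF that] openin_trans_full by blast
    qed
    moreover have "snd ` V = (\<Union>ab\<in>?S \<times> ?S. {x. (ab, x) \<in> V})"
    proof
      show "snd ` V \<subseteq> (\<Union>ab\<in>?S \<times> ?S. {x. (ab, x) \<in> V})"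
      proof
        fix x assume "x \<in> snd ` V"
        then obtain ab where ab: "(ab, x) \<in> V" by force
        then have "ab \<in> ?S \<times> ?S" using openin_subset[OF V] unfolding ts by blast
        then show "x \<in> (\<Union>ab\<in>?S \<times> ?S. {x. (ab, x) \<in> V})" using ab by blast
      qed
      show "(\<Union>ab\<in>?S \<times> ?S. {x. (ab, x) \<in> V}) \<subseteq> snd ` V" by force
    qed
    ultimately show "openin path.mtopology (snd ` V)" by (simp only:) (rule openin_Union, blast)
  qed
  show "snd ` topspace (path_space (X l)) = topspace path.mtopology"
  proof
    show "snd ` topspace (path_space (X l)) \<subseteq> topspace path.mtopology" unfolding ts by (auto dest: subsetD[OF AE])
    show "topspace path.mtopology \<subseteq> snd ` topspace (path_space (X l))"
    proof
      fix \<gamma> assume "\<gamma> \<in> topspace path.mtopology"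
      then have \<gamma>: "\<gamma> \<in> E" by simp
      have "((\<gamma> 0, \<gamma> 1), \<gamma>) \<in> topspace (path_space (X l))"
        unfolding ts using multipointedD(4,5)[OF X_multipointed[OF order_refl] \<gamma>] \<gamma>
        by (simp add: A_def execution_paths_between_def)
      then show "\<gamma> \<in> snd ` topspace (path_space (X l))" by force
    qed
  qed
  show "inj_on snd (topspace (path_space (X l)))"
    unfolding ts by (auto simp: inj_on_def A_def execution_paths_between_def)
qed

end

theorem theorem11:
  fixes C :: top_category
    and P :: reparam_kind
    and l :: "'i::wellorder"
    and X :: "'i \<Rightarrow> 'a mdspace"
    and tr :: "'i \<Rightarrow> 'i \<Rightarrow> 'a \<Rightarrow> 'a"
    and n :: "'i \<Rightarrow> nat"
    and g h :: "'i \<Rightarrow> cell_point \<Rightarrow> 'a"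
  assumes "cellular_sequence C P l X tr n g h"
    and "locally_finite_cells l X tr n h"
  shows "(\<forall>\<alpha>\<in>states (X l). \<forall>\<beta>\<in>states (X l). delta_generated (path_space_between_co (X l) \<alpha> \<beta>)) \<and>
    metrizable_space (underlying (X l)) \<and>
    (\<forall>d. Metric_space (topspace (underlying (X l))) d \<and>
         Metric_space.mtopology (topspace (underlying (X l))) d = underlying (X l) \<longrightarrow>
       Metric_space (execution_paths (X l)) (uniform_dist (X l) d) \<and>
       homeomorphic_map (path_space (X l))
         (Metric_space.mtopology (execution_paths (X l)) (uniform_dist (X l) d)) snd) \<and>
    homeomorphic_map (path_space (X l)) (path_space_co (X l)) snd"
proof -
  interpret locally_finite_cellular C P l X tr n g h
    by unfold_locales (use assms in auto)
  have metrized: "metrized_cellular C P l X tr n g h d"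
    if "Metric_space (topspace (underlying (X l))) d"
      "Metric_space.mtopology (topspace (underlying (X l))) d = underlying (X l)" for d
  proof -
    interpret Metric_space "topspace (underlying (X l))" d by (rule that(1))
    show ?thesis by unfold_locales (rule that(2))
  qed
  have each: "(\<forall>\<alpha> \<beta>. delta_generated (path_space_between_co (X l) \<alpha> \<beta>)) \<and>
      Metric_space (execution_paths (X l)) (uniform_dist (X l) d) \<and>
      homeomorphic_map (path_space (X l)) (Metric_space.mtopology (execution_paths (X l)) (uniform_dist (X l) d)) snd \<and>
      homeomorphic_map (path_space (X l)) (path_space_co (X l)) snd"
    if d: "Metric_space (topspace (underlying (X l))) d"
      "Metric_space.mtopology (topspace (underlying (X l))) d = underlying (X l)" for d
  proof -
    interpret mc: metrized_cellular C P l X tr n g h d by (rule metrized[OF d])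
    show ?thesis
      using mc.delta_generated_path_space_between_co mc.Metric_space_u mc.path_space_homeomorphic
        mc.path_mtopology_eq_compact_open by simp
  qed
  obtain M d where Md: "Metric_space M d" "underlying (X l) = Metric_space.mtopology M d"
    using metrizable_T unfolding metrizable_space_def by blast
  then have "topspace (underlying (X l)) = M" by (simp add: Metric_space.topspace_mtopology)
  then have "Metric_space (topspace (underlying (X l))) d"
    "Metric_space.mtopology (topspace (underlying (X l))) d = underlying (X l)" using Md by simp_all
  from each[OF this] show ?thesis using each metrizable_T by blast
qed

end
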